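(* Let $E=(E^0,E^1,r_E,s_E)$ be an arbitrary directed graph and let $K$ be a field. Let $\gamma_E:\overline{M}_E\to\mathcal{V}[L_K(E)]$ be the monoid morphism determined by $\gamma_E([a_v])=[p_v]$ for all $v\in E^0$ and $\gamma_E([a_{v,S}])=\left[p_v-\sum_{e\in S}t_et_e^*\right]$ for every infinite emitter $v$ and every non-empty finite subset $S\subseteq s_E^{-1}(v)$. Then $\gamma_E$ is a monoid isomorphism.
   Context: A (directed) graph $E=(E^0,E^1,r_E,s_E)$ consists of a set $E^0$ of vertices, a set $E^1$ of edges (both of arbitrary cardinality), and range and source maps $r_E,s_E:E^1\to E^0$. A vertex $v$ is a sink if $s_E^{-1}(v)=\emptyset$, an infinite emitter if $s_E^{-1}(v)$ is infinite, singular if it is a sink or an infinite emitter, and regular otherwise. A Leavitt $E$-family in a ring $R$ is a collection $\{P_v,S_e,S_{e^*}: v\in E^0,e\in E^1\}\subseteq R$ such that the $P_v$ are pairwise orthogonal idempotents and: (1) $P_{s_E(e)}S_e=S_eP_{r_E(e)}=S_e$; (2) $P_{r_E(e)}S_{e^*}=S_{e^*}P_{s_E(e)}=S_{e^*}$; (3) $S_{e^*}S_f=\delta_{e,f}P_{r_E(e)}$ for all $e,f\in E^1$; (4) $P_v=\sum_{e\in s_E^{-1}(v)}S_eS_{e^*}$ for every regular vertex $v$. The Leavitt path algebra $L_K(E)$ is the universal (not necessarily unital) $K$-algebra generated by a Leavitt $E$-family; its canonical generators are denoted $p_v,t_e,t_e^*$. For a (not necessarily unital) ring $R$, $\mathsf{M}_\infty(R)=\bigcup_n\mathsf{M}_n(R)$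 with $\mathsf{M}_n(R)\subseteq\mathsf{M}_{n+1}(R)$ via $a\mapsto a\oplus 0$. Idempotents $e,f\in\mathsf{M}_\infty(R)$ are equivalent, $e\sim f$, if there are $x,y\in\mathsf{M}_\infty(R)$ with $e=xy$, $f=yx$. $\mathcal{V}[R]$ is the abelian monoid of equivalence classes $[e]$ of idempotents of $\mathsf{M}_\infty(R)$ with $[e]+[f]=[e\oplus f]$. $\overline{M}_E$ is the abelian monoid generated by $\{a_v:v\in E^0\}\cup\{a_{v,S}: v \text{ an infinite emitter}, S \text{ a non-empty finite subset of } s_E^{-1}(v)\}$ subject to the relations: $a_v=\sum_{e\in s_E^{-1}(v)}a_{r_E(e)}$ for every regular vertex $v$; and, for every infinite emitter $v$ and all non-empty finite $S,T\subseteq s_E^{-1}(v)$, $a_{v,S}+\sum_{e\in S}a_{r_E(e)}=a_v$ and $a_{v,S}+\sum_{e\in S\setminus T}a_{r_E(e)}=a_{v,T}+\sum_{e\in T\setminus S}a_{r_E(e)}$. The class of a generator in $\overline{M}_E$ is written $[a_v]$ or $[a_{v,S}]$. The stated formulas for $\gamma_E$ respect these relations, so $\gamma_E$ is a well-defined monoid morphism. *)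

theory Defs
  imports
    "HOL-Library.Multiset"
    "HOL-Algebra.Module"
    "Graph_Theory.Digraph"
begin

section \<open>Graphs\<close>

text \<open>
  A graph is a (well-formed) \<^typ>\<open>('v, 'e) pre_digraph\<close>; \<^const>\<open>tail\<close> is the source map,
  \<^const>\<open>head\<close> the range map, and \<^term>\<open>out_arcs E v\<close> the set of edges emitted by
  \<^term>\<open>v\<close>.
\<close>

definition regular_vertex :: "('v, 'e) pre_digraph \<Rightarrow> 'v \<Rightarrow> bool" where
  "regular_vertex E v \<longleftrightarrow> v \<in> verts E \<and> finite (out_arcs E v) \<and> out_arcs E v \<noteq> {}"

definition infinite_emitter :: "('v, 'e) pre_digraph \<Rightarrow> 'v \<Rightarrow> bool" where
  "infinite_emitter E v \<longleftrightarrow> v \<in> verts E \<and> infinite (out_arcs E v)"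


section \<open>Non-unital rings and algebras\<close>

text \<open>
  Non-unital rings and algebras reuse the ring and module records of HOL-Algebra; their
  \<^const>\<open>one\<close> component is never referred to.
\<close>

locale nu_ring = abelian_group R for R (structure) +
  assumes m_closed [simp, intro]:
      "\<lbrakk>x \<in> carrier R; y \<in> carrier R\<rbrakk> \<Longrightarrow> x \<otimes> y \<in> carrier R"
    and m_assoc:
      "\<lbrakk>x \<in> carrier R; y \<in> carrier R; z \<in> carrier R\<rbrakk> \<Longrightarrow> (x \<otimes> y) \<otimes> z = x \<otimes> (y \<otimes> z)"
    and l_distr:
      "\<lbrakk>x \<in> carrier R; y \<in> carrier R; z \<in> carrier R\<rbrakk> \<Longrightarrow> (x \<oplus> y) \<otimes> z = x \<otimes> z \<oplus> y \<otimes> z"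
    and r_distr:
      "\<lbrakk>x \<in> carrier R; y \<in> carrier R; z \<in> carrier R\<rbrakk> \<Longrightarrow> z \<otimes> (x \<oplus> y) = z \<otimes> x \<oplus> z \<otimes> y"

locale nu_algebra = Module.module K A + nu_ring A for K and A (structure) +
  assumes smult_mult_left:
      "\<lbrakk>c \<in> carrier K; x \<in> carrier A; y \<in> carrier A\<rbrakk> \<Longrightarrow> (c \<odot> x) \<otimes> y = c \<odot> (x \<otimes> y)"
    and smult_mult_right:
      "\<lbrakk>c \<in> carrier K; x \<in> carrier A; y \<in> carrier A\<rbrakk> \<Longrightarrow> x \<otimes> (c \<odot> y) = c \<odot> (x \<otimes> y)"

definition nu_alg_hom ::
  "('k, 'm) ring_scheme \<Rightarrow> ('k, 'a, 'n) module_scheme \<Rightarrow> ('k, 'b, 'p) module_scheme \<Rightarrow> ('a \<Rightarrow> 'b) set"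
  where
  "nu_alg_hom K A B = {\<phi>. \<phi> ` carrier A \<subseteq> carrier B \<and>
     (\<forall>x \<in> carrier A. \<forall>y \<in> carrier A.
        \<phi> (x \<oplus>\<^bsub>A\<^esub> y) = \<phi> x \<oplus>\<^bsub>B\<^esub> \<phi> y \<and> \<phi> (x \<otimes>\<^bsub>A\<^esub> y) = \<phi> x \<otimes>\<^bsub>B\<^esub> \<phi> y) \<and>
     (\<forall>c \<in> carrier K. \<forall>x \<in> carrier A. \<phi> (c \<odot>\<^bsub>A\<^esub> x) = c \<odot>\<^bsub>B\<^esub> \<phi> x)}"

context nu_ring
begin

lemma l_null [simp]: "x \<in> carrier R \<Longrightarrow> \<zero> \<otimes> x = \<zero>"
  by (metis (full_types) add.l_cancel_one' l_distr m_closed r_zero zero_closed)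

lemma r_null [simp]: "x \<in> carrier R \<Longrightarrow> x \<otimes> \<zero> = \<zero>"
  by (metis (full_types) add.l_cancel_one' r_distr m_closed r_zero zero_closed)

lemma l_minus: "\<lbrakk>x \<in> carrier R; y \<in> carrier R\<rbrakk> \<Longrightarrow> (\<ominus> x) \<otimes> y = \<ominus> (x \<otimes> y)"
  by (metis add.inv_closed add.inv_equality l_distr l_neg l_null m_closed)

lemma r_minus: "\<lbrakk>x \<in> carrier R; y \<in> carrier R\<rbrakk> \<Longrightarrow> x \<otimes> (\<ominus> y) = \<ominus> (x \<otimes> y)"
  by (metis add.inv_closed add.inv_equality r_distr l_neg r_null m_closed)

lemma finsum_ldistr':
  "\<lbrakk>finite A; a \<in> carrier R; \<And>i. i \<in> A \<Longrightarrow> f i \<in> carrier R\<rbrakk> \<Longrightarrow>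
    (\<Oplus>i\<in>A. f i) \<otimes> a = (\<Oplus>i\<in>A. f i \<otimes> a)"
  by (induction A rule: finite_induct) (auto simp: l_distr Pi_def)

lemma finsum_rdistr':
  "\<lbrakk>finite A; a \<in> carrier R; \<And>i. i \<in> A \<Longrightarrow> f i \<in> carrier R\<rbrakk> \<Longrightarrow>
    a \<otimes> (\<Oplus>i\<in>A. f i) = (\<Oplus>i\<in>A. a \<otimes> f i)"
  by (induction A rule: finite_induct) (auto simp: r_distr Pi_def)

lemma finsum_swap':
  assumes "finite A" "finite B" "\<And>i j. \<lbrakk>i \<in> A; j \<in> B\<rbrakk> \<Longrightarrow> f i j \<in> carrier R"
  shows "(\<Oplus>i\<in>A. \<Oplus>j\<in>B. f i j) = (\<Oplus>j\<in>B. \<Oplus>i\<in>A. f i j)"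
  using assms(1,3)
proof (induction A rule: finite_induct)
  case empty
  then show ?case using add.finprod_one[of B] by simp
next
  case (insert a A)
  have "(\<Oplus>i\<in>insert a A. \<Oplus>j\<in>B. f i j) = (\<Oplus>j\<in>B. f a j) \<oplus> (\<Oplus>j\<in>B. \<Oplus>i\<in>A. f i j)"
    using insert by (simp add: Pi_def)
  also have "\<dots> = (\<Oplus>j\<in>B. f a j \<oplus> (\<Oplus>i\<in>A. f i j))"
    using insert by (subst finsum_addf) (auto simp: Pi_def)
  also have "\<dots> = (\<Oplus>j\<in>B. \<Oplus>i\<in>insert a A. f i j)"
    using insert by (intro finsum_cong) (auto simp: Pi_def simp_implies_def)
  finally show ?case .
qed

end


section \<open>Leavitt families and Leavitt path algebras\<close>

definition leavitt_family ::
  "('v, 'e) pre_digraph \<Rightarrow> ('a, 'm) ring_scheme \<Rightarrow> ('v \<Rightarrow> 'a) \<Rightarrow> ('e \<Rightarrow> 'a) \<Rightarrow> ('e \<Rightarrow> 'a) \<Rightarrow> bool"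
  where
  "leavitt_family E R P S S' \<longleftrightarrow>
     P ` verts E \<subseteq> carrier R \<and> S ` arcs E \<subseteq> carrier R \<and> S' ` arcs E \<subseteq> carrier R \<and>
     (\<forall>v \<in> verts E. \<forall>w \<in> verts E. P v \<otimes>\<^bsub>R\<^esub> P w = (if v = w then P v else \<zero>\<^bsub>R\<^esub>)) \<and>
     (\<forall>e \<in> arcs E. P (tail E e) \<otimes>\<^bsub>R\<^esub> S e = S e \<and> S e \<otimes>\<^bsub>R\<^esub> P (head E e) = S e) \<and>
     (\<forall>e \<in> arcs E. P (head E e) \<otimes>\<^bsub>R\<^esub> S' e = S' e \<and> S' e \<otimes>\<^bsub>R\<^esub> P (tail E e) = S' e) \<and>
     (\<forall>e \<in> arcs E. \<forall>f \<in> arcs E.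
        S' e \<otimes>\<^bsub>R\<^esub> S f = (if e = f then P (head E e) else \<zero>\<^bsub>R\<^esub>)) \<and>
     (\<forall>v. regular_vertex E v \<longrightarrow> P v = (\<Oplus>\<^bsub>R\<^esub>e \<in> out_arcs E v. S e \<otimes>\<^bsub>R\<^esub> S' e))"

text \<open>
  The universal algebra is constructed as formal \<open>K\<close>-algebra expressions in the generators,
  modulo the least congruence that contains the laws of non-unital associative \<open>K\<close>-algebras and
  the relations of a Leavitt \<open>E\<close>-family.  That this has the defining universal property is
  \<open>lpa_universal\<close> below.
\<close>

datatype ('v, 'e, 'k) lpa_term =
    TVert 'v | TEdge 'e | TGhost 'e
  | TZero
  | TNeg "('v, 'e, 'k) lpa_term"
  | TAdd "('v, 'e, 'k) lpa_term" "('v, 'e, 'k) lpa_term"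
  | TMul "('v, 'e, 'k) lpa_term" "('v, 'e, 'k) lpa_term"
  | TScal 'k "('v, 'e, 'k) lpa_term"

inductive_set lpa_terms ::
  "('k, 'm) ring_scheme \<Rightarrow> ('v, 'e) pre_digraph \<Rightarrow> ('v, 'e, 'k) lpa_term set"
  for K :: "('k, 'm) ring_scheme" and E :: "('v, 'e) pre_digraph"
  where
    "v \<in> verts E \<Longrightarrow> TVert v \<in> lpa_terms K E"
  | "e \<in> arcs E \<Longrightarrow> TEdge e \<in> lpa_terms K E"
  | "e \<in> arcs E \<Longrightarrow> TGhost e \<in> lpa_terms K E"
  | "TZero \<in> lpa_terms K E"
  | "x \<in> lpa_terms K E \<Longrightarrow> TNeg x \<in> lpa_terms K E"
  | "\<lbrakk>x \<in> lpa_terms K E; y \<in> lpa_terms K E\<rbrakk> \<Longrightarrow> TAdd x y \<in> lpa_terms K E"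
  | "\<lbrakk>x \<in> lpa_terms K E; y \<in> lpa_terms K E\<rbrakk> \<Longrightarrow> TMul x y \<in> lpa_terms K E"
  | "\<lbrakk>c \<in> carrier K; x \<in> lpa_terms K E\<rbrakk> \<Longrightarrow> TScal c x \<in> lpa_terms K E"

inductive lpa_cong ::
  "('k, 'm) ring_scheme \<Rightarrow> ('v, 'e) pre_digraph \<Rightarrow>
    ('v, 'e, 'k) lpa_term \<Rightarrow> ('v, 'e, 'k) lpa_term \<Rightarrow> bool"
  for K :: "('k, 'm) ring_scheme" and E :: "('v, 'e) pre_digraph"
  where
  \<comment> \<open>congruence\<close>
    refl: "x \<in> lpa_terms K E \<Longrightarrow> lpa_cong K E x x"
  | sym: "lpa_cong K E x y \<Longrightarrow> lpa_cong K E y x"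
  | trans: "\<lbrakk>lpa_cong K E x y; lpa_cong K E y z\<rbrakk> \<Longrightarrow> lpa_cong K E x z"
  | neg: "lpa_cong K E x x' \<Longrightarrow> lpa_cong K E (TNeg x) (TNeg x')"
  | add: "\<lbrakk>lpa_cong K E x x'; lpa_cong K E y y'\<rbrakk> \<Longrightarrow> lpa_cong K E (TAdd x y) (TAdd x' y')"
  | mul: "\<lbrakk>lpa_cong K E x x'; lpa_cong K E y y'\<rbrakk> \<Longrightarrow> lpa_cong K E (TMul x y) (TMul x' y')"
  | scal: "\<lbrakk>c \<in> carrier K; lpa_cong K E x x'\<rbrakk> \<Longrightarrow> lpa_cong K E (TScal c x) (TScal c x')"
  \<comment> \<open>laws of non-unital associative algebras\<close>
  | add_assoc: "\<lbrakk>x \<in> lpa_terms K E; y \<in> lpa_terms K E; z \<in> lpa_terms K E\<rbrakk> \<Longrightarrow>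
      lpa_cong K E (TAdd (TAdd x y) z) (TAdd x (TAdd y z))"
  | add_comm: "\<lbrakk>x \<in> lpa_terms K E; y \<in> lpa_terms K E\<rbrakk> \<Longrightarrow> lpa_cong K E (TAdd x y) (TAdd y x)"
  | add_zero: "x \<in> lpa_terms K E \<Longrightarrow> lpa_cong K E (TAdd TZero x) x"
  | add_neg: "x \<in> lpa_terms K E \<Longrightarrow> lpa_cong K E (TAdd (TNeg x) x) TZero"
  | mul_assoc: "\<lbrakk>x \<in> lpa_terms K E; y \<in> lpa_terms K E; z \<in> lpa_terms K E\<rbrakk> \<Longrightarrow>
      lpa_cong K E (TMul (TMul x y) z) (TMul x (TMul y z))"
  | distrib_left: "\<lbrakk>x \<in> lpa_terms K E; y \<in> lpa_terms K E; z \<in> lpa_terms K E\<rbrakk> \<Longrightarrow>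
      lpa_cong K E (TMul (TAdd x y) z) (TAdd (TMul x z) (TMul y z))"
  | distrib_right: "\<lbrakk>x \<in> lpa_terms K E; y \<in> lpa_terms K E; z \<in> lpa_terms K E\<rbrakk> \<Longrightarrow>
      lpa_cong K E (TMul z (TAdd x y)) (TAdd (TMul z x) (TMul z y))"
  | scal_add: "\<lbrakk>c \<in> carrier K; x \<in> lpa_terms K E; y \<in> lpa_terms K E\<rbrakk> \<Longrightarrow>
      lpa_cong K E (TScal c (TAdd x y)) (TAdd (TScal c x) (TScal c y))"
  | add_scal: "\<lbrakk>c \<in> carrier K; d \<in> carrier K; x \<in> lpa_terms K E\<rbrakk> \<Longrightarrow>
      lpa_cong K E (TScal (c \<oplus>\<^bsub>K\<^esub> d) x) (TAdd (TScal c x) (TScal d x))"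
  | scal_scal: "\<lbrakk>c \<in> carrier K; d \<in> carrier K; x \<in> lpa_terms K E\<rbrakk> \<Longrightarrow>
      lpa_cong K E (TScal (c \<otimes>\<^bsub>K\<^esub> d) x) (TScal c (TScal d x))"
  | scal_one: "x \<in> lpa_terms K E \<Longrightarrow> lpa_cong K E (TScal \<one>\<^bsub>K\<^esub> x) x"
  | scal_mul_left: "\<lbrakk>c \<in> carrier K; x \<in> lpa_terms K E; y \<in> lpa_terms K E\<rbrakk> \<Longrightarrow>
      lpa_cong K E (TMul (TScal c x) y) (TScal c (TMul x y))"
  | scal_mul_right: "\<lbrakk>c \<in> carrier K; x \<in> lpa_terms K E; y \<in> lpa_terms K E\<rbrakk> \<Longrightarrow>
      lpa_cong K E (TMul x (TScal c y)) (TScal c (TMul x y))"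
  \<comment> \<open>relations of a Leavitt family\<close>
  | vert_idem: "v \<in> verts E \<Longrightarrow> lpa_cong K E (TMul (TVert v) (TVert v)) (TVert v)"
  | vert_orth: "\<lbrakk>v \<in> verts E; w \<in> verts E; v \<noteq> w\<rbrakk> \<Longrightarrow>
      lpa_cong K E (TMul (TVert v) (TVert w)) TZero"
  | tail_edge: "e \<in> arcs E \<Longrightarrow> lpa_cong K E (TMul (TVert (tail E e)) (TEdge e)) (TEdge e)"
  | edge_head: "e \<in> arcs E \<Longrightarrow> lpa_cong K E (TMul (TEdge e) (TVert (head E e))) (TEdge e)"
  | head_ghost: "e \<in> arcs E \<Longrightarrow> lpa_cong K E (TMul (TVert (head E e)) (TGhost e)) (TGhost e)"
  | ghost_tail: "e \<in> arcs E \<Longrightarrow> lpa_cong K E (TMul (TGhost e) (TVert (tail E e))) (TGhost e)"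
  | ghost_edge: "e \<in> arcs E \<Longrightarrow> lpa_cong K E (TMul (TGhost e) (TEdge e)) (TVert (head E e))"
  | ghost_edge_orth: "\<lbrakk>e \<in> arcs E; f \<in> arcs E; e \<noteq> f\<rbrakk> \<Longrightarrow>
      lpa_cong K E (TMul (TGhost e) (TEdge f)) TZero"
  | vert_sum: "\<lbrakk>regular_vertex E v; distinct es; set es = out_arcs E v\<rbrakk> \<Longrightarrow>
      lpa_cong K E (TVert v) (foldr (\<lambda>e. TAdd (TMul (TEdge e) (TGhost e))) es TZero)"

definition lpa_rel ::
  "('k, 'm) ring_scheme \<Rightarrow> ('v, 'e) pre_digraph \<Rightarrow> ('v, 'e, 'k) lpa_term rel" where
  "lpa_rel K E = {(x, y). lpa_cong K E x y}"

definition lpa_class ::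
  "('k, 'm) ring_scheme \<Rightarrow> ('v, 'e) pre_digraph \<Rightarrow> ('v, 'e, 'k) lpa_term \<Rightarrow> ('v, 'e, 'k) lpa_term set"
  where
  "lpa_class K E x = lpa_rel K E `` {x}"

definition leavitt_path_algebra ::
  "('k, 'm) ring_scheme \<Rightarrow> ('v, 'e) pre_digraph \<Rightarrow> ('k, ('v, 'e, 'k) lpa_term set) module" where
  "leavitt_path_algebra K E =
     \<lparr>carrier = lpa_terms K E // lpa_rel K E,
      mult = (\<lambda>X Y. \<Union>x\<in>X. \<Union>y\<in>Y. lpa_class K E (TMul x y)),
      one = undefined,
      zero = lpa_class K E TZero,
      add = (\<lambda>X Y. \<Union>x\<in>X. \<Union>y\<in>Y. lpa_class K E (TAdd x y)),
      smult = (\<lambda>c X. \<Union>x\<in>X. lpa_class K E (TScal c x))\<rparr>"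

text \<open>The canonical generators \<open>p\<^sub>v\<close>, \<open>t\<^sub>e\<close> and \<open>t\<^sub>e\<^sup>*\<close>.\<close>

definition lpa_p :: "('k, 'm) ring_scheme \<Rightarrow> ('v, 'e) pre_digraph \<Rightarrow> 'v \<Rightarrow> ('v, 'e, 'k) lpa_term set"
  where "lpa_p K E v = lpa_class K E (TVert v)"

definition lpa_t :: "('k, 'm) ring_scheme \<Rightarrow> ('v, 'e) pre_digraph \<Rightarrow> 'e \<Rightarrow> ('v, 'e, 'k) lpa_term set"
  where "lpa_t K E e = lpa_class K E (TEdge e)"

definition lpa_t_star ::
  "('k, 'm) ring_scheme \<Rightarrow> ('v, 'e) pre_digraph \<Rightarrow> 'e \<Rightarrow> ('v, 'e, 'k) lpa_term set"
  where "lpa_t_star K E e = lpa_class K E (TGhost e)"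


section \<open>The monoid of idempotent matrices\<close>

text \<open>
  A matrix in \<open>M\<^sub>n(R)\<close> is stored as a function on all of \<open>nat \<times> nat\<close> that vanishes outside
  the upper left \<open>n \<times> n\<close> corner, so that the embedding of \<open>M\<^sub>n(R)\<close> into
  \<open>M\<^sub>n\<^sub>+\<^sub>1(R)\<close> by \<open>a \<mapsto> a \<oplus> 0\<close> is set inclusion.
\<close>

definition matn :: "('a, 'm) ring_scheme \<Rightarrow> nat \<Rightarrow> (nat \<Rightarrow> nat \<Rightarrow> 'a) set" where
  "matn R n = {a. (\<forall>i j. a i j \<in> carrier R) \<and> (\<forall>i j. n \<le> i \<or> n \<le> j \<longrightarrow> a i j = \<zero>\<^bsub>R\<^esub>)}"

definition mat_inf :: "('a, 'm) ring_scheme \<Rightarrow> (nat \<Rightarrow> nat \<Rightarrow> 'a) set" where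
  "mat_inf R = (\<Union>n. matn R n)"

text \<open>The summation is restricted to the non-zero terms because \<^const>\<open>finsum\<close> needs a finite
  index set.\<close>

definition mat_times ::
  "('a, 'm) ring_scheme \<Rightarrow> (nat \<Rightarrow> nat \<Rightarrow> 'a) \<Rightarrow> (nat \<Rightarrow> nat \<Rightarrow> 'a) \<Rightarrow> (nat \<Rightarrow> nat \<Rightarrow> 'a)" where
  "mat_times R a b =
     (\<lambda>i j. \<Oplus>\<^bsub>R\<^esub>k \<in> {k. a i k \<otimes>\<^bsub>R\<^esub> b k j \<noteq> \<zero>\<^bsub>R\<^esub>}. a i k \<otimes>\<^bsub>R\<^esub> b k j)"

definition mat_zero :: "('a, 'm) ring_scheme \<Rightarrow> nat \<Rightarrow> nat \<Rightarrow> 'a" where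
  "mat_zero R = (\<lambda>i j. \<zero>\<^bsub>R\<^esub>)"

text \<open>The image of a ring element under \<open>R = M\<^sub>1(R) \<subseteq> M\<^sub>\<infinity>(R)\<close>.\<close>

definition mat_single :: "('a, 'm) ring_scheme \<Rightarrow> 'a \<Rightarrow> nat \<Rightarrow> nat \<Rightarrow> 'a" where
  "mat_single R a = (\<lambda>i j. if i = 0 \<and> j = 0 then a else \<zero>\<^bsub>R\<^esub>)"

text \<open>The block sum \<open>a \<oplus> b\<close>, where \<open>a\<close> is regarded as an \<open>n \<times> n\<close> matrix.\<close>

definition block_sum ::
  "('a, 'm) ring_scheme \<Rightarrow> nat \<Rightarrow> (nat \<Rightarrow> nat \<Rightarrow> 'a) \<Rightarrow> (nat \<Rightarrow> nat \<Rightarrow> 'a) \<Rightarrow> (nat \<Rightarrow> nat \<Rightarrow> 'a)" where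
  "block_sum R n a b =
     (\<lambda>i j. if i < n \<and> j < n then a i j
            else if n \<le> i \<and> n \<le> j then b (i - n) (j - n)
            else \<zero>\<^bsub>R\<^esub>)"

definition idem_mats :: "('a, 'm) ring_scheme \<Rightarrow> (nat \<Rightarrow> nat \<Rightarrow> 'a) set" where
  "idem_mats R = {e \<in> mat_inf R. mat_times R e e = e}"

definition idem_rel :: "('a, 'm) ring_scheme \<Rightarrow> (nat \<Rightarrow> nat \<Rightarrow> 'a) rel" where
  "idem_rel R = {(e, f). e \<in> idem_mats R \<and> f \<in> idem_mats R \<and>
     (\<exists>x \<in> mat_inf R. \<exists>y \<in> mat_inf R. e = mat_times R x y \<and> f = mat_times R y x)}"

definition idem_class :: "('a, 'm) ring_scheme \<Rightarrow> (nat \<Rightarrow> nat \<Rightarrow> 'a) \<Rightarrow> (nat \<Rightarrow> nat \<Rightarrow> 'a) set" where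
  "idem_class R e = idem_rel R `` {e}"

text \<open>
  Both monoids \<open>\<V>[R]\<close> and \<open>M\<^sub>E\<close> are additively written abelian monoids in the literature; here
  they are HOL-Algebra monoids, whose operation is \<^const>\<open>mult\<close>.  The class of \<open>e \<oplus> f\<close> does
  not depend on the size \<open>n\<close> at which \<open>e\<close> is cut off, see \<open>V_mult\<close> below.
\<close>

definition V_monoid :: "('a, 'm) ring_scheme \<Rightarrow> (nat \<Rightarrow> nat \<Rightarrow> 'a) set monoid" where
  "V_monoid R =
     \<lparr>carrier = idem_mats R // idem_rel R,
      mult = (\<lambda>X Y. \<Union>e\<in>X. \<Union>f\<in>Y. \<Union>n\<in>{n. e \<in> matn R n}. idem_class R (block_sum R n e f)),
      one = idem_class R (mat_zero R)\<rparr>"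


section \<open>The graph monoid\<close>

datatype ('v, 'e) mbar_gen = GVert 'v | GCut 'v "'e set"

definition mbar_gens :: "('v, 'e) pre_digraph \<Rightarrow> ('v, 'e) mbar_gen set" where
  "mbar_gens E = GVert ` verts E \<union>
     {GCut v S | v S. infinite_emitter E v \<and> finite S \<and> S \<noteq> {} \<and> S \<subseteq> out_arcs E v}"

definition mbar_words :: "('v, 'e) pre_digraph \<Rightarrow> ('v, 'e) mbar_gen multiset set" where
  "mbar_words E = {m. set_mset m \<subseteq> mbar_gens E}"

text \<open>The formal sum of the \<open>a\<close>-generators at the ranges of the edges in a finite set.\<close>

definition range_sum :: "('v, 'e) pre_digraph \<Rightarrow> 'e set \<Rightarrow> ('v, 'e) mbar_gen multiset" where
  "range_sum E S = image_mset (\<lambda>e. GVert (head E e)) (mset_set S)"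

inductive mbar_cong ::
  "('v, 'e) pre_digraph \<Rightarrow> ('v, 'e) mbar_gen multiset \<Rightarrow> ('v, 'e) mbar_gen multiset \<Rightarrow> bool"
  for E :: "('v, 'e) pre_digraph"
  where
    refl: "m \<in> mbar_words E \<Longrightarrow> mbar_cong E m m"
  | sym: "mbar_cong E m n \<Longrightarrow> mbar_cong E n m"
  | trans: "\<lbrakk>mbar_cong E m n; mbar_cong E n k\<rbrakk> \<Longrightarrow> mbar_cong E m k"
  | add: "\<lbrakk>mbar_cong E m m'; mbar_cong E n n'\<rbrakk> \<Longrightarrow> mbar_cong E (m + n) (m' + n')"
  | regular: "regular_vertex E v \<Longrightarrow> mbar_cong E {#GVert v#} (range_sum E (out_arcs E v))"
  | cut: "\<lbrakk>infinite_emitter E v; finite S; S \<noteq> {}; S \<subseteq> out_arcs E v\<rbrakk> \<Longrightarrow>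
      mbar_cong E ({#GCut v S#} + range_sum E S) {#GVert v#}"
  | cut_cut: "\<lbrakk>infinite_emitter E v; finite S; S \<noteq> {}; S \<subseteq> out_arcs E v;
        finite T; T \<noteq> {}; T \<subseteq> out_arcs E v\<rbrakk> \<Longrightarrow>
      mbar_cong E ({#GCut v S#} + range_sum E (S - T)) ({#GCut v T#} + range_sum E (T - S))"

definition mbar_rel :: "('v, 'e) pre_digraph \<Rightarrow> ('v, 'e) mbar_gen multiset rel" where
  "mbar_rel E = {(m, n). mbar_cong E m n}"

definition mbar_class ::
  "('v, 'e) pre_digraph \<Rightarrow> ('v, 'e) mbar_gen multiset \<Rightarrow> ('v, 'e) mbar_gen multiset set" where
  "mbar_class E m = mbar_rel E `` {m}"

definition mbar_monoid :: "('v, 'e) pre_digraph \<Rightarrow> ('v, 'e) mbar_gen multiset set monoid" where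
  "mbar_monoid E =
     \<lparr>carrier = mbar_words E // mbar_rel E,
      mult = (\<lambda>X Y. \<Union>m\<in>X. \<Union>n\<in>Y. mbar_class E (m + n)),
      one = mbar_class E {#}\<rparr>"


section \<open>The comparison morphism\<close>

text \<open>The defining properties of \<open>\<gamma>\<^sub>E\<close>; membership in \<^const>\<open>extensional\<close> only fixes the
  values outside the carrier.\<close>

definition is_gamma ::
  "('k, 'm) ring_scheme \<Rightarrow> ('v, 'e) pre_digraph \<Rightarrow>
    (('v, 'e) mbar_gen multiset set \<Rightarrow> (nat \<Rightarrow> nat \<Rightarrow> ('v, 'e, 'k) lpa_term set) set) \<Rightarrow> bool" where
  "is_gamma K E \<gamma> \<longleftrightarrow>
     (let L = leavitt_path_algebra K E in
       \<gamma> \<in> extensional (carrier (mbar_monoid E)) \<and>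
       \<gamma> \<in> hom (mbar_monoid E) (V_monoid L) \<and>
       \<gamma> \<one>\<^bsub>mbar_monoid E\<^esub> = \<one>\<^bsub>V_monoid L\<^esub> \<and>
       (\<forall>v \<in> verts E. \<gamma> (mbar_class E {#GVert v#}) = idem_class L (mat_single L (lpa_p K E v))) \<and>
       (\<forall>v S. infinite_emitter E v \<and> finite S \<and> S \<noteq> {} \<and> S \<subseteq> out_arcs E v \<longrightarrow>
          \<gamma> (mbar_class E {#GCut v S#}) =
            idem_class L (mat_single L
              (lpa_p K E v \<ominus>\<^bsub>L\<^esub> (\<Oplus>\<^bsub>L\<^esub>e\<in>S. lpa_t K E e \<otimes>\<^bsub>L\<^esub> lpa_t_star K E e)))))"

definition gamma ::
  "('k, 'm) ring_scheme \<Rightarrow> ('v, 'e) pre_digraph \<Rightarrow>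
    ('v, 'e) mbar_gen multiset set \<Rightarrow> (nat \<Rightarrow> nat \<Rightarrow> ('v, 'e, 'k) lpa_term set) set" where
  "gamma K E = (THE \<gamma>. is_gamma K E \<gamma>)"


section \<open>Basic facts about these notions\<close>

text \<open>
  \<open>\<V>[R]\<close> and \<open>M\<^sub>E\<close> are commutative monoids (\<open>V_comm_monoid\<close>, \<open>mbar_comm_monoid\<close>), the
  Leavitt path algebra is a \<open>K\<close>-algebra with the required universal property
  (\<open>nu_algebra_L\<close>, \<open>leavitt_family_L\<close>, \<open>lpa_universal\<close>), and the morphism \<open>\<gamma>\<^sub>E\<close> exists and
  is unique (\<open>gamma_ex1\<close>, \<open>is_gamma_gamma\<close>).
\<close>

subsection \<open>The monoid structure of \<open>\<V>[R]\<close>\<close>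

lemma matn_mono: "n \<le> m \<Longrightarrow> matn R n \<subseteq> matn R m"
  by (auto simp: matn_def)

lemma matn_carrier: "a \<in> matn R n \<Longrightarrow> a i j \<in> carrier R"
  by (auto simp: matn_def)

lemma matn_zero: "a \<in> matn R n \<Longrightarrow> n \<le> i \<or> n \<le> j \<Longrightarrow> a i j = \<zero>\<^bsub>R\<^esub>"
  by (auto simp: matn_def)

lemma matn_imp_mat_inf: "a \<in> matn R n \<Longrightarrow> a \<in> mat_inf R"
  by (auto simp: mat_inf_def)

lemma mat_infE: assumes "a \<in> mat_inf R" obtains n where "a \<in> matn R n"
  using assms by (auto simp: mat_inf_def)

lemma mat_inf_bound2:
  assumes "a \<in> mat_inf R" "b \<in> mat_inf R"
  shows "\<exists>n. a \<in> matn R n \<and> b \<in> matn R n \<and> N \<le> n"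
proof -
  obtain k where k: "a \<in> matn R k" using assms(1) by (rule mat_infE)
  obtain l where l: "b \<in> matn R l" using assms(2) by (rule mat_infE)
  let ?n = "k + l + N"
  have "a \<in> matn R ?n" "b \<in> matn R ?n"
    using k l matn_mono[of k ?n R] matn_mono[of l ?n R] by auto
  then show ?thesis by (intro exI[of _ ?n]) simp
qed

lemma mat_inf_bound3:
  assumes "a \<in> mat_inf R" "b \<in> mat_inf R" "c \<in> mat_inf R"
  shows "\<exists>n. a \<in> matn R n \<and> b \<in> matn R n \<and> c \<in> matn R n"
proof -
  obtain k where k: "c \<in> matn R k" using assms(3) by (rule mat_infE)
  obtain n where n: "a \<in> matn R n" "b \<in> matn R n" "k \<le> n"
    using mat_inf_bound2[OF assms(1,2)] by blast
  then show ?thesis using k matn_mono[of k n R] by blast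
qed

lemma block_sum_assoc:
  "block_sum R n a (block_sum R m b c) = block_sum R (n + m) (block_sum R n a b) c"
  by (intro ext) (auto simp: block_sum_def algebra_simps)

context nu_ring
begin

lemma mat_times_eq:
  assumes "finite F" "\<And>i j. a i j \<in> carrier R" "\<And>i j. b i j \<in> carrier R"
    and "\<And>k. k \<notin> F \<Longrightarrow> a i k \<otimes> b k j = \<zero>"
  shows "mat_times R a b i j = (\<Oplus>k\<in>F. a i k \<otimes> b k j)"
  unfolding mat_times_def
proof (rule add.finprod_mono_neutral_cong_left)
  show "{k. a i k \<otimes> b k j \<noteq> \<zero>} \<subseteq> F" using assms(4) by blast
qed (use assms in auto)

lemma mat_times_matn:
  assumes "a \<in> matn R n" "b \<in> matn R n"
  shows "mat_times R a b i j = (\<Oplus>k\<in>{..<n}. a i k \<otimes> b k j)"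
  by (rule mat_times_eq) (use assms in \<open>auto simp: matn_carrier matn_zero not_less\<close>)

lemma mat_times_closed:
  assumes "a \<in> matn R n" "b \<in> matn R n"
  shows "mat_times R a b \<in> matn R n"
  using assms
  by (auto simp: matn_def mat_times_matn[OF assms] Pi_def intro!: finsum_closed
      add.finprod_one_eqI)

lemma mat_times_inf_closed:
  assumes "a \<in> mat_inf R" "b \<in> mat_inf R"
  shows "mat_times R a b \<in> mat_inf R"
proof -
  obtain n where "a \<in> matn R n" "b \<in> matn R n" using mat_inf_bound2[OF assms] by blast
  then show ?thesis using mat_times_closed matn_imp_mat_inf by blast
qed

lemma mat_times_assoc:
  assumes "a \<in> mat_inf R" "b \<in> mat_inf R" "c \<in> mat_inf R"
  shows "mat_times R (mat_times R a b) c = mat_times R a (mat_times R b c)"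
proof (intro ext)
  fix i j
  obtain n where n: "a \<in> matn R n" "b \<in> matn R n" "c \<in> matn R n"
    using mat_inf_bound3[OF assms] by blast
  note car = matn_carrier[OF n(1)] matn_carrier[OF n(2)] matn_carrier[OF n(3)]
  have "mat_times R (mat_times R a b) c i j = (\<Oplus>k\<in>{..<n}. (\<Oplus>l\<in>{..<n}. a i l \<otimes> b l k) \<otimes> c k j)"
    using n by (simp add: mat_times_matn[OF mat_times_closed] mat_times_matn)
  also have "\<dots> = (\<Oplus>k\<in>{..<n}. \<Oplus>l\<in>{..<n}. a i l \<otimes> b l k \<otimes> c k j)"
    by (intro finsum_cong) (auto simp: finsum_ldistr' car Pi_def simp_implies_def)
  also have "\<dots> = (\<Oplus>l\<in>{..<n}. \<Oplus>k\<in>{..<n}. a i l \<otimes> b l k \<otimes> c k j)"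
    by (rule finsum_swap') (auto simp: car)
  also have "\<dots> = (\<Oplus>l\<in>{..<n}. a i l \<otimes> (\<Oplus>k\<in>{..<n}. b l k \<otimes> c k j))"
    by (intro finsum_cong) (auto simp: finsum_rdistr' car Pi_def simp_implies_def m_assoc)
  also have "\<dots> = mat_times R a (mat_times R b c) i j"
    using n by (simp add: mat_times_matn[OF _ mat_times_closed] mat_times_matn)
  finally show "mat_times R (mat_times R a b) c i j = mat_times R a (mat_times R b c) i j" .
qed

lemma idemD: "e \<in> idem_mats R \<Longrightarrow> e \<in> mat_inf R" "e \<in> idem_mats R \<Longrightarrow> mat_times R e e = e"
  by (auto simp: idem_mats_def)

lemma idem_relI:
  "\<lbrakk>e \<in> idem_mats R; f \<in> idem_mats R; x \<in> mat_inf R; y \<in> mat_inf R; mat_times R x y = e; mat_times R y x = f\<rbrakk>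
    \<Longrightarrow> (e, f) \<in> idem_rel R"
  unfolding idem_rel_def by blast

lemma equiv_idem_rel: "equiv (idem_mats R) (idem_rel R)"
proof (rule equivI)
  show "idem_rel R \<subseteq> idem_mats R \<times> idem_mats R" by (auto simp: idem_rel_def)
  show "refl_on (idem_mats R) (idem_rel R)"
    by (rule refl_onI) (metis idem_relI idemD)
  show "sym (idem_rel R)"
    by (rule symI) (auto simp: idem_rel_def)
  show "trans (idem_rel R)"
  proof (rule transI)
    fix e f g assume "(e, f) \<in> idem_rel R" "(f, g) \<in> idem_rel R"
    then obtain x y z w where
      id: "e \<in> idem_mats R" "f \<in> idem_mats R" "g \<in> idem_mats R" and
      x: "x \<in> mat_inf R" "y \<in> mat_inf R" "z \<in> mat_inf R" "w \<in> mat_inf R" and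
      eq: "e = mat_times R x y" "f = mat_times R y x" "f = mat_times R z w" "g = mat_times R w z"
      unfolding idem_rel_def by blast
    have 1: "mat_times R (mat_times R x z) (mat_times R w y) = e"
    proof -
      have "mat_times R (mat_times R x z) (mat_times R w y) = mat_times R x (mat_times R f y)"
        using x by (simp add: mat_times_assoc mat_times_inf_closed eq(3))
      also have "\<dots> = mat_times R e e"
        using x by (simp add: mat_times_assoc mat_times_inf_closed eq(1,2))
      finally show ?thesis using id idemD by auto
    qed
    have 2: "mat_times R (mat_times R w y) (mat_times R x z) = g"
    proof -
      have "mat_times R (mat_times R w y) (mat_times R x z) = mat_times R w (mat_times R f z)"
        using x by (simp add: mat_times_assoc mat_times_inf_closed eq(2))
      also have "\<dots> = mat_times R g g"
        using x by (simp add: mat_times_assoc mat_times_inf_closed eq(3,4))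
      finally show ?thesis using id idemD by auto
    qed
    show "(e, g) \<in> idem_rel R"
      by (rule idem_relI[OF id(1,3) mat_times_inf_closed[OF x(1,3)] mat_times_inf_closed[OF x(4,2)] 1 2])
  qed
qed

lemma idem_relE:
  assumes "(e, f) \<in> idem_rel R"
  obtains x y where "e \<in> idem_mats R" "f \<in> idem_mats R" "x \<in> mat_inf R" "y \<in> mat_inf R"
    "mat_times R x y = e" "mat_times R y x = f"
  using assms unfolding idem_rel_def by blast

lemma idem_rel_trans: "\<lbrakk>(e, f) \<in> idem_rel R; (f, g) \<in> idem_rel R\<rbrakk> \<Longrightarrow> (e, g) \<in> idem_rel R"
  using equiv_idem_rel by (meson equivE transE)

lemma idem_rel_sym: "(e, f) \<in> idem_rel R \<Longrightarrow> (f, e) \<in> idem_rel R"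
  using equiv_idem_rel by (meson equivE symE)

lemma idem_rel_refl: "e \<in> idem_mats R \<Longrightarrow> (e, e) \<in> idem_rel R"
  using equiv_idem_rel by (meson equivE refl_onD)

lemma idem_class_eq_iff:
  "\<lbrakk>e \<in> idem_mats R; f \<in> idem_mats R\<rbrakk> \<Longrightarrow> idem_class R e = idem_class R f \<longleftrightarrow> (e, f) \<in> idem_rel R"
  unfolding idem_class_def using eq_equiv_class_iff[OF equiv_idem_rel] by blast

lemma idem_class_eqI: "(e, f) \<in> idem_rel R \<Longrightarrow> idem_class R e = idem_class R f"
  by (metis idem_class_eq_iff idem_relE)

lemma block_sum_matn:
  assumes "a \<in> matn R n" "b \<in> matn R m"
  shows "block_sum R n a b \<in> matn R (n + m)"
  using assms by (auto simp: block_sum_def matn_def)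

lemma block_sum_mat_inf:
  "\<lbrakk>a \<in> matn R n; b \<in> mat_inf R\<rbrakk> \<Longrightarrow> block_sum R n a b \<in> mat_inf R"
  by (metis block_sum_matn mat_infE matn_imp_mat_inf)

lemma block_sum_times:
  assumes a: "a \<in> matn R n" and c: "c \<in> matn R n" and "b \<in> mat_inf R" "d \<in> mat_inf R"
  shows "mat_times R (block_sum R n a b) (block_sum R n c d) =
    block_sum R n (mat_times R a c) (mat_times R b d)"
proof (intro ext)
  fix i j
  obtain m where b: "b \<in> matn R m" and d: "d \<in> matn R m"
    using mat_inf_bound2[OF assms(3,4)] by blast
  note car = matn_carrier[OF a] matn_carrier[OF b] matn_carrier[OF c] matn_carrier[OF d]
  have car': "block_sum R n a b i j \<in> carrier R" "block_sum R n c d i j \<in> carrier R" for i j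
    by (auto simp: block_sum_def car)
  consider "i < n" "j < n" | "n \<le> i" "n \<le> j" | "i < n" "n \<le> j" | "n \<le> i" "j < n" by linarith
  then show "mat_times R (block_sum R n a b) (block_sum R n c d) i j =
    block_sum R n (mat_times R a c) (mat_times R b d) i j"
  proof cases
    case 1
    have "mat_times R (block_sum R n a b) (block_sum R n c d) i j =
      (\<Oplus>k\<in>{..<n}. block_sum R n a b i k \<otimes> block_sum R n c d k j)"
      by (rule mat_times_eq) (auto simp: car', use 1 in \<open>auto simp: block_sum_def car\<close>)
    also have "\<dots> = (\<Oplus>k\<in>{..<n}. a i k \<otimes> c k j)"
      using 1 by (intro finsum_cong) (auto simp: block_sum_def car)
    finally show ?thesis using 1 a c by (simp add: mat_times_matn block_sum_def)
  next
    case 2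
    have "mat_times R (block_sum R n a b) (block_sum R n c d) i j =
      (\<Oplus>k\<in>(\<lambda>k. k + n) ` {..<m}. block_sum R n a b i k \<otimes> block_sum R n c d k j)"
    proof (rule mat_times_eq)
      fix k assume k: "k \<notin> (\<lambda>k. k + n) ` {..<m}"
      show "block_sum R n a b i k \<otimes> block_sum R n c d k j = \<zero>"
      proof (cases "k < n")
        case True then show ?thesis using 2 by (simp add: block_sum_def)
      next
        case False
        have "\<not> k - n < m" using k False by (metis image_eqI le_add_diff_inverse2 lessThan_iff not_less)
        then show ?thesis using 2 False car by (simp add: block_sum_def matn_zero[OF b])
      qed
    qed (auto simp: car')
    also have "\<dots> = (\<Oplus>k\<in>{..<m}. block_sum R n a b i (k + n) \<otimes> block_sum R n c d (k + n) j)"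
      by (rule finsum_reindex) (auto simp: car')
    also have "\<dots> = (\<Oplus>k\<in>{..<m}. b (i - n) k \<otimes> d k (j - n))"
      using 2 by (intro finsum_cong) (auto simp: block_sum_def car)
    finally show ?thesis using 2 b d by (simp add: mat_times_matn block_sum_def)
  next
    case 3
    have "mat_times R (block_sum R n a b) (block_sum R n c d) i j =
      (\<Oplus>k\<in>{}. block_sum R n a b i k \<otimes> block_sum R n c d k j)"
      by (rule mat_times_eq) (auto simp: car', use 3 in \<open>auto simp: block_sum_def car\<close>)
    then show ?thesis using 3 by (simp add: block_sum_def)
  next
    case 4
    have "mat_times R (block_sum R n a b) (block_sum R n c d) i j =
      (\<Oplus>k\<in>{}. block_sum R n a b i k \<otimes> block_sum R n c d k j)"
      by (rule mat_times_eq) (auto simp: car', use 4 in \<open>auto simp: block_sum_def car\<close>)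
    then show ?thesis using 4 by (simp add: block_sum_def)
  qed
qed

lemma block_sum_idem:
  "\<lbrakk>e \<in> idem_mats R; e \<in> matn R n; f \<in> idem_mats R\<rbrakk> \<Longrightarrow> block_sum R n e f \<in> idem_mats R"
  by (auto simp: idem_mats_def block_sum_mat_inf block_sum_times)

lemma mat_zero_matn: "mat_zero R \<in> matn R n"
  by (auto simp: mat_zero_def matn_def)

lemma mat_zero_idem: "mat_zero R \<in> idem_mats R"
proof -
  have "mat_times R (mat_zero R) (mat_zero R) = mat_zero R"
    by (intro ext, simp add: mat_times_matn[OF mat_zero_matn[of 0] mat_zero_matn])
       (simp add: mat_zero_def)
  then show ?thesis using mat_zero_matn matn_imp_mat_inf by (auto simp: idem_mats_def)
qed

lemma permute_idem_rel:
  assumes e: "e \<in> idem_mats R" and \<sigma>: "bij \<sigma>"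
    and m: "(\<lambda>i j. e (\<sigma> i) (\<sigma> j)) \<in> mat_inf R"
  shows "(e, \<lambda>i j. e (\<sigma> i) (\<sigma> j)) \<in> idem_rel R"
proof -
  obtain n where n: "e \<in> matn R n" using e idemD mat_infE by blast
  have inj: "inj \<sigma>" using \<sigma> by (rule bij_is_inj)
  have fin: "finite {k. \<sigma> k < n}"
    using finite_vimageI[OF finite_lessThan[of n] inj] by (simp add: vimage_def)
  then obtain N0 where N0: "\<And>k. \<sigma> k < n \<Longrightarrow> k < N0"
    by (metis (mono_tags, lifting) finite_nat_set_iff_bounded mem_Collect_eq)
  define N where "N = max N0 n"
  have N: "\<not> \<sigma> k < n" if "N \<le> k" for k using N0[of k] that by (auto simp: N_def)
  have nN: "n \<le> N" by (simp add: N_def)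
  let ?x = "\<lambda>i j. e i (\<sigma> j)" and ?y = "\<lambda>i j. e (\<sigma> i) j"
  have xy: "?x \<in> matn R N" "?y \<in> matn R N"
    using n nN N unfolding matn_def by (auto simp: not_less)
  have idem': "e = mat_times R e e" using e idemD by auto
  have img: "\<sigma> ` {k. \<sigma> k < n} = {..<n}"
    using \<sigma> by (auto simp: image_iff) (metis bij_pointE)
  have 1: "mat_times R ?x ?y = e"
  proof (intro ext)
    fix i j
    have "mat_times R ?x ?y i j = (\<Oplus>k\<in>{k. \<sigma> k < n}. e i (\<sigma> k) \<otimes> e (\<sigma> k) j)"
      by (rule mat_times_eq) (use fin n in \<open>auto simp: matn_carrier matn_zero\<close>)
    also have "\<dots> = (\<Oplus>k\<in>\<sigma> ` {k. \<sigma> k < n}. e i k \<otimes> e k j)"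
      by (rule finsum_reindex[symmetric])
         (use n inj in \<open>auto simp: matn_carrier intro: inj_on_subset\<close>)
    also have "\<dots> = mat_times R e e i j" unfolding img using n by (simp add: mat_times_matn)
    finally show "mat_times R ?x ?y i j = e i j" using idem' by simp
  qed
  have 2: "mat_times R ?y ?x = (\<lambda>i j. e (\<sigma> i) (\<sigma> j))"
  proof (intro ext)
    fix i j
    have "mat_times R ?y ?x i j = (\<Oplus>k\<in>{..<n}. e (\<sigma> i) k \<otimes> e k (\<sigma> j))"
      by (rule mat_times_eq) (use n in \<open>auto simp: matn_carrier matn_zero\<close>)
    also have "\<dots> = mat_times R e e (\<sigma> i) (\<sigma> j)" using n by (simp add: mat_times_matn)
    finally show "mat_times R ?y ?x i j = e (\<sigma> i) (\<sigma> j)" using idem' by simp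
  qed
  have 3: "mat_times R (\<lambda>i j. e (\<sigma> i) (\<sigma> j)) (\<lambda>i j. e (\<sigma> i) (\<sigma> j)) = (\<lambda>i j. e (\<sigma> i) (\<sigma> j))"
  proof -
    note mi = xy[THEN matn_imp_mat_inf] n[THEN matn_imp_mat_inf]
    have "mat_times R (mat_times R ?y ?x) (mat_times R ?y ?x) =
        mat_times R ?y (mat_times R (mat_times R ?x ?y) ?x)"
      using mi by (simp add: mat_times_assoc mat_times_inf_closed)
    also have "\<dots> = mat_times R ?y ?x"
    proof -
      have "mat_times R e ?x = ?x"
      proof (intro ext)
        fix i j
        have "mat_times R e ?x i j = (\<Oplus>k\<in>{..<n}. e i k \<otimes> e k (\<sigma> j))"
          by (rule mat_times_eq) (use n in \<open>auto simp: matn_carrier matn_zero\<close>)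
        also have "\<dots> = mat_times R e e i (\<sigma> j)" using n by (simp add: mat_times_matn)
        finally show "mat_times R e ?x i j = e i (\<sigma> j)" using idem' by simp
      qed
      then show ?thesis by (simp only: 1)
    qed
    finally show ?thesis by (simp only: 2)
  qed
  have "(\<lambda>i j. e (\<sigma> i) (\<sigma> j)) \<in> idem_mats R" unfolding idem_mats_def using m 3 by blast
  then show ?thesis
    by (rule idem_relI[OF e _ matn_imp_mat_inf[OF xy(1)] matn_imp_mat_inf[OF xy(2)] 1 2])
qed

lemma block_sum_comm_rel:
  assumes "e \<in> idem_mats R" "f \<in> idem_mats R" and e: "e \<in> matn R n" and f: "f \<in> matn R m"
  shows "(block_sum R n e f, block_sum R m f e) \<in> idem_rel R"
proof -
  define \<sigma> where "\<sigma> i = (if i < m then i + n else if i < n + m then i - m else i)" for i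
  define \<tau> where "\<tau> i = (if i < n then i + m else if i < n + m then i - n else i)" for i
  have bij: "bij \<sigma>"
    by (rule bij_betw_byWitness[of _ \<tau>]) (auto simp: \<sigma>_def \<tau>_def)
  have eq: "(\<lambda>i j. block_sum R n e f (\<sigma> i) (\<sigma> j)) = block_sum R m f e"
  proof (intro ext)
    fix i j
    have "\<not> i < n + m \<Longrightarrow> f (i - n) k = \<zero>" "\<not> j < n + m \<Longrightarrow> f k (j - n) = \<zero>"
      "\<not> i < n + m \<Longrightarrow> e (i - m) k = \<zero>" "\<not> j < n + m \<Longrightarrow> e k (j - m) = \<zero>" for k
      by (auto intro!: matn_zero[OF f] matn_zero[OF e])
    then show "block_sum R n e f (\<sigma> i) (\<sigma> j) = block_sum R m f e i j"
      by (auto simp: \<sigma>_def block_sum_def)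
  qed
  show ?thesis
    using permute_idem_rel[OF block_sum_idem[OF assms(1) e assms(2)] bij] eq
      block_sum_mat_inf[OF f] assms(1) idemD(1) by simp
qed

lemma block_sum_cong_right:
  assumes "e \<in> idem_mats R" "e \<in> matn R n" "(f, f') \<in> idem_rel R"
  shows "(block_sum R n e f, block_sum R n e f') \<in> idem_rel R"
  using assms(3)
proof (rule idem_relE)
  fix x y assume *: "f \<in> idem_mats R" "f' \<in> idem_mats R" "x \<in> mat_inf R" "y \<in> mat_inf R"
    "mat_times R x y = f" "mat_times R y x = f'"
  show ?thesis
    by (rule idem_relI[of _ _ "block_sum R n e x" "block_sum R n e y"])
       (use * assms in \<open>auto simp: block_sum_idem block_sum_mat_inf block_sum_times idemD\<close>)
qed

lemma block_sum_zero_right: "f \<in> matn R m \<Longrightarrow> block_sum R m f (mat_zero R) = f"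
  by (intro ext) (auto simp: block_sum_def mat_zero_def matn_zero)

lemma block_sum_zero_left:
  assumes "f \<in> idem_mats R"
  shows "(block_sum R d (mat_zero R) f, f) \<in> idem_rel R"
proof -
  obtain m where m: "f \<in> matn R m" using assms idemD mat_infE by blast
  show ?thesis
    using block_sum_comm_rel[OF mat_zero_idem assms mat_zero_matn m]
    by (simp add: block_sum_zero_right[OF m])
qed

lemma block_sum_enlarge:
  assumes "e \<in> idem_mats R" "e \<in> matn R n" "f \<in> idem_mats R" "n \<le> N"
  shows "(block_sum R n e f, block_sum R N e f) \<in> idem_rel R"
proof -
  have "block_sum R N e f = block_sum R n e (block_sum R (N - n) (mat_zero R) f)"
    using assms(4) unfolding block_sum_assoc by (simp add: block_sum_zero_right[OF assms(2)])
  then show ?thesis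
    using block_sum_cong_right[OF assms(1,2) idem_rel_sym[OF block_sum_zero_left[OF assms(3)]]]
    by simp
qed

lemma block_sum_cong:
  assumes ee: "(e, e') \<in> idem_rel R" and ff: "(f, f') \<in> idem_rel R"
    and n: "e \<in> matn R n" and n': "e' \<in> matn R n'"
  shows "(block_sum R n e f, block_sum R n' e' f') \<in> idem_rel R"
proof -
  obtain x y where e: "e \<in> idem_mats R" "e' \<in> idem_mats R" and x: "x \<in> mat_inf R" "y \<in> mat_inf R"
    and xy: "mat_times R x y = e" "mat_times R y x = e'"
    using ee by (rule idem_relE)
  obtain z w where f: "f \<in> idem_mats R" "f' \<in> idem_mats R" and z: "z \<in> mat_inf R" "w \<in> mat_inf R"
    and zw: "mat_times R z w = f" "mat_times R w z = f'"
    using ff by (rule idem_relE)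
  obtain N where N: "x \<in> matn R N" "y \<in> matn R N" "max n n' \<le> N"
    using mat_inf_bound2[OF x] by blast
  have eN: "e \<in> matn R N" "e' \<in> matn R N"
    using N n n' matn_mono by (meson max.boundedE subsetD)+
  have "(block_sum R N e f, block_sum R N e' f') \<in> idem_rel R"
    by (rule idem_relI[of _ _ "block_sum R N x z" "block_sum R N y w"])
       (use e f N z xy zw eN in \<open>auto simp: block_sum_idem block_sum_mat_inf block_sum_times\<close>)
  moreover have "(block_sum R n e f, block_sum R N e f) \<in> idem_rel R"
    "(block_sum R n' e' f', block_sum R N e' f') \<in> idem_rel R"
    using block_sum_enlarge e f n n' N by auto
  ultimately show ?thesis by (meson idem_rel_sym idem_rel_trans)
qed

lemma V_carrierE:
  assumes "X \<in> carrier (V_monoid R)"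
  obtains e n where "e \<in> idem_mats R" "e \<in> matn R n" "X = idem_class R e"
  using assms unfolding V_monoid_def idem_class_def quotient_def
  by (auto, metis idemD(1) mat_infE)

lemma idem_class_V: "e \<in> idem_mats R \<Longrightarrow> idem_class R e \<in> carrier (V_monoid R)"
  by (auto simp: V_monoid_def idem_class_def intro: quotientI)

lemma V_mult:
  assumes "e \<in> idem_mats R" "f \<in> idem_mats R" "e \<in> matn R n"
  shows "idem_class R e \<otimes>\<^bsub>V_monoid R\<^esub> idem_class R f = idem_class R (block_sum R n e f)"
proof -
  have *: "idem_class R (block_sum R n' e' f') = idem_class R (block_sum R n e f)"
    if "(e, e') \<in> idem_rel R" "(f, f') \<in> idem_rel R" "e' \<in> matn R n'" for e' f' n'
    using idem_class_eqI[OF block_sum_cong[OF that(1,2) assms(3) that(3)]] by simp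
  have "idem_class R e \<otimes>\<^bsub>V_monoid R\<^esub> idem_class R f =
    (\<Union>e'\<in>idem_class R e. \<Union>f'\<in>idem_class R f. \<Union>n\<in>{n. e' \<in> matn R n}.
      idem_class R (block_sum R n e' f'))"
    by (simp add: V_monoid_def)
  also have "\<dots> = idem_class R (block_sum R n e f)" (is "?U = ?C")
  proof
    show "?U \<subseteq> ?C" using * unfolding idem_class_def by fastforce
    show "?C \<subseteq> ?U"
      using idem_rel_refl[OF assms(1)] idem_rel_refl[OF assms(2)] assms(3)
      by (auto simp: idem_class_def)
  qed
  finally show ?thesis .
qed

lemma V_comm_monoid: "comm_monoid (V_monoid R)"
proof (rule comm_monoidI)
  fix X Y assume X: "X \<in> carrier (V_monoid R)" and Y: "Y \<in> carrier (V_monoid R)"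
  obtain e n where e: "e \<in> idem_mats R" "e \<in> matn R n" "X = idem_class R e" using X by (rule V_carrierE)
  obtain f m where f: "f \<in> idem_mats R" "f \<in> matn R m" "Y = idem_class R f" using Y by (rule V_carrierE)
  show "X \<otimes>\<^bsub>V_monoid R\<^esub> Y \<in> carrier (V_monoid R)"
    using e f by (simp add: V_mult idem_class_V block_sum_idem)
  show "X \<otimes>\<^bsub>V_monoid R\<^esub> Y = Y \<otimes>\<^bsub>V_monoid R\<^esub> X"
    using e f V_mult idem_class_eqI[OF block_sum_comm_rel[OF e(1) f(1) e(2) f(2)]] by simp
  fix Z assume Z: "Z \<in> carrier (V_monoid R)"
  obtain g k where g: "g \<in> idem_mats R" "g \<in> matn R k" "Z = idem_class R g" using Z by (rule V_carrierE)
  show "X \<otimes>\<^bsub>V_monoid R\<^esub> Y \<otimes>\<^bsub>V_monoid R\<^esub> Z = X \<otimes>\<^bsub>V_monoid R\<^esub> (Y \<otimes>\<^bsub>V_monoid R\<^esub> Z)"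
    using e f g
    by (simp add: V_mult[of _ _ n] V_mult[of _ _ m] V_mult[of _ _ "n + m"] block_sum_idem
        block_sum_matn block_sum_assoc)
next
  show "\<one>\<^bsub>V_monoid R\<^esub> \<in> carrier (V_monoid R)"
    using idem_class_V[OF mat_zero_idem] by (simp add: V_monoid_def)
next
  fix X assume X: "X \<in> carrier (V_monoid R)"
  obtain e n where e: "e \<in> idem_mats R" "e \<in> matn R n" "X = idem_class R e" using X by (rule V_carrierE)
  have "\<one>\<^bsub>V_monoid R\<^esub> = idem_class R (mat_zero R)" by (simp add: V_monoid_def)
  then show "\<one>\<^bsub>V_monoid R\<^esub> \<otimes>\<^bsub>V_monoid R\<^esub> X = X"
    using e V_mult[OF mat_zero_idem e(1) mat_zero_matn]
      idem_class_eqI[OF block_sum_zero_left[OF e(1)]] by simp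
qed

lemma mat_single_matn: "a \<in> carrier R \<Longrightarrow> mat_single R a \<in> matn R 1"
  by (auto simp: mat_single_def matn_def)

lemma mat_single_times:
  assumes "a \<in> carrier R" "b \<in> carrier R"
  shows "mat_times R (mat_single R a) (mat_single R b) = mat_single R (a \<otimes> b)"
proof -
  have "{..<1::nat} = {0}" by auto
  then show ?thesis
    using assms by (intro ext, simp add: mat_times_matn[OF mat_single_matn mat_single_matn])
      (auto simp: mat_single_def)
qed

lemma mat_single_idem: "\<lbrakk>a \<in> carrier R; a \<otimes> a = a\<rbrakk> \<Longrightarrow> mat_single R a \<in> idem_mats R"
  by (simp add: idem_mats_def mat_single_times matn_imp_mat_inf[OF mat_single_matn])

lemma mat_single_rel:
  assumes "x \<in> carrier R" "y \<in> carrier R" "(x \<otimes> y) \<otimes> (x \<otimes> y) = x \<otimes> y" "(y \<otimes> x) \<otimes> (y \<otimes> x) = y \<otimes> x"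
  shows "idem_class R (mat_single R (x \<otimes> y)) = idem_class R (mat_single R (y \<otimes> x))"
  by (rule idem_class_eqI, rule idem_relI[of _ _ "mat_single R x" "mat_single R y"])
     (use assms in \<open>auto simp: mat_single_idem mat_single_times matn_imp_mat_inf[OF mat_single_matn]\<close>)

lemma mat_single_add:
  assumes "a \<in> carrier R" "b \<in> carrier R" "a \<otimes> a = a" "b \<otimes> b = b" "a \<otimes> b = \<zero>" "b \<otimes> a = \<zero>"
  shows "idem_class R (mat_single R (a \<oplus> b)) =
    idem_class R (mat_single R a) \<otimes>\<^bsub>V_monoid R\<^esub> idem_class R (mat_single R b)"
proof -
  let ?x = "\<lambda>i j::nat. if i = 0 \<and> j = 0 then a else if i = 0 \<and> j = 1 then b else \<zero>"
  let ?y = "\<lambda>i j::nat. if i = 0 \<and> j = 0 then a else if i = 1 \<and> j = 0 then b else \<zero>"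
  have x: "?x \<in> matn R 2" "?y \<in> matn R 2" using assms by (auto simp: matn_def)
  have two: "{..<2::nat} = {0, 1}" by auto
  have ab: "(a \<oplus> b) \<otimes> (a \<oplus> b) = a \<oplus> b" using assms by (simp add: l_distr r_distr)
  have 1: "mat_times R ?x ?y = mat_single R (a \<oplus> b)"
    using assms
    by (intro ext, simp add: mat_times_matn[OF x] two) (auto simp: mat_single_def)
  have 2: "mat_times R ?y ?x = block_sum R 1 (mat_single R a) (mat_single R b)"
    using assms
    by (intro ext, simp add: mat_times_matn[OF x(2) x(1)] two)
       (auto simp: mat_single_def block_sum_def)
  have "(mat_single R (a \<oplus> b), block_sum R 1 (mat_single R a) (mat_single R b)) \<in> idem_rel R"
  proof (rule idem_relI[OF _ _ matn_imp_mat_inf[OF x(1)] matn_imp_mat_inf[OF x(2)] 1 2])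
    show "mat_single R (a \<oplus> b) \<in> idem_mats R" using assms ab by (simp add: mat_single_idem)
    show "block_sum R 1 (mat_single R a) (mat_single R b) \<in> idem_mats R"
      by (rule block_sum_idem) (use assms in \<open>auto simp: mat_single_idem mat_single_matn simp del: One_nat_def\<close>)
  qed
  then show ?thesis
    using assms by (simp add: idem_class_eqI V_mult[OF _ _ mat_single_matn] mat_single_idem)
qed

lemma mat_single_zero: "idem_class R (mat_single R \<zero>) = \<one>\<^bsub>V_monoid R\<^esub>"
proof -
  have "mat_single R \<zero> = mat_zero R" by (intro ext) (simp add: mat_single_def mat_zero_def)
  then show ?thesis by (simp add: V_monoid_def)
qed

end

subsection \<open>The Leavitt path algebra and its universal property\<close>

lemma UN_const: "\<lbrakk>a \<in> A; \<And>x. x \<in> A \<Longrightarrow> F x = C\<rbrakk> \<Longrightarrow> (\<Union>x\<in>A. F x) = C"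
  by auto

lemma UN_const2:
  assumes "a \<in> A" "b \<in> B" "\<And>x y. \<lbrakk>x \<in> A; y \<in> B\<rbrakk> \<Longrightarrow> F x y = C"
  shows "(\<Union>x\<in>A. \<Union>y\<in>B. F x y) = C"
  using assms by (intro UN_const[OF assms(1)] UN_const[OF assms(2)])

locale lpa_setup = wf_digraph E + K: field K
  for E :: "('v, 'e) pre_digraph" and K :: "('k, 'm) ring_scheme"
begin

abbreviation "L \<equiv> leavitt_path_algebra K E"
abbreviation "cls \<equiv> lpa_class K E"

lemma lpa_cong_terms: "lpa_cong K E x y \<Longrightarrow> x \<in> lpa_terms K E \<and> y \<in> lpa_terms K E"
proof (induction rule: lpa_cong.induct)
  case (vert_sum v es)
  have "foldr (\<lambda>e. TAdd (TMul (TEdge e) (TGhost e))) xs TZero \<in> lpa_terms K E"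
    if "set xs \<subseteq> arcs E" for xs
    using that by (induction xs) (auto intro: lpa_terms.intros)
  then show ?case using vert_sum
    by (auto simp: regular_vertex_def out_arcs_def intro: lpa_terms.intros)
qed (auto intro!: lpa_terms.intros)

lemma equiv_lpa_rel: "equiv (lpa_terms K E) (lpa_rel K E)"
proof (rule equivI)
  show "lpa_rel K E \<subseteq> lpa_terms K E \<times> lpa_terms K E"
    using lpa_cong_terms by (auto simp: lpa_rel_def)
  show "refl_on (lpa_terms K E) (lpa_rel K E)"
    by (rule refl_onI) (auto simp: lpa_rel_def intro: lpa_cong.refl)
  show "sym (lpa_rel K E)" by (rule symI) (auto simp: lpa_rel_def intro: lpa_cong.sym)
  show "trans (lpa_rel K E)" by (rule transI) (auto simp: lpa_rel_def intro: lpa_cong.trans)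
qed

lemma cls_eqI: "lpa_cong K E x y \<Longrightarrow> cls x = cls y"
  unfolding lpa_class_def by (rule equiv_class_eq[OF equiv_lpa_rel]) (simp add: lpa_rel_def)

lemma cls_eqD: "\<lbrakk>cls x = cls y; x \<in> lpa_terms K E; y \<in> lpa_terms K E\<rbrakk> \<Longrightarrow> lpa_cong K E x y"
  unfolding lpa_class_def using eq_equiv_class_iff[OF equiv_lpa_rel] by (auto simp: lpa_rel_def)

lemma cls_self: "x \<in> lpa_terms K E \<Longrightarrow> x \<in> cls x"
  by (auto simp: lpa_class_def lpa_rel_def intro: lpa_cong.refl)

lemma cls_mem: "y \<in> cls x \<longleftrightarrow> lpa_cong K E x y"
  by (auto simp: lpa_class_def lpa_rel_def)

lemma cls_carrier: "x \<in> lpa_terms K E \<Longrightarrow> cls x \<in> carrier L"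
  by (auto simp: leavitt_path_algebra_def lpa_class_def intro: quotientI)

lemma L_carrierE:
  assumes "X \<in> carrier L" obtains x where "x \<in> lpa_terms K E" "X = cls x"
  using assms by (auto simp: leavitt_path_algebra_def lpa_class_def quotient_def)

lemma L_zero: "\<zero>\<^bsub>L\<^esub> = cls TZero"
  by (simp add: leavitt_path_algebra_def)

lemma L_add:
  assumes "x \<in> lpa_terms K E" "y \<in> lpa_terms K E"
  shows "cls x \<oplus>\<^bsub>L\<^esub> cls y = cls (TAdd x y)"
proof -
  have "cls (TAdd x' y') = cls (TAdd x y)" if "x' \<in> cls x" "y' \<in> cls y" for x' y'
    by (rule cls_eqI[symmetric], rule lpa_cong.add) (use that in \<open>simp_all add: cls_mem\<close>)
  then have "(\<Union>x'\<in>cls x. \<Union>y'\<in>cls y. cls (TAdd x' y')) = cls (TAdd x y)"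
    by (rule UN_const2[OF cls_self[OF assms(1)] cls_self[OF assms(2)]])
  then show ?thesis by (simp add: leavitt_path_algebra_def)
qed

lemma L_mult:
  assumes "x \<in> lpa_terms K E" "y \<in> lpa_terms K E"
  shows "cls x \<otimes>\<^bsub>L\<^esub> cls y = cls (TMul x y)"
proof -
  have "cls (TMul x' y') = cls (TMul x y)" if "x' \<in> cls x" "y' \<in> cls y" for x' y'
    by (rule cls_eqI[symmetric], rule lpa_cong.mul) (use that in \<open>simp_all add: cls_mem\<close>)
  then have "(\<Union>x'\<in>cls x. \<Union>y'\<in>cls y. cls (TMul x' y')) = cls (TMul x y)"
    by (rule UN_const2[OF cls_self[OF assms(1)] cls_self[OF assms(2)]])
  then show ?thesis by (simp add: leavitt_path_algebra_def)
qed

lemma L_smult: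
  assumes "c \<in> carrier K" "x \<in> lpa_terms K E"
  shows "c \<odot>\<^bsub>L\<^esub> cls x = cls (TScal c x)"
proof -
  have "cls (TScal c x') = cls (TScal c x)" if "x' \<in> cls x" for x'
    by (rule cls_eqI[symmetric], rule lpa_cong.scal) (use that assms in \<open>simp_all add: cls_mem\<close>)
  then have "(\<Union>x'\<in>cls x. cls (TScal c x')) = cls (TScal c x)"
    by (rule UN_const[OF cls_self[OF assms(2)]])
  then show ?thesis by (simp add: leavitt_path_algebra_def)
qed

lemmas L_ops = L_zero L_add L_mult L_smult

lemma nu_algebra_L: "nu_algebra K L"
proof -
  note [intro] = lpa_terms.intros
  have abg: "abelian_group L"
  proof (rule abelian_groupI)
    fix X Y assume "X \<in> carrier L" "Y \<in> carrier L"
    then show "X \<oplus>\<^bsub>L\<^esub> Y \<in> carrier L"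
      by (elim L_carrierE) (auto simp: L_ops intro: cls_carrier)
  next
    show "\<zero>\<^bsub>L\<^esub> \<in> carrier L" by (auto simp: L_ops intro: cls_carrier)
  next
    fix X Y Z assume "X \<in> carrier L" "Y \<in> carrier L" "Z \<in> carrier L"
    then show "X \<oplus>\<^bsub>L\<^esub> Y \<oplus>\<^bsub>L\<^esub> Z = X \<oplus>\<^bsub>L\<^esub> (Y \<oplus>\<^bsub>L\<^esub> Z)"
      by (elim L_carrierE) (auto simp: L_ops lpa_terms.intros intro!: cls_eqI lpa_cong.add_assoc)
  next
    fix X Y assume "X \<in> carrier L" "Y \<in> carrier L"
    then show "X \<oplus>\<^bsub>L\<^esub> Y = Y \<oplus>\<^bsub>L\<^esub> X"
      by (elim L_carrierE) (auto simp: L_ops lpa_terms.intros intro!: cls_eqI lpa_cong.add_comm)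
  next
    fix X assume "X \<in> carrier L"
    then show "\<zero>\<^bsub>L\<^esub> \<oplus>\<^bsub>L\<^esub> X = X"
      by (elim L_carrierE) (auto simp: L_ops lpa_terms.intros intro!: cls_eqI lpa_cong.add_zero)
  next
    fix X assume "X \<in> carrier L"
    then obtain x where x: "x \<in> lpa_terms K E" "X = cls x" by (rule L_carrierE)
    show "\<exists>Y\<in>carrier L. Y \<oplus>\<^bsub>L\<^esub> X = \<zero>\<^bsub>L\<^esub>"
      by (rule bexI[of _ "cls (TNeg x)"])
        (use x in \<open>auto simp: L_ops lpa_terms.intros intro!: cls_eqI cls_carrier lpa_cong.add_neg\<close>)
  qed
  have mod: "Module.module K L"
  proof (rule Module.moduleI[OF K.is_cring abg])
    fix c X assume "c \<in> carrier K" "X \<in> carrier L"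
    then show "c \<odot>\<^bsub>L\<^esub> X \<in> carrier L"
      by (elim L_carrierE) (auto simp: L_ops intro: cls_carrier)
  next
    fix c d X assume "c \<in> carrier K" "d \<in> carrier K" "X \<in> carrier L"
    then show "(c \<oplus>\<^bsub>K\<^esub> d) \<odot>\<^bsub>L\<^esub> X = c \<odot>\<^bsub>L\<^esub> X \<oplus>\<^bsub>L\<^esub> d \<odot>\<^bsub>L\<^esub> X"
      by (elim L_carrierE) (auto simp: L_ops lpa_terms.intros intro!: cls_eqI lpa_cong.add_scal)
  next
    fix c X Y assume "c \<in> carrier K" "X \<in> carrier L" "Y \<in> carrier L"
    then show "c \<odot>\<^bsub>L\<^esub> (X \<oplus>\<^bsub>L\<^esub> Y) = c \<odot>\<^bsub>L\<^esub> X \<oplus>\<^bsub>L\<^esub> c \<odot>\<^bsub>L\<^esub> Y"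
      by (elim L_carrierE) (auto simp: L_ops lpa_terms.intros intro!: cls_eqI lpa_cong.scal_add)
  next
    fix c d X assume "c \<in> carrier K" "d \<in> carrier K" "X \<in> carrier L"
    then show "(c \<otimes>\<^bsub>K\<^esub> d) \<odot>\<^bsub>L\<^esub> X = c \<odot>\<^bsub>L\<^esub> (d \<odot>\<^bsub>L\<^esub> X)"
      by (elim L_carrierE) (auto simp: L_ops lpa_terms.intros intro!: cls_eqI lpa_cong.scal_scal)
  next
    fix X assume "X \<in> carrier L"
    then show "\<one>\<^bsub>K\<^esub> \<odot>\<^bsub>L\<^esub> X = X"
      by (elim L_carrierE) (auto simp: L_ops lpa_terms.intros intro!: cls_eqI lpa_cong.scal_one)
  qed
  have "nu_ring_axioms L"
  proof
    fix X Y assume "X \<in> carrier L" "Y \<in> carrier L"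
    then show "X \<otimes>\<^bsub>L\<^esub> Y \<in> carrier L"
      by (elim L_carrierE) (auto simp: L_ops intro: cls_carrier)
  next
    fix X Y Z assume "X \<in> carrier L" "Y \<in> carrier L" "Z \<in> carrier L"
    then show "X \<otimes>\<^bsub>L\<^esub> Y \<otimes>\<^bsub>L\<^esub> Z = X \<otimes>\<^bsub>L\<^esub> (Y \<otimes>\<^bsub>L\<^esub> Z)"
      by (elim L_carrierE) (auto simp: L_ops lpa_terms.intros intro!: cls_eqI lpa_cong.mul_assoc)
  next
    fix X Y Z assume "X \<in> carrier L" "Y \<in> carrier L" "Z \<in> carrier L"
    then show "(X \<oplus>\<^bsub>L\<^esub> Y) \<otimes>\<^bsub>L\<^esub> Z = X \<otimes>\<^bsub>L\<^esub> Z \<oplus>\<^bsub>L\<^esub> Y \<otimes>\<^bsub>L\<^esub> Z"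
      by (elim L_carrierE) (auto simp: L_ops lpa_terms.intros intro!: cls_eqI lpa_cong.distrib_left)
  next
    fix X Y Z assume "X \<in> carrier L" "Y \<in> carrier L" "Z \<in> carrier L"
    then show "Z \<otimes>\<^bsub>L\<^esub> (X \<oplus>\<^bsub>L\<^esub> Y) = Z \<otimes>\<^bsub>L\<^esub> X \<oplus>\<^bsub>L\<^esub> Z \<otimes>\<^bsub>L\<^esub> Y"
      by (elim L_carrierE) (auto simp: L_ops lpa_terms.intros intro!: cls_eqI lpa_cong.distrib_right)
  qed
  moreover have "nu_algebra_axioms K L"
  proof
    fix c X Y assume "c \<in> carrier K" "X \<in> carrier L" "Y \<in> carrier L"
    then show "(c \<odot>\<^bsub>L\<^esub> X) \<otimes>\<^bsub>L\<^esub> Y = c \<odot>\<^bsub>L\<^esub> (X \<otimes>\<^bsub>L\<^esub> Y)"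
      by (elim L_carrierE) (auto simp: L_ops lpa_terms.intros intro!: cls_eqI lpa_cong.scal_mul_left)
  next
    fix c X Y assume "c \<in> carrier K" "X \<in> carrier L" "Y \<in> carrier L"
    then show "X \<otimes>\<^bsub>L\<^esub> (c \<odot>\<^bsub>L\<^esub> Y) = c \<odot>\<^bsub>L\<^esub> (X \<otimes>\<^bsub>L\<^esub> Y)"
      by (elim L_carrierE) (auto simp: L_ops lpa_terms.intros intro!: cls_eqI lpa_cong.scal_mul_right)
  qed
  ultimately show ?thesis
    using abg mod by (simp add: nu_algebra_def nu_ring_def)
qed

end

sublocale lpa_setup \<subseteq> L: nu_algebra K L
  by (rule nu_algebra_L)

context lpa_setup
begin

lemma leavitt_family_L: "leavitt_family E L (lpa_p K E) (lpa_t K E) (lpa_t_star K E)"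
proof -
  note [simp] = lpa_terms.intros L_ops lpa_p_def lpa_t_def lpa_t_star_def
  have sum: "cls (foldr (\<lambda>e. TAdd (TMul (TEdge e) (TGhost e))) es TZero) =
      (\<Oplus>\<^bsub>L\<^esub>e\<in>set es. lpa_t K E e \<otimes>\<^bsub>L\<^esub> lpa_t_star K E e) \<and>
      foldr (\<lambda>e. TAdd (TMul (TEdge e) (TGhost e))) es TZero \<in> lpa_terms K E"
    if "distinct es" "set es \<subseteq> arcs E" for es
    using that
  proof (induction es)
    case Nil
    then show ?case using L.finsum_empty by simp
  next
    case (Cons e es)
    have "(\<Oplus>\<^bsub>L\<^esub>e\<in>set (e # es). lpa_t K E e \<otimes>\<^bsub>L\<^esub> lpa_t_star K E e) =
      lpa_t K E e \<otimes>\<^bsub>L\<^esub> lpa_t_star K E e \<oplus>\<^bsub>L\<^esub>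
      (\<Oplus>\<^bsub>L\<^esub>e\<in>set es. lpa_t K E e \<otimes>\<^bsub>L\<^esub> lpa_t_star K E e)"
      using Cons.prems
      by (simp del: L_mult L_add, subst L.finsum_insert)
        (auto simp: cls_carrier simp del: L_mult L_add)
    also have "\<dots> = cls (TMul (TEdge e) (TGhost e)) \<oplus>\<^bsub>L\<^esub>
      cls (foldr (\<lambda>e. TAdd (TMul (TEdge e) (TGhost e))) es TZero)"
    proof -
      have "lpa_t K E e \<otimes>\<^bsub>L\<^esub> lpa_t_star K E e = cls (TMul (TEdge e) (TGhost e))"
        using Cons.prems by simp
      moreover have "(\<Oplus>\<^bsub>L\<^esub>e\<in>set es. lpa_t K E e \<otimes>\<^bsub>L\<^esub> lpa_t_star K E e) =
          cls (foldr (\<lambda>e. TAdd (TMul (TEdge e) (TGhost e))) es TZero)"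
        using Cons.IH Cons.prems by (metis distinct.simps(2) list.set_intros(2) subset_iff)
      ultimately show ?thesis by metis
    qed
    also have "\<dots> = cls (foldr (\<lambda>e. TAdd (TMul (TEdge e) (TGhost e))) (e # es) TZero)"
    proof -
      have "foldr (\<lambda>e. TAdd (TMul (TEdge e) (TGhost e))) es TZero \<in> lpa_terms K E"
        using Cons by simp
      then show ?thesis using Cons.prems by simp
    qed
    finally have "(\<Oplus>\<^bsub>L\<^esub>e\<in>set (e # es). lpa_t K E e \<otimes>\<^bsub>L\<^esub> lpa_t_star K E e) =
      cls (foldr (\<lambda>e. TAdd (TMul (TEdge e) (TGhost e))) (e # es) TZero)" .
    moreover have "foldr (\<lambda>e. TAdd (TMul (TEdge e) (TGhost e))) (e # es) TZero \<in> lpa_terms K E"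
      using Cons by simp
    ultimately show ?case by metis
  qed
  have reg: "lpa_p K E v = (\<Oplus>\<^bsub>L\<^esub>e\<in>out_arcs E v. lpa_t K E e \<otimes>\<^bsub>L\<^esub> lpa_t_star K E e)"
    if v: "regular_vertex E v" for v
  proof -
    obtain es where es: "set es = out_arcs E v" "distinct es"
      using v finite_distinct_list unfolding regular_vertex_def by blast
    have "lpa_p K E v = cls (foldr (\<lambda>e. TAdd (TMul (TEdge e) (TGhost e))) es TZero)"
      using lpa_cong.vert_sum[OF v es(2,1), THEN cls_eqI] by simp
    also have "\<dots> = (\<Oplus>\<^bsub>L\<^esub>e\<in>set es. lpa_t K E e \<otimes>\<^bsub>L\<^esub> lpa_t_star K E e)"
      using sum[OF es(2)] es(1) by (auto simp: out_arcs_def)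
    finally show ?thesis by (simp only: es(1))
  qed
  show ?thesis
    unfolding leavitt_family_def
  proof (intro conjI ballI allI impI)
    show "lpa_p K E v = (\<Oplus>\<^bsub>L\<^esub>e\<in>out_arcs E v. lpa_t K E e \<otimes>\<^bsub>L\<^esub> lpa_t_star K E e)"
      if "regular_vertex E v" for v using that by (rule reg)
  qed (auto intro!: cls_carrier cls_eqI lpa_cong.vert_idem lpa_cong.vert_orth lpa_cong.tail_edge
      lpa_cong.edge_head lpa_cong.head_ghost lpa_cong.ghost_tail lpa_cong.ghost_edge
      lpa_cong.ghost_edge_orth)
qed

end

primrec lpa_eval ::
  "('k, 'a, 'n) module_scheme \<Rightarrow> ('v \<Rightarrow> 'a) \<Rightarrow> ('e \<Rightarrow> 'a) \<Rightarrow> ('e \<Rightarrow> 'a) \<Rightarrow>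
    ('v, 'e, 'k) lpa_term \<Rightarrow> 'a" where
  "lpa_eval A P S S' (TVert v) = P v"
| "lpa_eval A P S S' (TEdge e) = S e"
| "lpa_eval A P S S' (TGhost e) = S' e"
| "lpa_eval A P S S' TZero = \<zero>\<^bsub>A\<^esub>"
| "lpa_eval A P S S' (TNeg x) = \<ominus>\<^bsub>A\<^esub> lpa_eval A P S S' x"
| "lpa_eval A P S S' (TAdd x y) = lpa_eval A P S S' x \<oplus>\<^bsub>A\<^esub> lpa_eval A P S S' y"
| "lpa_eval A P S S' (TMul x y) = lpa_eval A P S S' x \<otimes>\<^bsub>A\<^esub> lpa_eval A P S S' y"
| "lpa_eval A P S S' (TScal c x) = c \<odot>\<^bsub>A\<^esub> lpa_eval A P S S' x"

context lpa_setup
begin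

lemma lpa_universal:
  assumes A: "nu_algebra K A" and fam: "leavitt_family E A P S S'"
  shows "\<exists>!\<phi>. \<phi> \<in> extensional (carrier L) \<and> \<phi> \<in> nu_alg_hom K L A \<and>
    (\<forall>v \<in> verts E. \<phi> (lpa_p K E v) = P v) \<and>
    (\<forall>e \<in> arcs E. \<phi> (lpa_t K E e) = S e \<and> \<phi> (lpa_t_star K E e) = S' e)"
proof -
  interpret A: nu_algebra K A by (rule A)
  let ?ev = "lpa_eval A P S S'"
  have P: "v \<in> verts E \<Longrightarrow> P v \<in> carrier A" and S: "e \<in> arcs E \<Longrightarrow> S e \<in> carrier A"
    and S': "e \<in> arcs E \<Longrightarrow> S' e \<in> carrier A" for v e
    using fam unfolding leavitt_family_def by auto
  have ev_carrier: "?ev x \<in> carrier A" if "x \<in> lpa_terms K E" for x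
    using that by (induction rule: lpa_terms.induct) (auto simp: P S S')
  have ev_sum: "?ev (foldr (\<lambda>e. TAdd (TMul (TEdge e) (TGhost e))) es TZero) =
    (\<Oplus>\<^bsub>A\<^esub>e\<in>set es. S e \<otimes>\<^bsub>A\<^esub> S' e)" if "distinct es" "set es \<subseteq> arcs E" for es
    using that
  proof (induction es)
    case Nil
    then show ?case using A.finsum_empty by simp
  next
    case (Cons e es)
    then show ?case by (simp, subst A.finsum_insert) (auto simp: S S')
  qed
  have ev_cong: "?ev x = ?ev y" if "lpa_cong K E x y" for x y
    using that
  proof (induction rule: lpa_cong.induct)
    case (vert_sum v es)
    then have "?ev (foldr (\<lambda>e. TAdd (TMul (TEdge e) (TGhost e))) es TZero) = P v"
      using ev_sum[of es] fam unfolding leavitt_family_def by (auto simp: out_arcs_def)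
    then show ?case by simp
  next
    case (add_neg x) then show ?case by (simp add: ev_carrier A.l_neg)
  next
    case (add_assoc x y z) then show ?case by (simp add: ev_carrier A.a_assoc)
  next
    case (add_comm x y) then show ?case by (simp add: ev_carrier A.a_comm)
  next
    case (distrib_left x y z) then show ?case by (simp add: ev_carrier A.l_distr)
  next
    case (distrib_right x y z) then show ?case by (simp add: ev_carrier A.r_distr)
  next
    case (mul_assoc x y z) then show ?case by (simp add: ev_carrier A.m_assoc)
  next
    case (scal_mul_left c x y) then show ?case by (simp add: ev_carrier A.smult_mult_left)
  next
    case (scal_mul_right c x y) then show ?case by (simp add: ev_carrier A.smult_mult_right)
  next
    case (scal_add c x y) then show ?case by (simp add: ev_carrier A.smult_r_distr)
  next
    case (add_scal c d x) then show ?case by (simp add: ev_carrier A.smult_l_distr)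
  next
    case (scal_scal c d x) then show ?case by (simp add: ev_carrier A.smult_assoc1)
  qed (use fam in \<open>auto simp: ev_carrier leavitt_family_def\<close>)
  define \<phi> where "\<phi> = restrict (\<lambda>X. ?ev (SOME x. x \<in> X)) (carrier L)"
  have \<phi>: "\<phi> (cls x) = ?ev x" if "x \<in> lpa_terms K E" for x
  proof -
    have "(SOME y. y \<in> cls x) \<in> cls x" using cls_self[OF that] by (rule someI)
    then have "?ev (SOME y. y \<in> cls x) = ?ev x" using ev_cong cls_mem by metis
    then show ?thesis using that by (simp add: \<phi>_def cls_carrier)
  qed
  show ?thesis
  proof (rule ex1I[of _ \<phi>])
    have "\<phi> \<in> nu_alg_hom K L A"
      unfolding nu_alg_hom_def
      by (auto elim!: L_carrierE simp: L_ops \<phi> ev_carrier lpa_terms.intros)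
    then show "\<phi> \<in> extensional (carrier L) \<and> \<phi> \<in> nu_alg_hom K L A \<and>
      (\<forall>v \<in> verts E. \<phi> (lpa_p K E v) = P v) \<and>
      (\<forall>e \<in> arcs E. \<phi> (lpa_t K E e) = S e \<and> \<phi> (lpa_t_star K E e) = S' e)"
      by (auto simp: lpa_p_def lpa_t_def lpa_t_star_def \<phi> lpa_terms.intros)
         (simp add: \<phi>_def)
  next
    fix \<psi> assume \<psi>: "\<psi> \<in> extensional (carrier L) \<and> \<psi> \<in> nu_alg_hom K L A \<and>
      (\<forall>v \<in> verts E. \<psi> (lpa_p K E v) = P v) \<and>
      (\<forall>e \<in> arcs E. \<psi> (lpa_t K E e) = S e \<and> \<psi> (lpa_t_star K E e) = S' e)"
    then have hom: "\<psi> X \<in> carrier A" "\<psi> (X \<oplus>\<^bsub>L\<^esub> Y) = \<psi> X \<oplus>\<^bsub>A\<^esub> \<psi> Y"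
      "\<psi> (X \<otimes>\<^bsub>L\<^esub> Y) = \<psi> X \<otimes>\<^bsub>A\<^esub> \<psi> Y"
      "c \<in> carrier K \<Longrightarrow> \<psi> (c \<odot>\<^bsub>L\<^esub> X) = c \<odot>\<^bsub>A\<^esub> \<psi> X"
      if "X \<in> carrier L" "Y \<in> carrier L" for X Y c
      using that unfolding nu_alg_hom_def by auto
    have zero: "\<psi> \<zero>\<^bsub>L\<^esub> = \<zero>\<^bsub>A\<^esub>"
      using hom(1,2)[of "\<zero>\<^bsub>L\<^esub>" "\<zero>\<^bsub>L\<^esub>"] by (simp add: A.add.l_cancel_one')
    have "\<psi> (cls x) = ?ev x" if "x \<in> lpa_terms K E" for x
      using that
    proof (induction rule: lpa_terms.induct)
      case 4 then show ?case using zero by (simp add: L_zero)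
    next
      case (5 x)
      have "cls (TNeg x) \<oplus>\<^bsub>L\<^esub> cls x = \<zero>\<^bsub>L\<^esub>"
        using 5 by (auto simp: L_ops lpa_terms.intros intro!: cls_eqI lpa_cong.add_neg)
      then have "\<psi> (cls (TNeg x)) \<oplus>\<^bsub>A\<^esub> \<psi> (cls x) = \<zero>\<^bsub>A\<^esub>"
        using hom(2)[of "cls (TNeg x)" "cls x"] 5 zero by (simp add: cls_carrier lpa_terms.intros)
      then have "\<ominus>\<^bsub>A\<^esub> \<psi> (cls x) = \<psi> (cls (TNeg x))"
        by (rule A.minus_equality) (use 5 hom(1) cls_carrier lpa_terms.intros(5) in blast)+
      then show ?case using 5 by simp
    next
      case (6 x y)
      then show ?case using hom(2)[of "cls x" "cls y"] by (simp add: cls_carrier L_add)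
    next
      case (7 x y)
      then show ?case using hom(3)[of "cls x" "cls y"] by (simp add: cls_carrier L_mult)
    next
      case (8 c x)
      then show ?case using hom(4)[of "cls x" "cls x" c] by (simp add: cls_carrier L_smult)
    qed (use \<psi> in \<open>auto simp: lpa_p_def lpa_t_def lpa_t_star_def\<close>)
    then show "\<psi> = \<phi>"
      using \<psi> by (intro extensionalityI[of _ "carrier L"])
        (auto elim!: L_carrierE simp: \<phi>, simp add: \<phi>_def)
  qed
qed

end

subsection \<open>The monoid structure of the graph monoid\<close>

context wf_digraph
begin

lemma mbar_words_add [simp, intro]:
  "\<lbrakk>m \<in> mbar_words G; n \<in> mbar_words G\<rbrakk> \<Longrightarrow> m + n \<in> mbar_words G"
  by (auto simp: mbar_words_def)

lemma mbar_words_empty [simp, intro]: "{#} \<in> mbar_words G"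
  by (auto simp: mbar_words_def)

lemma range_sum_words: "S \<subseteq> arcs G \<Longrightarrow> range_sum G S \<in> mbar_words G"
  by (cases "finite S") (auto simp: range_sum_def mbar_words_def mbar_gens_def)

lemma mbar_cong_words: "mbar_cong G m n \<Longrightarrow> m \<in> mbar_words G \<and> n \<in> mbar_words G"
proof (induction rule: mbar_cong.induct)
  case (regular v)
  then show ?case
    using range_sum_words[of "out_arcs G v"]
    by (auto simp: mbar_words_def mbar_gens_def regular_vertex_def out_arcs_def)
next
  case (cut v S)
  then show ?case
    using range_sum_words[of S]
    by (auto simp: mbar_words_def mbar_gens_def infinite_emitter_def out_arcs_def)
next
  case (cut_cut v S T)
  moreover have "S - T \<subseteq> arcs G" "T - S \<subseteq> arcs G"
    using cut_cut by (auto simp: out_arcs_def)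
  then have "range_sum G (S - T) \<in> mbar_words G" "range_sum G (T - S) \<in> mbar_words G"
    by (auto intro: range_sum_words)
  ultimately show ?case
    by (intro conjI mbar_words_add) (auto simp: mbar_words_def mbar_gens_def)
qed auto

lemma equiv_mbar_rel: "equiv (mbar_words G) (mbar_rel G)"
proof (rule equivI)
  show "mbar_rel G \<subseteq> mbar_words G \<times> mbar_words G"
    using mbar_cong_words by (auto simp: mbar_rel_def)
  show "refl_on (mbar_words G) (mbar_rel G)"
    by (rule refl_onI) (auto simp: mbar_rel_def intro: mbar_cong.refl)
  show "sym (mbar_rel G)" by (rule symI) (auto simp: mbar_rel_def intro: mbar_cong.sym)
  show "trans (mbar_rel G)" by (rule transI) (auto simp: mbar_rel_def intro: mbar_cong.trans)
qed

lemma mbar_class_eqI: "mbar_cong G m n \<Longrightarrow> mbar_class G m = mbar_class G n"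
  unfolding mbar_class_def by (rule equiv_class_eq[OF equiv_mbar_rel]) (simp add: mbar_rel_def)

lemma mbar_class_mem: "n \<in> mbar_class G m \<longleftrightarrow> mbar_cong G m n"
  by (auto simp: mbar_class_def mbar_rel_def)

lemma mbar_class_carrier: "m \<in> mbar_words G \<Longrightarrow> mbar_class G m \<in> carrier (mbar_monoid G)"
  by (auto simp: mbar_monoid_def mbar_class_def intro: quotientI)

lemma mbar_carrierE:
  assumes "X \<in> carrier (mbar_monoid G)" obtains m where "m \<in> mbar_words G" "X = mbar_class G m"
  using assms by (auto simp: mbar_monoid_def mbar_class_def quotient_def)

lemma mbar_one: "\<one>\<^bsub>mbar_monoid G\<^esub> = mbar_class G {#}"
  by (simp add: mbar_monoid_def)

lemma mbar_mult:
  assumes "m \<in> mbar_words G" "n \<in> mbar_words G"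
  shows "mbar_class G m \<otimes>\<^bsub>mbar_monoid G\<^esub> mbar_class G n = mbar_class G (m + n)"
proof -
  have "mbar_class G (m' + n') = mbar_class G (m + n)"
    if "m' \<in> mbar_class G m" "n' \<in> mbar_class G n" for m' n'
    by (rule mbar_class_eqI[symmetric], rule mbar_cong.add)
      (use that in \<open>simp_all add: mbar_class_mem\<close>)
  moreover have "m \<in> mbar_class G m" "n \<in> mbar_class G n"
    using assms by (auto simp: mbar_class_mem intro: mbar_cong.refl)
  ultimately have "(\<Union>m'\<in>mbar_class G m. \<Union>n'\<in>mbar_class G n. mbar_class G (m' + n')) =
      mbar_class G (m + n)"
    by (intro UN_const2[of m _ n])
  then show ?thesis by (simp add: mbar_monoid_def)
qed

lemma mbar_comm_monoid: "comm_monoid (mbar_monoid G)"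
proof (rule comm_monoidI)
  fix X Y Z
  assume "X \<in> carrier (mbar_monoid G)" "Y \<in> carrier (mbar_monoid G)"
    "Z \<in> carrier (mbar_monoid G)"
  then show "X \<otimes>\<^bsub>mbar_monoid G\<^esub> Y \<otimes>\<^bsub>mbar_monoid G\<^esub> Z =
      X \<otimes>\<^bsub>mbar_monoid G\<^esub> (Y \<otimes>\<^bsub>mbar_monoid G\<^esub> Z)"
    by (elim mbar_carrierE) (simp add: mbar_mult add.assoc)
qed (auto elim!: mbar_carrierE simp: mbar_mult mbar_one add.commute intro!: mbar_class_carrier)

end

subsection \<open>Existence and uniqueness of \<open>\<gamma>\<^sub>E\<close>\<close>

context nu_ring
begin

lemma minus_idem:
  assumes "p \<in> carrier R" "x \<in> carrier R" "p \<otimes> p = p" "p \<otimes> x = x" "x \<otimes> p = x" "x \<otimes> x = x"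
  shows "(p \<ominus> x) \<otimes> (p \<ominus> x) = p \<ominus> x"
  using assms by (simp add: a_minus_def l_distr r_distr l_minus r_minus minus_minus r_neg l_neg
      add.inv_closed)

lemma minus_orth:
  assumes "p \<in> carrier R" "x \<in> carrier R" "b \<in> carrier R"
  shows "\<lbrakk>p \<otimes> b = b; x \<otimes> b = b\<rbrakk> \<Longrightarrow> (p \<ominus> x) \<otimes> b = \<zero>"
    and "\<lbrakk>b \<otimes> p = b; b \<otimes> x = b\<rbrakk> \<Longrightarrow> b \<otimes> (p \<ominus> x) = \<zero>"
  using assms by (simp_all add: a_minus_def l_distr r_distr l_minus r_minus r_neg)

end

context lpa_setup
begin

abbreviation "V \<equiv> V_monoid L"
abbreviation "q e \<equiv> lpa_t K E e \<otimes>\<^bsub>L\<^esub> lpa_t_star K E e"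
abbreviation "Q S \<equiv> (\<Oplus>\<^bsub>L\<^esub>e\<in>S. q e)"
abbreviation "icls x \<equiv> idem_class L (mat_single L x)"

lemma p_closed: "v \<in> verts E \<Longrightarrow> lpa_p K E v \<in> carrier L"
  and t_closed: "e \<in> arcs E \<Longrightarrow> lpa_t K E e \<in> carrier L"
  and t_star_closed: "e \<in> arcs E \<Longrightarrow> lpa_t_star K E e \<in> carrier L"
  and p_idem: "v \<in> verts E \<Longrightarrow> lpa_p K E v \<otimes>\<^bsub>L\<^esub> lpa_p K E v = lpa_p K E v"
  and p_t: "e \<in> arcs E \<Longrightarrow> lpa_p K E (tail E e) \<otimes>\<^bsub>L\<^esub> lpa_t K E e = lpa_t K E e"
  and t_p: "e \<in> arcs E \<Longrightarrow> lpa_t K E e \<otimes>\<^bsub>L\<^esub> lpa_p K E (head E e) = lpa_t K E e"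
  and t_star_p: "e \<in> arcs E \<Longrightarrow> lpa_t_star K E e \<otimes>\<^bsub>L\<^esub> lpa_p K E (tail E e) = lpa_t_star K E e"
  and p_t_star: "e \<in> arcs E \<Longrightarrow> lpa_p K E (head E e) \<otimes>\<^bsub>L\<^esub> lpa_t_star K E e = lpa_t_star K E e"
  and t_star_t: "\<lbrakk>e \<in> arcs E; f \<in> arcs E\<rbrakk> \<Longrightarrow>
    lpa_t_star K E e \<otimes>\<^bsub>L\<^esub> lpa_t K E f = (if e = f then lpa_p K E (head E e) else \<zero>\<^bsub>L\<^esub>)"
  and p_regular: "regular_vertex E v \<Longrightarrow> lpa_p K E v = Q (out_arcs E v)"
  using leavitt_family_L unfolding leavitt_family_def by auto

lemma q_closed: "e \<in> arcs E \<Longrightarrow> q e \<in> carrier L"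
  by (simp add: t_closed t_star_closed)

lemma q_q:
  assumes "e \<in> arcs E" "f \<in> arcs E"
  shows "q e \<otimes>\<^bsub>L\<^esub> q f = (if e = f then q e else \<zero>\<^bsub>L\<^esub>)"
proof -
  have "q e \<otimes>\<^bsub>L\<^esub> q f =
      (lpa_t K E e \<otimes>\<^bsub>L\<^esub> (lpa_t_star K E e \<otimes>\<^bsub>L\<^esub> lpa_t K E f)) \<otimes>\<^bsub>L\<^esub> lpa_t_star K E f"
    using assms by (simp add: L.m_assoc t_closed t_star_closed)
  then show ?thesis using assms by (simp add: t_star_t t_p t_closed t_star_closed)
qed

lemma Q_closed: "S \<subseteq> arcs E \<Longrightarrow> Q S \<in> carrier L"
  by (rule L.finsum_closed) (auto simp: t_closed t_star_closed)

lemma Q_insert: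
  "\<lbrakk>finite S; e \<notin> S; insert e S \<subseteq> arcs E\<rbrakk> \<Longrightarrow> Q (insert e S) = q e \<oplus>\<^bsub>L\<^esub> Q S"
  by (rule L.finsum_insert) (auto simp: t_closed t_star_closed)

lemma Q_q:
  assumes "finite S" "S \<subseteq> arcs E" "e \<in> arcs E"
  shows "Q S \<otimes>\<^bsub>L\<^esub> q e = (if e \<in> S then q e else \<zero>\<^bsub>L\<^esub>) \<and>
         q e \<otimes>\<^bsub>L\<^esub> Q S = (if e \<in> S then q e else \<zero>\<^bsub>L\<^esub>)"
  using assms(1,2)
proof (induction S rule: finite_induct)
  case empty
  then show ?case using assms(3) by (simp add: L.finsum_empty q_closed)
next
  case (insert f S)
  then have "Q (insert f S) = q f \<oplus>\<^bsub>L\<^esub> Q S" by (intro Q_insert) auto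
  with insert assms(3) show ?case
    by (auto simp: L.l_distr L.r_distr q_closed Q_closed q_q simp del: L.m_closed)
qed

lemma Q_Q:
  assumes "finite S" "S \<subseteq> arcs E" "T \<subseteq> S"
  shows "Q S \<otimes>\<^bsub>L\<^esub> Q T = Q T" "Q T \<otimes>\<^bsub>L\<^esub> Q S = Q T"
proof -
  have T: "finite T" "T \<subseteq> arcs E" using assms finite_subset by auto
  have "Q S \<otimes>\<^bsub>L\<^esub> Q T = (\<Oplus>\<^bsub>L\<^esub>e\<in>T. Q S \<otimes>\<^bsub>L\<^esub> q e)"
    by (rule L.finsum_rdistr') (use T Q_closed[OF assms(2)] in \<open>auto simp: q_closed\<close>)
  also have "\<dots> = Q T"
    by (rule L.finsum_cong') (use T assms Q_q[OF assms(1,2)] in \<open>auto simp: q_closed subset_iff\<close>)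
  finally show "Q S \<otimes>\<^bsub>L\<^esub> Q T = Q T" .
  have "Q T \<otimes>\<^bsub>L\<^esub> Q S = (\<Oplus>\<^bsub>L\<^esub>e\<in>T. q e \<otimes>\<^bsub>L\<^esub> Q S)"
    by (rule L.finsum_ldistr') (use T Q_closed[OF assms(2)] in \<open>auto simp: q_closed\<close>)
  also have "\<dots> = Q T"
    by (rule L.finsum_cong') (use T assms Q_q[OF assms(1,2)] in \<open>auto simp: q_closed subset_iff\<close>)
  finally show "Q T \<otimes>\<^bsub>L\<^esub> Q S = Q T" .
qed

lemma p_Q:
  assumes "v \<in> verts E" "finite S" "S \<subseteq> out_arcs E v"
  shows "lpa_p K E v \<otimes>\<^bsub>L\<^esub> Q S = Q S" "Q S \<otimes>\<^bsub>L\<^esub> lpa_p K E v = Q S"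
proof -
  have S: "e \<in> arcs E" "tail E e = v" if "e \<in> S" for e
    using assms(3) that by (auto simp: out_arcs_def)
  have 1: "lpa_p K E v \<otimes>\<^bsub>L\<^esub> q e = q e" if "e \<in> S" for e
    using S[OF that] assms(1) by (metis L.m_assoc p_t p_closed t_closed t_star_closed)
  have 2: "q e \<otimes>\<^bsub>L\<^esub> lpa_p K E v = q e" if "e \<in> S" for e
    using S[OF that] assms(1) by (metis L.m_assoc t_star_p p_closed t_closed t_star_closed)
  have "lpa_p K E v \<otimes>\<^bsub>L\<^esub> Q S = (\<Oplus>\<^bsub>L\<^esub>e\<in>S. lpa_p K E v \<otimes>\<^bsub>L\<^esub> q e)"
    by (rule L.finsum_rdistr') (use S assms in \<open>auto simp: q_closed p_closed\<close>)
  also have "\<dots> = Q S" by (rule L.finsum_cong') (use S 1 in \<open>auto simp: q_closed\<close>)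
  finally show "lpa_p K E v \<otimes>\<^bsub>L\<^esub> Q S = Q S" .
  have "Q S \<otimes>\<^bsub>L\<^esub> lpa_p K E v = (\<Oplus>\<^bsub>L\<^esub>e\<in>S. q e \<otimes>\<^bsub>L\<^esub> lpa_p K E v)"
    by (rule L.finsum_ldistr') (use S assms in \<open>auto simp: q_closed p_closed\<close>)
  also have "\<dots> = Q S" by (rule L.finsum_cong') (use S 2 in \<open>auto simp: q_closed\<close>)
  finally show "Q S \<otimes>\<^bsub>L\<^esub> lpa_p K E v = Q S" .
qed

lemma cut_idem:
  assumes "v \<in> verts E" "finite S" "S \<subseteq> out_arcs E v"
  shows "(lpa_p K E v \<ominus>\<^bsub>L\<^esub> Q S) \<in> carrier L"
    "(lpa_p K E v \<ominus>\<^bsub>L\<^esub> Q S) \<otimes>\<^bsub>L\<^esub> (lpa_p K E v \<ominus>\<^bsub>L\<^esub> Q S) = lpa_p K E v \<ominus>\<^bsub>L\<^esub> Q S"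
proof -
  have S: "S \<subseteq> arcs E" using assms by (auto simp: out_arcs_def)
  show "(lpa_p K E v \<ominus>\<^bsub>L\<^esub> Q S) \<in> carrier L"
    using S assms by (simp add: p_closed Q_closed)
  show "(lpa_p K E v \<ominus>\<^bsub>L\<^esub> Q S) \<otimes>\<^bsub>L\<^esub> (lpa_p K E v \<ominus>\<^bsub>L\<^esub> Q S) = lpa_p K E v \<ominus>\<^bsub>L\<^esub> Q S"
    by (rule L.minus_idem)
      (use S assms p_Q[OF assms] Q_Q[OF assms(2) S order_refl] in \<open>simp_all add: p_closed Q_closed p_idem\<close>)
qed

lemma icls_q: "e \<in> arcs E \<Longrightarrow> icls (q e) = icls (lpa_p K E (head E e))"
  using L.mat_single_rel[of "lpa_t K E e" "lpa_t_star K E e"] q_q[of e e]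
  by (simp add: t_closed t_star_closed t_star_t p_idem)

lemma icls_cut:
  assumes "v \<in> verts E" "finite B" "B \<subseteq> out_arcs E v" "A \<subseteq> B"
  shows "icls (lpa_p K E v \<ominus>\<^bsub>L\<^esub> Q A) =
    icls (lpa_p K E v \<ominus>\<^bsub>L\<^esub> Q B) \<otimes>\<^bsub>V\<^esub> icls (Q (B - A))"
proof -
  have B: "B \<subseteq> arcs E" and A: "A \<subseteq> arcs E" and BA: "B - A \<subseteq> arcs E"
    and finA: "finite A" "finite (B - A)" and BAo: "B - A \<subseteq> out_arcs E v"
    using assms finite_subset[of A B] by (auto simp: out_arcs_def)
  let ?p = "lpa_p K E v"
  note closed = p_closed[OF assms(1)] Q_closed[OF B] Q_closed[OF A] Q_closed[OF BA]
  have BAs: "B - A \<subseteq> B" by auto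
  have "Q B = Q (A \<union> (B - A))" using assms(4) by (simp add: Un_absorb1)
  also have "\<dots> = Q A \<oplus>\<^bsub>L\<^esub> Q (B - A)"
    by (rule L.finsum_Un_disjoint) (use A BA finA in \<open>auto simp: t_closed t_star_closed\<close>)
  finally have QB: "Q B = Q A \<oplus>\<^bsub>L\<^esub> Q (B - A)" .
  have "?p \<ominus>\<^bsub>L\<^esub> Q B \<oplus>\<^bsub>L\<^esub> Q (B - A) = ?p \<ominus>\<^bsub>L\<^esub> Q A"
    unfolding QB using closed
    by (simp add: a_minus_def L.minus_add L.a_assoc L.l_neg L.add.inv_closed)
  moreover have "icls (?p \<ominus>\<^bsub>L\<^esub> Q B \<oplus>\<^bsub>L\<^esub> Q (B - A)) =
      icls (?p \<ominus>\<^bsub>L\<^esub> Q B) \<otimes>\<^bsub>V\<^esub> icls (Q (B - A))"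
  proof (rule L.mat_single_add)
    show "(?p \<ominus>\<^bsub>L\<^esub> Q B) \<otimes>\<^bsub>L\<^esub> Q (B - A) = \<zero>\<^bsub>L\<^esub>"
      by (rule L.minus_orth(1)) (use closed p_Q[OF assms(1) finA(2) BAo] Q_Q[OF assms(2) B BAs] in simp_all)
    show "Q (B - A) \<otimes>\<^bsub>L\<^esub> (?p \<ominus>\<^bsub>L\<^esub> Q B) = \<zero>\<^bsub>L\<^esub>"
      by (rule L.minus_orth(2)) (use closed p_Q[OF assms(1) finA(2) BAo] Q_Q[OF assms(2) B BAs] in simp_all)
    show "Q (B - A) \<otimes>\<^bsub>L\<^esub> Q (B - A) = Q (B - A)" by (rule Q_Q(1)[OF finA(2) BA order_refl])
  qed (use closed cut_idem[OF assms(1-3)] in auto)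
  ultimately show ?thesis by simp
qed

fun gval where
  "gval (GVert v) = icls (lpa_p K E v)"
| "gval (GCut v S) = icls (lpa_p K E v \<ominus>\<^bsub>L\<^esub> Q S)"

lemma gval_closed: "g \<in> mbar_gens E \<Longrightarrow> gval g \<in> carrier V"
  by (auto simp: mbar_gens_def infinite_emitter_def p_closed p_idem cut_idem
      intro!: L.idem_class_V L.mat_single_idem)

interpretation V: comm_monoid V by (rule L.V_comm_monoid)

definition gstep where
  "gstep g X = (if g \<in> mbar_gens E \<and> X \<in> carrier V then gval g \<otimes>\<^bsub>V\<^esub> X else X)"

definition geval where "geval m = fold_mset gstep \<one>\<^bsub>V\<^esub> m"

lemma gstep_commute: "comp_fun_commute gstep"
  by standard (auto simp: gstep_def fun_eq_iff gval_closed V.m_lcomm)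

lemma geval_empty: "geval {#} = \<one>\<^bsub>V\<^esub>"
  by (simp add: geval_def)

lemma geval_step: "geval (add_mset g m) = gstep g (geval m)"
  unfolding geval_def by (rule comp_fun_commute.fold_mset_add_mset[OF gstep_commute])

lemma geval_closed: "geval m \<in> carrier V"
  by (induction m) (auto simp: geval_empty geval_step gstep_def gval_closed)

lemma geval_add_mset: "g \<in> mbar_gens E \<Longrightarrow> geval (add_mset g m) = gval g \<otimes>\<^bsub>V\<^esub> geval m"
  by (simp add: geval_step gstep_def geval_closed)

lemma geval_single: "g \<in> mbar_gens E \<Longrightarrow> geval {#g#} = gval g"
  by (simp add: geval_add_mset geval_empty gval_closed)

lemma geval_add: "m \<in> mbar_words E \<Longrightarrow> geval (m + n) = geval m \<otimes>\<^bsub>V\<^esub> geval n"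
proof (induction m)
  case empty then show ?case by (simp add: geval_empty geval_closed)
next
  case (add g m)
  then have "g \<in> mbar_gens E" "m \<in> mbar_words E" by (auto simp: mbar_words_def)
  then show ?case using add by (simp add: geval_add_mset gval_closed geval_closed V.m_assoc)
qed

lemma geval_range_sum:
  assumes "finite S" "S \<subseteq> arcs E" shows "geval (range_sum E S) = icls (Q S)"
  using assms
proof (induction S rule: finite_induct)
  case empty
  then show ?case
    by (simp add: range_sum_def geval_empty L.finsum_empty L.mat_single_zero)
next
  case (insert e S)
  have "range_sum E (insert e S) = add_mset (GVert (head E e)) (range_sum E S)"
    using insert by (simp add: range_sum_def)
  then have "geval (range_sum E (insert e S)) = icls (lpa_p K E (head E e)) \<otimes>\<^bsub>V\<^esub> icls (Q S)"
    using insert by (simp add: geval_add_mset mbar_gens_def)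
  also have "\<dots> = icls (q e) \<otimes>\<^bsub>V\<^esub> icls (Q S)" using insert by (simp add: icls_q)
  also have "\<dots> = icls (q e \<oplus>\<^bsub>L\<^esub> Q S)"
    using insert Q_q[of S e] q_q[of e e] Q_Q[of S S]
    by (intro L.mat_single_add[symmetric]) (auto simp: q_closed Q_closed simp del: L.m_closed)
  also have "\<dots> = icls (Q (insert e S))" using insert by (simp add: Q_insert)
  finally show ?case .
qed

lemma geval_cong: "mbar_cong E m n \<Longrightarrow> geval m = geval n"
proof (induction rule: mbar_cong.induct)
  case (add m m' n n')
  then show ?case using mbar_cong_words by (metis geval_add)
next
  case (regular v)
  then have "GVert v \<in> mbar_gens E" "finite (out_arcs E v)" "out_arcs E v \<subseteq> arcs E"
    by (auto simp: regular_vertex_def mbar_gens_def out_arcs_def)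
  then show ?case using regular by (simp add: geval_single geval_range_sum p_regular)
next
  case (cut v S)
  then have g: "GCut v S \<in> mbar_gens E" "GVert v \<in> mbar_gens E" "S \<subseteq> arcs E" "v \<in> verts E"
    by (auto simp: mbar_gens_def infinite_emitter_def out_arcs_def)
  have "lpa_p K E v \<ominus>\<^bsub>L\<^esub> Q {} = lpa_p K E v"
    using g by (simp add: L.finsum_empty a_minus_def p_closed)
  then have "geval {#GVert v#} = icls (lpa_p K E v \<ominus>\<^bsub>L\<^esub> Q S) \<otimes>\<^bsub>V\<^esub> icls (Q S)"
    using cut g icls_cut[of v S "{}"] by (simp add: geval_single)
  then show ?case using cut g by (simp add: geval_add_mset[of "GCut v S"] geval_range_sum)
next
  case (cut_cut v S T)
  then have g: "GCut v S \<in> mbar_gens E" "GCut v T \<in> mbar_gens E" "S \<subseteq> arcs E" "T \<subseteq> arcs E" "v \<in> verts E"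
    by (auto simp: mbar_gens_def infinite_emitter_def out_arcs_def)
  have "S - S \<inter> T = S - T" "T - S \<inter> T = T - S" "S - T \<subseteq> arcs E" "T - S \<subseteq> arcs E" using g by auto
  then show ?case
    using cut_cut g icls_cut[of v S "S \<inter> T"] icls_cut[of v T "S \<inter> T"]
    by (simp add: geval_add_mset geval_range_sum)
qed auto

lemma gamma_ex1: "\<exists>!\<gamma>. is_gamma K E \<gamma>"
proof (rule ex_ex1I)
  define \<gamma> where "\<gamma> = restrict (\<lambda>X. geval (SOME m. m \<in> X)) (carrier (mbar_monoid E))"
  have \<gamma>: "\<gamma> (mbar_class E m) = geval m" if "m \<in> mbar_words E" for m
  proof -
    have "m \<in> mbar_class E m" using that by (simp add: mbar_class_mem mbar_cong.refl)
    then have "(SOME n. n \<in> mbar_class E m) \<in> mbar_class E m" by (rule someI)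
    then have "geval (SOME n. n \<in> mbar_class E m) = geval m"
      using geval_cong mbar_class_mem by metis
    then show ?thesis using that by (simp add: \<gamma>_def mbar_class_carrier)
  qed
  have "\<gamma> \<in> hom (mbar_monoid E) V"
    by (rule homI) (auto elim!: mbar_carrierE simp: mbar_mult \<gamma> geval_add geval_closed)
  moreover have "\<gamma> (mbar_class E {#GVert v#}) = icls (lpa_p K E v)" if "v \<in> verts E" for v
  proof -
    have "GVert v \<in> mbar_gens E" using that by (auto simp: mbar_gens_def)
    then show ?thesis by (subst \<gamma>) (auto simp: geval_single mbar_words_def)
  qed
  moreover have "\<gamma> (mbar_class E {#GCut v S#}) = icls (lpa_p K E v \<ominus>\<^bsub>L\<^esub> Q S)"
    if "infinite_emitter E v" "finite S" "S \<noteq> {}" "S \<subseteq> out_arcs E v" for v S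
  proof -
    have "GCut v S \<in> mbar_gens E" using that by (auto simp: mbar_gens_def)
    then show ?thesis by (subst \<gamma>) (auto simp: geval_single mbar_words_def)
  qed
  moreover have "\<gamma> \<one>\<^bsub>mbar_monoid E\<^esub> = \<one>\<^bsub>V\<^esub>" by (simp add: mbar_one \<gamma> geval_empty)
  moreover have "\<gamma> \<in> extensional (carrier (mbar_monoid E))" by (simp add: \<gamma>_def)
  ultimately show "\<exists>\<gamma>. is_gamma K E \<gamma>" unfolding is_gamma_def Let_def by blast
next
  have *: "\<gamma> (mbar_class E m) = geval m" if "is_gamma K E \<gamma>" "m \<in> mbar_words E" for \<gamma> m
    using that(2)
  proof (induction m)
    case empty
    then show ?case using that(1) by (simp add: is_gamma_def Let_def mbar_one geval_empty)
  next
    case (add g m)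
    then have g: "g \<in> mbar_gens E" "m \<in> mbar_words E" and g1: "{#g#} \<in> mbar_words E"
      by (auto simp: mbar_words_def)
    have "\<gamma> (mbar_class E {#g#}) = gval g"
      using g(1) that(1) unfolding mbar_gens_def is_gamma_def Let_def
      by (elim UnE imageE CollectE exE conjE) simp_all
    moreover have "mbar_class E (add_mset g m) =
        mbar_class E {#g#} \<otimes>\<^bsub>mbar_monoid E\<^esub> mbar_class E m"
      using g g1 by (simp add: mbar_mult)
    moreover have "\<gamma> \<in> hom (mbar_monoid E) V" using that(1) by (simp add: is_gamma_def Let_def)
    ultimately show ?case
      using add g g1 by (simp add: hom_mult mbar_class_carrier geval_add_mset)
  qed
  fix \<gamma> \<gamma>' assume "is_gamma K E \<gamma>" "is_gamma K E \<gamma>'"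
  then show "\<gamma> = \<gamma>'"
    by (intro extensionalityI[of _ "carrier (mbar_monoid E)"])
      (auto elim!: mbar_carrierE simp: *, auto simp: is_gamma_def Let_def)
qed

end

lemma is_gamma_gamma: "\<lbrakk>wf_digraph E; field K\<rbrakk> \<Longrightarrow> is_gamma K E (gamma K E)"
  unfolding gamma_def by (rule theI'[OF lpa_setup.gamma_ex1]) (simp add: lpa_setup_def)


end

theory Submission
  imports Defs "Graph_Theory.Arc_Walk" "HOL-Library.Sublist"
begin

text \<open>
  A finite set of relations or matrix entries involves only finitely many vertices and edges, and
  these span a finite graph in which an infinite emitter \<open>v\<close> gains an extra edge carrying the
  idempotent \<open>p\<^sub>v - \<Sum>\<^sub>e\<^sub>\<in>\<^sub>S t\<^sub>e t\<^sub>e\<^sup>*\<close>.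
  Elements of its path algebra become linear combinations of honest paths once they are multiplied
  on the right by all long enough paths.  For a finite family of such combinations, division with
  remainder (order paths by length, then lexicographically, and subtract right multiples) makes the
  leading paths prefix-free.  The family is then independent over the whole algebra, so that every
  idempotent is resolved as a sum of products \<open>b\<^sub>j y\<^sub>j\<close> with
  \<open>y\<^sub>i b\<^sub>j = \<delta>\<^sub>i\<^sub>j p\<^sub>w\<^sub>j\<close>; this gives
  surjectivity.  If a diagonal idempotent is resolved in this way, the leading paths form a complete
  prefix code, and expanding a vertex along such a code uses only the defining relations of the
  graph monoid; this gives injectivity.  That paths are linearly independent is seen on functions on
  a branching system.
\<close>

section \<open>Spans of paths in a Leavitt family\<close>

text \<open>Ghost edges are the obstacle: because of them an element of the algebra has no leading
  path. Composing on the right with a complete code removes them and loses nothing, since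
  \<open>P w\<close> is the sum of \<open>sp w \<gamma> \<otimes> sq w \<gamma>\<close> over the
  code. What remains is the argument by which right ideals of a free algebra are free. Write an
  idempotent as e = BY with a row B and a column Y. Cancelling a leading path multiplies B by an
  elementary matrix and Y by its inverse, so BY does not change. Once the entries of B are
  independent, comparing b_k = e b_k = \<Sum> b_j (y_j b_k) with the trivial expansion of b_k forces
  the orthogonality relations. For two equivalent diagonal idempotents these relations hold from the
  outset, and the reduction serves only to bring the leading paths to light. Division takes place on
  the right, so leading paths are compared among paths with a common start; a root without incoming
  edges, with the diagonal entries as outgoing edges, provides that start.\<close>

context nu_algebra
begin

text \<open>The span grows by one term at a time, which gives an induction rule and avoids choosing
  finite supports and coefficients.\<close>

inductive_set kspan :: "'c set \<Rightarrow> 'c set" for G where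
  zero: "\<zero> \<in> kspan G"
| step: "\<lbrakk>x \<in> kspan G; c \<in> carrier K; g \<in> G\<rbrakk> \<Longrightarrow> x \<oplus> c \<odot> g \<in> kspan G"

lemma kspan_closed: "\<lbrakk>x \<in> kspan G; G \<subseteq> carrier A\<rbrakk> \<Longrightarrow> x \<in> carrier A"
  by (induction rule: kspan.induct) auto

lemma kspan_mono: "\<lbrakk>x \<in> kspan G; G \<subseteq> H\<rbrakk> \<Longrightarrow> x \<in> kspan H"
  by (induction rule: kspan.induct) (auto intro: kspan.intros)

lemma kspan_add:
  assumes "x \<in> kspan G" "y \<in> kspan G" "G \<subseteq> carrier A"
  shows "x \<oplus> y \<in> kspan G"
  using assms(2)
proof (induction rule: kspan.induct)
  case zero
  then show ?case using assms kspan_closed by simp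
next
  case (step y c g)
  have "x \<oplus> (y \<oplus> c \<odot> g) = (x \<oplus> y) \<oplus> c \<odot> g"
    using step assms kspan_closed by (subst a_assoc) auto
  then show ?case using step by (auto intro: kspan.step)
qed

lemma kspan_smult:
  assumes "x \<in> kspan G" "d \<in> carrier K" "G \<subseteq> carrier A"
  shows "d \<odot> x \<in> kspan G"
  using assms(1)
proof (induction rule: kspan.induct)
  case zero
  then show ?case using assms smult_r_null by (simp add: kspan.zero)
next
  case (step x c g)
  have "d \<odot> (x \<oplus> c \<odot> g) = d \<odot> x \<oplus> (d \<otimes>\<^bsub>K\<^esub> c) \<odot> g"
    using step assms kspan_closed by (subst smult_r_distr) (auto simp: smult_assoc1)
  then show ?case using step assms by (auto intro: kspan.step)
qed

lemma kspan_gen: "\<lbrakk>g \<in> G; G \<subseteq> carrier A\<rbrakk> \<Longrightarrow> g \<in> kspan G"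
  using kspan.step[OF kspan.zero, of "\<one>\<^bsub>K\<^esub>" g G] by (auto simp: smult_one)

lemma kspan_minus:
  assumes "x \<in> kspan G" "G \<subseteq> carrier A"
  shows "\<ominus> x \<in> kspan G"
  using assms(1)
proof (induction rule: kspan.induct)
  case zero
  have "\<ominus> \<zero> = \<zero>" by (rule minus_equality) auto
  then show ?case by (metis kspan.zero)
next
  case (step x c g)
  have "\<ominus> (x \<oplus> c \<odot> g) = \<ominus> x \<oplus> (\<ominus>\<^bsub>K\<^esub> c) \<odot> g"
    using step assms kspan_closed by (subst minus_add) (auto simp: smult_l_minus)
  then show ?case using step assms by (auto intro: kspan.step)
qed

lemma kspan_diff: "\<lbrakk>x \<in> kspan G; y \<in> kspan G; G \<subseteq> carrier A\<rbrakk> \<Longrightarrow> x \<ominus> y \<in> kspan G"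
  unfolding a_minus_def by (intro kspan_add kspan_minus)

lemma kspan_finsum:
  assumes "finite I" "\<And>i. i \<in> I \<Longrightarrow> f i \<in> kspan G" "G \<subseteq> carrier A"
  shows "(\<Oplus>i\<in>I. f i) \<in> kspan G"
  using assms(1,2)
proof (induction I rule: finite_induct)
  case empty
  then show ?case by (simp add: kspan.zero)
next
  case (insert i I)
  then have "(\<Oplus>i\<in>insert i I. f i) = f i \<oplus> (\<Oplus>i\<in>I. f i)"
    using assms(3) kspan_closed by (intro finsum_insert) (auto simp: Pi_def)
  then show ?case using insert assms(3) by (auto intro: kspan_add)
qed

lemma kspan_mult:
  assumes x: "x \<in> kspan G" and y: "y \<in> kspan H"
    and GH: "G \<subseteq> carrier A" "H \<subseteq> carrier A" "I \<subseteq> carrier A"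
    and mult: "\<And>g h. \<lbrakk>g \<in> G; h \<in> H\<rbrakk> \<Longrightarrow> g \<otimes> h \<in> kspan I"
  shows "x \<otimes> y \<in> kspan I"
proof -
  have *: "g \<otimes> y \<in> kspan I" if "g \<in> G" for g
    using y
  proof (induction rule: kspan.induct)
    case zero
    then show ?case using that GH by (auto simp: kspan.zero subset_iff)
  next
    case (step y c h)
    have "g \<otimes> (y \<oplus> c \<odot> h) = g \<otimes> y \<oplus> c \<odot> (g \<otimes> h)"
      using step that GH(1,2) kspan_closed[of y H] by (simp add: r_distr smult_mult_right subset_iff)
    then show ?case using step mult[OF that] GH(3) by (simp add: kspan_add kspan_smult)
  qed
  have yc: "y \<in> carrier A" using kspan_closed[OF y] GH by simp
  show ?thesis using x
  proof (induction rule: kspan.induct)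
    case zero
    then show ?case using yc by (simp add: kspan.zero)
  next
    case (step x c g)
    have "(x \<oplus> c \<odot> g) \<otimes> y = x \<otimes> y \<oplus> c \<odot> (g \<otimes> y)"
      using step yc GH(1) kspan_closed[of x G] by (simp add: l_distr smult_mult_left subset_iff)
    then show ?case using step * GH(3) by (simp add: kspan_add kspan_smult)
  qed
qed

text \<open>The coefficient \<open>c\<close> need not be unique. In \<open>LM_exists\<close> the
  generator split off is the largest path.\<close>

lemma kspan_insert:
  assumes "x \<in> kspan (insert s G)" "G \<subseteq> carrier A" "s \<in> carrier A"
  shows "\<exists>c\<in>carrier K. \<exists>r\<in>kspan G. x = c \<odot> s \<oplus> r"
  using assms(1)
proof (induction rule: kspan.induct)
  case zero
  show ?case
    by (rule bexI[of _ "\<zero>\<^bsub>K\<^esub>"], rule bexI[of _ \<zero>]) (use assms smult_l_null in \<open>auto simp: kspan.zero\<close>)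
next
  case (step x c g)
  then obtain d r where d: "d \<in> carrier K" "r \<in> kspan G" "x = d \<odot> s \<oplus> r" by blast
  have r: "r \<in> carrier A" using d kspan_closed assms by auto
  show ?case
  proof (cases "g = s")
    case True
    have "x \<oplus> c \<odot> g = (d \<oplus>\<^bsub>K\<^esub> c) \<odot> s \<oplus> r"
      using d r step True assms by (simp add: smult_l_distr a_ac)
    then show ?thesis using d step by (intro bexI[of _ "d \<oplus>\<^bsub>K\<^esub> c"] bexI[of _ r]) auto
  next
    case False
    then have g: "g \<in> G" "g \<in> carrier A" using step assms by auto
    have "x \<oplus> c \<odot> g = d \<odot> s \<oplus> (r \<oplus> c \<odot> g)"
      using d r step g assms by (simp add: a_ac)
    then show ?thesis
      using d step g by (intro bexI[of _ d] bexI[of _ "r \<oplus> c \<odot> g"]) (auto intro: kspan.step)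
  qed
qed

text \<open>Additivity and the values on scalar multiples of the generators determine
  \<open>f\<close> on the span; these are the data that \<open>indep\<close> supplies.\<close>

lemma kspan_functional_zero:
  assumes "x \<in> kspan G" "G \<subseteq> carrier A" "f \<in> carrier A \<rightarrow> carrier K"
    and add: "\<And>x y. \<lbrakk>x \<in> carrier A; y \<in> carrier A\<rbrakk> \<Longrightarrow> f (x \<oplus> y) = f x \<oplus>\<^bsub>K\<^esub> f y"
    and gen: "\<And>c g. \<lbrakk>c \<in> carrier K; g \<in> G\<rbrakk> \<Longrightarrow> f (c \<odot> g) = \<zero>\<^bsub>K\<^esub>"
  shows "f x = \<zero>\<^bsub>K\<^esub>"
  using assms(1)
proof (induction rule: kspan.induct)
  case zero
  have "f \<zero> \<in> carrier K" using assms(3) by auto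
  moreover have "f \<zero> = f \<zero> \<oplus>\<^bsub>K\<^esub> f \<zero>" using add[of \<zero> \<zero>] by simp
  ultimately show ?case using R.add.l_cancel_one' by metis
next
  case (step x c g)
  have "x \<in> carrier A" "c \<odot> g \<in> carrier A" using step kspan_closed[of x G] assms(2) by auto
  then have "f (x \<oplus> c \<odot> g) = f x \<oplus>\<^bsub>K\<^esub> f (c \<odot> g)" by (rule add)
  then show ?case using step gen by simp
qed

end

text \<open>
  The relation \<open>S'_S\<close> is required for edges with the same source only, since the idempotents
  \<open>P g\<close> used below are not orthogonal: \<open>p\<^sub>v\<close> and the cut-down \<open>p\<^sub>v\<close>'s occur together.
\<close>

locale leavitt_rep = nu_algebra K A + K: field K + wf_digraph F
  for K :: "('k, 'm) ring_scheme" and A :: "('k, 'a, 'n) module_scheme" (structure)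
    and F :: "('g, 'd) pre_digraph" +
  fixes P :: "'g \<Rightarrow> 'a" and S S' :: "'d \<Rightarrow> 'a"
  assumes finite_out: "finite (out_arcs F g)"
    and P_closed [simp]: "g \<in> verts F \<Longrightarrow> P g \<in> carrier A"
    and S_closed [simp]: "e \<in> arcs F \<Longrightarrow> S e \<in> carrier A"
    and S'_closed [simp]: "e \<in> arcs F \<Longrightarrow> S' e \<in> carrier A"
    and P_idem [simp]: "g \<in> verts F \<Longrightarrow> P g \<otimes> P g = P g"
    and P_S: "e \<in> arcs F \<Longrightarrow> P (tail F e) \<otimes> S e = S e"
    and S_P: "e \<in> arcs F \<Longrightarrow> S e \<otimes> P (head F e) = S e"
    and P_S': "e \<in> arcs F \<Longrightarrow> P (head F e) \<otimes> S' e = S' e"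
    and S'_P: "e \<in> arcs F \<Longrightarrow> S' e \<otimes> P (tail F e) = S' e"
    and S'_S: "\<lbrakk>e \<in> arcs F; f \<in> arcs F; tail F e = tail F f\<rbrakk> \<Longrightarrow>
      S' e \<otimes> S f = (if e = f then P (head F e) else \<zero>)"
    and P_sum: "\<lbrakk>g \<in> verts F; out_arcs F g \<noteq> {}\<rbrakk> \<Longrightarrow> P g = (\<Oplus>e\<in>out_arcs F g. S e \<otimes> S' e)"
begin

text \<open>The start vertex is an argument because the empty path has to give \<open>P g\<close>.
  With \<open>sq\<close> for the reversed ghost path, the products
  \<open>sp g \<alpha> \<otimes> sq w \<beta>\<close> are the usual spanning monomials of a Leavitt
  path algebra.\<close>

fun sp where
  "sp g [] = P g"
| "sp g (e # \<alpha>) = S e \<otimes> sp (head F e) \<alpha>"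

fun sq where
  "sq g [] = P g"
| "sq g (e # \<alpha>) = sq (head F e) \<alpha> \<otimes> S' e"

lemma sp_closed [simp]: "awalk g \<alpha> w \<Longrightarrow> sp g \<alpha> \<in> carrier A"
  by (induction \<alpha> arbitrary: g) (auto simp: awalk_simps)

lemma sq_closed [simp]: "awalk g \<alpha> w \<Longrightarrow> sq g \<alpha> \<in> carrier A"
  by (induction \<alpha> arbitrary: g) (auto simp: awalk_simps)

lemma P_sp: "awalk g \<alpha> w \<Longrightarrow> P g \<otimes> sp g \<alpha> = sp g \<alpha>"
  by (cases \<alpha>) (auto simp: awalk_simps P_S m_assoc[symmetric])

lemma sp_P: "awalk g \<alpha> w \<Longrightarrow> sp g \<alpha> \<otimes> P w = sp g \<alpha>"
  by (induction \<alpha> arbitrary: g) (auto simp: awalk_simps m_assoc awalk_last_in_verts)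

lemma sq_P: "awalk g \<alpha> w \<Longrightarrow> sq g \<alpha> \<otimes> P g = sq g \<alpha>"
  by (cases \<alpha>) (auto simp: awalk_simps S'_P m_assoc)

lemma P_sq: "awalk g \<alpha> w \<Longrightarrow> P w \<otimes> sq g \<alpha> = sq g \<alpha>"
  by (induction \<alpha> arbitrary: g) (auto simp: awalk_simps m_assoc[symmetric] awalk_last_in_verts)

lemma sp_append: "\<lbrakk>awalk g \<alpha> u; awalk u \<beta> w\<rbrakk> \<Longrightarrow> sp g (\<alpha> @ \<beta>) = sp g \<alpha> \<otimes> sp u \<beta>"
  by (induction \<alpha> arbitrary: g) (auto simp: awalk_simps P_sp m_assoc)

lemma sq_append: "\<lbrakk>awalk g \<alpha> u; awalk u \<beta> w\<rbrakk> \<Longrightarrow> sq g (\<alpha> @ \<beta>) = sq u \<beta> \<otimes> sq g \<alpha>"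
  by (induction \<alpha> arbitrary: g) (auto simp: awalk_simps sq_P m_assoc)

text \<open>Edge by edge, \<open>S' e \<otimes> S f\<close> either cancels or vanishes. Both walks
  leave from the same vertex at every stage, so \<open>S'_S\<close> for edges with a common source
  is enough.\<close>

lemma sq_sp:
  assumes "awalk g \<beta> u" "awalk g \<gamma> w"
  shows "sq g \<beta> \<otimes> sp g \<gamma> =
    (if prefix \<beta> \<gamma> then sp u (drop (length \<beta>) \<gamma>)
     else if prefix \<gamma> \<beta> then sq w (drop (length \<gamma>) \<beta>) else \<zero>)"
  using assms
proof (induction \<beta> arbitrary: g \<gamma>)
  case Nil
  then show ?case by (auto simp: awalk_simps P_sp)
next
  case (Cons e \<beta>)
  show ?case
  proof (cases \<gamma>)
    case Nil
    then show ?thesis using Cons.prems sq_P[OF Cons.prems(1)] by (auto simp: awalk_simps)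
  next
    case (Cons f \<gamma>')
    then have ef: "e \<in> arcs F" "f \<in> arcs F" "tail F e = tail F f" "awalk (head F e) \<beta> u"
      "awalk (head F f) \<gamma>' w"
      using Cons.prems \<open>awalk g (e # \<beta>) u\<close> by (auto simp: awalk_simps)
    have "sq g (e # \<beta>) \<otimes> sp g \<gamma> = sq (head F e) \<beta> \<otimes> ((S' e \<otimes> S f) \<otimes> sp (head F f) \<gamma>')"
      using ef Cons by (simp add: m_assoc)
    also have "\<dots> = (if e = f then sq (head F e) \<beta> \<otimes> sp (head F e) \<gamma>' else \<zero>)"
      using ef P_sp by (simp add: S'_S)
    finally show ?thesis
      using Cons.IH[OF ef(4), of \<gamma>'] ef Cons by auto
  qed
qed

lemma awalk_prefixE:
  assumes "awalk g \<gamma> w" "prefix \<beta> \<gamma>" "awalk g \<beta> u"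
  obtains \<delta> where "\<gamma> = \<beta> @ \<delta>" "awalk u \<delta> w"
proof -
  obtain \<delta> where \<delta>: "\<gamma> = \<beta> @ \<delta>" using assms(2) by (auto simp: prefix_def)
  have "awlast g \<gamma> = w" "awlast g \<beta> = u" using assms by (auto elim!: awalkE')
  then have "awalk u \<delta> w" using assms(1) by (simp add: \<delta> awlast_append)
  with \<delta> that show ?thesis by blast
qed

text \<open>Both spans are indexed by a pair of vertices and composed like morphisms of a category.
  As the \<open>P g\<close> may overlap, nothing is known about products whose end points do not
  match.\<close>

definition "Kgen g w = sp g ` {\<alpha>. awalk g \<alpha> w}"
definition "Lgen g w = {sp g \<alpha> \<otimes> sq w \<beta> | \<alpha> \<beta> u. awalk g \<alpha> u \<and> awalk w \<beta> u}"
abbreviation "Kspan g w \<equiv> kspan (Kgen g w)"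
abbreviation "Lspan g w \<equiv> kspan (Lgen g w)"

lemma Kgen_carrier: "Kgen g w \<subseteq> carrier A" by (auto simp: Kgen_def)
lemma Lgen_carrier: "Lgen g w \<subseteq> carrier A" by (auto simp: Lgen_def)

lemma Kspan_closed: "x \<in> Kspan g w \<Longrightarrow> x \<in> carrier A"
  using kspan_closed Kgen_carrier by blast
lemma Lspan_closed: "x \<in> Lspan g w \<Longrightarrow> x \<in> carrier A"
  using kspan_closed Lgen_carrier by blast

lemma sp_Kspan: "awalk g \<alpha> w \<Longrightarrow> sp g \<alpha> \<in> Kspan g w"
  by (rule kspan_gen) (auto simp: Kgen_def)

lemma sp_sq_Lspan: "\<lbrakk>awalk g \<alpha> u; awalk w \<beta> u\<rbrakk> \<Longrightarrow> sp g \<alpha> \<otimes> sq w \<beta> \<in> Lspan g w"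
  by (rule kspan_gen) (auto simp: Lgen_def)

lemma sp_Lspan: assumes "awalk g \<alpha> w" shows "sp g \<alpha> \<in> Lspan g w"
proof -
  have "awalk w [] w" using assms by (auto simp: awalk_simps awalk_last_in_verts)
  from sp_sq_Lspan[OF assms this] show ?thesis using sp_P[OF assms] by simp
qed

lemma sq_Lspan: assumes "awalk g \<alpha> w" shows "sq g \<alpha> \<in> Lspan w g"
proof -
  have "awalk w [] w" using assms by (auto simp: awalk_simps awalk_last_in_verts)
  from sp_sq_Lspan[OF this assms] show ?thesis using P_sq[OF assms] by simp
qed

lemma Kspan_imp_Lspan:
  assumes "x \<in> Kspan g w" shows "x \<in> Lspan g w"
  using assms
proof (induction rule: kspan.induct)
  case zero then show ?case by (rule kspan.zero)
next
  case (step x c h)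
  then have "h \<in> Lspan g w" by (auto simp: Kgen_def intro: sp_Lspan)
  then show ?case using step by (simp add: Lgen_carrier kspan_add kspan_smult)
qed

text \<open>The two middle factors collapse by \<open>sq_sp\<close> to a path, which the left factor
  absorbs, to a ghost path, which the right factor absorbs, or to zero.\<close>

lemma Lspan_mult:
  assumes "x \<in> Lspan g u" "y \<in> Lspan u w" shows "x \<otimes> y \<in> Lspan g w"
proof (rule kspan_mult[OF assms Lgen_carrier Lgen_carrier Lgen_carrier])
  fix a b assume "a \<in> Lgen g u" "b \<in> Lgen u w"
  then obtain \<alpha> \<beta> \<gamma> \<delta> r t where
    a: "a = sp g \<alpha> \<otimes> sq u \<beta>" "awalk g \<alpha> r" "awalk u \<beta> r" and
    b: "b = sp u \<gamma> \<otimes> sq w \<delta>" "awalk u \<gamma> t" "awalk w \<delta> t"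
    by (auto simp: Lgen_def)
  have ab: "a \<otimes> b = sp g \<alpha> \<otimes> (sq u \<beta> \<otimes> sp u \<gamma>) \<otimes> sq w \<delta>" using a b by (simp add: m_assoc)
  consider "prefix \<beta> \<gamma>" | "\<not> prefix \<beta> \<gamma>" "prefix \<gamma> \<beta>" | "\<not> prefix \<beta> \<gamma>" "\<not> prefix \<gamma> \<beta>" by blast
  then show "a \<otimes> b \<in> Lspan g w"
  proof cases
    case 1
    then obtain \<epsilon> where e: "\<gamma> = \<beta> @ \<epsilon>" "awalk r \<epsilon> t" using awalk_prefixE a b by metis
    have "sq u \<beta> \<otimes> sp u \<gamma> = sp r \<epsilon>" unfolding sq_sp[OF a(3) b(2)] using 1 e by simp
    then have "a \<otimes> b = sp g (\<alpha> @ \<epsilon>) \<otimes> sq w \<delta>" unfolding ab sp_append[OF a(2) e(2)] by simp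
    then show ?thesis using sp_sq_Lspan[OF awalk_appendI[OF a(2) e(2)] b(3)] by simp
  next
    case 2
    then obtain \<epsilon> where e: "\<beta> = \<gamma> @ \<epsilon>" "awalk t \<epsilon> r" using awalk_prefixE a b by metis
    have "sq u \<beta> \<otimes> sp u \<gamma> = sq t \<epsilon>" unfolding sq_sp[OF a(3) b(2)] using 2 e by simp
    then have "a \<otimes> b = sp g \<alpha> \<otimes> sq w (\<delta> @ \<epsilon>)"
      unfolding ab sq_append[OF b(3) e(2)] using a b e by (simp add: m_assoc)
    then show ?thesis using sp_sq_Lspan[OF a(2) awalk_appendI[OF b(3) e(2)]] by simp
  next
    case 3
    then have "sq u \<beta> \<otimes> sp u \<gamma> = \<zero>" by (simp add: sq_sp[OF a(3) b(2)])
    then have "a \<otimes> b = \<zero>" unfolding ab using a b by simp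
    then show ?thesis by (simp add: kspan.zero)
  qed
qed

lemma Lspan_P_left:
  assumes "x \<in> Lspan g w" "g \<in> verts F" shows "P g \<otimes> x = x"
  using assms(1)
proof (induction rule: kspan.induct)
  case zero then show ?case using assms by simp
next
  case (step x c h)
  then have h: "P g \<otimes> h = h" "h \<in> carrier A"
    using assms(2) by (auto simp: Lgen_def m_assoc[symmetric] P_sp)
  then show ?case
    using step assms Lspan_closed[of x g w] by (simp add: r_distr smult_mult_right)
qed

lemma Lspan_P_right:
  assumes "x \<in> Lspan g w" "w \<in> verts F" shows "x \<otimes> P w = x"
  using assms(1)
proof (induction rule: kspan.induct)
  case zero then show ?case using assms by simp
next
  case (step x c h)
  then have h: "h \<otimes> P w = h" "h \<in> carrier A"
    using assms(2) by (auto simp: Lgen_def m_assoc sq_P)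
  then show ?case
    using step assms Lspan_closed[of x g w] by (simp add: l_distr smult_mult_left)
qed

text \<open>These are the leaves of the tree of paths from \<open>g\<close> cut at depth
  \<open>n\<close>: the paths of length \<open>n\<close>, and the shorter ones that end at a
  sink.\<close>

fun code where
  "code 0 g = {[]}"
| "code (Suc n) g =
    (if out_arcs F g = {} then {[]} else (\<Union>e\<in>out_arcs F g. (#) e ` code n (head F e)))"

lemma finite_code: "finite (code n g)"
  by (induction n arbitrary: g) (auto simp: finite_out)

lemma code_awalk: "\<lbrakk>\<gamma> \<in> code n g; g \<in> verts F\<rbrakk> \<Longrightarrow> \<exists>w. awalk g \<gamma> w"
proof (induction n arbitrary: g \<gamma>)
  case 0 then show ?case by (auto simp: awalk_simps)
next
  case (Suc n)
  show ?case
  proof (cases "out_arcs F g = {}")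
    case True with Suc show ?thesis by (auto simp: awalk_simps)
  next
    case False
    then have "\<gamma> \<in> (\<Union>e\<in>out_arcs F g. (#) e ` code n (head F e))" using Suc.prems by (simp only: code.simps if_False)
    then obtain e \<gamma>' where e: "e \<in> out_arcs F g" "\<gamma> = e # \<gamma>'" "\<gamma>' \<in> code n (head F e)" by blast
    then obtain w where "awalk (head F e) \<gamma>' w" using Suc.IH[of \<gamma>' "head F e"] by auto
    then show ?thesis using e by (auto simp: awalk_simps)
  qed
qed

text \<open>A codeword of length below \<open>n\<close> ends at a sink and cannot be continued.
  Hence a ghost path of length at most \<open>n\<close> never sticks out beyond a codeword, which is
  what \<open>Lspan_code\<close> needs.\<close>

lemma code_maximal: "\<lbrakk>\<gamma> \<in> code n g; awalk g (\<gamma> @ \<beta>) w; length (\<gamma> @ \<beta>) \<le> n\<rbrakk> \<Longrightarrow> \<beta> = []"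
proof (induction n arbitrary: g \<gamma>)
  case (Suc n)
  show ?case
  proof (cases "out_arcs F g = {}")
    case True with Suc show ?thesis by (cases \<beta>) (auto simp: awalk_Cons_iff)
  next
    case False
    then have "\<gamma> \<in> (\<Union>e\<in>out_arcs F g. (#) e ` code n (head F e))" using Suc.prems by (simp only: code.simps if_False)
    then obtain e \<gamma>' where e: "e \<in> out_arcs F g" "\<gamma> = e # \<gamma>'" "\<gamma>' \<in> code n (head F e)" by blast
    then show ?thesis using Suc.IH[of \<gamma>' "head F e"] Suc.prems by (auto simp: awalk_Cons_iff simp del: awalk_append_iff)
  qed
qed simp

text \<open>The relation \<open>P_sum\<close>, iterated down the tree. It says nothing at sinks,
  where codewords stop early.\<close>

lemma P_code:
  "g \<in> verts F \<Longrightarrow> P g = (\<Oplus>\<gamma>\<in>code n g. sp g \<gamma> \<otimes> sq g \<gamma>)"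
proof (induction n arbitrary: g)
  case 0 then show ?case by simp
next
  case (Suc n)
  show ?case
  proof (cases "out_arcs F g = {}")
    case True with Suc.prems show ?thesis by simp
  next
    case False
    have c: "sp (head F e) \<gamma> \<in> carrier A" "sq (head F e) \<gamma> \<in> carrier A" "S e \<in> carrier A" "S' e \<in> carrier A"
      if "e \<in> out_arcs F g" "\<gamma> \<in> code n (head F e)" for e \<gamma>
      using code_awalk[OF that(2)] that(1) sp_closed sq_closed by auto
    have "P g = (\<Oplus>e\<in>out_arcs F g. S e \<otimes> S' e)" using Suc False P_sum by blast
    also have "\<dots> = (\<Oplus>e\<in>out_arcs F g. \<Oplus>\<gamma>\<in>(#) e ` code n (head F e). sp g \<gamma> \<otimes> sq g \<gamma>)"
    proof (rule finsum_cong')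
      fix e assume e: "e \<in> out_arcs F g"
      have "S e \<otimes> S' e = S e \<otimes> P (head F e) \<otimes> S' e" using e by (simp add: S_P)
      also have "\<dots> = S e \<otimes> (\<Oplus>\<gamma>\<in>code n (head F e). sp (head F e) \<gamma> \<otimes> sq (head F e) \<gamma>) \<otimes> S' e"
        using Suc.IH[of "head F e"] e by simp
      also have "\<dots> = (\<Oplus>\<gamma>\<in>code n (head F e). S e \<otimes> (sp (head F e) \<gamma> \<otimes> sq (head F e) \<gamma>)) \<otimes> S' e"
        using e c[OF e] by (subst finsum_rdistr') (auto simp: finite_code)
      also have "\<dots> = (\<Oplus>\<gamma>\<in>code n (head F e). S e \<otimes> (sp (head F e) \<gamma> \<otimes> sq (head F e) \<gamma>) \<otimes> S' e)"
        using e c[OF e] by (subst finsum_ldistr') (auto simp: finite_code)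
      also have "\<dots> = (\<Oplus>\<gamma>\<in>code n (head F e). sp g (e # \<gamma>) \<otimes> sq g (e # \<gamma>))"
        using e c[OF e] by (intro finsum_cong') (auto simp: m_assoc)
      also have "\<dots> = (\<Oplus>\<gamma>\<in>(#) e ` code n (head F e). sp g \<gamma> \<otimes> sq g \<gamma>)"
        using e c[OF e] by (subst finsum_reindex) auto
      finally show "S e \<otimes> S' e = (\<Oplus>\<gamma>\<in>(#) e ` code n (head F e). sp g \<gamma> \<otimes> sq g \<gamma>)" .
    qed (use c in \<open>auto intro!: finsum_closed\<close>)
    also have "\<dots> = (\<Oplus>\<gamma>\<in>(\<Union>e\<in>out_arcs F g. (#) e ` code n (head F e)). sp g \<gamma> \<otimes> sq g \<gamma>)"
      by (rule add.finprod_UN_disjoint[symmetric]) (use c in \<open>auto simp: finite_out finite_code disjnt_def pairwise_def\<close>)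
    finally show ?thesis using False by simp
  qed
qed

text \<open>By \<open>P_code\<close>, \<open>x\<close> is the sum of the products
  \<open>(x \<otimes> sp w \<gamma>) \<otimes> sq w \<gamma>\<close>, so it can be recovered from
  its products with a whole code.\<close>

lemma code_detect:
  assumes "x \<in> Lspan g w" "w \<in> verts F" "\<And>\<gamma>. \<gamma> \<in> code n w \<Longrightarrow> x \<otimes> sp w \<gamma> = \<zero>"
  shows "x = \<zero>"
proof -
  have x: "x \<in> carrier A" using assms Lspan_closed by blast
  have c: "sp w \<gamma> \<in> carrier A" "sq w \<gamma> \<in> carrier A" if "\<gamma> \<in> code n w" for \<gamma>
    using code_awalk[OF that assms(2)] sp_closed sq_closed by auto
  have "x = x \<otimes> (\<Oplus>\<gamma>\<in>code n w. sp w \<gamma> \<otimes> sq w \<gamma>)"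
    using assms Lspan_P_right P_code by metis
  also have "\<dots> = (\<Oplus>\<gamma>\<in>code n w. x \<otimes> (sp w \<gamma> \<otimes> sq w \<gamma>))"
    using c x by (intro finsum_rdistr') (auto simp: finite_code)
  also have "\<dots> = (\<Oplus>\<gamma>\<in>code n w. \<zero>)"
    using c x assms(3) by (intro finsum_cong') (auto simp: m_assoc[symmetric])
  finally show ?thesis by simp
qed

text \<open>As soon as \<open>n\<close> is at least the length of all ghost paths in
  \<open>x\<close>, every codeword swallows or annihilates each of them. The claim is made for all
  large \<open>n\<close> so that several terms, and then several elements, can share one
  \<open>n\<close>.\<close>

lemma Lspan_code:
  assumes "x \<in> Lspan g w" "w \<in> verts F"
  shows "\<exists>n0. \<forall>n\<ge>n0. \<forall>\<gamma>\<in>code n w. \<forall>u. awalk w \<gamma> u \<longrightarrow> x \<otimes> sp w \<gamma> \<in> Kspan g u"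
  using assms(1)
proof (induction rule: kspan.induct)
  case zero
  show ?case by (rule exI[of _ 0]) (auto simp: kspan.zero)
next
  case (step x c h)
  then obtain n0 where n0: "x \<otimes> sp w \<gamma> \<in> Kspan g u" if "n \<ge> n0" "\<gamma> \<in> code n w" "awalk w \<gamma> u" for n \<gamma> u
    by blast
  obtain \<alpha> \<beta> r where h: "h = sp g \<alpha> \<otimes> sq w \<beta>" "awalk g \<alpha> r" "awalk w \<beta> r"
    using step by (auto simp: Lgen_def)
  have x: "x \<in> carrier A" using step Lspan_closed by blast
  have "(x \<oplus> c \<odot> h) \<otimes> sp w \<gamma> \<in> Kspan g u"
    if n: "n \<ge> max n0 (length \<beta>)" and \<gamma>: "\<gamma> \<in> code n w" "awalk w \<gamma> u" for n \<gamma> u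
  proof -
    have "h \<otimes> sp w \<gamma> = sp g \<alpha> \<otimes> (sq w \<beta> \<otimes> sp w \<gamma>)" using h \<gamma> by (simp add: m_assoc)
    moreover consider "prefix \<beta> \<gamma>" | "prefix \<gamma> \<beta>" "\<not> prefix \<beta> \<gamma>" | "\<not> prefix \<beta> \<gamma>" "\<not> prefix \<gamma> \<beta>" by blast
    then have "sp g \<alpha> \<otimes> (sq w \<beta> \<otimes> sp w \<gamma>) \<in> Kspan g u"
    proof cases
      case 1
      then obtain \<epsilon> where e: "\<gamma> = \<beta> @ \<epsilon>" "awalk r \<epsilon> u" using awalk_prefixE \<gamma> h by metis
      have "sq w \<beta> \<otimes> sp w \<gamma> = sp r \<epsilon>" unfolding sq_sp[OF h(3) \<gamma>(2)] using 1 e by simp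
      then have "sp g \<alpha> \<otimes> (sq w \<beta> \<otimes> sp w \<gamma>) = sp g (\<alpha> @ \<epsilon>)" unfolding sp_append[OF h(2) e(2)] by simp
      then show ?thesis using sp_Kspan awalk_appendI[OF h(2) e(2)] by simp
    next
      case 2
      then obtain \<epsilon> where e: "\<beta> = \<gamma> @ \<epsilon>" by (auto simp: prefix_def)
      \<comment> \<open>The length of \<open>\<beta>\<close> is at most \<open>n\<close>, so the
        codeword cannot be a proper prefix of it.\<close>
      then have "\<epsilon> = []" using code_maximal[OF \<gamma>(1), of \<epsilon> r] h(3) n unfolding e by (simp del: awalk_append_iff)
      then show ?thesis using 2 e by simp
    next
      case 3
      then show ?thesis using h by (simp add: sq_sp[OF h(3) \<gamma>(2)] kspan.zero)
    qed
    moreover have "(x \<oplus> c \<odot> h) \<otimes> sp w \<gamma> = x \<otimes> sp w \<gamma> \<oplus> c \<odot> (h \<otimes> sp w \<gamma>)"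
      using x step h \<gamma> by (simp add: l_distr smult_mult_left)
    ultimately show ?thesis
      using n0[of n \<gamma> u] n \<gamma> step by (simp add: Kgen_carrier kspan_add kspan_smult)
  qed
  then show ?case by blast
qed

lemma Lspan_code_family:
  assumes "finite J" "\<And>j. j \<in> J \<Longrightarrow> x j \<in> Lspan (g j) (w j)" "\<And>j. j \<in> J \<Longrightarrow> w j \<in> verts F"
  shows "\<exists>n>0. \<forall>j\<in>J. \<forall>\<gamma>\<in>code n (w j). \<forall>u. awalk (w j) \<gamma> u \<longrightarrow> x j \<otimes> sp (w j) \<gamma> \<in> Kspan (g j) u"
proof -
  have "\<exists>n0. \<forall>n\<ge>n0. \<forall>j\<in>J. \<forall>\<gamma>\<in>code n (w j). \<forall>u. awalk (w j) \<gamma> u \<longrightarrow> x j \<otimes> sp (w j) \<gamma> \<in> Kspan (g j) u"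
    using assms
  proof (induction J rule: finite_induct)
    case empty then show ?case by simp
  next
    case (insert i J)
    then obtain n0 where n0: "\<forall>n\<ge>n0. \<forall>j\<in>J. \<forall>\<gamma>\<in>code n (w j). \<forall>u. awalk (w j) \<gamma> u \<longrightarrow> x j \<otimes> sp (w j) \<gamma> \<in> Kspan (g j) u"
      by auto
    obtain n1 where n1: "\<forall>n\<ge>n1. \<forall>\<gamma>\<in>code n (w i). \<forall>u. awalk (w i) \<gamma> u \<longrightarrow> x i \<otimes> sp (w i) \<gamma> \<in> Kspan (g i) u"
      using Lspan_code[of "x i" "g i" "w i"] insert by auto
    show ?case by (rule exI[of _ "max n0 n1"]) (use n0 n1 in auto)
  qed
  then obtain n0 where "\<forall>n\<ge>n0. \<forall>j\<in>J. \<forall>\<gamma>\<in>code n (w j). \<forall>u. awalk (w j) \<gamma> u \<longrightarrow> x j \<otimes> sp (w j) \<gamma> \<in> Kspan (g j) u" ..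
  \<comment> \<open>A successor of \<open>n0\<close> serves: a positive depth guarantees later that
    codewords leave the root.\<close>
  then show ?thesis by (meson le_SucI order_refl zero_less_Suc)
qed

section \<open>Leading paths\<close>

text \<open>Lexicographic comparison needs a strict well-order on the whole type of edges; the
  well-ordering theorem supplies one.\<close>

definition "aord = (SOME r :: 'd rel. wf r \<and> total r \<and> trans r)"

lemma aord: "wf aord" "total aord" "trans aord" "irrefl aord"
proof -
  obtain r :: "'d rel" where r: "Well_order r" "Field r = UNIV" using well_ordering[where 'a = 'd] by (elim exE conjE)
  then have r': "refl_on UNIV r" "trans r" "antisym r" "total_on UNIV r" and 1: "wf (r - Id)"
    unfolding well_order_on_def linear_order_on_def partial_order_on_def preorder_on_def by simp_all
  have 2: "total (r - Id)" using r'(4) unfolding total_on_def by simp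
  have 3: "trans (r - Id)" using r'(2,3) by (rule trans_diff_Id)
  have "wf (r - Id) \<and> total (r - Id) \<and> trans (r - Id)" using 1 2 3 by blast
  then have "wf aord \<and> total aord \<and> trans aord"
    unfolding aord_def by (rule someI[of "\<lambda>r. wf r \<and> total r \<and> trans r"])
  then show "wf aord" "total aord" "trans aord" "irrefl aord"
    using wf_irrefl[of aord] by (simp_all add: irrefl_def)
qed

text \<open>Length comes first because the plain lexicographic order on two or more edges is neither
  well-founded nor stable under appending on the right.\<close>

definition mless where "mless m m' \<longleftrightarrow> (m, m') \<in> lenlex aord"

lemma wfp_mless: "wf {(m, m'). mless m m'}"
  unfolding mless_def by (simp add: aord wf_lenlex)

lemma mless_trans: "mless a b \<Longrightarrow> mless b c \<Longrightarrow> mless a c"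
  unfolding mless_def using lenlex_trans aord by blast

lemma mless_irrefl: "\<not> mless a a"
  unfolding mless_def using wfp_mless[unfolded mless_def] by (simp add: wf_irrefl)

lemma mless_total: "a \<noteq> b \<Longrightarrow> mless a b \<or> mless b a"
  unfolding mless_def using total_lenlex[OF aord(2)] by (auto simp: total_on_def)

lemma mless_append_right: "mless a b \<Longrightarrow> mless (a @ c) (b @ c)"
  unfolding mless_def by (rule lenlex_append1) auto

lemma mless_append_left: "mless a b \<Longrightarrow> mless (c @ a) (c @ b)"
  unfolding mless_def by (simp add: lenlex_append2[OF aord(4)])

definition "below g w m = sp g ` {m'. awalk g m' w \<and> mless m' m}"

text \<open>\<open>HLM g w x m\<close>: the combination \<open>x\<close> of paths from \<open>g\<close> to \<open>w\<close> has leading path \<open>m\<close>.\<close>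

definition "HLM g w x m \<longleftrightarrow> awalk g m w \<and>
  (\<exists>c\<in>carrier K - {\<zero>\<^bsub>K\<^esub>}. \<exists>r\<in>kspan (below g w m). x = c \<odot> sp g m \<oplus> r)"

lemma below_carrier: "below g w m \<subseteq> carrier A" by (auto simp: below_def)

lemma below_gen: "\<lbrakk>x = sp g m'; awalk g m' w; mless m' m\<rbrakk> \<Longrightarrow> x \<in> kspan (below g w m)"
  by (rule kspan_gen[OF _ below_carrier]) (auto simp: below_def)

lemma below_mono: "mless m m' \<Longrightarrow> below g w m \<subseteq> below g w m'"
  unfolding below_def using mless_trans by blast

lemma below_Kspan: "x \<in> kspan (below g w m) \<Longrightarrow> x \<in> Kspan g w"
  by (erule kspan_mono) (auto simp: below_def Kgen_def)

text \<open>Finitely many paths occur in \<open>x\<close> and \<open>mless\<close> is total, so one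
  of them bounds the others. Its coefficient may still be zero.\<close>

lemma kspan_bound:
  assumes "x \<in> kspan (sp g ` M)"
  shows "x = \<zero> \<or> (\<exists>m\<in>M. x \<in> kspan (sp g ` {m'\<in>M. m' = m \<or> mless m' m}))"
proof -
  define U where "U m = {m'\<in>M. m' = m \<or> mless m' m}" for m
  have "x \<in> kspan {} \<or> (\<exists>m\<in>M. x \<in> kspan (sp g ` U m))"
    using assms
  proof (induction rule: kspan.induct)
    case zero then show ?case by (simp add: kspan.zero)
  next
    case (step x c h)
    then obtain m where m: "m \<in> M" "h = sp g m" by auto
    from step.IH obtain m1 where m1: "m1 \<in> M" "x \<in> kspan (sp g ` U m1)"
      using m kspan_mono[of x "{}" "sp g ` U m"] by blast
    have U: "U a \<subseteq> U b" if "mless a b" for a b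
      unfolding U_def using that mless_trans[of _ a b] by auto
    obtain m2 where m2: "m2 \<in> M" "U m \<subseteq> U m2" "U m1 \<subseteq> U m2"
    proof (cases "m = m1")
      case True then show ?thesis using that m by blast
    next
      case False then show ?thesis using that[OF m(1)] that[OF m1(1)] U mless_total by blast
    qed
    have "h \<in> sp g ` U m2" using m m2 by (auto simp: U_def)
    moreover have "x \<in> kspan (sp g ` U m2)" using kspan_mono[OF m1(2)] m2 by blast
    ultimately show ?case using m2(1) step(2) kspan.step by blast
  qed
  moreover have "x = \<zero>" if "x \<in> kspan {}" using that by (cases rule: kspan.cases) auto
  ultimately show ?thesis unfolding U_def by blast
qed

text \<open>Well-founded descent: if the bounding path has coefficient zero, \<open>x\<close> lies
  in the span of smaller paths and a new bound is taken there. Only existence is obtained;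
  uniqueness rests on independence and comes with \<open>HLM_unique\<close>, which is why
  \<open>HLM\<close> is a relation.\<close>

lemma LM_exists:
  assumes M: "M \<subseteq> {m. awalk g m w}" and x: "x \<in> kspan (sp g ` M)"
  shows "x = \<zero> \<or> (\<exists>m\<in>M. HLM g w x m)"
proof -
  have "x = \<zero> \<or> (\<exists>m\<in>M. HLM g w x m)" if "m \<in> M" "x \<in> kspan (sp g ` {m'\<in>M. m' = m \<or> mless m' m})" for m x
    using wfp_mless that
  proof (induction m arbitrary: x rule: wf_induct_rule)
    case (less m)
    let ?B = "{m'\<in>M. mless m' m}"
    have B: "sp g ` ?B \<subseteq> below g w m" using M by (auto simp: below_def)
    have Bc: "sp g ` ?B \<subseteq> carrier A" using B below_carrier by blast
    have am: "awalk g m w" using less.prems M by auto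
    have "{m'\<in>M. m' = m \<or> mless m' m} = insert m ?B" using less.prems by auto
    then obtain c r where c: "c \<in> carrier K" "r \<in> kspan (sp g ` ?B)" "x = c \<odot> sp g m \<oplus> r"
      using kspan_insert[of x "sp g m" "sp g ` ?B"] less.prems Bc am by auto
    show ?case
    proof (cases "c = \<zero>\<^bsub>K\<^esub>")
      case True
      have "x = r" using c True am kspan_closed[OF c(2) Bc] by (simp add: smult_l_null)
      then consider "x = \<zero>" | m' where "m' \<in> ?B" "x \<in> kspan (sp g ` {m''\<in>?B. m'' = m' \<or> mless m'' m'})"
        using kspan_bound[OF c(2)] by blast
      then show ?thesis
      proof cases
        case 2
        then have "x \<in> kspan (sp g ` {m''\<in>M. m'' = m' \<or> mless m'' m'})"
          by (elim kspan_mono) auto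
        then show ?thesis using less.IH[of m'] 2 by auto
      qed simp
    next
      case False
      then have "HLM g w x m" unfolding HLM_def using am c kspan_mono[OF c(2) B] by blast
      then show ?thesis using less.prems by blast
    qed
  qed
  then show ?thesis using kspan_bound[OF x] by blast
qed

lemma Kspan_LM: "x \<in> Kspan g w \<Longrightarrow> x = \<zero> \<or> (\<exists>m. HLM g w x m)"
  using LM_exists[of "{m. awalk g m w}" g w x] by (auto simp: Kgen_def)

lemma below_LM: "x \<in> kspan (below g w m) \<Longrightarrow> x = \<zero> \<or> (\<exists>m'. mless m' m \<and> HLM g w x m')"
  using LM_exists[of "{m'. awalk g m' w \<and> mless m' m}" g w x] by (auto simp: below_def)

lemma HLM_awalk: "HLM g w x m \<Longrightarrow> awalk g m w"
  by (simp add: HLM_def)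

lemma HLM_Kspan:
  assumes "HLM g w x m" shows "x \<in> Kspan g w"
proof -
  obtain c r where c: "c \<in> carrier K" "r \<in> kspan (below g w m)" "x = c \<odot> sp g m \<oplus> r" "awalk g m w"
    using assms unfolding HLM_def by blast
  then show ?thesis by (simp add: kspan_add kspan_smult sp_Kspan below_Kspan Kgen_carrier)
qed

lemma HLM_sp: assumes "awalk g m w" shows "HLM g w (sp g m) m"
proof -
  have "sp g m = \<one>\<^bsub>K\<^esub> \<odot> sp g m \<oplus> \<zero>" using assms by (simp add: smult_one)
  then show ?thesis unfolding HLM_def using assms kspan.zero[of "below g w m"] K.one_not_zero by blast
qed

text \<open>The order is stable under composition on both sides, so every other product of terms
  stays below \<open>m @ \<gamma>\<close>; the leading coefficient is a product of nonzero elements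
  of a field.\<close>

lemma HLM_mult:
  assumes "HLM g u x m" "HLM u w k \<gamma>"
  shows "HLM g w (x \<otimes> k) (m @ \<gamma>)"
proof -
  obtain c r where c: "c \<in> carrier K - {\<zero>\<^bsub>K\<^esub>}" "r \<in> kspan (below g u m)" "x = c \<odot> sp g m \<oplus> r" "awalk g m u"
    using assms unfolding HLM_def by blast
  obtain d s where d: "d \<in> carrier K - {\<zero>\<^bsub>K\<^esub>}" "s \<in> kspan (below u w \<gamma>)" "k = d \<odot> sp u \<gamma> \<oplus> s" "awalk u \<gamma> w"
    using assms unfolding HLM_def by blast
  note cl = kspan_closed[OF c(2) below_carrier] kspan_closed[OF d(2) below_carrier]
    Kspan_closed[OF HLM_Kspan[OF assms(2)]] sp_closed[OF c(4)] sp_closed[OF d(4)]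
  have 1: "sp g m \<otimes> s \<in> kspan (below g w (m @ \<gamma>))"
  proof (rule kspan_mult[of _ "{sp g m}", OF kspan_gen d(2)])
    fix a b assume "a \<in> {sp g m}" "b \<in> below u w \<gamma>"
    then obtain \<gamma>' where "a = sp g m" "b = sp u \<gamma>'" "awalk u \<gamma>' w" "mless \<gamma>' \<gamma>" by (auto simp: below_def)
    then have "a \<otimes> b = sp g (m @ \<gamma>')" "awalk g (m @ \<gamma>') w" "mless (m @ \<gamma>') (m @ \<gamma>)"
      using c(4) by (simp_all add: sp_append mless_append_left awalk_appendI del: awalk_append_iff)
    then show "a \<otimes> b \<in> kspan (below g w (m @ \<gamma>))" by (intro below_gen)
  qed (use cl below_carrier in auto)
  have 2: "r \<otimes> k \<in> kspan (below g w (m @ \<gamma>))"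
  proof (rule kspan_mult[OF c(2), of _ "insert (sp u \<gamma>) (below u w \<gamma>)"])
    show "k \<in> kspan (insert (sp u \<gamma>) (below u w \<gamma>))"
      using d cl below_carrier
      by (simp add: kspan_add kspan_smult kspan_gen kspan_mono[OF d(2) subset_insertI])
    fix a b assume "a \<in> below g u m" "b \<in> insert (sp u \<gamma>) (below u w \<gamma>)"
    then obtain m' \<gamma>' where *: "a = sp g m'" "awalk g m' u" "mless m' m" "b = sp u \<gamma>'" "awalk u \<gamma>' w"
      "\<gamma>' = \<gamma> \<or> mless \<gamma>' \<gamma>"
      using d(4) by (auto simp: below_def)
    then have "mless (m' @ \<gamma>') (m @ \<gamma>)"
      using mless_append_right[of m' m \<gamma>] mless_append_left[of \<gamma>' \<gamma> m'] mless_trans by blast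
    with * have "a \<otimes> b = sp g (m' @ \<gamma>')" "awalk g (m' @ \<gamma>') w" "mless (m' @ \<gamma>') (m @ \<gamma>)"
      by (simp_all add: sp_append awalk_appendI del: awalk_append_iff)
    then show "a \<otimes> b \<in> kspan (below g w (m @ \<gamma>))" by (intro below_gen)
  qed (use cl below_carrier in auto)
  have "x \<otimes> k = c \<odot> (sp g m \<otimes> k) \<oplus> r \<otimes> k"
    using c cl by (simp add: l_distr smult_mult_left)
  also have "sp g m \<otimes> k = d \<odot> sp g (m @ \<gamma>) \<oplus> sp g m \<otimes> s"
    using d cl by (simp add: r_distr smult_mult_right sp_append[OF c(4) d(4)])
  also have "c \<odot> (d \<odot> sp g (m @ \<gamma>) \<oplus> sp g m \<otimes> s) \<oplus> r \<otimes> k =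
      (c \<otimes>\<^bsub>K\<^esub> d) \<odot> sp g (m @ \<gamma>) \<oplus> (c \<odot> (sp g m \<otimes> s) \<oplus> r \<otimes> k)"
    using c d cl sp_closed[OF awalk_appendI[OF c(4) d(4)]]
    by (simp add: smult_r_distr smult_assoc1 a_assoc)
  finally have eq: "x \<otimes> k = (c \<otimes>\<^bsub>K\<^esub> d) \<odot> sp g (m @ \<gamma>) \<oplus> (c \<odot> (sp g m \<otimes> s) \<oplus> r \<otimes> k)" .
  have "c \<odot> (sp g m \<otimes> s) \<oplus> r \<otimes> k \<in> kspan (below g w (m @ \<gamma>))"
    using 1 2 c below_carrier by (simp add: kspan_add kspan_smult)
  moreover have "c \<otimes>\<^bsub>K\<^esub> d \<in> carrier K - {\<zero>\<^bsub>K\<^esub>}" using c d K.integral by auto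
  ultimately show ?thesis unfolding HLM_def using eq awalk_appendI[OF c(4) d(4)] by blast
qed

lemma HLM_add:
  assumes "HLM g w x m" "HLM g w y m'" "mless m m'"
  shows "HLM g w (x \<oplus> y) m'"
proof -
  obtain c r where c: "c \<in> carrier K" "r \<in> kspan (below g w m)" "x = c \<odot> sp g m \<oplus> r" "awalk g m w"
    using assms unfolding HLM_def by blast
  obtain d s where d: "d \<in> carrier K - {\<zero>\<^bsub>K\<^esub>}" "s \<in> kspan (below g w m')" "y = d \<odot> sp g m' \<oplus> s" "awalk g m' w"
    using assms unfolding HLM_def by blast
  have "sp g m \<in> kspan (below g w m')"
    by (rule kspan_gen) (use assms c below_carrier in \<open>auto simp: below_def\<close>)
  then have "x \<in> kspan (below g w m')"
    using c kspan_mono[OF c(2) below_mono[OF assms(3)]] below_carrier by (simp add: kspan_add kspan_smult)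
  then have x: "x \<oplus> s \<in> kspan (below g w m')" using d below_carrier by (simp add: kspan_add)
  have "x \<oplus> y = d \<odot> sp g m' \<oplus> (x \<oplus> s)"
    using d kspan_closed[OF d(2) below_carrier] Kspan_closed[OF HLM_Kspan[OF assms(1)]]
    by (simp add: a_ac)
  then show ?thesis unfolding HLM_def using d x by blast
qed

text \<open>Among distinct leading paths the largest one has nothing to cancel against.\<close>

lemma HLM_sum:
  assumes "finite J" "J \<noteq> {}" "\<And>j. j \<in> J \<Longrightarrow> HLM g w (x j) (m j)" "inj_on m J"
  shows "\<exists>j\<in>J. HLM g w (\<Oplus>j\<in>J. x j) (m j)"
  using assms
proof (induction J rule: finite_ne_induct)
  case (singleton j)
  have j: "HLM g w (x j) (m j)" by (rule singleton) simp
  then have "x j \<in> carrier A" by (rule Kspan_closed[OF HLM_Kspan])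
  then have "(\<Oplus>j\<in>{j}. x j) = x j" by simp
  then show ?case using j by simp
next
  case (insert i J)
  have cl: "x j \<in> carrier A" if "j \<in> insert i J" for j
    by (rule Kspan_closed[OF HLM_Kspan[OF insert.prems(1)[OF that]]])
  have "\<exists>j\<in>J. HLM g w (\<Oplus>j\<in>J. x j) (m j)"
    by (rule insert.IH) (use insert.prems in \<open>simp_all add: inj_on_def\<close>)
  then obtain j where j: "j \<in> J" "HLM g w (\<Oplus>j\<in>J. x j) (m j)" ..
  have i: "HLM g w (x i) (m i)" by (rule insert.prems(1)) simp
  have ij: "m i \<noteq> m j" using insert.prems(2) insert.hyps j by (auto simp: inj_on_def)
  have eq: "(\<Oplus>j\<in>insert i J. x j) = x i \<oplus> (\<Oplus>j\<in>J. x j)"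
    using insert cl by (intro finsum_insert) auto
  have "x i \<oplus> (\<Oplus>j\<in>J. x j) = (\<Oplus>j\<in>J. x j) \<oplus> x i"
    using cl by (intro a_comm finsum_closed) auto
  then show ?case
    using mless_total[OF ij] HLM_add[OF i j(2)] HLM_add[OF j(2) i] eq j(1) by (metis insertCI)
qed

end

context nu_ring
begin

lemma minus_zero': "\<ominus> \<zero> = \<zero>"
  by (rule minus_equality) auto

text \<open>Isolates the two indices that a transvection touches.\<close>

lemma finsum_split2:
  assumes "finite J" "i \<in> J" "j \<in> J" "i \<noteq> j" "\<And>l. l \<in> J \<Longrightarrow> f l \<in> carrier R"
  shows "(\<Oplus>l\<in>J. f l) = (f i \<oplus> f j) \<oplus> (\<Oplus>l\<in>J - {i, j}. f l)"
proof -
  have J: "J = insert i (insert j (J - {i, j}))" using assms by auto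
  have "(\<Oplus>l\<in>insert i (insert j (J - {i, j})). f l) = f i \<oplus> (f j \<oplus> (\<Oplus>l\<in>J - {i, j}. f l))"
    using assms by (subst finsum_insert, auto simp: Pi_def)+
  then show ?thesis using assms J by (simp add: a_assoc Pi_def)
qed

lemma finsum_Sigma':
  assumes "finite I" "\<And>i. i \<in> I \<Longrightarrow> finite (B i)"
    "\<And>i j. \<lbrakk>i \<in> I; j \<in> B i\<rbrakk> \<Longrightarrow> f (i, j) \<in> carrier R"
  shows "(\<Oplus>p\<in>Sigma I B. f p) = (\<Oplus>i\<in>I. \<Oplus>j\<in>B i. f (i, j))"
proof -
  have "Sigma I B = (\<Union>i\<in>I. Pair i ` B i)" by auto
  then have "(\<Oplus>p\<in>Sigma I B. f p) = (\<Oplus>i\<in>I. \<Oplus>p\<in>Pair i ` B i. f p)"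
    using assms by (simp only:) (subst add.finprod_UN_disjoint, auto simp: disjnt_def pairwise_def)
  also have "\<dots> = (\<Oplus>i\<in>I. \<Oplus>j\<in>B i. f (i, j))"
    using assms by (intro finsum_cong') (auto intro!: finsum_closed finsum_reindex simp: inj_on_def)
  finally show ?thesis .
qed

end

lemma sum_singleton_mset: "finite A \<Longrightarrow> (\<Sum>a\<in>A. {#f a#}) = image_mset f (mset_set A)"
  by (induction A rule: finite_induct) auto

context leavitt_rep
begin

lemma code_prefix_free: "\<lbrakk>\<gamma> \<in> code n g; \<gamma> @ \<beta> \<in> code n g\<rbrakk> \<Longrightarrow> \<beta> = []"
proof (induction n arbitrary: g \<gamma>)
  case (Suc n)
  show ?case
  proof (cases "out_arcs F g = {}")
    case True with Suc.prems show ?thesis by simp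
  next
    case False
    then have c: "code (Suc n) g = (\<Union>e\<in>out_arcs F g. (#) e ` code n (head F e))" by (simp only: code.simps if_False)
    obtain e \<gamma>' where e: "\<gamma> = e # \<gamma>'" "\<gamma>' \<in> code n (head F e)" using Suc.prems(1) unfolding c by blast
    then have "\<gamma>' @ \<beta> \<in> code n (head F e)" using Suc.prems(2) unfolding c by auto
    then show ?thesis using Suc.IH e by blast
  qed
qed simp

text \<open>Distinct codewords are incomparable for the prefix order, so the ghost of one
  annihilates the other.\<close>

lemma code_sq_sp:
  assumes "\<gamma> \<in> code n g" "\<delta> \<in> code n g" "g \<in> verts F"
  shows "sq g \<gamma> \<otimes> sp g \<delta> = (if \<gamma> = \<delta> then P (awlast g \<gamma>) else \<zero>)"
proof -
  obtain u w where uw: "awalk g \<gamma> u" "awalk g \<delta> w" using code_awalk assms by meson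
  then have "awlast g \<gamma> = u" by (auto elim!: awalkE')
  moreover have "\<gamma> = \<delta>" if "prefix \<gamma> \<delta> \<or> prefix \<delta> \<gamma>"
    using that code_prefix_free assms unfolding prefix_def by (metis append_Nil2)
  ultimately show ?thesis using sq_sp[OF uw] by auto
qed

text \<open>A single division step: \<open>c\<close> is the quotient of the two leading
  coefficients.\<close>

lemma HLM_cancel:
  assumes "HLM g w x m" "HLM g w y m"
  shows "\<exists>c\<in>carrier K. x \<ominus> c \<odot> y \<in> kspan (below g w m)"
proof -
  obtain c r where c: "c \<in> carrier K" "r \<in> kspan (below g w m)" "x = c \<odot> sp g m \<oplus> r" "awalk g m w"
    using assms unfolding HLM_def by blast
  obtain d s where d: "d \<in> carrier K - {\<zero>\<^bsub>K\<^esub>}" "s \<in> kspan (below g w m)" "y = d \<odot> sp g m \<oplus> s"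
    using assms unfolding HLM_def by blast
  define a where "a = c \<otimes>\<^bsub>K\<^esub> inv\<^bsub>K\<^esub> d"
  have dU: "d \<in> Units K" using d K.field_Units by auto
  have a: "a \<in> carrier K" "a \<otimes>\<^bsub>K\<^esub> d = c"
    using c d dU by (simp_all add: a_def R.m_assoc)
  note cl = kspan_closed[OF c(2) below_carrier] kspan_closed[OF d(2) below_carrier] sp_closed[OF c(4)]
  have "a \<odot> y = c \<odot> sp g m \<oplus> a \<odot> s"
    using a d cl by (simp add: smult_r_distr smult_assoc1[symmetric])
  then have "x \<ominus> a \<odot> y = r \<ominus> a \<odot> s"
    using c a cl by (simp add: minus_add a_minus_def a_ac r_neg1 r_neg)
  then show ?thesis
    using a c d below_carrier by (intro bexI[of _ a]) (simp_all add: kspan_diff kspan_smult)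
qed

end

section \<open>Prefix-free families\<close>

text \<open>The functional in \<open>indep\<close> reads off the coefficient of one path; this is
  the form in which a representation on functions delivers independence. Walks ending away from the
  root suffice, since by \<open>no_in\<close> and \<open>root_out\<close> every codeword of positive
  depth leaves the root and never comes back.\<close>

locale rooted_leavitt_rep = leavitt_rep K A F P S S'
  for K :: "('k, 'm) ring_scheme" and A :: "('k, 'a, 'n) module_scheme" (structure)
    and F :: "('g, 'd) pre_digraph" and P :: "'g \<Rightarrow> 'a" and S S' :: "'d \<Rightarrow> 'a" +
  fixes root :: 'g
  assumes root_in: "root \<in> verts F"
    and no_in: "e \<in> arcs F \<Longrightarrow> head F e \<noteq> root"
    and root_out: "out_arcs F root \<noteq> {}"
    and P_nonzero: "g \<in> verts F \<Longrightarrow> P g \<noteq> \<zero>"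
    and indep: "\<lbrakk>w \<noteq> root; awalk root m w\<rbrakk> \<Longrightarrow> \<exists>f. f \<in> carrier A \<rightarrow> carrier K \<and>
      (\<forall>x\<in>carrier A. \<forall>y\<in>carrier A. f (x \<oplus> y) = f x \<oplus>\<^bsub>K\<^esub> f y) \<and>
      (\<forall>c\<in>carrier K. \<forall>m'. awalk root m' w \<longrightarrow>
        f (c \<odot> sp root m') = (if m' = m then c else \<zero>\<^bsub>K\<^esub>))"
begin

text \<open>One functional settles both \<open>HLM_nonzero\<close> and \<open>HLM_unique\<close>: it
  detects \<open>x\<close>, but neither zero nor anything with a smaller leading path.\<close>

lemma HLM_separate:
  assumes "w \<noteq> root" "HLM root w x m"
  shows "\<exists>f. f x \<noteq> \<zero>\<^bsub>K\<^esub> \<and> f \<zero> = \<zero>\<^bsub>K\<^esub> \<and> (\<forall>y m'. HLM root w y m' \<longrightarrow> mless m' m \<longrightarrow> f y = \<zero>\<^bsub>K\<^esub>)"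
proof -
  obtain c r where c: "c \<in> carrier K - {\<zero>\<^bsub>K\<^esub>}" "r \<in> kspan (below root w m)" "x = c \<odot> sp root m \<oplus> r"
    and am: "awalk root m w"
    using assms unfolding HLM_def by blast
  obtain f where f: "f \<in> carrier A \<rightarrow> carrier K"
      "\<And>x y. \<lbrakk>x \<in> carrier A; y \<in> carrier A\<rbrakk> \<Longrightarrow> f (x \<oplus> y) = f x \<oplus>\<^bsub>K\<^esub> f y"
      "\<And>c m'. \<lbrakk>c \<in> carrier K; awalk root m' w\<rbrakk> \<Longrightarrow> f (c \<odot> sp root m') = (if m' = m then c else \<zero>\<^bsub>K\<^esub>)"
    using indep[OF assms(1) am] by blast
  have below: "f y = \<zero>\<^bsub>K\<^esub>" if "y \<in> kspan (below root w m)" for y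
  proof (rule kspan_functional_zero[OF that below_carrier f(1,2)])
    fix c g assume "c \<in> carrier K" "g \<in> below root w m"
    then show "f (c \<odot> g) = \<zero>\<^bsub>K\<^esub>" using f(3) mless_irrefl by (auto simp: below_def)
  qed auto
  have "f x = c"
    using c am f(2)[of "c \<odot> sp root m" r] f(3)[of c m] below[OF c(2)] kspan_closed[OF c(2) below_carrier] by simp
  moreover have "f y = \<zero>\<^bsub>K\<^esub>" if y: "HLM root w y m'" "mless m' m" for y m'
  proof (rule below)
    obtain d s where d: "d \<in> carrier K" "s \<in> kspan (below root w m')" "y = d \<odot> sp root m' \<oplus> s" "awalk root m' w"
      using y unfolding HLM_def by blast
    then show "y \<in> kspan (below root w m)"
      using below_gen[OF HOL.refl d(4) y(2)] kspan_mono[OF d(2) below_mono[OF y(2)]]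
      by (simp add: kspan_add kspan_smult below_carrier)
  qed
  ultimately show ?thesis using c below[OF kspan.zero] by blast
qed

lemma HLM_nonzero: "\<lbrakk>w \<noteq> root; HLM root w x m\<rbrakk> \<Longrightarrow> x \<noteq> \<zero>"
  using HLM_separate by blast

lemma HLM_unique: "\<lbrakk>w \<noteq> root; HLM root w x m; HLM root w x m'\<rbrakk> \<Longrightarrow> m = m'"
  using HLM_separate mless_total by metis

lemma awalk_to_root: "awalk g \<alpha> root \<Longrightarrow> g = root"
  using no_in by (induction \<alpha> arbitrary: g) (auto simp: awalk_simps)

lemma code_root_end: "\<lbrakk>\<gamma> \<in> code n root; n > 0; awalk root \<gamma> w\<rbrakk> \<Longrightarrow> w \<noteq> root"
proof
  assume \<gamma>: "\<gamma> \<in> code n root" "n > 0" "awalk root \<gamma> w" and w: "w = root"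
  then obtain n' where "n = Suc n'" by (cases n) auto
  then have "\<gamma> \<in> (\<Union>e\<in>out_arcs F root. (#) e ` code n' (head F e))"
    using \<gamma>(1) root_out by (simp only: code.simps if_False)
  then obtain e \<delta> where "\<gamma> = e # \<delta>" by blast
  then have "e \<in> arcs F" "awalk (head F e) \<delta> root" using \<gamma>(3) w by (auto simp: awalk_simps)
  then show False using awalk_to_root no_in by blast
qed

text \<open>If \<open>mm i @ \<gamma> i\<close> and \<open>mm j @ \<gamma> j\<close> agreed, one of
  \<open>mm i\<close>, \<open>mm j\<close> would be a prefix of the other. So the leading paths of
  the summands are distinct and \<open>HLM_sum\<close> applies.\<close>

lemma LM_comb:
  assumes J: "finite J" and b: "\<And>j. j \<in> J \<Longrightarrow> HLM root (ww j) (b j) (mm j)"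
    and pf: "\<And>i j. \<lbrakk>i \<in> J; j \<in> J; i \<noteq> j\<rbrakk> \<Longrightarrow> \<not> prefix (mm i) (mm j)"
    and k: "\<And>j. j \<in> J \<Longrightarrow> k j \<in> Kspan (ww j) w" and nz: "i \<in> J" "k i \<noteq> \<zero>"
  shows "\<exists>j\<in>J. \<exists>\<gamma>. HLM root w (\<Oplus>j\<in>J. b j \<otimes> k j) (mm j @ \<gamma>)"
proof -
  \<comment> \<open>Zero coefficients have to go, because they have no leading path to
    contribute.\<close>
  define J' where "J' = {j\<in>J. k j \<noteq> \<zero>}"
  have "\<exists>\<gamma>. HLM (ww j) w (k j) \<gamma>" if "j \<in> J'" for j using Kspan_LM[OF k[of j]] that unfolding J'_def by blast
  then obtain \<gamma> where \<gamma>: "\<And>j. j \<in> J' \<Longrightarrow> HLM (ww j) w (k j) (\<gamma> j)" by metis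
  have cl: "b j \<in> carrier A" "k j \<in> carrier A" if "j \<in> J" for j
    using Kspan_closed[OF HLM_Kspan[OF b[OF that]]] Kspan_closed[OF k[OF that]] .
  have "(\<Oplus>j\<in>J'. b j \<otimes> k j) = (\<Oplus>j\<in>J. b j \<otimes> k j)"
    using J cl by (intro add.finprod_mono_neutral_cong_left) (auto simp: J'_def)
  moreover have "\<exists>j\<in>J'. HLM root w (\<Oplus>j\<in>J'. b j \<otimes> k j) (mm j @ \<gamma> j)"
  proof (rule HLM_sum)
    show "finite J'" "J' \<noteq> {}" using J nz by (auto simp: J'_def)
    show "HLM root w (b j \<otimes> k j) (mm j @ \<gamma> j)" if "j \<in> J'" for j
      using HLM_mult[OF b \<gamma>[OF that]] that by (simp add: J'_def)
    show "inj_on (\<lambda>j. mm j @ \<gamma> j) J'"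
    proof (rule inj_onI)
      fix i j assume ij: "i \<in> J'" "j \<in> J'" "mm i @ \<gamma> i = mm j @ \<gamma> j"
      then have "prefix (mm i) (mm j) \<or> prefix (mm j) (mm i)"
        by (metis prefixI prefix_same_cases)
      then show "i = j" using pf ij by (auto simp: J'_def)
    qed
  qed
  ultimately show ?thesis by (auto simp: J'_def)
qed

text \<open>Multiplying by a code clears the coefficients of ghost edges. If one of them then stayed
  nonzero, the vanishing sum would acquire a leading path; so all vanish, and
  \<open>code_detect\<close> carries this back.\<close>

lemma Lspan_independent:
  assumes J: "finite J" and b: "\<And>j. j \<in> J \<Longrightarrow> HLM root (ww j) (b j) (mm j)"
    and pf: "\<And>i j. \<lbrakk>i \<in> J; j \<in> J; i \<noteq> j\<rbrakk> \<Longrightarrow> \<not> prefix (mm i) (mm j)"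
    and z: "\<And>j. j \<in> J \<Longrightarrow> z j \<in> Lspan (ww j) w" and w: "w \<in> verts F" "w \<noteq> root"
    and sum: "(\<Oplus>j\<in>J. b j \<otimes> z j) = \<zero>" and j: "j \<in> J"
  shows "z j = \<zero>"
proof -
  obtain n where n: "\<And>j \<gamma> u. \<lbrakk>j \<in> J; \<gamma> \<in> code n w; awalk w \<gamma> u\<rbrakk> \<Longrightarrow> z j \<otimes> sp w \<gamma> \<in> Kspan (ww j) u"
    using Lspan_code_family[of J z ww "\<lambda>_. w"] J z w by blast
  have cl: "b j \<in> carrier A" "z j \<in> carrier A" if "j \<in> J" for j
    using Kspan_closed[OF HLM_Kspan[OF b[OF that]]] Lspan_closed[OF z[OF that]] .
  have "z j \<otimes> sp w \<gamma> = \<zero>" if \<gamma>: "\<gamma> \<in> code n w" for \<gamma>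
  proof (rule ccontr)
    assume nz: "z j \<otimes> sp w \<gamma> \<noteq> \<zero>"
    obtain u where u: "awalk w \<gamma> u" using code_awalk[OF \<gamma> w(1)] ..
    have "\<exists>j\<in>J. \<exists>\<delta>. HLM root u (\<Oplus>j\<in>J. b j \<otimes> (z j \<otimes> sp w \<gamma>)) (mm j @ \<delta>)"
      by (rule LM_comb[OF J b pf]) (use n[OF _ \<gamma> u] j nz in auto)
    moreover have "(\<Oplus>j\<in>J. b j \<otimes> (z j \<otimes> sp w \<gamma>)) = (\<Oplus>j\<in>J. b j \<otimes> z j \<otimes> sp w \<gamma>)"
      using cl u by (intro finsum_cong') (auto simp: m_assoc)
    moreover have "\<dots> = (\<Oplus>j\<in>J. b j \<otimes> z j) \<otimes> sp w \<gamma>"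
      using cl u J by (intro finsum_ldistr'[symmetric]) auto
    moreover have "u \<noteq> root" using awalk_to_root u w by blast
    ultimately show False using sum u HLM_nonzero by auto
  qed
  then show ?thesis using code_detect[OF z[OF j] w(1)] by blast
qed

text \<open>For \<open>ww j \<noteq> root\<close> a member equal to zero has no leading path and is
  unconstrained.\<close>

definition reduced where
  "reduced J ww b \<longleftrightarrow> (\<forall>i\<in>J. \<forall>j\<in>J. \<forall>m m'. i \<noteq> j \<longrightarrow> HLM root (ww i) (b i) m \<longrightarrow>
    HLM root (ww j) (b j) m' \<longrightarrow> \<not> prefix m m')"

text \<open>A multiset with at most one element, so that a member reduced to zero drops out of the
  measure.\<close>

definition lm where "lm w x = (if x = \<zero> then {#} else {#THE m. HLM root w x m#})"

lemma lm_HLM: assumes "w \<noteq> root" "HLM root w x m" shows "lm w x = {#m#}"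
proof -
  have "(THE m. HLM root w x m) = m" using assms HLM_unique by (intro the_equality) auto
  then show ?thesis using HLM_nonzero[OF assms] by (simp add: lm_def)
qed

text \<open>
  \<open>\<Phi>\<close> is an invariant of the transvections that leave \<open>\<Sum>\<^sub>j b\<^sub>j y\<^sub>j\<close> unchanged.  The multiset of leading
  paths decreases, because the leading path of \<open>b j\<close> is cancelled.
\<close>

lemma reduce_family:
  assumes J: "finite J" and ww: "\<And>j. j \<in> J \<Longrightarrow> ww j \<noteq> root"
    and pres: "\<And>b y i j k. \<lbrakk>i \<in> J; j \<in> J; i \<noteq> j; k \<in> Kspan (ww i) (ww j); \<Phi> b y\<rbrakk> \<Longrightarrow>
      \<Phi> (b(j := b j \<ominus> b i \<otimes> k)) (y(i := y i \<oplus> k \<otimes> y j))"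
    and "\<Phi> b y" "\<And>j. j \<in> J \<Longrightarrow> b j \<in> Kspan root (ww j)"
  shows "\<exists>b' y'. \<Phi> b' y' \<and> (\<forall>j\<in>J. b' j \<in> Kspan root (ww j)) \<and> reduced J ww b'"
proof -
  define \<mu> where "\<mu> b = (\<Sum>j\<in>J. lm (ww j) (b j))" for b
  have "wf (inv_image (Multiset.mult {(m, m'). mless m m'}) \<mu>)"
    by (intro wf_inv_image wf_mult wfp_mless)
  then show ?thesis using assms(4,5)
  proof (induction b arbitrary: y rule: wf_induct_rule)
    case (less b)
    show ?case
    proof (cases "reduced J ww b")
      case True then show ?thesis using less.prems by blast
    next
      case False
      then obtain i j m \<gamma> where ij: "i \<in> J" "j \<in> J" "i \<noteq> j" "HLM root (ww i) (b i) m"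
        "HLM root (ww j) (b j) (m @ \<gamma>)"
        unfolding reduced_def prefix_def by blast
      have am: "awalk root m (ww i)" "awalk root (m @ \<gamma>) (ww j)"
        by (rule HLM_awalk[OF ij(4)], rule HLM_awalk[OF ij(5)])
      have a\<gamma>: "awalk (ww i) \<gamma> (ww j)" using awalk_prefixE[OF am(2) _ am(1)] by (metis prefixI same_append_eq)
      \<comment> \<open>By \<open>HLM_mult\<close> the right multiple
        \<open>b i \<otimes> sp (ww i) \<gamma>\<close> also has leading path
        \<open>m @ \<gamma>\<close>, so a scalar multiple of it cancels the leading term of
        \<open>b j\<close>.\<close>
      obtain c where c: "c \<in> carrier K"
        "b j \<ominus> c \<odot> (b i \<otimes> sp (ww i) \<gamma>) \<in> kspan (below root (ww j) (m @ \<gamma>))"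
        using HLM_cancel[OF ij(5) HLM_mult[OF ij(4) HLM_sp[OF a\<gamma>]]] by blast
      define k where "k = c \<odot> sp (ww i) \<gamma>"
      define b' where "b' = b(j := b j \<ominus> b i \<otimes> k)"
      have k: "k \<in> Kspan (ww i) (ww j)" using c a\<gamma> by (simp add: k_def kspan_smult sp_Kspan Kgen_carrier)
      have "b i \<otimes> k = c \<odot> (b i \<otimes> sp (ww i) \<gamma>)"
        using c sp_closed[OF a\<gamma>] Kspan_closed[OF less.prems(2)[OF ij(1)]] by (simp add: k_def smult_mult_right)
      then have new: "b' j \<in> kspan (below root (ww j) (m @ \<gamma>))" using c by (simp add: b'_def)
      have lmj: "lm (ww j) (b j) = {#m @ \<gamma>#}" using lm_HLM ww ij by blast
      have lmb: "\<forall>k\<in>set_mset (lm (ww j) (b' j)). mless k (m @ \<gamma>)"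
      proof (cases "b' j = \<zero>")
        case False
        then obtain m' where m': "mless m' (m @ \<gamma>)" "HLM root (ww j) (b' j) m'"
          using below_LM[OF new] by blast
        then show ?thesis using lm_HLM[OF ww[OF ij(2)] m'(2)] by simp
      qed (simp add: lm_def)
      have "\<mu> b' = (\<Sum>l\<in>J - {j}. lm (ww l) (b l)) + lm (ww j) (b' j)"
        unfolding \<mu>_def using J ij by (subst sum.remove[of _ j]) (auto simp: b'_def intro!: sum.cong)
      moreover have "\<mu> b = (\<Sum>l\<in>J - {j}. lm (ww l) (b l)) + lm (ww j) (b j)"
        unfolding \<mu>_def using J ij by (subst sum.remove[of _ j]) auto
      ultimately have "(\<mu> b', \<mu> b) \<in> Multiset.mult {(m, m'). mless m m'}"
        using lmj lmb one_step_implies_mult[of "{#m @ \<gamma>#}" "lm (ww j) (b' j)" "{(m, m'). mless m m'}"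
            "\<Sum>l\<in>J - {j}. lm (ww l) (b l)"] by simp
      moreover have "b' l \<in> Kspan root (ww l)" if "l \<in> J" for l
        using that less.prems(2) below_Kspan[OF new] by (auto simp: b'_def)
      moreover have "\<Phi> b' (y(i := y i \<oplus> k \<otimes> y j))"
        unfolding b'_def by (rule pres[OF ij(1-3) k less.prems(1)])
      ultimately show ?thesis using less.IH[of b'] by simp
    qed
  qed
qed

end

context leavitt_rep
begin

lemma awlast_eq: "awalk g \<alpha> w \<Longrightarrow> awlast g \<alpha> = w"
  by (auto elim!: awalkE')

lemma awalk_awlast: "awalk g \<alpha> w \<Longrightarrow> awalk g \<alpha> (awlast g \<alpha>)"
  using awlast_eq by metis

end

section \<open>Resolutions of idempotents\<close>

context rooted_leavitt_rep
begin

text \<open>A factorisation e = BY into a row and a column. Together with \<open>biorth\<close>,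
  which makes YB the diagonal matrix of the \<open>P (ww i)\<close>, it exhibits \<open>e\<close> as
  equivalent to a diagonal idempotent.\<close>

definition resolves where
  "resolves J ww e b y \<longleftrightarrow>
    (\<forall>j\<in>J. b j \<in> Lspan root (ww j) \<and> y j \<in> Lspan (ww j) root) \<and> e = (\<Oplus>j\<in>J. b j \<otimes> y j)"

definition biorth where
  "biorth J ww b y \<longleftrightarrow> (\<forall>i\<in>J. \<forall>j\<in>J. y i \<otimes> b j = (if i = j then P (ww i) else \<zero>))"

text \<open>B is multiplied on the right by an elementary matrix, and Y on the left by its
  inverse.\<close>

lemma resolves_transvection:
  assumes J: "finite J" and ij: "i \<in> J" "j \<in> J" "i \<noteq> j" and k: "k \<in> Kspan (ww i) (ww j)"
    and r: "resolves J ww e b y"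
  shows "resolves J ww e (b(j := b j \<ominus> b i \<otimes> k)) (y(i := y i \<oplus> k \<otimes> y j))"
proof -
  let ?b = "b(j := b j \<ominus> b i \<otimes> k)" and ?y = "y(i := y i \<oplus> k \<otimes> y j)"
  have kL: "k \<in> Lspan (ww i) (ww j)" using Kspan_imp_Lspan[OF k] .
  have by': "b l \<in> Lspan root (ww l)" "y l \<in> Lspan (ww l) root" if "l \<in> J" for l
    using r that by (auto simp: resolves_def)
  have "b i \<otimes> k \<in> Lspan root (ww j)" "k \<otimes> y j \<in> Lspan (ww i) root"
    using Lspan_mult[OF by'(1) kL] Lspan_mult[OF kL by'(2)] ij by blast+
  then have new: "?b l \<in> Lspan root (ww l)" "?y l \<in> Lspan (ww l) root" if "l \<in> J" for l
    using by' that ij by (auto intro!: kspan_add kspan_diff Lgen_carrier)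
  note cl = Lspan_closed[OF by'(1)] Lspan_closed[OF by'(2)] Lspan_closed[OF kL]
  note ncl = Lspan_closed[OF new(1)] Lspan_closed[OF new(2)]
  have "(\<Oplus>l\<in>J. ?b l \<otimes> ?y l) = (?b i \<otimes> ?y i \<oplus> ?b j \<otimes> ?y j) \<oplus> (\<Oplus>l\<in>J - {i, j}. ?b l \<otimes> ?y l)"
    by (rule finsum_split2[OF J ij]) (use ncl in blast)
  also have "(\<Oplus>l\<in>J - {i, j}. ?b l \<otimes> ?y l) = (\<Oplus>l\<in>J - {i, j}. b l \<otimes> y l)"
    by (rule finsum_cong') (use cl in auto)
  also have "?b i \<otimes> ?y i \<oplus> ?b j \<otimes> ?y j = b i \<otimes> y i \<oplus> b j \<otimes> y j"
    using ij cl by (simp add: r_distr l_distr a_minus_def l_minus m_assoc a_ac r_neg r_neg1 r_neg2)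
  also have "(b i \<otimes> y i \<oplus> b j \<otimes> y j) \<oplus> (\<Oplus>l\<in>J - {i, j}. b l \<otimes> y l) = (\<Oplus>l\<in>J. b l \<otimes> y l)"
    by (rule finsum_split2[symmetric, OF J ij]) (use cl in blast)
  finally show ?thesis using r new by (simp add: resolves_def)
qed

text \<open>YB is conjugated by an elementary matrix. It stays the diagonal matrix of the
  \<open>P (ww i)\<close> because \<open>P (ww i) \<otimes> k\<close> and
  \<open>k \<otimes> P (ww j)\<close> are both \<open>k\<close>.\<close>

lemma biorth_transvection:
  assumes ij: "i \<in> J" "j \<in> J" "i \<noteq> j" and k: "k \<in> Kspan (ww i) (ww j)"
    and ww: "\<And>j. j \<in> J \<Longrightarrow> ww j \<in> verts F"
    and r: "resolves J ww e b y" and bo: "biorth J ww b y"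
  shows "biorth J ww (b(j := b j \<ominus> b i \<otimes> k)) (y(i := y i \<oplus> k \<otimes> y j))"
  unfolding biorth_def
proof (intro ballI)
  let ?b = "b(j := b j \<ominus> b i \<otimes> k)" and ?y = "y(i := y i \<oplus> k \<otimes> y j)"
  fix l m assume lm: "l \<in> J" "m \<in> J"
  have kL: "k \<in> Lspan (ww i) (ww j)" using Kspan_imp_Lspan[OF k] .
  have cl: "b l \<in> carrier A" "y l \<in> carrier A" if "l \<in> J" for l
    using r that Lspan_closed by (auto simp: resolves_def)
  have kc: "k \<in> carrier A" using Lspan_closed[OF kL] .
  have Pk: "P (ww i) \<otimes> k = k" "k \<otimes> P (ww j) = k"
    using Lspan_P_left[OF kL] Lspan_P_right[OF kL] ww ij by auto
  have yb: "y l \<otimes> b m = (if l = m then P (ww l) else \<zero>)" if "l \<in> J" "m \<in> J" for l m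
    using bo that by (simp add: biorth_def)
  have kyb: "(k \<otimes> y j) \<otimes> b m = (if j = m then k else \<zero>)" if "m \<in> J" for m
    using yb[of j m] that ij cl kc Pk by (auto simp: m_assoc)
  have ybk: "y l \<otimes> (b i \<otimes> k) = (if l = i then k else \<zero>)" if "l \<in> J" for l
    using yb[of l i] that ij cl kc Pk by (auto simp: m_assoc[symmetric])
  have kybk: "(k \<otimes> y j) \<otimes> (b i \<otimes> k) = \<zero>"
    using ybk[of j] ij cl kc by (simp add: m_assoc)
  have Pc: "P (ww l) \<in> carrier A" if "l \<in> J" for l using ww[OF that] by simp
  have yc: "k \<otimes> y j \<in> carrier A" "b i \<otimes> k \<in> carrier A"
    using cl ij kc by auto
  consider "l \<noteq> i" "m \<noteq> j" | "l = i" "m \<noteq> j" | "l \<noteq> i" "m = j" | "l = i" "m = j" by blast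
  then show "?y l \<otimes> ?b m = (if l = m then P (ww l) else \<zero>)"
  proof cases
    case 1
    then show ?thesis using yb[OF lm] by simp
  next
    case 2
    have "(y i \<oplus> k \<otimes> y j) \<otimes> b m = y i \<otimes> b m \<oplus> (k \<otimes> y j) \<otimes> b m"
      using cl ij lm kc by (intro l_distr) auto
    then show ?thesis using 2 lm ij yb[of i m] kyb[of m] Pc by simp
  next
    case 3
    have "y l \<otimes> (b j \<ominus> b i \<otimes> k) = y l \<otimes> b j \<ominus> y l \<otimes> (b i \<otimes> k)"
      using cl ij lm kc by (simp add: a_minus_def r_distr r_minus)
    then show ?thesis using 3 lm ij yb[of l j] ybk[of l] Pc by (auto simp: a_minus_def minus_zero')
  next
    \<comment> \<open>Two terms survive, one from \<open>(k \<otimes> y j) \<otimes> b j\<close> and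
      one from \<open>y i \<otimes> (b i \<otimes> k)\<close>; both are \<open>k\<close> and they
      cancel.\<close>
    case 4
    have "(y i \<oplus> k \<otimes> y j) \<otimes> (b j \<ominus> b i \<otimes> k) =
        (y i \<otimes> b j \<oplus> (k \<otimes> y j) \<otimes> b j) \<ominus> (y i \<otimes> (b i \<otimes> k) \<oplus> (k \<otimes> y j) \<otimes> (b i \<otimes> k))"
      using cl[OF ij(1)] cl[OF ij(2)] yc kc by (simp only: a_minus_def r_distr r_minus l_distr a_closed m_closed add.inv_closed)
    then show ?thesis using 4 ij kc yb[of i j] kyb[of j] ybk[of i] kybk by (simp add: a_minus_def r_neg)
  qed
qed

text \<open>\<open>P (ww j)\<close> is inserted between \<open>b j\<close> and \<open>y j\<close>
  and expanded by \<open>P_code\<close>. This is how the row gets rid of ghost edges without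
  changing the sum.\<close>

lemma resolves_code:
  assumes J: "finite J" and ww: "\<And>j. j \<in> J \<Longrightarrow> ww j \<in> verts F" and r: "resolves J ww e b y"
  shows "resolves (SIGMA j:J. code n (ww j)) (\<lambda>(j, \<gamma>). awlast (ww j) \<gamma>) e
    (\<lambda>(j, \<gamma>). b j \<otimes> sp (ww j) \<gamma>) (\<lambda>(j, \<gamma>). sq (ww j) \<gamma> \<otimes> y j)"
proof -
  have by': "b l \<in> Lspan root (ww l)" "y l \<in> Lspan (ww l) root" if "l \<in> J" for l
    using r that by (auto simp: resolves_def)
  note cl = Lspan_closed[OF by'(1)] Lspan_closed[OF by'(2)]
  have aw: "awalk (ww j) \<gamma> (awlast (ww j) \<gamma>)" if "j \<in> J" "\<gamma> \<in> code n (ww j)" for j \<gamma>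
    using code_awalk[OF that(2) ww[OF that(1)]] awalk_awlast by blast
  note scl = sp_closed[OF aw] sq_closed[OF aw]
  have "e = (\<Oplus>j\<in>J. b j \<otimes> y j)" using r by (simp add: resolves_def)
  also have "\<dots> = (\<Oplus>j\<in>J. \<Oplus>\<gamma>\<in>code n (ww j). (b j \<otimes> sp (ww j) \<gamma>) \<otimes> (sq (ww j) \<gamma> \<otimes> y j))"
  proof (rule finsum_cong')
    fix j assume j: "j \<in> J"
    have "b j \<otimes> y j = b j \<otimes> P (ww j) \<otimes> y j" using Lspan_P_right[OF by'(1) ww] j by simp
    also have "\<dots> = b j \<otimes> (\<Oplus>\<gamma>\<in>code n (ww j). sp (ww j) \<gamma> \<otimes> sq (ww j) \<gamma>) \<otimes> y j"
      using P_code[OF ww[OF j]] by simp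
    also have "\<dots> = (\<Oplus>\<gamma>\<in>code n (ww j). b j \<otimes> (sp (ww j) \<gamma> \<otimes> sq (ww j) \<gamma>)) \<otimes> y j"
      using cl scl j by (subst finsum_rdistr') (auto simp: finite_code)
    also have "\<dots> = (\<Oplus>\<gamma>\<in>code n (ww j). b j \<otimes> (sp (ww j) \<gamma> \<otimes> sq (ww j) \<gamma>) \<otimes> y j)"
      using cl scl j by (subst finsum_ldistr') (auto simp: finite_code)
    also have "\<dots> = (\<Oplus>\<gamma>\<in>code n (ww j). (b j \<otimes> sp (ww j) \<gamma>) \<otimes> (sq (ww j) \<gamma> \<otimes> y j))"
      using cl scl j by (intro finsum_cong') (auto simp: m_assoc)
    finally show "b j \<otimes> y j = (\<Oplus>\<gamma>\<in>code n (ww j). (b j \<otimes> sp (ww j) \<gamma>) \<otimes> (sq (ww j) \<gamma> \<otimes> y j))" .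
  qed (use cl scl in \<open>auto intro!: finsum_closed\<close>)
  also have "\<dots> = (\<Oplus>p\<in>(SIGMA j:J. code n (ww j)).
      (case p of (j, \<gamma>) \<Rightarrow> b j \<otimes> sp (ww j) \<gamma>) \<otimes> (case p of (j, \<gamma>) \<Rightarrow> sq (ww j) \<gamma> \<otimes> y j))"
    using J cl scl by (subst finsum_Sigma') (auto simp: finite_code)
  finally show ?thesis
    unfolding resolves_def
    using Lspan_mult[OF by'(1) sp_Lspan[OF aw]] Lspan_mult[OF sq_Lspan[OF aw] by'(2)] by auto
qed

lemma biorth_code:
  assumes ww: "\<And>j. j \<in> J \<Longrightarrow> ww j \<in> verts F" and r: "resolves J ww e b y" and bo: "biorth J ww b y"
  shows "biorth (SIGMA j:J. code n (ww j)) (\<lambda>(j, \<gamma>). awlast (ww j) \<gamma>)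
    (\<lambda>(j, \<gamma>). b j \<otimes> sp (ww j) \<gamma>) (\<lambda>(j, \<gamma>). sq (ww j) \<gamma> \<otimes> y j)"
  unfolding biorth_def
proof (intro ballI)
  fix p q assume "p \<in> (SIGMA j:J. code n (ww j))" "q \<in> (SIGMA j:J. code n (ww j))"
  then obtain i \<gamma> j \<delta> where pq: "p = (i, \<gamma>)" "q = (j, \<delta>)" and ij: "i \<in> J" "j \<in> J"
    and \<gamma>: "\<gamma> \<in> code n (ww i)" "\<delta> \<in> code n (ww j)" by auto
  have cl: "b l \<in> carrier A" "y l \<in> carrier A" if "l \<in> J" for l
    using r that Lspan_closed by (auto simp: resolves_def)
  obtain u v where a: "awalk (ww i) \<gamma> u" "awalk (ww j) \<delta> v" using code_awalk \<gamma> ij ww by meson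
  note scl = sq_closed[OF a(1)] sp_closed[OF a(2)]
  have "sq (ww i) \<gamma> \<otimes> y i \<otimes> (b j \<otimes> sp (ww j) \<delta>) = sq (ww i) \<gamma> \<otimes> (y i \<otimes> b j) \<otimes> sp (ww j) \<delta>"
    using cl[OF ij(1)] cl[OF ij(2)] scl by (simp add: m_assoc)
  also have "\<dots> = (if i = j then sq (ww i) \<gamma> \<otimes> sp (ww j) \<delta> else \<zero>)"
    using bo ij scl sq_P[OF a(1)] by (auto simp: biorth_def)
  also have "\<dots> = (if (i, \<gamma>) = (j, \<delta>) then P (awlast (ww i) \<gamma>) else \<zero>)"
    using code_sq_sp[of \<gamma> n "ww i" \<delta>] \<gamma> ww ij by auto
  finally show "(case p of (j, \<gamma>) \<Rightarrow> sq (ww j) \<gamma> \<otimes> y j) \<otimes> (case q of (j, \<gamma>) \<Rightarrow> b j \<otimes> sp (ww j) \<gamma>) =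
    (if p = q then P (case p of (j, \<gamma>) \<Rightarrow> awlast (ww j) \<gamma>) else \<zero>)" by (simp add: pq)
qed

text \<open>After reduction the row consists of independent elements fixed by \<open>e\<close> on
  the left. Then b_k has two expansions in the row, the trivial one and the one obtained from b_k =
  e b_k; equality of their coefficients is biorthogonality.\<close>

theorem idempotent_resolution:
  assumes e: "e \<in> Lspan root root" "e \<otimes> e = e"
  shows "\<exists>(J :: (unit \<times> 'd list) set) ww b y. finite J \<and> (\<forall>j\<in>J. ww j \<in> verts F \<and> ww j \<noteq> root) \<and>
    resolves J ww e b y \<and> biorth J ww b y"
proof -
  have ec: "e \<in> carrier A" using e Lspan_closed by blast
  obtain n where n: "n > 0" "\<And>\<gamma> u. \<lbrakk>\<gamma> \<in> code n root; awalk root \<gamma> u\<rbrakk> \<Longrightarrow> e \<otimes> sp root \<gamma> \<in> Kspan root u"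
    using Lspan_code_family[of "{()}" "\<lambda>_. e" "\<lambda>_. root" "\<lambda>_. root"] e root_in by auto
  \<comment> \<open>The starting point is the factorisation of \<open>e\<close> as
    \<open>e \<otimes> e\<close>, with the one index \<open>()\<close> at the root, refined by a
    code there; hence the index type in the statement.\<close>
  define J where "J = (SIGMA j:{()}. code n root)"
  define ww where "ww = (\<lambda>(j :: unit, \<gamma>). awlast root \<gamma>)"
  define b where "b = (\<lambda>(j :: unit, \<gamma>). e \<otimes> sp root \<gamma>)"
  define y where "y = (\<lambda>(j :: unit, \<gamma>). sq root \<gamma> \<otimes> e)"
  \<comment> \<open>Transvections change a member only by right multiples of another one, so they
    keep \<open>e \<otimes> b j = b j\<close>, which is what the comparison of expansions starts
    from.\<close>
  define \<Phi> where "\<Phi> b y \<longleftrightarrow> resolves J ww e b y \<and> (\<forall>j\<in>J. e \<otimes> b j = b j)" for b y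
  have J: "finite J" by (simp add: J_def finite_code)
  have aw: "awalk root (snd j) (ww j)" "ww j \<noteq> root" if "j \<in> J" for j
  proof -
    have j: "snd j \<in> code n root" using that by (auto simp: J_def)
    then obtain u where "awalk root (snd j) u" using code_awalk root_in by blast
    then show "awalk root (snd j) (ww j)" using awalk_awlast by (auto simp: ww_def split_def)
    then show "ww j \<noteq> root" using code_root_end[OF j n(1)] by blast
  qed
  have wv: "ww j \<in> verts F" if "j \<in> J" for j using aw(1)[OF that] by (rule awalk_last_in_verts)
  have "resolves {()} (\<lambda>_. root) e (\<lambda>_. e) (\<lambda>_. e)"
    using e ec by (simp add: resolves_def)
  then have "resolves J ww e b y"
    unfolding J_def ww_def b_def y_def using resolves_code[of "{()}" "\<lambda>_. root" e "\<lambda>_. e" "\<lambda>_. e" n] root_in by simp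
  moreover have "e \<otimes> b j = b j" if "j \<in> J" for j
  proof -
    have "sp root (snd j) \<in> carrier A" using aw(1)[OF that] by (rule sp_closed)
    then show ?thesis using e ec by (simp add: b_def split_def m_assoc[symmetric])
  qed
  ultimately have \<Phi>0: "\<Phi> b y" by (simp add: \<Phi>_def)
  have "\<exists>b' y'. \<Phi> b' y' \<and> (\<forall>j\<in>J. b' j \<in> Kspan root (ww j)) \<and> reduced J ww b'"
  proof (rule reduce_family[where \<Phi> = \<Phi>, OF J _ _ \<Phi>0])
    fix b y i j k
    assume ij: "i \<in> J" "j \<in> J" "i \<noteq> j" and k: "k \<in> Kspan (ww i) (ww j)" and \<Phi>: "\<Phi> b y"
    have r: "resolves J ww e b y" and eb: "\<And>l. l \<in> J \<Longrightarrow> e \<otimes> b l = b l" using \<Phi> by (auto simp: \<Phi>_def)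
    have cl: "b l \<in> carrier A" if "l \<in> J" for l using r that Lspan_closed by (auto simp: resolves_def)
    have "e \<otimes> (b j \<ominus> b i \<otimes> k) = b j \<ominus> b i \<otimes> k"
      using ec cl[OF ij(1)] cl[OF ij(2)] Kspan_closed[OF k] eb[OF ij(1)] eb[OF ij(2)]
      by (simp add: a_minus_def r_distr r_minus m_assoc[symmetric])
    then show "\<Phi> (b(j := b j \<ominus> b i \<otimes> k)) (y(i := y i \<oplus> k \<otimes> y j))"
      using resolves_transvection[OF J ij k r] eb by (simp add: \<Phi>_def)
  next
    fix j assume j: "j \<in> J"
    show "ww j \<noteq> root" using aw(2)[OF j] .
    show "b j \<in> Kspan root (ww j)"
      using n(2)[of "snd j" "ww j"] aw(1)[OF j] j by (auto simp: J_def b_def)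
  qed
  then obtain b' y' where by': "\<Phi> b' y'" "\<And>j. j \<in> J \<Longrightarrow> b' j \<in> Kspan root (ww j)" "reduced J ww b'" by blast
  have r: "resolves J ww e b' y'" and eb: "\<And>j. j \<in> J \<Longrightarrow> e \<otimes> b' j = b' j" using by' by (auto simp: \<Phi>_def)
  have cl: "b' l \<in> carrier A" "y' l \<in> carrier A" if "l \<in> J" for l
    using r that Lspan_closed by (auto simp: resolves_def)
  \<comment> \<open>\<open>Lspan_independent\<close> asks for a leading path of every member; those
    reduced to zero add nothing to the sum.\<close>
  define J' where "J' = {j\<in>J. b' j \<noteq> \<zero>}"
  have J': "finite J'" "J' \<subseteq> J" using J by (auto simp: J'_def)
  have sumJ': "(\<Oplus>j\<in>J'. b' j \<otimes> z j) = (\<Oplus>j\<in>J. b' j \<otimes> z j)" if "\<And>j. j \<in> J \<Longrightarrow> z j \<in> carrier A" for z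
    using J cl that by (intro add.finprod_mono_neutral_cong_left) (auto simp: J'_def)
  have r': "resolves J' ww e b' y'" using r sumJ'[OF cl(2)] J' by (auto simp: resolves_def)
  have "\<exists>m. HLM root (ww j) (b' j) m" if "j \<in> J'" for j
    using Kspan_LM[OF by'(2)[of j]] that by (auto simp: J'_def)
  then obtain mm where mm: "\<And>j. j \<in> J' \<Longrightarrow> HLM root (ww j) (b' j) (mm j)" by metis
  have pf: "\<not> prefix (mm i) (mm j)" if "i \<in> J'" "j \<in> J'" "i \<noteq> j" for i j
    using by'(3) that mm J' unfolding reduced_def by blast
  have "biorth J' ww b' y'"
    unfolding biorth_def
  proof (intro ballI)
    fix i k assume i: "i \<in> J'" and k: "k \<in> J'"
    define I where "I j = (if j = k then P (ww k) else \<zero>)" for j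
    \<comment> \<open>The difference of the coefficients in the two expansions of
      \<open>b' k\<close>.\<close>
    define z where "z j = y' j \<otimes> b' k \<ominus> I j" for j
    have kJ: "k \<in> J" using k J' by auto
    have wk: "ww k \<in> verts F" using wv[OF kJ] .
    have Ic: "I j \<in> carrier A" for j using wk by (simp add: I_def)
    have bk: "b' k \<in> Lspan root (ww k)" using r kJ by (simp add: resolves_def)
    have IL: "I j \<in> Lspan (ww j) (ww k)" for j
      using sp_Lspan[of "ww k" "[]" "ww k"] wk by (auto simp: I_def awalk_simps kspan.zero)
    have zL: "z j \<in> Lspan (ww j) (ww k)" if "j \<in> J'" for j
      using r' that bk IL Lspan_mult unfolding z_def by (intro kspan_diff Lgen_carrier) (auto simp: resolves_def)
    have sI: "(\<Oplus>j\<in>J'. b' j \<otimes> I j) = b' k"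
    proof -
      have "(\<Oplus>j\<in>J'. b' j \<otimes> I j) = (\<Oplus>j\<in>J'. if k = j then b' j else \<zero>)"
        using cl J' k Lspan_P_right[OF bk wk] wk by (intro finsum_cong') (auto simp: I_def)
      also have "\<dots> = b' k" using J' k cl by (intro add.finprod_singleton) auto
      finally show ?thesis .
    qed
    have zc: "z j \<in> carrier A" if "j \<in> J'" for j using Lspan_closed[OF zL[OF that]] .
    have zI: "z j \<oplus> I j = y' j \<otimes> b' k" if "j \<in> J'" for j
    proof -
      have "y' j \<otimes> b' k \<in> carrier A" using cl[of j] cl[OF kJ] J' that by blast
      then show ?thesis using Ic[of j] unfolding z_def by (simp add: a_minus_def a_assoc l_neg)
    qed
    have "(\<Oplus>j\<in>J'. b' j \<otimes> z j) \<oplus> b' k = (\<Oplus>j\<in>J'. b' j \<otimes> z j) \<oplus> (\<Oplus>j\<in>J'. b' j \<otimes> I j)"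
      using sI by simp
    also have "\<dots> = (\<Oplus>j\<in>J'. b' j \<otimes> z j \<oplus> b' j \<otimes> I j)"
      using cl J' zc Ic by (intro finsum_addf[symmetric]) (auto simp: subset_iff)
    also have "\<dots> = (\<Oplus>j\<in>J'. b' j \<otimes> y' j \<otimes> b' k)"
      using cl J' cl[OF kJ] zc Ic by (intro finsum_cong') (auto simp: r_distr[symmetric] zI m_assoc subset_iff)
    also have "\<dots> = (\<Oplus>j\<in>J'. b' j \<otimes> y' j) \<otimes> b' k"
      using cl J' cl[OF kJ] by (intro finsum_ldistr'[symmetric]) (auto simp: subset_iff)
    also have "\<dots> = b' k" using r' eb[OF kJ] by (simp add: resolves_def)
    finally have "(\<Oplus>j\<in>J'. b' j \<otimes> z j) \<oplus> b' k = b' k" .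
    moreover have "(\<Oplus>j\<in>J'. b' j \<otimes> z j) \<in> carrier A"
      using cl J' zc by (intro finsum_closed) (auto simp: subset_iff)
    ultimately have s0: "(\<Oplus>j\<in>J'. b' j \<otimes> z j) = \<zero>"
      using cl[OF kJ] add.r_cancel_one by blast
    have "z i = \<zero>"
      by (rule Lspan_independent[OF J'(1) mm pf zL wk aw(2)[OF kJ] s0 i])
    then have "y' i \<otimes> b' k = I i" using zI[OF i] Ic[of i] by simp
    then show "y' i \<otimes> b' k = (if i = k then P (ww i) else \<zero>)" by (simp add: I_def)
  qed
  then show ?thesis using J' r' wv aw(2) by (intro exI[of _ J'] exI[of _ ww] exI[of _ b'] exI[of _ y']) auto
qed

text \<open>
  In this lemma and the next theorem, \<open>R\<close> is any congruence containing the relations of the graph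
  monoid; it will be pulled back from the generators of \<open>mbar_monoid\<close>.
\<close>

lemma complete_code_class:
  fixes R :: "'g multiset \<Rightarrow> 'g multiset \<Rightarrow> bool"
  assumes refl: "\<And>m. set_mset m \<subseteq> verts F \<Longrightarrow> R m m"
    and trans: "\<And>l m n. \<lbrakk>R l m; R m n\<rbrakk> \<Longrightarrow> R l n"
    and add: "\<And>l l' m m'. \<lbrakk>R l l'; R m m'\<rbrakk> \<Longrightarrow> R (l + m) (l' + m')"
    and reg: "\<And>g. \<lbrakk>g \<in> verts F; out_arcs F g \<noteq> {}\<rbrakk> \<Longrightarrow> R {#g#} (\<Sum>e\<in>out_arcs F g. {#head F e#})"
    and g: "g \<in> verts F" and M: "finite M" "\<And>m. m \<in> M \<Longrightarrow> \<exists>w. awalk g m w"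
    and pf: "\<And>m m'. \<lbrakk>m \<in> M; m' \<in> M; prefix m m'\<rbrakk> \<Longrightarrow> m = m'"
    and complete: "\<And>\<gamma>. \<gamma> \<in> code n g \<Longrightarrow> \<exists>m\<in>M. prefix m \<gamma>"
  shows "R {#g#} (\<Sum>m\<in>M. {#awlast g m#})"
proof -
  have R_sum: "R (\<Sum>i\<in>I. f i) (\<Sum>i\<in>I. h i)" if "finite I" "\<And>i. i \<in> I \<Longrightarrow> R (f i) (h i)"
    for I :: "'d set" and f h
    using that
  proof (induction I rule: finite_induct)
    case empty then show ?case using refl[of "{#}"] by simp
  next
    case (insert i I) then show ?case by (simp add: add)
  qed
  have base: "R {#g#} (\<Sum>m\<in>M. {#awlast g m#})"
    if "[] \<in> M" "\<And>m m'. \<lbrakk>m \<in> M; m' \<in> M; prefix m m'\<rbrakk> \<Longrightarrow> m = m'" "g \<in> verts F" for M g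
  proof -
    have "M = {[]}" using that(1) that(2)[OF that(1)] by auto
    then show ?thesis using refl[of "{#g#}"] that(3) by simp
  qed
  \<comment> \<open>Induction on the depth: either \<open>M\<close> consists of the empty path, or
    it splits according to first edges into sets that are complete for depth \<open>n\<close> at the
    heads of these edges.\<close>
  show ?thesis
    using g M pf complete
  proof (induction n arbitrary: g M)
    case 0
    then have "[] \<in> M" by auto
    then show ?case using 0 by (intro base)
  next
    case (Suc n)
    show ?case
    proof (cases "[] \<in> M")
      case True then show ?thesis using Suc.prems by (intro base)
    next
      case False
      define N where "N e = {m. e # m \<in> M}" for e
      have M_eq: "M = (\<Union>e\<in>out_arcs F g. (#) e ` N e)"
      proof
        show "M \<subseteq> (\<Union>e\<in>out_arcs F g. (#) e ` N e)"
        proof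
          fix m assume m: "m \<in> M"
          then obtain e m' where e: "m = e # m'" using False by (cases m) auto
          then have "e \<in> out_arcs F g" using Suc.prems(3)[OF m] by (auto simp: awalk_simps)
          then show "m \<in> (\<Union>e\<in>out_arcs F g. (#) e ` N e)" using e m by (auto simp: N_def)
        qed
      qed (auto simp: N_def)
      \<comment> \<open>At a sink the empty path would be a codeword, and its only prefix is
        itself.\<close>
      have ne: "out_arcs F g \<noteq> {}"
      proof
        assume "out_arcs F g = {}"
        then have "[] \<in> code (Suc n) g" by simp
        then show False using Suc.prems(5) False by fastforce
      qed
      have finN: "finite (N e)" for e
        using finite_vimageI[OF Suc.prems(2), of "(#) e"] by (simp add: N_def vimage_def)
      have 1: "R {#g#} (\<Sum>e\<in>out_arcs F g. {#head F e#})" using reg[OF Suc.prems(1) ne] .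
      have 2: "R (\<Sum>e\<in>out_arcs F g. {#head F e#}) (\<Sum>e\<in>out_arcs F g. \<Sum>m\<in>N e. {#awlast (head F e) m#})"
      proof (rule R_sum[OF finite_out])
        fix e assume e: "e \<in> out_arcs F g"
        show "R {#head F e#} (\<Sum>m\<in>N e. {#awlast (head F e) m#})"
        proof (rule Suc.IH)
          show "head F e \<in> verts F" using e by simp
          show "finite (N e)" by (rule finN)
          show "\<exists>w. awalk (head F e) m w" if "m \<in> N e" for m
            using Suc.prems(3)[of "e # m"] that by (auto simp: N_def awalk_simps)
          show "m = m'" if "m \<in> N e" "m' \<in> N e" "prefix m m'" for m m'
            using Suc.prems(4)[of "e # m" "e # m'"] that by (auto simp: N_def)
          show "\<exists>m\<in>N e. prefix m \<gamma>" if \<gamma>: "\<gamma> \<in> code n (head F e)" for \<gamma>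
          proof -
            have "e # \<gamma> \<in> code (Suc n) g" using \<gamma> e ne by auto
            then obtain m where "m \<in> M" "prefix m (e # \<gamma>)" using Suc.prems(5) by blast
            then show ?thesis using False by (cases m) (auto simp: N_def)
          qed
        qed
      qed
      have "(\<Sum>m\<in>M. {#awlast g m#}) = (\<Sum>e\<in>out_arcs F g. \<Sum>m\<in>(#) e ` N e. {#awlast g m#})"
        unfolding M_eq by (rule sum.UNION_disjoint) (auto simp: finite_out finN)
      also have "\<dots> = (\<Sum>e\<in>out_arcs F g. \<Sum>m\<in>N e. {#awlast (head F e) m#})"
        by (rule sum.cong) (simp_all add: sum.reindex)
      finally show ?thesis using trans[OF 1 2] by simp
    qed
  qed
qed

theorem resolution_class:
  fixes R :: "'g multiset \<Rightarrow> 'g multiset \<Rightarrow> bool"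
  assumes refl: "\<And>m. set_mset m \<subseteq> verts F \<Longrightarrow> R m m"
    and sym: "\<And>l m. R l m \<Longrightarrow> R m l"
    and trans: "\<And>l m n. \<lbrakk>R l m; R m n\<rbrakk> \<Longrightarrow> R l n"
    and add: "\<And>l l' m m'. \<lbrakk>R l l'; R m m'\<rbrakk> \<Longrightarrow> R (l + m) (l' + m')"
    and reg: "\<And>g. \<lbrakk>g \<in> verts F; out_arcs F g \<noteq> {}\<rbrakk> \<Longrightarrow> R {#g#} (\<Sum>e\<in>out_arcs F g. {#head F e#})"
    and J: "finite J" and ww: "\<And>j. j \<in> J \<Longrightarrow> ww j \<in> verts F" "\<And>j. j \<in> J \<Longrightarrow> ww j \<noteq> root"
    and r: "resolves J ww (P root) b y" and bo: "biorth J ww b y"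
  shows "R {#root#} (\<Sum>j\<in>J. {#ww j#})"
proof -
  have bL: "b j \<in> Lspan root (ww j)" if "j \<in> J" for j using r that by (simp add: resolves_def)
  obtain n where n: "\<And>j \<gamma> u. \<lbrakk>j \<in> J; \<gamma> \<in> code n (ww j); awalk (ww j) \<gamma> u\<rbrakk> \<Longrightarrow> b j \<otimes> sp (ww j) \<gamma> \<in> Kspan root u"
    using Lspan_code_family[of J b "\<lambda>_. root" ww] J ww(1) bL by blast
  define I where "I = (SIGMA j:J. code n (ww j))"
  define w' where "w' = (\<lambda>(j, \<gamma>). awlast (ww j) \<gamma>)"
  define b0 where "b0 = (\<lambda>(j, \<gamma>). b j \<otimes> sp (ww j) \<gamma>)"
  define y0 where "y0 = (\<lambda>(j, \<gamma>). sq (ww j) \<gamma> \<otimes> y j)"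
  \<comment> \<open>Biorthogonality is among the data here, so it is carried as an invariant instead
    of being deduced at the end.\<close>
  define \<Phi> where "\<Phi> b y \<longleftrightarrow> resolves I w' (P root) b y \<and> biorth I w' b y" for b y
  have I: "finite I" using J by (simp add: I_def finite_code)
  have aw: "awalk (ww (fst p)) (snd p) (w' p)" if "p \<in> I" for p
    using that code_awalk ww(1) awalk_awlast by (fastforce simp: I_def w'_def)
  have w'v: "w' p \<in> verts F" if "p \<in> I" for p using aw[OF that] by (rule awalk_last_in_verts)
  have w'r: "w' p \<noteq> root" if "p \<in> I" for p
  proof
    assume "w' p = root"
    then have "ww (fst p) = root" using aw[OF that] awalk_to_root by simp
    then show False using ww(2)[of "fst p"] that by (auto simp: I_def)
  qed
  have \<Phi>0: "\<Phi> b0 y0"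
    unfolding \<Phi>_def I_def w'_def b0_def y0_def
    using resolves_code[OF J ww(1) r] biorth_code[OF ww(1) r bo] by blast
  have "\<exists>b' y'. \<Phi> b' y' \<and> (\<forall>j\<in>I. b' j \<in> Kspan root (w' j)) \<and> reduced I w' b'"
  proof (rule reduce_family[where \<Phi> = \<Phi>, OF I _ _ \<Phi>0])
    fix b y i j k
    assume ij: "i \<in> I" "j \<in> I" "i \<noteq> j" and k: "k \<in> Kspan (w' i) (w' j)" and \<Phi>: "\<Phi> b y"
    show "\<Phi> (b(j := b j \<ominus> b i \<otimes> k)) (y(i := y i \<oplus> k \<otimes> y j))"
      using \<Phi> resolves_transvection[OF I ij k] biorth_transvection[OF ij k w'v] unfolding \<Phi>_def by blast
  next
    fix p assume p: "p \<in> I"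
    show "w' p \<noteq> root" using w'r[OF p] .
    show "b0 p \<in> Kspan root (w' p)"
      using n[of "fst p" "snd p" "w' p"] aw[OF p] p by (auto simp: I_def b0_def)
  qed
  then obtain b' y' where by': "\<Phi> b' y'" "\<And>j. j \<in> I \<Longrightarrow> b' j \<in> Kspan root (w' j)" "reduced I w' b'" by blast
  have r': "resolves I w' (P root) b' y'" and bo': "biorth I w' b' y'" using by' by (auto simp: \<Phi>_def)
  have cl: "b' l \<in> carrier A" "y' l \<in> carrier A" if "l \<in> I" for l
    using r' that Lspan_closed by (auto simp: resolves_def)
  \<comment> \<open>Since \<open>y' p \<otimes> b' p\<close> is the nonzero \<open>P (w' p)\<close>,
    no member vanishes and none of the end points \<open>w' p\<close> is lost.\<close>
  have "\<exists>m. HLM root (w' p) (b' p) m" if p: "p \<in> I" for p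
  proof -
    have "y' p \<otimes> b' p = P (w' p)" using bo' p by (simp add: biorth_def)
    then have "b' p \<noteq> \<zero>" using P_nonzero[OF w'v[OF p]] cl[OF p] by auto
    then show ?thesis using Kspan_LM[OF by'(2)[OF p]] by blast
  qed
  then obtain mm where mm: "\<And>p. p \<in> I \<Longrightarrow> HLM root (w' p) (b' p) (mm p)" by metis
  have pf: "\<not> prefix (mm i) (mm j)" if "i \<in> I" "j \<in> I" "i \<noteq> j" for i j
    using by'(3) that mm unfolding reduced_def by blast
  have inj: "inj_on mm I" using pf by (fastforce intro: inj_onI)
  have yL: "y' j \<in> Lspan (w' j) root" if "j \<in> I" for j using r' that by (simp add: resolves_def)
  obtain N where N: "N > 0" "\<And>j \<gamma> u. \<lbrakk>j \<in> I; \<gamma> \<in> code N root; awalk root \<gamma> u\<rbrakk> \<Longrightarrow> y' j \<otimes> sp root \<gamma> \<in> Kspan (w' j) u"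
    using Lspan_code_family[of I y' w' "\<lambda>_. root"] I root_in yL by blast
  \<comment> \<open>Expanded along the family, \<open>sp root \<gamma>\<close> has coefficients
    without ghost edges by the choice of \<open>N\<close>. Its leading path, which is
    \<open>\<gamma>\<close> itself, therefore begins with some \<open>mm j\<close>.\<close>
  have complete: "\<exists>m\<in>mm ` I. prefix m \<gamma>" if \<gamma>: "\<gamma> \<in> code N root" for \<gamma>
  proof -
    obtain u where u: "awalk root \<gamma> u" using code_awalk[OF \<gamma> root_in] ..
    have ur: "u \<noteq> root" using code_root_end[OF \<gamma> N(1) u] .
    have "sp root \<gamma> = (\<Oplus>j\<in>I. b' j \<otimes> y' j) \<otimes> sp root \<gamma>"
      using r' P_sp[OF u] by (simp add: resolves_def)
    also have "\<dots> = (\<Oplus>j\<in>I. b' j \<otimes> y' j \<otimes> sp root \<gamma>)"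
      using I cl u by (intro finsum_ldistr') auto
    also have "\<dots> = (\<Oplus>j\<in>I. b' j \<otimes> (y' j \<otimes> sp root \<gamma>))"
      using cl u by (intro finsum_cong') (auto simp: m_assoc)
    finally have eq: "sp root \<gamma> = (\<Oplus>j\<in>I. b' j \<otimes> (y' j \<otimes> sp root \<gamma>))" .
    have "\<exists>i\<in>I. y' i \<otimes> sp root \<gamma> \<noteq> \<zero>"
    proof (rule ccontr)
      assume "\<not> (\<exists>i\<in>I. y' i \<otimes> sp root \<gamma> \<noteq> \<zero>)"
      then have "(\<Oplus>j\<in>I. b' j \<otimes> (y' j \<otimes> sp root \<gamma>)) = (\<Oplus>j\<in>I. \<zero>)"
        using cl by (intro finsum_cong') auto
      then show False using eq HLM_nonzero[OF ur HLM_sp[OF u]] by simp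
    qed
    then obtain i where i: "i \<in> I" "y' i \<otimes> sp root \<gamma> \<noteq> \<zero>" by blast
    have "\<exists>j\<in>I. \<exists>\<delta>. HLM root u (\<Oplus>j\<in>I. b' j \<otimes> (y' j \<otimes> sp root \<gamma>)) (mm j @ \<delta>)"
      by (rule LM_comb[where k = "\<lambda>j. y' j \<otimes> sp root \<gamma>" and ww = w' and i = i])
        (use I mm pf i N(2)[OF _ \<gamma> u] in auto)
    then obtain j \<delta> where "j \<in> I" "HLM root u (sp root \<gamma>) (mm j @ \<delta>)" using eq by auto
    then have "j \<in> I" "\<gamma> = mm j @ \<delta>" using HLM_unique[OF ur HLM_sp[OF u]] by auto
    then show ?thesis by (intro bexI[of _ "mm j"]) (auto simp: prefix_def)
  qed
  have "R {#root#} (\<Sum>m\<in>mm ` I. {#awlast root m#})"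
  proof (rule complete_code_class[of R root "mm ` I" N])
    show "\<exists>w. awalk root m w" if "m \<in> mm ` I" for m using that HLM_awalk mm by blast
    show "m = m'" if "m \<in> mm ` I" "m' \<in> mm ` I" "prefix m m'" for m m' using that pf by blast
  qed (use I root_in complete assms(1,3,4,5) in auto)
  also have "(\<Sum>m\<in>mm ` I. {#awlast root m#}) = (\<Sum>p\<in>I. {#w' p#})"
    using inj awlast_eq[OF HLM_awalk[OF mm]] by (simp add: sum.reindex)
  also have "\<dots> = (\<Sum>j\<in>J. \<Sum>\<gamma>\<in>code n (ww j). {#awlast (ww j) \<gamma>#})"
    unfolding I_def w'_def using J by (subst sum.Sigma) (auto simp: finite_code split_def)
  finally have 1: "R {#root#} (\<Sum>j\<in>J. \<Sum>\<gamma>\<in>code n (ww j). {#awlast (ww j) \<gamma>#})" .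
  \<comment> \<open>The end points \<open>w' p\<close>, so far the ends of the leading paths from
    the root, are counted a second time as ends of codes starting at the
    \<open>ww j\<close>.\<close>
  have step: "R {#ww j#} (\<Sum>\<gamma>\<in>code n (ww j). {#awlast (ww j) \<gamma>#})" if j: "j \<in> J" for j
  proof (rule complete_code_class[of R "ww j" "code n (ww j)" n])
    show "m = m'" if "m \<in> code n (ww j)" "m' \<in> code n (ww j)" "prefix m m'" for m m'
      using that code_prefix_free unfolding prefix_def by fastforce
    show "\<exists>w. awalk (ww j) m w" if "m \<in> code n (ww j)" for m using that code_awalk ww(1) j by blast
  qed (use assms(1,3,4,5) ww(1) j in \<open>auto simp: finite_code\<close>)
  have "R (\<Sum>j\<in>J. {#ww j#}) (\<Sum>j\<in>J. \<Sum>\<gamma>\<in>code n (ww j). {#awlast (ww j) \<gamma>#})"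
    using J step
  proof (induction J rule: finite_induct)
    case empty then show ?case using refl[of "{#}"] by simp
  next
    case (insert i J)
    have "R ({#ww i#} + (\<Sum>j\<in>J. {#ww j#}))
        ((\<Sum>\<gamma>\<in>code n (ww i). {#awlast (ww i) \<gamma>#}) + (\<Sum>j\<in>J. \<Sum>\<gamma>\<in>code n (ww j). {#awlast (ww j) \<gamma>#}))"
      by (rule add) (use insert in auto)
    then show ?case unfolding sum.insert[OF insert.hyps(1,2)] .
  qed
  then show ?thesis using 1 sym trans by blast
qed

end

section \<open>The algebra of finite matrices\<close>

text \<open>With the matrices as an algebra over \<open>K\<close>, the preceding sections apply to
  idempotent matrices directly, edges being represented by matrix units with one entry.\<close>

definition mat_alg :: "('k, 'a, 'n) module_scheme \<Rightarrow> ('k, nat \<Rightarrow> nat \<Rightarrow> 'a) module" where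
  "mat_alg A =
     \<lparr>carrier = mat_inf A, mult = mat_times A, one = undefined, zero = mat_zero A,
      add = (\<lambda>a b i j. a i j \<oplus>\<^bsub>A\<^esub> b i j), smult = (\<lambda>c a i j. c \<odot>\<^bsub>A\<^esub> a i j)\<rparr>"

lemma mat_alg_simps:
  "carrier (mat_alg A) = mat_inf A"
  "x \<otimes>\<^bsub>mat_alg A\<^esub> y = mat_times A x y"
  "\<zero>\<^bsub>mat_alg A\<^esub> = mat_zero A"
  "(x \<oplus>\<^bsub>mat_alg A\<^esub> y) i j = x i j \<oplus>\<^bsub>A\<^esub> y i j"
  "(c \<odot>\<^bsub>mat_alg A\<^esub> x) i j = c \<odot>\<^bsub>A\<^esub> x i j"
  by (simp_all add: mat_alg_def)

definition munit :: "('a, 'm) ring_scheme \<Rightarrow> nat \<Rightarrow> nat \<Rightarrow> 'a \<Rightarrow> nat \<Rightarrow> nat \<Rightarrow> 'a" where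
  "munit R i j a = (\<lambda>k l. if k = i \<and> l = j then a else \<zero>\<^bsub>R\<^esub>)"

context nu_ring
begin

lemma mat_inf_carrier: "a \<in> mat_inf R \<Longrightarrow> a i j \<in> carrier R"
  by (auto simp: mat_inf_def matn_def)

lemma munit_matn: "\<lbrakk>a \<in> carrier R; i < n; j < n\<rbrakk> \<Longrightarrow> munit R i j a \<in> matn R n"
  by (auto simp: munit_def matn_def)

lemma munit_closed: "a \<in> carrier R \<Longrightarrow> munit R i j a \<in> mat_inf R"
  by (rule matn_imp_mat_inf[OF munit_matn[of a i "Suc (i + j)" j]]) auto

lemma munit_zero: "munit R i j \<zero> = mat_zero R"
  by (auto simp: munit_def mat_zero_def fun_eq_iff)

lemma munit_times_left:
  assumes "a \<in> carrier R" "X \<in> mat_inf R"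
  shows "mat_times R (munit R i j a) X k l = (if k = i then a \<otimes> X j l else \<zero>)"
proof -
  have "mat_times R (munit R i j a) X k l = (\<Oplus>m\<in>{j}. munit R i j a k m \<otimes> X m l)"
    by (rule mat_times_eq) (use assms in \<open>auto simp: munit_def mat_inf_carrier\<close>)
  then show ?thesis using assms by (simp add: munit_def mat_inf_carrier)
qed

lemma munit_times_right:
  assumes "a \<in> carrier R" "X \<in> mat_inf R"
  shows "mat_times R X (munit R i j a) k l = (if l = j then X k i \<otimes> a else \<zero>)"
proof -
  have "mat_times R X (munit R i j a) k l = (\<Oplus>m\<in>{i}. X k m \<otimes> munit R i j a m l)"
    by (rule mat_times_eq) (use assms in \<open>auto simp: munit_def mat_inf_carrier\<close>)
  then show ?thesis using assms by (simp add: munit_def mat_inf_carrier)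
qed

lemma munit_times:
  assumes "a \<in> carrier R" "b \<in> carrier R"
  shows "mat_times R (munit R i j a) (munit R k l b) = (if j = k then munit R i l (a \<otimes> b) else mat_zero R)"
  using assms by (auto simp: fun_eq_iff munit_times_left munit_closed) (auto simp: munit_def mat_zero_def)

lemma mat_single_munit: "mat_single R a = munit R 0 0 a"
  by (simp add: mat_single_def munit_def)

end

context nu_algebra
begin

lemma mat_add_closed: "\<lbrakk>a \<in> mat_inf A; b \<in> mat_inf A\<rbrakk> \<Longrightarrow> (\<lambda>i j. a i j \<oplus> b i j) \<in> mat_inf A"
proof -
  assume "a \<in> mat_inf A" "b \<in> mat_inf A"
  then obtain n where "a \<in> matn A n" "b \<in> matn A n" using mat_inf_bound2 by blast
  then have "(\<lambda>i j. a i j \<oplus> b i j) \<in> matn A n" by (auto simp: matn_def)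
  then show ?thesis by (rule matn_imp_mat_inf)
qed

lemma mat_smult_closed: "\<lbrakk>c \<in> carrier K; a \<in> mat_inf A\<rbrakk> \<Longrightarrow> (\<lambda>i j. c \<odot> a i j) \<in> mat_inf A"
  by (auto simp: mat_inf_def matn_def smult_r_null) (metis smult_r_null)

lemma mat_neg_closed: "a \<in> mat_inf A \<Longrightarrow> (\<lambda>i j. \<ominus> a i j) \<in> mat_inf A"
  by (auto simp: mat_inf_def matn_def minus_zero')

lemma mat_times_l_distr:
  assumes "a \<in> mat_inf A" "b \<in> mat_inf A" "c \<in> mat_inf A"
  shows "mat_times A (\<lambda>i j. a i j \<oplus> b i j) c = (\<lambda>i j. mat_times A a c i j \<oplus> mat_times A b c i j)"
proof (intro ext)
  fix i j
  obtain n where n: "a \<in> matn A n" "b \<in> matn A n" "c \<in> matn A n" using mat_inf_bound3[OF assms] by blast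
  then have "(\<lambda>i j. a i j \<oplus> b i j) \<in> matn A n" by (auto simp: matn_def)
  then have "mat_times A (\<lambda>i j. a i j \<oplus> b i j) c i j = (\<Oplus>k\<in>{..<n}. a i k \<otimes> c k j \<oplus> b i k \<otimes> c k j)"
    using n by (simp add: mat_times_matn l_distr matn_carrier)
  also have "\<dots> = mat_times A a c i j \<oplus> mat_times A b c i j"
    using n by (simp add: mat_times_matn matn_carrier finsum_addf Pi_def)
  finally show "mat_times A (\<lambda>i j. a i j \<oplus> b i j) c i j = mat_times A a c i j \<oplus> mat_times A b c i j" .
qed

lemma mat_times_r_distr:
  assumes "a \<in> mat_inf A" "b \<in> mat_inf A" "c \<in> mat_inf A"
  shows "mat_times A c (\<lambda>i j. a i j \<oplus> b i j) = (\<lambda>i j. mat_times A c a i j \<oplus> mat_times A c b i j)"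
proof (intro ext)
  fix i j
  obtain n where n: "a \<in> matn A n" "b \<in> matn A n" "c \<in> matn A n" using mat_inf_bound3[OF assms] by blast
  then have "(\<lambda>i j. a i j \<oplus> b i j) \<in> matn A n" by (auto simp: matn_def)
  then have "mat_times A c (\<lambda>i j. a i j \<oplus> b i j) i j = (\<Oplus>k\<in>{..<n}. c i k \<otimes> a k j \<oplus> c i k \<otimes> b k j)"
    using n by (simp add: mat_times_matn r_distr matn_carrier)
  also have "\<dots> = mat_times A c a i j \<oplus> mat_times A c b i j"
    using n by (simp add: mat_times_matn matn_carrier finsum_addf Pi_def)
  finally show "mat_times A c (\<lambda>i j. a i j \<oplus> b i j) i j = mat_times A c a i j \<oplus> mat_times A c b i j" .
qed

lemma mat_times_smult_left:
  assumes "c \<in> carrier K" "a \<in> mat_inf A" "b \<in> mat_inf A"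
  shows "mat_times A (\<lambda>i j. c \<odot> a i j) b = (\<lambda>i j. c \<odot> mat_times A a b i j)"
proof (intro ext)
  fix i j
  obtain n where n: "a \<in> matn A n" "b \<in> matn A n" using mat_inf_bound2[OF assms(2,3)] by blast
  then have "(\<lambda>i j. c \<odot> a i j) \<in> matn A n" using assms(1) by (auto simp: matn_def smult_r_null)
  then have "mat_times A (\<lambda>i j. c \<odot> a i j) b i j = (\<Oplus>k\<in>{..<n}. c \<odot> (a i k \<otimes> b k j))"
    using n assms(1) by (simp add: mat_times_matn smult_mult_left matn_carrier)
  also have "\<dots> = c \<odot> mat_times A a b i j"
    using n assms(1) by (simp add: mat_times_matn matn_carrier finsum_smult_ldistr Pi_def)
  finally show "mat_times A (\<lambda>i j. c \<odot> a i j) b i j = c \<odot> mat_times A a b i j" .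
qed

lemma mat_times_smult_right:
  assumes "c \<in> carrier K" "a \<in> mat_inf A" "b \<in> mat_inf A"
  shows "mat_times A a (\<lambda>i j. c \<odot> b i j) = (\<lambda>i j. c \<odot> mat_times A a b i j)"
proof (intro ext)
  fix i j
  obtain n where n: "a \<in> matn A n" "b \<in> matn A n" using mat_inf_bound2[OF assms(2,3)] by blast
  then have "(\<lambda>i j. c \<odot> b i j) \<in> matn A n" using assms(1) by (auto simp: matn_def smult_r_null)
  then have "mat_times A a (\<lambda>i j. c \<odot> b i j) i j = (\<Oplus>k\<in>{..<n}. c \<odot> (a i k \<otimes> b k j))"
    using n assms(1) by (simp add: mat_times_matn smult_mult_right matn_carrier)
  also have "\<dots> = c \<odot> mat_times A a b i j"
    using n assms(1) by (simp add: mat_times_matn matn_carrier finsum_smult_ldistr Pi_def)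
  finally show "mat_times A a (\<lambda>i j. c \<odot> b i j) i j = c \<odot> mat_times A a b i j" .
qed

lemma nu_algebra_mat_alg: "nu_algebra K (mat_alg A)"
proof -
  have abg: "abelian_group (mat_alg A)"
  proof (rule abelian_groupI)
    fix x assume x: "x \<in> carrier (mat_alg A)"
    show "\<exists>y\<in>carrier (mat_alg A). y \<oplus>\<^bsub>mat_alg A\<^esub> x = \<zero>\<^bsub>mat_alg A\<^esub>"
      by (rule bexI[of _ "\<lambda>i j. \<ominus> x i j"])
        (use x in \<open>auto simp: mat_alg_def mat_neg_closed mat_zero_def l_neg mat_inf_carrier\<close>)
  next
    show "\<zero>\<^bsub>mat_alg A\<^esub> \<in> carrier (mat_alg A)"
      using matn_imp_mat_inf[OF mat_zero_matn[of 0]] by (simp add: mat_alg_def)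
  qed (auto simp: mat_alg_def mat_add_closed mat_zero_def mat_inf_carrier a_assoc intro!: ext a_comm)
  have mod: "Module.module K (mat_alg A)"
    by (rule Module.moduleI[OF R.is_cring abg])
      (auto simp: mat_alg_def mat_smult_closed mat_inf_carrier smult_l_distr smult_r_distr smult_assoc1)
  have "nu_ring_axioms (mat_alg A)"
    by standard (auto simp: mat_alg_def mat_times_inf_closed mat_times_assoc mat_times_l_distr mat_times_r_distr)
  moreover have "nu_algebra_axioms K (mat_alg A)"
    by standard (auto simp: mat_alg_def mat_times_smult_left mat_times_smult_right)
  ultimately show ?thesis using abg mod by (simp add: nu_algebra_def nu_ring_def)
qed

end

text \<open>By \<open>nu_algebra_mat_alg\<close> the second algebra comes with the first; the locale
  gives its facts the qualifier \<open>M\<close>.\<close>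

locale nu_matrix = nu_algebra K A + M: nu_algebra K "mat_alg A"
  for K :: "('k, 'm) ring_scheme" and A :: "('k, 'a, 'n) module_scheme" (structure)
begin

abbreviation "M \<equiv> mat_alg A"

lemma idem_mats_M: "idem_mats A = {e \<in> carrier M. e \<otimes>\<^bsub>M\<^esub> e = e}"
  by (simp add: idem_mats_def mat_alg_simps)

lemma finsum_M_entry:
  "\<lbrakk>finite I; \<And>x. x \<in> I \<Longrightarrow> f x \<in> carrier M\<rbrakk> \<Longrightarrow> (\<Oplus>\<^bsub>M\<^esub>x\<in>I. f x) i j = (\<Oplus>x\<in>I. f x i j)"
proof (induction I rule: finite_induct)
  case empty
  then show ?case by (simp add: M.finsum_empty mat_alg_simps mat_zero_def)
next
  case (insert x I)
  then have "(\<Oplus>\<^bsub>M\<^esub>x\<in>insert x I. f x) = f x \<oplus>\<^bsub>M\<^esub> (\<Oplus>\<^bsub>M\<^esub>x\<in>I. f x)" by (intro M.finsum_insert) auto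
  moreover have "(\<Oplus>x\<in>insert x I. f x i j) = f x i j \<oplus> (\<Oplus>x\<in>I. f x i j)"
    using insert by (intro finsum_insert) (auto simp: mat_alg_simps(1) mat_inf_carrier)
  ultimately show ?case using insert by (simp add: mat_alg_simps(4))
qed

text \<open>Addition in \<open>V_monoid\<close> is defined by block sums, so \<open>f\<close> has to
  be moved into a block disjoint from that of \<open>e\<close>, by an equivalence that leaves
  \<open>e\<close> in place.\<close>

lemma idem_class_orth_add:
  assumes e: "e \<in> idem_mats A" and f: "f \<in> idem_mats A" and ef: "e \<otimes>\<^bsub>M\<^esub> f = \<zero>\<^bsub>M\<^esub>" "f \<otimes>\<^bsub>M\<^esub> e = \<zero>\<^bsub>M\<^esub>"
  shows "e \<oplus>\<^bsub>M\<^esub> f \<in> idem_mats A"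
    "idem_class A (e \<oplus>\<^bsub>M\<^esub> f) = idem_class A e \<otimes>\<^bsub>V_monoid A\<^esub> idem_class A f"
proof -
  have ec: "e \<in> carrier M" "e \<otimes>\<^bsub>M\<^esub> e = e" and fc: "f \<in> carrier M" "f \<otimes>\<^bsub>M\<^esub> f = f"
    using e f by (auto simp: idem_mats_M)
  show add: "e \<oplus>\<^bsub>M\<^esub> f \<in> idem_mats A"
    using ec fc ef by (simp add: idem_mats_M M.l_distr M.r_distr)
  obtain n where n: "e \<in> matn A n" using ec mat_infE by (auto simp: mat_alg_simps)
  define f' where "f' = block_sum A n (mat_zero A) f"
  have z: "mat_zero A \<in> matn A n" "mat_zero A \<in> mat_inf A" using mat_zero_matn matn_imp_mat_inf by blast+
  have fi: "f \<in> mat_inf A" using fc by (simp add: mat_alg_simps)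
  have f'i: "f' \<in> idem_mats A" unfolding f'_def by (rule block_sum_idem[OF mat_zero_idem mat_zero_matn f])
  then have f'c: "f' \<in> carrier M" "f' \<otimes>\<^bsub>M\<^esub> f' = f'" by (auto simp: idem_mats_M)
  have zz: "mat_times A e (mat_zero A) = mat_zero A" "mat_times A (mat_zero A) e = mat_zero A"
    "mat_times A f (mat_zero A) = mat_zero A" "mat_times A (mat_zero A) f = mat_zero A"
    using M.l_null[OF ec(1)] M.r_null[OF ec(1)] M.l_null[OF fc(1)] M.r_null[OF fc(1)] by (simp_all add: mat_alg_simps)
  have e_eq: "e = block_sum A n e (mat_zero A)" using block_sum_zero_right[OF n] by simp
  have zb: "block_sum A n (mat_zero A) (mat_zero A) = mat_zero A"
    by (simp add: block_sum_def mat_zero_def fun_eq_iff)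
  have ef': "e \<otimes>\<^bsub>M\<^esub> f' = \<zero>\<^bsub>M\<^esub>" "f' \<otimes>\<^bsub>M\<^esub> e = \<zero>\<^bsub>M\<^esub>"
    using block_sum_times[OF n z(1) z(2) fi] block_sum_times[OF z(1) n fi z(2)] e_eq
    by (simp_all add: mat_alg_simps f'_def zz zb)
  have sum: "e \<oplus>\<^bsub>M\<^esub> f' = block_sum A n e f"
  proof (intro ext)
    fix i j
    show "(e \<oplus>\<^bsub>M\<^esub> f') i j = block_sum A n e f i j"
      using n matn_carrier[OF n] matn_zero[OF n] mat_inf_carrier[OF fi]
      by (auto simp: mat_alg_simps f'_def block_sum_def mat_zero_def not_less)
  qed
  have "(f', f) \<in> idem_rel A" unfolding f'_def by (rule block_sum_zero_left[OF f])
  then obtain x y where xy: "x \<in> carrier M" "y \<in> carrier M" "x \<otimes>\<^bsub>M\<^esub> y = f'" "y \<otimes>\<^bsub>M\<^esub> x = f"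
    by (auto simp: mat_alg_simps elim!: idem_relE)
  \<comment> \<open>\<open>x\<close> and \<open>y\<close> themselves need not be orthogonal to
    \<open>e\<close>. Cut down to f' x = x f and f y = y f' they are, and their products do not
    change.\<close>
  define u where "u = f' \<otimes>\<^bsub>M\<^esub> x"
  define v where "v = f \<otimes>\<^bsub>M\<^esub> y"
  have uv_c: "u \<in> carrier M" "v \<in> carrier M" using xy f'c fc by (simp_all add: u_def v_def)
  have u2: "u = x \<otimes>\<^bsub>M\<^esub> f" and v2: "v = y \<otimes>\<^bsub>M\<^esub> f'"
    using xy by (auto simp: u_def v_def M.m_assoc)
  have uv: "u \<otimes>\<^bsub>M\<^esub> v = f'"
  proof -
    have "u \<otimes>\<^bsub>M\<^esub> v = f' \<otimes>\<^bsub>M\<^esub> (x \<otimes>\<^bsub>M\<^esub> y) \<otimes>\<^bsub>M\<^esub> f'"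
      unfolding v2 unfolding u_def using xy(1,2) f'c(1) by (simp only: M.m_assoc M.m_closed)
    then show ?thesis using xy(3) f'c by simp
  qed
  have vu: "v \<otimes>\<^bsub>M\<^esub> u = f"
  proof -
    have "v \<otimes>\<^bsub>M\<^esub> u = f \<otimes>\<^bsub>M\<^esub> (y \<otimes>\<^bsub>M\<^esub> x) \<otimes>\<^bsub>M\<^esub> f"
      unfolding u2 unfolding v_def using xy(1,2) fc(1) by (simp only: M.m_assoc M.m_closed)
    then show ?thesis using xy(4) fc by simp
  qed
  have "e \<otimes>\<^bsub>M\<^esub> v = (e \<otimes>\<^bsub>M\<^esub> f) \<otimes>\<^bsub>M\<^esub> y" unfolding v_def using xy(1,2) ec(1) fc(1) by (simp only: M.m_assoc)
  moreover have "u \<otimes>\<^bsub>M\<^esub> e = x \<otimes>\<^bsub>M\<^esub> (f \<otimes>\<^bsub>M\<^esub> e)" unfolding u2 using xy(1,2) ec(1) fc(1) by (simp only: M.m_assoc)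
  moreover have "e \<otimes>\<^bsub>M\<^esub> u = (e \<otimes>\<^bsub>M\<^esub> f') \<otimes>\<^bsub>M\<^esub> x" unfolding u_def using xy(1,2) ec(1) f'c(1) by (simp only: M.m_assoc)
  moreover have "v \<otimes>\<^bsub>M\<^esub> e = y \<otimes>\<^bsub>M\<^esub> (f' \<otimes>\<^bsub>M\<^esub> e)" unfolding v2 using xy(1,2) ec(1) f'c(1) by (simp only: M.m_assoc)
  ultimately have zero: "e \<otimes>\<^bsub>M\<^esub> v = \<zero>\<^bsub>M\<^esub>" "u \<otimes>\<^bsub>M\<^esub> e = \<zero>\<^bsub>M\<^esub>" "e \<otimes>\<^bsub>M\<^esub> u = \<zero>\<^bsub>M\<^esub>" "v \<otimes>\<^bsub>M\<^esub> e = \<zero>\<^bsub>M\<^esub>"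
    using ef ef' xy(1,2) by simp_all
  have "(e \<oplus>\<^bsub>M\<^esub> f', e \<oplus>\<^bsub>M\<^esub> f) \<in> idem_rel A"
  proof (rule idem_relI[where x = "e \<oplus>\<^bsub>M\<^esub> u" and y = "e \<oplus>\<^bsub>M\<^esub> v"])
    show "e \<oplus>\<^bsub>M\<^esub> f' \<in> idem_mats A" unfolding sum by (rule block_sum_idem[OF e n f])
    show "e \<oplus>\<^bsub>M\<^esub> u \<in> mat_inf A" "e \<oplus>\<^bsub>M\<^esub> v \<in> mat_inf A"
      using M.a_closed[OF ec(1) uv_c(1)] M.a_closed[OF ec(1) uv_c(2)] by (simp_all add: mat_alg_simps)
    have "(e \<oplus>\<^bsub>M\<^esub> u) \<otimes>\<^bsub>M\<^esub> (e \<oplus>\<^bsub>M\<^esub> v) = e \<oplus>\<^bsub>M\<^esub> f'" "(e \<oplus>\<^bsub>M\<^esub> v) \<otimes>\<^bsub>M\<^esub> (e \<oplus>\<^bsub>M\<^esub> u) = e \<oplus>\<^bsub>M\<^esub> f"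
      using ec fc(1) f'c(1) uv_c zero uv vu by (simp_all add: M.l_distr M.r_distr)
    then show "mat_times A (e \<oplus>\<^bsub>M\<^esub> u) (e \<oplus>\<^bsub>M\<^esub> v) = e \<oplus>\<^bsub>M\<^esub> f'" "mat_times A (e \<oplus>\<^bsub>M\<^esub> v) (e \<oplus>\<^bsub>M\<^esub> u) = e \<oplus>\<^bsub>M\<^esub> f"
      by (simp_all add: mat_alg_simps)
  qed (rule add)
  then show "idem_class A (e \<oplus>\<^bsub>M\<^esub> f) = idem_class A e \<otimes>\<^bsub>V_monoid A\<^esub> idem_class A f"
    using V_mult[OF e f n] idem_class_eqI sum by metis
qed

text \<open>Each product of \<open>b j\<close> and \<open>y j\<close> is equivalent to the reversed
  product \<open>p j\<close>, and biorthogonality makes these idempotents mutually orthogonal, so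
  that \<open>idem_class_orth_add\<close> applies step by step.\<close>

lemma idem_class_resolution:
  assumes J: "finite J"
    and c: "\<And>j. j \<in> J \<Longrightarrow> b j \<in> carrier M \<and> y j \<in> carrier M \<and> b j \<otimes>\<^bsub>M\<^esub> p j = b j \<and> p j \<in> carrier M"
    and yb: "\<And>i j. \<lbrakk>i \<in> J; j \<in> J\<rbrakk> \<Longrightarrow> y i \<otimes>\<^bsub>M\<^esub> b j = (if i = j then p i else \<zero>\<^bsub>M\<^esub>)"
    and pp: "\<And>j. j \<in> J \<Longrightarrow> p j \<otimes>\<^bsub>M\<^esub> p j = p j"
  shows "(\<Oplus>\<^bsub>M\<^esub>j\<in>J. b j \<otimes>\<^bsub>M\<^esub> y j) \<in> idem_mats A \<and>
    idem_class A (\<Oplus>\<^bsub>M\<^esub>j\<in>J. b j \<otimes>\<^bsub>M\<^esub> y j) = finprod (V_monoid A) (\<lambda>j. idem_class A (p j)) J"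
proof -
  interpret V: comm_monoid "V_monoid A" by (rule V_comm_monoid)
  show ?thesis using J c yb pp
  proof (induction J rule: finite_induct)
    case empty
    show ?case using mat_zero_idem by (simp add: M.finsum_empty mat_alg_simps) (simp add: V_monoid_def)
  next
    case (insert i J)
    let ?s = "\<Oplus>\<^bsub>M\<^esub>j\<in>J. b j \<otimes>\<^bsub>M\<^esub> y j"
    have cl: "b j \<in> carrier M" "y j \<in> carrier M" "b j \<otimes>\<^bsub>M\<^esub> p j = b j" "p j \<in> carrier M"
      if "j \<in> insert i J" for j using insert.prems(1)[OF that] by auto
    have IH: "?s \<in> idem_mats A" "idem_class A ?s = finprod (V_monoid A) (\<lambda>j. idem_class A (p j)) J"
      using insert.IH insert.prems by auto
    have i: "b i \<in> carrier M" "y i \<in> carrier M" "b i \<otimes>\<^bsub>M\<^esub> p i = b i" "p i \<in> carrier M" using cl by auto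
    have yi: "y i \<otimes>\<^bsub>M\<^esub> b i = p i" using insert.prems(2)[of i i] by simp
    have by_idem: "(b i \<otimes>\<^bsub>M\<^esub> y i) \<otimes>\<^bsub>M\<^esub> (b i \<otimes>\<^bsub>M\<^esub> y i) = b i \<otimes>\<^bsub>M\<^esub> y i"
    proof -
      have "(b i \<otimes>\<^bsub>M\<^esub> y i) \<otimes>\<^bsub>M\<^esub> (b i \<otimes>\<^bsub>M\<^esub> y i) = b i \<otimes>\<^bsub>M\<^esub> (y i \<otimes>\<^bsub>M\<^esub> b i) \<otimes>\<^bsub>M\<^esub> y i"
        using i(1,2) by (simp only: M.m_assoc M.m_closed)
      then show ?thesis using i yi by simp
    qed
    have byi: "b i \<otimes>\<^bsub>M\<^esub> y i \<in> idem_mats A" and pi: "p i \<in> idem_mats A"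
      using by_idem i insert.prems(3) by (auto simp: idem_mats_M)
    have "idem_class A (b i \<otimes>\<^bsub>M\<^esub> y i) = idem_class A (p i)"
      by (rule idem_class_eqI, rule idem_relI[OF byi pi, of "b i" "y i"])
        (use i yi in \<open>auto simp: mat_alg_simps\<close>)
    moreover have "idem_class A (b i \<otimes>\<^bsub>M\<^esub> y i \<oplus>\<^bsub>M\<^esub> ?s) = idem_class A (b i \<otimes>\<^bsub>M\<^esub> y i) \<otimes>\<^bsub>V_monoid A\<^esub> idem_class A ?s"
      and "b i \<otimes>\<^bsub>M\<^esub> y i \<oplus>\<^bsub>M\<^esub> ?s \<in> idem_mats A"
    proof -
      have t: "y i \<otimes>\<^bsub>M\<^esub> (b j \<otimes>\<^bsub>M\<^esub> y j) = \<zero>\<^bsub>M\<^esub>" "(b j \<otimes>\<^bsub>M\<^esub> y j) \<otimes>\<^bsub>M\<^esub> b i = \<zero>\<^bsub>M\<^esub>" if "j \<in> J" for j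
      proof -
        have "i \<noteq> j" using that insert.hyps by auto
        then have "y i \<otimes>\<^bsub>M\<^esub> b j = \<zero>\<^bsub>M\<^esub>" "y j \<otimes>\<^bsub>M\<^esub> b i = \<zero>\<^bsub>M\<^esub>" using insert.prems(2) that by auto
        then show "y i \<otimes>\<^bsub>M\<^esub> (b j \<otimes>\<^bsub>M\<^esub> y j) = \<zero>\<^bsub>M\<^esub>" "(b j \<otimes>\<^bsub>M\<^esub> y j) \<otimes>\<^bsub>M\<^esub> b i = \<zero>\<^bsub>M\<^esub>"
          using cl[of j] i that by (simp_all add: M.m_assoc[symmetric]) (simp add: M.m_assoc)
      qed
      have "y i \<otimes>\<^bsub>M\<^esub> ?s = (\<Oplus>\<^bsub>M\<^esub>j\<in>J. y i \<otimes>\<^bsub>M\<^esub> (b j \<otimes>\<^bsub>M\<^esub> y j))"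
        using insert.hyps cl i by (intro M.finsum_rdistr') auto
      also have "\<dots> = (\<Oplus>\<^bsub>M\<^esub>j\<in>J. \<zero>\<^bsub>M\<^esub>)" using t by (intro M.finsum_cong') auto
      finally have 1: "y i \<otimes>\<^bsub>M\<^esub> ?s = \<zero>\<^bsub>M\<^esub>" by simp
      have "?s \<otimes>\<^bsub>M\<^esub> b i = (\<Oplus>\<^bsub>M\<^esub>j\<in>J. (b j \<otimes>\<^bsub>M\<^esub> y j) \<otimes>\<^bsub>M\<^esub> b i)"
        using insert.hyps cl i by (intro M.finsum_ldistr') auto
      also have "\<dots> = (\<Oplus>\<^bsub>M\<^esub>j\<in>J. \<zero>\<^bsub>M\<^esub>)" using t by (intro M.finsum_cong') auto
      finally have 2: "?s \<otimes>\<^bsub>M\<^esub> b i = \<zero>\<^bsub>M\<^esub>" by simp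
      have sc: "?s \<in> carrier M" using IH by (auto simp: idem_mats_M)
      have "(b i \<otimes>\<^bsub>M\<^esub> y i) \<otimes>\<^bsub>M\<^esub> ?s = \<zero>\<^bsub>M\<^esub>" "?s \<otimes>\<^bsub>M\<^esub> (b i \<otimes>\<^bsub>M\<^esub> y i) = \<zero>\<^bsub>M\<^esub>"
        using i sc 1 2 by (simp add: M.m_assoc, simp add: M.m_assoc[symmetric])
      then show "idem_class A (b i \<otimes>\<^bsub>M\<^esub> y i \<oplus>\<^bsub>M\<^esub> ?s) = idem_class A (b i \<otimes>\<^bsub>M\<^esub> y i) \<otimes>\<^bsub>V_monoid A\<^esub> idem_class A ?s"
        and "b i \<otimes>\<^bsub>M\<^esub> y i \<oplus>\<^bsub>M\<^esub> ?s \<in> idem_mats A"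
        using idem_class_orth_add[OF byi IH(1)] by simp_all
    qed
    moreover have "(\<Oplus>\<^bsub>M\<^esub>j\<in>insert i J. b j \<otimes>\<^bsub>M\<^esub> y j) = b i \<otimes>\<^bsub>M\<^esub> y i \<oplus>\<^bsub>M\<^esub> ?s"
      using insert.hyps cl by (intro M.finsum_insert) auto
    moreover have "finprod (V_monoid A) (\<lambda>j. idem_class A (p j)) (insert i J) =
        idem_class A (p i) \<otimes>\<^bsub>V_monoid A\<^esub> finprod (V_monoid A) (\<lambda>j. idem_class A (p j)) J"
      using insert.hyps cl insert.prems(3) by (intro V.finprod_insert) (auto intro!: idem_class_V simp: idem_mats_M)
    ultimately show ?case using IH by simp
  qed
qed

end

section \<open>A branching system\<close>

context lpa_setup
begin

text \<open>
  In the representation space \<open>'v \<times> int \<times> nat \<times> 'e list\<close> the first component is the fiber, the second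
  a degree that separates paths of different length, the third makes the fiber over a regular vertex
  the disjoint union of the images of the edges (division with remainder by the out-degree), and the
  list leaves \<open>(v, k, n, [])\<close> outside all these images if \<open>v\<close> is an infinite emitter.
\<close>

definition "idx v = (SOME h. bij_betw h (out_arcs E v) {0..<card (out_arcs E v)})"

lemma idx: "finite (out_arcs E v) \<Longrightarrow> bij_betw (idx v) (out_arcs E v) {0..<card (out_arcs E v)}"
  unfolding idx_def using someI_ex[OF ex_bij_betw_finite_nat] by blast

fun branch :: "'e \<Rightarrow> 'v \<times> int \<times> nat \<times> 'e list \<Rightarrow> 'v \<times> int \<times> nat \<times> 'e list" where
  "branch e (v, k, n, l) = (tail E e, k + 1,
     if finite (out_arcs E (tail E e))
     then (n * card (out_arcs E (tail E e)) + idx (tail E e) e, l) else (n, e # l))"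

definition fiber :: "'v \<Rightarrow> ('v \<times> int \<times> nat \<times> 'e list) set" where "fiber v = {x. fst x = v}"

lemma fst_branch [simp]: "fst (branch e y) = tail E e"
  by (cases y) auto

lemma level_branch: "fst (snd (branch e y)) = fst (snd y) + 1"
  by (cases y) auto

text \<open>Quotient and remainder, or the head of the list, return the third component and the
  edge. The fiber condition restores the first component, which \<open>branch\<close>
  overwrites.\<close>

lemma branch_eqD:
  assumes "e \<in> arcs E" "f \<in> arcs E" "branch e y = branch f z" "y \<in> fiber (head E e)" "z \<in> fiber (head E f)"
  shows "e = f \<and> y = z"
proof -
  obtain v k n l where y: "y = (v, k, n, l)" by (cases y)
  obtain v' k' n' l' where z: "z = (v', k', n', l')" by (cases z)
  have t: "tail E e = tail E f" using assms y z by simp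
  show ?thesis
  proof (cases "finite (out_arcs E (tail E e))")
    case True
    let ?d = "card (out_arcs E (tail E e))"
    have b: "bij_betw (idx (tail E e)) (out_arcs E (tail E e)) {0..<?d}" using idx[OF True] .
    have oe: "e \<in> out_arcs E (tail E e)" "f \<in> out_arcs E (tail E e)" using assms t by auto
    then have lt: "idx (tail E e) e < ?d" "idx (tail E e) f < ?d" using bij_betwE[OF b] by auto
    have eq: "n * ?d + idx (tail E e) e = n' * ?d + idx (tail E e) f" "l = l'" "k = k'"
      using assms(3) y z t True by auto
    have "(n * ?d + idx (tail E e) e) mod ?d = (n' * ?d + idx (tail E e) f) mod ?d"
      "(n * ?d + idx (tail E e) e) div ?d = (n' * ?d + idx (tail E e) f) div ?d" using eq(1) by simp_all
    then have "idx (tail E e) e = idx (tail E e) f" "n = n'" using lt by simp_all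
    then have "e = f" "n = n'" using b oe by (auto simp: bij_betw_def inj_on_def)
    then show ?thesis using y z eq assms by (auto simp: fiber_def)
  next
    case False
    then show ?thesis using assms y z t by (auto simp: fiber_def)
  qed
qed

text \<open>The edge is the one whose number is the remainder of the third component by the
  out-degree. The representation owes the relation \<open>vert_sum\<close> to this.\<close>

lemma branch_cover:
  assumes "regular_vertex E v" "fst x = v"
  shows "\<exists>e\<in>out_arcs E v. x \<in> branch e ` fiber (head E e)"
proof -
  obtain k n l where x: "x = (v, k, n, l)" using assms by (cases x) auto
  let ?d = "card (out_arcs E v)"
  have fin: "finite (out_arcs E v)" "?d > 0" using assms by (auto simp: regular_vertex_def card_gt_0_iff)
  have b: "bij_betw (idx v) (out_arcs E v) {0..<?d}" using idx[OF fin(1)] .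
  then obtain e where e: "e \<in> out_arcs E v" "idx v e = n mod ?d"
    using fin(2) by (metis atLeastLessThan_iff bij_betw_imp_surj_on image_iff mod_less_divisor zero_le)
  have "branch e (head E e, k - 1, n div ?d, l) = x"
    using e fin x by (auto simp: mult.commute)
  moreover have "(head E e, k - 1, n div ?d, l) \<in> fiber (head E e)" by (simp add: fiber_def)
  ultimately show ?thesis using e by (metis imageI)
qed

lemma base_not_branch:
  "\<lbrakk>infinite (out_arcs E v)\<rbrakk> \<Longrightarrow> (v, k, n, []) \<notin> branch e ` fiber w"
  by (auto simp: image_iff)

declare branch.simps [simp del]

lemma branch_inj: "e \<in> arcs E \<Longrightarrow> inj_on (branch e) (fiber (head E e))"
  using branch_eqD by (blast intro: inj_onI)

lemma branch_disjoint:
  assumes "e \<in> arcs E" "f \<in> arcs E" "e \<noteq> f" "x \<in> branch e ` fiber (head E e)"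
  shows "x \<notin> branch f ` fiber (head E f)"
proof
  assume "x \<in> branch f ` fiber (head E f)"
  then obtain y z where "x = branch e y" "x = branch f z" "y \<in> fiber (head E e)" "z \<in> fiber (head E f)"
    using assms(4) by blast
  then show False using branch_eqD[of e f y z] assms by simp
qed

lemma inv_branch [simp]:
  "\<lbrakk>e \<in> arcs E; y \<in> fiber (head E e)\<rbrakk> \<Longrightarrow> inv_into (fiber (head E e)) (branch e) (branch e y) = y"
  using branch_inj by (rule inv_into_f_f)

text \<open>The action is defined on terms and on arbitrary functions: passing to classes then takes
  only \<open>act_cong\<close>, whereas \<open>lpa_universal\<close> would ask for an algebra of
  endomorphisms as target.\<close>

primrec act :: "('v, 'e, 'k) lpa_term \<Rightarrow> ('v \<times> int \<times> nat \<times> 'e list \<Rightarrow> 'k) \<Rightarrow> 'v \<times> int \<times> nat \<times> 'e list \<Rightarrow> 'k" where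
  "act (TVert v) \<phi> = (\<lambda>x. if fst x = v then \<phi> x else \<zero>\<^bsub>K\<^esub>)"
| "act (TEdge e) \<phi> = (\<lambda>x. if x \<in> branch e ` fiber (head E e)
     then \<phi> (inv_into (fiber (head E e)) (branch e) x) else \<zero>\<^bsub>K\<^esub>)"
| "act (TGhost e) \<phi> = (\<lambda>x. if x \<in> fiber (head E e) then \<phi> (branch e x) else \<zero>\<^bsub>K\<^esub>)"
| "act TZero \<phi> = (\<lambda>x. \<zero>\<^bsub>K\<^esub>)"
| "act (TNeg s) \<phi> = (\<lambda>x. \<ominus>\<^bsub>K\<^esub> act s \<phi> x)"
| "act (TAdd s t) \<phi> = (\<lambda>x. act s \<phi> x \<oplus>\<^bsub>K\<^esub> act t \<phi> x)"
| "act (TMul s t) \<phi> = act s (act t \<phi>)"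
| "act (TScal c s) \<phi> = (\<lambda>x. c \<otimes>\<^bsub>K\<^esub> act s \<phi> x)"

lemma act_closed: "\<lbrakk>s \<in> lpa_terms K E; \<And>x. \<phi> x \<in> carrier K\<rbrakk> \<Longrightarrow> act s \<phi> x \<in> carrier K"
  by (induction arbitrary: \<phi> x rule: lpa_terms.induct) auto

lemma act_add:
  "\<lbrakk>s \<in> lpa_terms K E; \<And>x. \<phi> x \<in> carrier K; \<And>x. \<psi> x \<in> carrier K\<rbrakk> \<Longrightarrow>
    act s (\<lambda>x. \<phi> x \<oplus>\<^bsub>K\<^esub> \<psi> x) = (\<lambda>x. act s \<phi> x \<oplus>\<^bsub>K\<^esub> act s \<psi> x)"
proof (induction arbitrary: \<phi> \<psi> rule: lpa_terms.induct)
  case (5 s) then show ?case by (auto simp: fun_eq_iff act_closed K.minus_add)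
next
  case (6 s t) then show ?case by (auto simp: fun_eq_iff act_closed K.add.m_ac)
next
  case (7 s t) then show ?case by (simp add: act_closed)
next
  case (8 c s) then show ?case by (auto simp: fun_eq_iff act_closed K.r_distr)
qed auto

lemma act_scal:
  "\<lbrakk>s \<in> lpa_terms K E; \<And>x. \<phi> x \<in> carrier K; c \<in> carrier K\<rbrakk> \<Longrightarrow>
    act s (\<lambda>x. c \<otimes>\<^bsub>K\<^esub> \<phi> x) = (\<lambda>x. c \<otimes>\<^bsub>K\<^esub> act s \<phi> x)"
proof (induction arbitrary: \<phi> rule: lpa_terms.induct)
  case (5 s) then show ?case by (auto simp: fun_eq_iff act_closed K.r_minus)
next
  case (6 s t) then show ?case by (auto simp: fun_eq_iff act_closed K.r_distr)
next
  case (7 s t) then show ?case by (simp add: act_closed)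
next
  case (8 d s) then show ?case by (auto simp: fun_eq_iff act_closed K.m_lcomm)
qed auto

text \<open>The images of distinct edges are disjoint, so at each point at most one summand is
  nonzero.\<close>

lemma act_range_projections:
  assumes "distinct es" "set es \<subseteq> arcs E" "\<And>x. \<phi> x \<in> carrier K"
  shows "act (foldr (\<lambda>e. TAdd (TMul (TEdge e) (TGhost e))) es TZero) \<phi> x =
    (if \<exists>e\<in>set es. x \<in> branch e ` fiber (head E e) then \<phi> x else \<zero>\<^bsub>K\<^esub>)"
  using assms(1,2)
proof (induction es)
  case Nil then show ?case by simp
next
  case (Cons e es)
  have 1: "act (TMul (TEdge e) (TGhost e)) \<phi> x = (if x \<in> branch e ` fiber (head E e) then \<phi> x else \<zero>\<^bsub>K\<^esub>)"
    using Cons.prems by auto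
  have 2: "x \<notin> branch f ` fiber (head E f)" if "x \<in> branch e ` fiber (head E e)" "f \<in> set es" for f
    by (rule branch_disjoint[OF _ _ _ that(1)]) (use Cons.prems that in auto)
  have IH: "act (foldr (\<lambda>e. TAdd (TMul (TEdge e) (TGhost e))) es TZero) \<phi> x =
      (if \<exists>e\<in>set es. x \<in> branch e ` fiber (head E e) then \<phi> x else \<zero>\<^bsub>K\<^esub>)"
    using Cons by simp
  have "act (foldr (\<lambda>e. TAdd (TMul (TEdge e) (TGhost e))) (e # es) TZero) \<phi> x =
      act (TMul (TEdge e) (TGhost e)) \<phi> x \<oplus>\<^bsub>K\<^esub> act (foldr (\<lambda>e. TAdd (TMul (TEdge e) (TGhost e))) es TZero) \<phi> x"
    by simp
  then show ?case unfolding 1 IH using 2 assms(3)[of x] by (cases "x \<in> branch e ` fiber (head E e)") auto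
qed

text \<open>Injectivity of the branch maps gives \<open>ghost_edge\<close>, disjointness of their
  images \<open>ghost_edge_orth\<close>, and \<open>branch_cover\<close> the sum at a regular
  vertex.\<close>

lemma act_cong: "\<lbrakk>lpa_cong K E s t; \<And>x. \<phi> x \<in> carrier K\<rbrakk> \<Longrightarrow> act s \<phi> = act t \<phi>"
proof (induction arbitrary: \<phi> rule: lpa_cong.induct)
  case (mul s s' t t')
  then have "act t \<phi> x \<in> carrier K" for x using act_closed lpa_cong_terms by blast
  then show ?case using mul by simp
next
  case (add_assoc x y z) then show ?case by (simp add: act_closed K.a_assoc)
next
  case (add_comm x y) then show ?case by (simp add: act_closed K.a_comm fun_eq_iff)
next
  case (add_neg x) then show ?case by (simp add: act_closed K.l_neg)
next
  case (distrib_right x y z) then show ?case by (simp add: act_closed act_add)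
next
  case (scal_add c x y) then show ?case by (simp add: act_closed K.r_distr)
next
  case (add_scal c d x) then show ?case by (simp add: act_closed K.l_distr)
next
  case (scal_scal c d x) then show ?case by (simp add: act_closed K.m_assoc)
next
  case (scal_mul_right c x y) then show ?case by (simp add: act_closed act_scal)
next
  case (tail_edge e)
  have "fst x = tail E e" if "x \<in> branch e ` fiber (head E e)" for x using that by auto
  then show ?case by (auto simp: fun_eq_iff simp del: split_paired_All)
next
  case (edge_head e)
  have "fst y = head E e" if "y \<in> fiber (head E e)" for y using that by (simp add: fiber_def)
  then show ?case using edge_head by (auto simp: fun_eq_iff simp del: split_paired_All)
next
  case (ghost_edge e)
  then show ?case by (auto simp: fun_eq_iff simp del: split_paired_All) (auto simp: fiber_def)
next
  case (ghost_edge_orth e f)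
  have "branch f y \<notin> branch e ` fiber (head E e)" if "y \<in> fiber (head E f)" for y
    using branch_disjoint[OF ghost_edge_orth(2,1)] ghost_edge_orth(3) that by blast
  moreover have "branch e y \<notin> branch f ` fiber (head E f)" if "y \<in> fiber (head E e)" for y
    using branch_disjoint[OF ghost_edge_orth(1,2)] ghost_edge_orth(3) that by blast
  ultimately show ?case by (simp add: fun_eq_iff del: split_paired_All)
next
  case (vert_sum v es)
  then have "set es \<subseteq> arcs E" by (auto simp: out_arcs_def)
  moreover have "(\<exists>e\<in>set es. x \<in> branch e ` fiber (head E e)) \<longleftrightarrow> fst x = v" for x
    using branch_cover[OF vert_sum(1), of x] vert_sum(3) by (auto simp del: split_paired_Ex split_paired_All)
  ultimately show ?case
    using vert_sum by (simp add: fun_eq_iff act_range_projections del: split_paired_All)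
qed (auto simp: act_closed fun_eq_iff fiber_def)

section \<open>Elements of the algebra acting on point masses\<close>

definition op where "op X = act (SOME s. s \<in> X)"

lemma op_cls: "\<lbrakk>s \<in> lpa_terms K E; \<And>x. \<phi> x \<in> carrier K\<rbrakk> \<Longrightarrow> op (cls s) \<phi> = act s \<phi>"
  unfolding op_def using someI[of "\<lambda>t. t \<in> cls s", OF cls_self] act_cong cls_mem by metis

lemma op_closed: "\<lbrakk>X \<in> carrier L; \<And>x. \<phi> x \<in> carrier K\<rbrakk> \<Longrightarrow> op X \<phi> x \<in> carrier K"
  by (elim L_carrierE) (simp add: op_cls act_closed)

lemma op_add:
  "\<lbrakk>X \<in> carrier L; Y \<in> carrier L; \<And>x. \<phi> x \<in> carrier K\<rbrakk> \<Longrightarrow> op (X \<oplus>\<^bsub>L\<^esub> Y) \<phi> x = op X \<phi> x \<oplus>\<^bsub>K\<^esub> op Y \<phi> x"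
  by (elim L_carrierE) (simp add: L_add op_cls lpa_terms.intros)

lemma op_mult:
  "\<lbrakk>X \<in> carrier L; Y \<in> carrier L; \<And>x. \<phi> x \<in> carrier K\<rbrakk> \<Longrightarrow> op (X \<otimes>\<^bsub>L\<^esub> Y) \<phi> = op X (op Y \<phi>)"
  by (elim L_carrierE) (simp add: L_mult op_cls act_closed lpa_terms.intros)

lemma op_smult:
  "\<lbrakk>X \<in> carrier L; c \<in> carrier K; \<And>x. \<phi> x \<in> carrier K\<rbrakk> \<Longrightarrow> op (c \<odot>\<^bsub>L\<^esub> X) \<phi> x = c \<otimes>\<^bsub>K\<^esub> op X \<phi> x"
  by (elim L_carrierE) (simp add: L_smult op_cls lpa_terms.intros)

lemma op_minus:
  assumes "X \<in> carrier L" "\<And>x. \<phi> x \<in> carrier K" shows "op (\<ominus>\<^bsub>L\<^esub> X) \<phi> x = \<ominus>\<^bsub>K\<^esub> op X \<phi> x"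
proof -
  have z: "op \<zero>\<^bsub>L\<^esub> \<phi> x = \<zero>\<^bsub>K\<^esub>" using assms by (simp add: L_zero op_cls lpa_terms.intros)
  have "op (\<ominus>\<^bsub>L\<^esub> X) \<phi> x \<oplus>\<^bsub>K\<^esub> op X \<phi> x = \<zero>\<^bsub>K\<^esub>"
    using op_add[of "\<ominus>\<^bsub>L\<^esub> X" X \<phi> x] assms z by (simp add: L.l_neg)
  then show ?thesis using assms by (metis K.minus_equality L.a_inv_closed op_closed)
qed

definition delta where "delta z = (\<lambda>x. if x = z then \<one>\<^bsub>K\<^esub> else \<zero>\<^bsub>K\<^esub>)"

lemma delta_closed: "delta z x \<in> carrier K" by (simp add: delta_def)

lemma op_zero: "(\<And>x. \<phi> x \<in> carrier K) \<Longrightarrow> op \<zero>\<^bsub>L\<^esub> \<phi> x = \<zero>\<^bsub>K\<^esub>"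
  by (simp add: L_zero op_cls lpa_terms.intros)

lemma op_p_delta: "v \<in> verts E \<Longrightarrow> op (lpa_p K E v) (delta z) = (if fst z = v then delta z else (\<lambda>x. \<zero>\<^bsub>K\<^esub>))"
  by (auto simp: lpa_p_def op_cls lpa_terms.intros delta_closed) (auto simp: delta_def fun_eq_iff)

text \<open>Edges carry point masses to point masses, hence so do paths, and two paths can be told
  apart by the image of one point. This is the source of the functionals in
  \<open>indep\<close>.\<close>

lemma op_t_delta:
  assumes "e \<in> arcs E" "fst z = head E e"
  shows "op (lpa_t K E e) (delta z) = delta (branch e z)"
proof (rule ext)
  fix x
  have z: "z \<in> fiber (head E e)" using assms by (simp add: fiber_def)
  show "op (lpa_t K E e) (delta z) x = delta (branch e z) x"
    using assms z branch_inj[OF assms(1)]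
    by (auto simp: lpa_t_def op_cls lpa_terms.intros delta_closed) (auto simp: delta_def inj_on_eq_iff)
qed

lemma op_q_delta:
  assumes "e \<in> arcs E" "z \<notin> branch e ` fiber (head E e)"
  shows "op (q e) (delta z) x = \<zero>\<^bsub>K\<^esub>"
proof -
  have "op (lpa_t_star K E e) (delta z) = (\<lambda>x. \<zero>\<^bsub>K\<^esub>)"
    using assms by (auto simp: lpa_t_star_def op_cls lpa_terms.intros delta_closed) (auto simp: delta_def fun_eq_iff simp del: split_paired_All)
  then show ?thesis
    using assms by (simp add: op_mult t_closed t_star_closed delta_closed) (simp add: lpa_t_def op_cls lpa_terms.intros)
qed

lemma op_Q_delta:
  assumes "finite S" "S \<subseteq> arcs E" "\<And>e. e \<in> S \<Longrightarrow> z \<notin> branch e ` fiber (head E e)"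
  shows "op (Q S) (delta z) x = \<zero>\<^bsub>K\<^esub>"
  using assms
proof (induction S rule: finite_induct)
  case empty then show ?case by (simp add: L.finsum_empty op_zero delta_closed)
next
  case (insert e S)
  then have "op (Q (insert e S)) (delta z) x = op (q e) (delta z) x \<oplus>\<^bsub>K\<^esub> op (Q S) (delta z) x"
    using insert by (subst Q_insert) (auto simp: op_add q_closed Q_closed delta_closed)
  then show ?case using insert op_q_delta by simp
qed

end

text \<open>\<open>GVert v\<close> is treated like a cut by the empty set, so that one formula
  \<open>gelt\<close> covers both kinds of generators.\<close>

fun gen_base :: "('v, 'e) mbar_gen \<Rightarrow> 'v" where
  "gen_base (GVert v) = v" | "gen_base (GCut v S) = v"

fun gen_cut :: "('v, 'e) mbar_gen \<Rightarrow> 'e set" where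
  "gen_cut (GVert v) = {}" | "gen_cut (GCut v S) = S"

context nu_ring
begin

lemma add_cancel_mid:
  assumes "x \<in> carrier R" "y \<in> carrier R"
  shows "x \<oplus> (y \<oplus> \<ominus> x) = y"
proof -
  have "x \<oplus> (y \<oplus> \<ominus> x) = y \<oplus> (x \<oplus> \<ominus> x)"
    using assms by (intro a_lcomm) auto
  then show ?thesis using assms by (simp add: r_neg)
qed

lemma minus_diff_cancel:
  assumes "x \<in> carrier R" "y \<in> carrier R"
  shows "\<ominus> x \<oplus> \<ominus> (y \<oplus> \<ominus> x) = \<ominus> y"
proof -
  have "\<ominus> x \<oplus> \<ominus> (y \<oplus> \<ominus> x) = \<ominus> (x \<oplus> (y \<oplus> \<ominus> x))"
    using assms by (simp add: minus_add)
  then show ?thesis using assms by (simp add: add_cancel_mid)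
qed

end

section \<open>The idempotents of the generators\<close>

context lpa_setup
begin

sublocale LM: nu_matrix K L
  by (rule nu_matrix.intro) (rule nu_algebra_L, rule L.nu_algebra_mat_alg)

abbreviation "MatL \<equiv> mat_alg L"

definition "gelt g = lpa_p K E (gen_base g) \<ominus>\<^bsub>L\<^esub> Q (gen_cut g)"

lemma gen_facts:
  assumes "g \<in> mbar_gens E"
  shows "gen_base g \<in> verts E" "finite (gen_cut g)" "gen_cut g \<subseteq> out_arcs E (gen_base g)" "gen_cut g \<subseteq> arcs E"
  using assms by (auto simp: mbar_gens_def infinite_emitter_def)

lemma gelt_GVert: "v \<in> verts E \<Longrightarrow> gelt (GVert v) = lpa_p K E v"
  by (simp add: gelt_def L.finsum_empty a_minus_def L.minus_zero' p_closed)

lemma gval_gelt: "g \<in> mbar_gens E \<Longrightarrow> gval g = icls (gelt g)"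
  by (cases g; simp add: gelt_GVert gen_facts(1)[of g, simplified] gelt_def[of "GCut _ _"]; use gen_facts(1) gelt_GVert in fastforce)

lemma gelt_closed: "g \<in> mbar_gens E \<Longrightarrow> gelt g \<in> carrier L"
  unfolding gelt_def by (rule cut_idem(1)[OF gen_facts(1-3)])

lemma gelt_idem: "g \<in> mbar_gens E \<Longrightarrow> gelt g \<otimes>\<^bsub>L\<^esub> gelt g = gelt g"
  unfolding gelt_def by (rule cut_idem(2)[OF gen_facts(1-3)])

lemma p_gelt:
  assumes "g \<in> mbar_gens E"
  shows "lpa_p K E (gen_base g) \<otimes>\<^bsub>L\<^esub> gelt g = gelt g" "gelt g \<otimes>\<^bsub>L\<^esub> lpa_p K E (gen_base g) = gelt g"
  using gen_facts[OF assms] p_Q[of "gen_base g" "gen_cut g"]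
  by (simp_all add: gelt_def a_minus_def L.l_distr L.r_distr L.l_minus L.r_minus p_closed Q_closed p_idem)

lemma p_orth: "\<lbrakk>v \<in> verts E; w \<in> verts E; v \<noteq> w\<rbrakk> \<Longrightarrow> lpa_p K E v \<otimes>\<^bsub>L\<^esub> lpa_p K E w = \<zero>\<^bsub>L\<^esub>"
  using leavitt_family_L unfolding leavitt_family_def by auto

lemma gelt_orth:
  assumes "g \<in> mbar_gens E" "h \<in> mbar_gens E" "gen_base g \<noteq> gen_base h"
  shows "gelt g \<otimes>\<^bsub>L\<^esub> gelt h = \<zero>\<^bsub>L\<^esub>"
proof -
  let ?p = "lpa_p K E (gen_base g)" and ?q = "lpa_p K E (gen_base h)"
  have c: "gelt g \<in> carrier L" "gelt h \<in> carrier L" "?p \<in> carrier L" "?q \<in> carrier L"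
    using assms gelt_closed gen_facts(1) p_closed by auto
  have "gelt g \<otimes>\<^bsub>L\<^esub> gelt h = (gelt g \<otimes>\<^bsub>L\<^esub> ?p) \<otimes>\<^bsub>L\<^esub> (?q \<otimes>\<^bsub>L\<^esub> gelt h)"
    using p_gelt assms by simp
  also have "\<dots> = gelt g \<otimes>\<^bsub>L\<^esub> (?p \<otimes>\<^bsub>L\<^esub> ?q) \<otimes>\<^bsub>L\<^esub> gelt h"
    using c by (simp only: L.m_assoc L.m_closed)
  finally show ?thesis using c p_orth[OF gen_facts(1)[OF assms(1)] gen_facts(1)[OF assms(2)] assms(3)] by simp
qed

lemma Q_t:
  assumes "finite S" "S \<subseteq> arcs E" "e \<in> arcs E"
  shows "Q S \<otimes>\<^bsub>L\<^esub> lpa_t K E e = (if e \<in> S then lpa_t K E e else \<zero>\<^bsub>L\<^esub>)"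
    "lpa_t_star K E e \<otimes>\<^bsub>L\<^esub> Q S = (if e \<in> S then lpa_t_star K E e else \<zero>\<^bsub>L\<^esub>)"
proof -
  have c: "lpa_t K E e \<in> carrier L" "lpa_t_star K E e \<in> carrier L" "Q S \<in> carrier L" "q e \<in> carrier L"
    using assms by (auto simp: t_closed t_star_closed Q_closed)
  have 1: "q e \<otimes>\<^bsub>L\<^esub> lpa_t K E e = lpa_t K E e"
    using assms c by (simp add: L.m_assoc t_star_t t_p)
  have 2: "lpa_t_star K E e \<otimes>\<^bsub>L\<^esub> q e = lpa_t_star K E e"
    using assms c by (simp add: L.m_assoc[symmetric] t_star_t p_t_star)
  have "Q S \<otimes>\<^bsub>L\<^esub> lpa_t K E e = Q S \<otimes>\<^bsub>L\<^esub> q e \<otimes>\<^bsub>L\<^esub> lpa_t K E e"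
    using L.m_assoc[OF c(3,4,1)] 1 by simp
  then show "Q S \<otimes>\<^bsub>L\<^esub> lpa_t K E e = (if e \<in> S then lpa_t K E e else \<zero>\<^bsub>L\<^esub>)"
    using Q_q[OF assms] 1 c by auto
  have "lpa_t_star K E e \<otimes>\<^bsub>L\<^esub> Q S = lpa_t_star K E e \<otimes>\<^bsub>L\<^esub> (q e \<otimes>\<^bsub>L\<^esub> Q S)"
    using L.m_assoc[OF c(2,4,3)] 2 by simp
  then show "lpa_t_star K E e \<otimes>\<^bsub>L\<^esub> Q S = (if e \<in> S then lpa_t_star K E e else \<zero>\<^bsub>L\<^esub>)"
    using Q_q[OF assms] 2 c by auto
qed

lemma gelt_t:
  assumes "g \<in> mbar_gens E" "e \<in> arcs E" "tail E e = gen_base g"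
  shows "gelt g \<otimes>\<^bsub>L\<^esub> lpa_t K E e = (if e \<in> gen_cut g then \<zero>\<^bsub>L\<^esub> else lpa_t K E e)"
    "lpa_t_star K E e \<otimes>\<^bsub>L\<^esub> gelt g = (if e \<in> gen_cut g then \<zero>\<^bsub>L\<^esub> else lpa_t_star K E e)"
  using assms gen_facts[OF assms(1)] Q_t[of "gen_cut g" e] p_t[OF assms(2)] t_star_p[OF assms(2)]
  by (simp_all add: gelt_def a_minus_def L.l_distr L.r_distr L.l_minus L.r_minus L.r_neg L.minus_zero'
      p_closed Q_closed t_closed t_star_closed)

lemma gelt_gelt:
  assumes "g \<in> mbar_gens E" "h \<in> mbar_gens E" "gen_base g = gen_base h" "gen_cut g \<subseteq> gen_cut h"
  shows "gelt g \<otimes>\<^bsub>L\<^esub> gelt h = gelt h" "gelt h \<otimes>\<^bsub>L\<^esub> gelt g = gelt h"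
proof -
  let ?p = "lpa_p K E (gen_base h)" and ?A = "Q (gen_cut g)" and ?B = "Q (gen_cut h)"
  note g = gen_facts[OF assms(1)] and h = gen_facts[OF assms(2)]
  have c: "?p \<in> carrier L" "?A \<in> carrier L" "?B \<in> carrier L" using g h p_closed Q_closed by auto
  have r: "?p \<otimes>\<^bsub>L\<^esub> ?p = ?p" "?p \<otimes>\<^bsub>L\<^esub> ?A = ?A" "?p \<otimes>\<^bsub>L\<^esub> ?B = ?B" "?A \<otimes>\<^bsub>L\<^esub> ?p = ?A" "?B \<otimes>\<^bsub>L\<^esub> ?p = ?B"
    "?A \<otimes>\<^bsub>L\<^esub> ?B = ?A" "?B \<otimes>\<^bsub>L\<^esub> ?A = ?A"
    using g h assms(3,4) p_Q[of "gen_base h" "gen_cut g"] p_Q[of "gen_base h" "gen_cut h"]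
      Q_Q[of "gen_cut h" "gen_cut g"] p_idem by auto
  show "gelt g \<otimes>\<^bsub>L\<^esub> gelt h = gelt h" "gelt h \<otimes>\<^bsub>L\<^esub> gelt g = gelt h"
    using c r by (simp_all add: gelt_def assms(3) a_minus_def L.l_distr L.r_distr L.l_minus L.r_minus
        L.a_ac L.r_neg L.r_neg1 L.r_neg2 L.minus_minus L.add.inv_closed L.minus_diff_cancel)
qed

text \<open>For an infinite emitter this takes the place of the relation at regular vertices: it is
  \<open>P_sum\<close> in the finite graph, with \<open>gelt h\<close> on the extra edge.\<close>

lemma gelt_split:
  assumes "g \<in> mbar_gens E" "h \<in> mbar_gens E" "gen_base g = gen_base h" "gen_cut g \<subseteq> gen_cut h"
  shows "gelt g = Q (gen_cut h - gen_cut g) \<oplus>\<^bsub>L\<^esub> gelt h"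
proof -
  note g = gen_facts[OF assms(1)] and h = gen_facts[OF assms(2)]
  let ?A = "gen_cut g" and ?B = "gen_cut h"
  have BA: "?B - ?A \<subseteq> arcs E" using h by auto
  have "Q ?B = Q (?A \<union> (?B - ?A))" using assms(4) by (simp add: Un_absorb1)
  also have "\<dots> = Q ?A \<oplus>\<^bsub>L\<^esub> Q (?B - ?A)"
    by (rule L.finsum_Un_disjoint) (use g h in \<open>auto simp: t_closed t_star_closed\<close>)
  finally have "Q ?B = Q ?A \<oplus>\<^bsub>L\<^esub> Q (?B - ?A)" .
  moreover have "Q (?B - ?A) \<oplus>\<^bsub>L\<^esub> (p \<oplus>\<^bsub>L\<^esub> \<ominus>\<^bsub>L\<^esub> (a \<oplus>\<^bsub>L\<^esub> Q (?B - ?A))) = p \<oplus>\<^bsub>L\<^esub> \<ominus>\<^bsub>L\<^esub> a"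
    if "p \<in> carrier L" "a \<in> carrier L" for p a
  proof -
    have "p \<oplus>\<^bsub>L\<^esub> \<ominus>\<^bsub>L\<^esub> (a \<oplus>\<^bsub>L\<^esub> Q (?B - ?A)) = (p \<oplus>\<^bsub>L\<^esub> \<ominus>\<^bsub>L\<^esub> a) \<oplus>\<^bsub>L\<^esub> \<ominus>\<^bsub>L\<^esub> Q (?B - ?A)"
      using that Q_closed[OF BA] by (simp add: L.minus_add L.a_assoc)
    then show ?thesis using that Q_closed[OF BA] L.add_cancel_mid[of "Q (?B - ?A)" "p \<oplus>\<^bsub>L\<^esub> \<ominus>\<^bsub>L\<^esub> a"] by simp
  qed
  ultimately show ?thesis
    using g h p_closed Q_closed[OF g(4)] by (simp add: gelt_def assms(3) a_minus_def)
qed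

end

section \<open>Finite pieces of the graph\<close>

text \<open>An edge is tagged with the generator it leaves, because \<open>GVert v\<close> and each
  \<open>GCut v S\<close> emit separate copies of the edges of \<open>v\<close> that they
  retain.\<close>

datatype ('v, 'e) cut_arc = AEdge "('v, 'e) mbar_gen" 'e | AStop "('v, 'e) mbar_gen" | ARow nat "('v, 'e) mbar_gen"

text \<open>
  A finite piece of \<open>E\<close>, given by generators \<open>W\<close> and edges \<open>T\<close>, becomes a finite graph whose
  sinks absorb whatever \<open>T\<close> leaves out: an infinite emitter \<open>v\<close> splits off \<open>GCut v S\<close> for
  \<open>S\<close> the set of edges in \<open>T\<close> emitted by \<open>v\<close>.  The extra vertex \<open>None\<close> emits one edge for
  each diagonal entry of the idempotent matrix under consideration, so that matrices over the
  Leavitt path algebra become linear combinations of paths starting at \<open>None\<close>.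
\<close>

locale cut_graph = lpa_setup E K
  for E :: "('v, 'e) pre_digraph" and K :: "('k, 'm) ring_scheme" +
  fixes W :: "('v, 'e) mbar_gen set" and T :: "'e set" and R :: "(nat \<times> ('v, 'e) mbar_gen) set"
  assumes finW: "finite W" and W_gens: "W \<subseteq> mbar_gens E"
    and W_base: "g \<in> W \<Longrightarrow> GVert (gen_base g) \<in> W" and W_cut: "g \<in> W \<Longrightarrow> gen_cut g \<subseteq> T"
    and finT: "finite T" and T_arcs: "T \<subseteq> arcs E"
    and T_verts: "e \<in> T \<Longrightarrow> GVert (tail E e) \<in> W \<and> GVert (head E e) \<in> W"
    and T_regular: "\<lbrakk>e \<in> T; regular_vertex E (tail E e)\<rbrakk> \<Longrightarrow> out_arcs E (tail E e) \<subseteq> T"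
    and T_cut: "\<lbrakk>infinite_emitter E v; T \<inter> out_arcs E v \<noteq> {}\<rbrakk> \<Longrightarrow> GCut v (T \<inter> out_arcs E v) \<in> W"
    and finR: "finite R" and R_ne: "R \<noteq> {}" and R_W: "(i, g) \<in> R \<Longrightarrow> g \<in> W"
    and R_base: "\<lbrakk>(i, g) \<in> R; (i, h) \<in> R; gen_base g = gen_base h\<rbrakk> \<Longrightarrow> g = h"
begin

abbreviation "full g \<equiv> T \<inter> out_arcs E (gen_base g)"
abbreviation "rest g \<equiv> GCut (gen_base g) (full g)"

text \<open>When the cut is already \<open>full g\<close>, the extra edge would be a loop at
  \<open>g = rest g\<close>; or, if \<open>full g\<close> is empty, it would lead to something that
  is not a generator.\<close>

definition "stops g \<longleftrightarrow> infinite_emitter E (gen_base g) \<and> gen_cut g \<noteq> full g"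

fun ctail where
  "ctail (AEdge g e) = Some g" | "ctail (AStop g) = Some g" | "ctail (ARow i g) = None"

fun chead where
  "chead (AEdge g e) = Some (GVert (head E e))" | "chead (AStop g) = Some (rest g)" | "chead (ARow i g) = Some g"

definition "G = \<lparr>verts = insert None (Some ` W),
  arcs = {AEdge g e | g e. g \<in> W \<and> e \<in> full g - gen_cut g} \<union>
    {AStop g | g. g \<in> W \<and> stops g} \<union>
    {ARow i g | i g. (i, g) \<in> R},
  tail = ctail, head = chead\<rparr>"

text \<open>All vertices except \<open>None\<close> live at the entry (0,0), and
  \<open>ARow i g\<close> passes between row \<open>i\<close> and row 0. The root thus carries the
  diagonal matrix while the rest of the graph stays inside \<open>L\<close>.\<close>

fun cP where
  "cP None = (\<Oplus>\<^bsub>MatL\<^esub>r\<in>R. case r of (i, g) \<Rightarrow> munit L i i (gelt g))"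
| "cP (Some g) = munit L 0 0 (gelt g)"

fun cS where
  "cS (AEdge g e) = munit L 0 0 (lpa_t K E e)"
| "cS (AStop g) = munit L 0 0 (gelt (rest g))"
| "cS (ARow i g) = munit L i 0 (gelt g)"

fun cS' where
  "cS' (AEdge g e) = munit L 0 0 (lpa_t_star K E e)"
| "cS' (AStop g) = munit L 0 0 (gelt (rest g))"
| "cS' (ARow i g) = munit L 0 i (gelt g)"

lemma G_sel [simp]: "verts G = insert None (Some ` W)" "tail G = ctail" "head G = chead"
  by (simp_all add: G_def)

lemma arcs_G: "a \<in> arcs G \<longleftrightarrow> (case a of AEdge g e \<Rightarrow> g \<in> W \<and> e \<in> full g - gen_cut g
    | AStop g \<Rightarrow> g \<in> W \<and> stops g
    | ARow i g \<Rightarrow> (i, g) \<in> R)"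
  by (auto simp: G_def split: cut_arc.splits)

lemma W_facts:
  assumes "g \<in> W"
  shows "g \<in> mbar_gens E" "gen_base g \<in> verts E" "gen_cut g \<subseteq> full g" "gelt g \<in> carrier L"
  using assms W_gens gen_facts gelt_closed W_cut by blast+

lemma rest_W:
  assumes "g \<in> W" "stops g" shows "rest g \<in> W"
  using assms T_cut W_facts(3) unfolding stops_def by blast

lemma finite_arcs_G: "finite (arcs G)"
proof -
  have "arcs G \<subseteq> (\<lambda>(g, e). AEdge g e) ` (W \<times> T) \<union> AStop ` W \<union> (\<lambda>(i, g). ARow i g) ` R"
    by (auto simp: G_def)
  then show ?thesis using finW finT finR by (meson finite_SigmaI finite_UnI finite_imageI finite_subset)
qed

lemma wf_G: "wf_digraph G"
proof
  fix a assume "a \<in> arcs G"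
  then show "tail G a \<in> verts G" "head G a \<in> verts G"
    using T_verts rest_W R_W by (auto simp: arcs_G split: cut_arc.splits)
qed

lemma munit_closed: "x \<in> carrier L \<Longrightarrow> munit L i j x \<in> carrier MatL"
  by (simp add: mat_alg_simps L.munit_closed)

lemma munit_mult:
  "\<lbrakk>x \<in> carrier L; y \<in> carrier L\<rbrakk> \<Longrightarrow>
    munit L i j x \<otimes>\<^bsub>MatL\<^esub> munit L k l y = (if j = k then munit L i l (x \<otimes>\<^bsub>L\<^esub> y) else \<zero>\<^bsub>MatL\<^esub>)"
  by (simp add: mat_alg_simps L.munit_times)

lemma munit_add: "\<lbrakk>x \<in> carrier L; y \<in> carrier L\<rbrakk> \<Longrightarrow> munit L i j (x \<oplus>\<^bsub>L\<^esub> y) = munit L i j x \<oplus>\<^bsub>MatL\<^esub> munit L i j y"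
  by (intro ext) (auto simp: mat_alg_simps munit_def)

lemma munit_zero: "munit L i j \<zero>\<^bsub>L\<^esub> = \<zero>\<^bsub>MatL\<^esub>"
  by (simp add: mat_alg_simps L.munit_zero)

lemma munit_finsum:
  "\<lbrakk>finite I; \<And>x. x \<in> I \<Longrightarrow> f x \<in> carrier L\<rbrakk> \<Longrightarrow> munit L i j (\<Oplus>\<^bsub>L\<^esub>x\<in>I. f x) = (\<Oplus>\<^bsub>MatL\<^esub>x\<in>I. munit L i j (f x))"
proof (induction I rule: finite_induct)
  case empty then show ?case by (simp add: L.finsum_empty LM.M.finsum_empty munit_zero)
next
  case (insert x I)
  have "munit L i j (\<Oplus>\<^bsub>L\<^esub>x\<in>insert x I. f x) = munit L i j (f x \<oplus>\<^bsub>L\<^esub> (\<Oplus>\<^bsub>L\<^esub>x\<in>I. f x))"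
    using insert by (subst L.finsum_insert) auto
  also have "\<dots> = munit L i j (f x) \<oplus>\<^bsub>MatL\<^esub> munit L i j (\<Oplus>\<^bsub>L\<^esub>x\<in>I. f x)"
    using insert by (intro munit_add L.finsum_closed) auto
  also have "\<dots> = (\<Oplus>\<^bsub>MatL\<^esub>x\<in>insert x I. munit L i j (f x))"
    using insert by (subst LM.M.finsum_insert) (auto intro: munit_closed)
  finally show ?case .
qed

text \<open>Here \<open>R_base\<close> enters: generators sharing a row must have different bases in
  order to be orthogonal.\<close>

lemma row_mult:
  assumes "(i, g) \<in> R" "(j, h) \<in> R"
  shows "munit L 0 i (gelt g) \<otimes>\<^bsub>MatL\<^esub> munit L j 0 (gelt h) = (if (i, g) = (j, h) then munit L 0 0 (gelt g) else \<zero>\<^bsub>MatL\<^esub>)"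
proof -
  have gh: "g \<in> W" "h \<in> W" using assms R_W by auto
  have "gelt g \<otimes>\<^bsub>L\<^esub> gelt h = \<zero>\<^bsub>L\<^esub>" if "i = j" "g \<noteq> h"
    using gelt_orth R_base assms that W_facts(1)[OF gh(1)] W_facts(1)[OF gh(2)] by blast
  then show ?thesis
    using gh W_facts gelt_idem by (auto simp: munit_mult munit_zero)
qed

lemma out_None: "out_arcs G None = (\<lambda>(i, g). ARow i g) ` R"
proof (rule Set.set_eqI)
  fix a show "a \<in> out_arcs G None \<longleftrightarrow> a \<in> (\<lambda>(i, g). ARow i g) ` R"
    by (cases a) (force simp: out_arcs_def arcs_G)+
qed

lemma out_Some:
  assumes "g \<in> W"
  shows "out_arcs G (Some g) = AEdge g ` (full g - gen_cut g) \<union>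
    (if stops g then {AStop g} else {})"
proof (rule Set.set_eqI)
  fix a show "a \<in> out_arcs G (Some g) \<longleftrightarrow> a \<in> AEdge g ` (full g - gen_cut g) \<union> (if stops g then {AStop g} else {})"
    using assms by (cases a) (auto simp: out_arcs_def arcs_G)
qed

lemma cS_closed: "a \<in> arcs G \<Longrightarrow> cS a \<in> carrier MatL \<and> cS' a \<in> carrier MatL"
  using T_arcs W_facts(4) W_facts(4)[OF rest_W] R_W
  by (cases a) (auto simp: arcs_G intro!: munit_closed t_closed t_star_closed)

lemma cP_None_sum: "cP None = (\<Oplus>\<^bsub>MatL\<^esub>a\<in>out_arcs G None. cS a \<otimes>\<^bsub>MatL\<^esub> cS' a)"
proof -
  have inj: "inj_on (\<lambda>(i, g). ARow i g) R" by (auto simp: inj_on_def)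
  have c: "gelt g \<in> carrier L" "gelt g \<otimes>\<^bsub>L\<^esub> gelt g = gelt g" if "(i, g) \<in> R" for i g
    using R_W that W_facts gelt_idem by blast+
  have "(\<Oplus>\<^bsub>MatL\<^esub>a\<in>out_arcs G None. cS a \<otimes>\<^bsub>MatL\<^esub> cS' a) =
      (\<Oplus>\<^bsub>MatL\<^esub>r\<in>R. cS (case r of (i, g) \<Rightarrow> ARow i g) \<otimes>\<^bsub>MatL\<^esub> cS' (case r of (i, g) \<Rightarrow> ARow i g))"
    unfolding out_None using inj c by (intro LM.M.finsum_reindex) (auto intro!: munit_closed LM.M.m_closed)
  also have "\<dots> = cP None"
    unfolding cP.simps using c by (intro LM.M.finsum_cong') (auto simp: munit_mult intro!: munit_closed)
  finally show ?thesis by simp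
qed

text \<open>At an infinite emitter the relation is \<open>gelt_split\<close>, the extra edge
  supplying the missing summand. At a regular vertex \<open>T_regular\<close> ensures that all its
  edges have been copied as soon as one has.\<close>

lemma cP_Some_sum:
  assumes g: "g \<in> W" and ne: "out_arcs G (Some g) \<noteq> {}"
  shows "cP (Some g) = (\<Oplus>\<^bsub>MatL\<^esub>a\<in>out_arcs G (Some g). cS a \<otimes>\<^bsub>MatL\<^esub> cS' a)"
proof -
  have fin: "finite (full g - gen_cut g)" "full g - gen_cut g \<subseteq> arcs E" using finT T_arcs by auto
  have qe: "q e \<in> carrier L" "lpa_t K E e \<in> carrier L" "lpa_t_star K E e \<in> carrier L" if "e \<in> full g - gen_cut g" for e
    using that fin(2) t_closed t_star_closed by auto
  have edges: "(\<Oplus>\<^bsub>MatL\<^esub>a\<in>AEdge g ` (full g - gen_cut g). cS a \<otimes>\<^bsub>MatL\<^esub> cS' a) = munit L 0 0 (Q (full g - gen_cut g))"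
  proof -
    have "(\<Oplus>\<^bsub>MatL\<^esub>a\<in>AEdge g ` (full g - gen_cut g). cS a \<otimes>\<^bsub>MatL\<^esub> cS' a) =
        (\<Oplus>\<^bsub>MatL\<^esub>e\<in>full g - gen_cut g. cS (AEdge g e) \<otimes>\<^bsub>MatL\<^esub> cS' (AEdge g e))"
      using qe by (intro LM.M.finsum_reindex) (auto simp: inj_on_def intro!: munit_closed LM.M.m_closed)
    also have "\<dots> = (\<Oplus>\<^bsub>MatL\<^esub>e\<in>full g - gen_cut g. munit L 0 0 (q e))"
      using qe by (intro LM.M.finsum_cong') (auto simp: munit_mult intro!: munit_closed)
    also have "\<dots> = munit L 0 0 (Q (full g - gen_cut g))"
      using fin qe by (intro munit_finsum[symmetric]) auto
    finally show ?thesis .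
  qed
  show ?thesis
  proof (cases "infinite_emitter E (gen_base g)")
    case True
    have cut: "stops g" using ne out_Some[OF g] True by (auto simp: stops_def)
    then have r: "rest g \<in> W" using rest_W[OF g] by blast
    have out: "out_arcs G (Some g) = insert (AStop g) (AEdge g ` (full g - gen_cut g))"
      using out_Some[OF g] cut by auto
    have rc: "gelt (rest g) \<in> carrier L" "gelt (rest g) \<otimes>\<^bsub>L\<^esub> gelt (rest g) = gelt (rest g)"
      using W_facts[OF r] gelt_idem by auto
    have "(\<Oplus>\<^bsub>MatL\<^esub>a\<in>out_arcs G (Some g). cS a \<otimes>\<^bsub>MatL\<^esub> cS' a) =
        cS (AStop g) \<otimes>\<^bsub>MatL\<^esub> cS' (AStop g) \<oplus>\<^bsub>MatL\<^esub> munit L 0 0 (Q (full g - gen_cut g))"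
      unfolding out edges[symmetric] using fin qe rc
      by (intro LM.M.finsum_insert) (auto intro!: munit_closed LM.M.m_closed)
    also have "\<dots> = munit L 0 0 (gelt (rest g) \<oplus>\<^bsub>L\<^esub> Q (full g - gen_cut g))"
      using rc Q_closed[OF fin(2)] by (simp add: munit_mult munit_add)
    also have "gelt (rest g) \<oplus>\<^bsub>L\<^esub> Q (full g - gen_cut g) = gelt g"
      using gelt_split[of g "rest g"] W_facts[OF g] W_facts[OF r] rc Q_closed[OF fin(2)] by (simp add: L.a_comm)
    finally show ?thesis by simp
  next
    case False
    obtain v where v: "g = GVert v" "v \<in> verts E" using W_facts(1)[OF g] False by (auto simp: mbar_gens_def)
    have out: "out_arcs G (Some g) = AEdge g ` (full g - gen_cut g)" using out_Some[OF g] False by (simp add: stops_def)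
    have "full g - gen_cut g \<noteq> {}" using ne unfolding out by blast
    then obtain e where "e \<in> full g" by blast
    then have e: "e \<in> T" "e \<in> out_arcs E v" using v(1) by simp_all
    have reg: "regular_vertex E v" using v False e by (auto simp: regular_vertex_def infinite_emitter_def)
    then have "out_arcs E v \<subseteq> T" using T_regular[OF e(1)] e(2) by simp
    then have "full g - gen_cut g = out_arcs E v" using v by auto
    then show ?thesis using edges out v p_regular[OF reg] gelt_GVert by simp
  qed
qed

lemma cP_closed: "g \<in> verts G \<Longrightarrow> cP g \<in> carrier MatL"
proof (cases g)
  case None
  have "(\<Oplus>\<^bsub>MatL\<^esub>r\<in>R. case r of (i, g) \<Rightarrow> munit L i i (gelt g)) \<in> carrier MatL"
    using R_W W_facts by (intro LM.M.finsum_closed) (auto intro!: munit_closed)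
  then show ?thesis using None by simp
qed (use W_facts in \<open>auto intro!: munit_closed\<close>)

lemma cP_row:
  assumes "(i, g) \<in> R"
  shows "cP None \<otimes>\<^bsub>MatL\<^esub> munit L i 0 (gelt g) = munit L i 0 (gelt g)" "munit L 0 i (gelt g) \<otimes>\<^bsub>MatL\<^esub> cP None = munit L 0 i (gelt g)"
proof -
  have c: "gelt h \<in> carrier L" if "(j, h) \<in> R" for j h using R_W that W_facts by blast
  have eq: "gelt h \<otimes>\<^bsub>L\<^esub> gelt g = (if h = g then gelt g else \<zero>\<^bsub>L\<^esub>)"
    "gelt g \<otimes>\<^bsub>L\<^esub> gelt h = (if h = g then gelt g else \<zero>\<^bsub>L\<^esub>)" if "(i, h) \<in> R" for h
  proof -
    have gh: "g \<in> mbar_gens E" "h \<in> mbar_gens E" using R_W assms that W_facts(1) by blast+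
    have "gen_base h \<noteq> gen_base g" if "h \<noteq> g" using R_base[OF \<open>(i, h) \<in> R\<close> assms] that by blast
    then show "gelt h \<otimes>\<^bsub>L\<^esub> gelt g = (if h = g then gelt g else \<zero>\<^bsub>L\<^esub>)"
      "gelt g \<otimes>\<^bsub>L\<^esub> gelt h = (if h = g then gelt g else \<zero>\<^bsub>L\<^esub>)"
      using gelt_orth[OF gh(2,1)] gelt_orth[OF gh] gelt_idem[OF gh(1)] by (metis (full_types))+
  qed
  have 1: "munit L j j (gelt h) \<otimes>\<^bsub>MatL\<^esub> munit L i 0 (gelt g) = (if (i, g) = (j, h) then munit L i 0 (gelt g) else \<zero>\<^bsub>MatL\<^esub>)"
    "munit L 0 i (gelt g) \<otimes>\<^bsub>MatL\<^esub> munit L j j (gelt h) = (if (i, g) = (j, h) then munit L 0 i (gelt g) else \<zero>\<^bsub>MatL\<^esub>)"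
    if "(j, h) \<in> R" for j h
    using c[OF that] c[OF assms] eq[of h] that by (auto simp: munit_mult munit_zero)
  have "cP None \<otimes>\<^bsub>MatL\<^esub> munit L i 0 (gelt g) = (\<Oplus>\<^bsub>MatL\<^esub>r\<in>R. (case r of (j, h) \<Rightarrow> munit L j j (gelt h)) \<otimes>\<^bsub>MatL\<^esub> munit L i 0 (gelt g))"
    unfolding cP.simps using finR c assms by (intro LM.M.finsum_ldistr') (auto intro!: munit_closed)
  also have "\<dots> = (\<Oplus>\<^bsub>MatL\<^esub>r\<in>R. if (i, g) = r then munit L i 0 (gelt g) else \<zero>\<^bsub>MatL\<^esub>)"
    using 1 c assms by (intro LM.M.finsum_cong') (auto intro!: munit_closed)
  also have "\<dots> = munit L i 0 (gelt g)"
    using assms finR c by (intro LM.M.add.finprod_singleton) (auto intro!: munit_closed)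
  finally show "cP None \<otimes>\<^bsub>MatL\<^esub> munit L i 0 (gelt g) = munit L i 0 (gelt g)" .
  have "munit L 0 i (gelt g) \<otimes>\<^bsub>MatL\<^esub> cP None = (\<Oplus>\<^bsub>MatL\<^esub>r\<in>R. munit L 0 i (gelt g) \<otimes>\<^bsub>MatL\<^esub> (case r of (j, h) \<Rightarrow> munit L j j (gelt h)))"
    unfolding cP.simps using finR c assms by (intro LM.M.finsum_rdistr') (auto intro!: munit_closed)
  also have "\<dots> = (\<Oplus>\<^bsub>MatL\<^esub>r\<in>R. if (i, g) = r then munit L 0 i (gelt g) else \<zero>\<^bsub>MatL\<^esub>)"
    using 1 c assms by (intro LM.M.finsum_cong') (auto intro!: munit_closed)
  also have "\<dots> = munit L 0 i (gelt g)"
    using assms finR c by (intro LM.M.add.finprod_singleton) (auto intro!: munit_closed)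
  finally show "munit L 0 i (gelt g) \<otimes>\<^bsub>MatL\<^esub> cP None = munit L 0 i (gelt g)" .
qed

lemma cP_None_idem: "cP None \<otimes>\<^bsub>MatL\<^esub> cP None = cP None"
proof -
  have c: "munit L i i (gelt g) \<in> carrier MatL" "munit L i 0 (gelt g) \<in> carrier MatL" "munit L 0 i (gelt g) \<in> carrier MatL"
    "munit L i i (gelt g) = munit L i 0 (gelt g) \<otimes>\<^bsub>MatL\<^esub> munit L 0 i (gelt g)" if "(i, g) \<in> R" for i g
    using R_W[OF that] W_facts gelt_idem by (auto simp: munit_mult intro!: munit_closed)
  have P: "cP None \<in> carrier MatL" by (rule cP_closed) simp
  have "cP None \<otimes>\<^bsub>MatL\<^esub> munit L i i (gelt g) = munit L i i (gelt g)" if "(i, g) \<in> R" for i g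
    using LM.M.m_assoc[OF P c(2,3)[OF that]] cP_row(1)[OF that] c(4)[OF that] by (simp del: cP.simps)
  then have "(\<Oplus>\<^bsub>MatL\<^esub>r\<in>R. cP None \<otimes>\<^bsub>MatL\<^esub> (case r of (i, g) \<Rightarrow> munit L i i (gelt g))) = cP None"
    unfolding cP.simps(1) using c by (intro LM.M.finsum_cong') auto
  moreover have "cP None \<otimes>\<^bsub>MatL\<^esub> cP None = (\<Oplus>\<^bsub>MatL\<^esub>r\<in>R. cP None \<otimes>\<^bsub>MatL\<^esub> (case r of (i, g) \<Rightarrow> munit L i i (gelt g)))"
    unfolding cP.simps(1)[symmetric] using LM.M.finsum_rdistr'[OF finR P, of "\<lambda>(i, g). munit L i i (gelt g)"] c by auto
  ultimately show ?thesis by simp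
qed

lemma leavitt_rep_G: "leavitt_rep K MatL G cP cS cS'"
proof (intro leavitt_rep.intro leavitt_rep_axioms.intro)
  show "nu_algebra K MatL" by (rule L.nu_algebra_mat_alg)
  show "field K" by (rule K.field_axioms)
  show "wf_digraph G" by (rule wf_G)
  show "finite (out_arcs G g)" for g using finite_arcs_G by (simp add: out_arcs_def)
  show "cP g \<in> carrier MatL" if "g \<in> verts G" for g using that by (rule cP_closed)
  show "cS a \<in> carrier MatL" "cS' a \<in> carrier MatL" if "a \<in> arcs G" for a using cS_closed[OF that] by auto
  show "cP g \<otimes>\<^bsub>MatL\<^esub> cP g = cP g" if "g \<in> verts G" for g
    using that cP_None_idem W_facts gelt_idem by (cases g) (auto simp: munit_mult simp del: cP.simps(1))
  show "cP g = (\<Oplus>\<^bsub>MatL\<^esub>a\<in>out_arcs G g. cS a \<otimes>\<^bsub>MatL\<^esub> cS' a)" if "g \<in> verts G" "out_arcs G g \<noteq> {}" for g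
  proof (cases g)
    case None then show ?thesis using cP_None_sum by (simp only:)
  next
    case (Some h)
    then have "h \<in> W" using that(1) by auto
    then show ?thesis using cP_Some_sum that(2) unfolding Some by blast
  qed
  fix a assume a: "a \<in> arcs G"
  have edge: "gelt g \<otimes>\<^bsub>L\<^esub> lpa_t K E e = lpa_t K E e" "lpa_t_star K E e \<otimes>\<^bsub>L\<^esub> gelt g = lpa_t_star K E e"
    "lpa_t K E e \<otimes>\<^bsub>L\<^esub> gelt (GVert (head E e)) = lpa_t K E e"
    "gelt (GVert (head E e)) \<otimes>\<^bsub>L\<^esub> lpa_t_star K E e = lpa_t_star K E e"
    "lpa_t K E e \<in> carrier L" "lpa_t_star K E e \<in> carrier L" "gelt g \<in> carrier L" "gelt (GVert (head E e)) \<in> carrier L"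
    if "g \<in> W" "e \<in> full g - gen_cut g" for g e
  proof -
    have e: "e \<in> arcs E" "e \<in> T" "tail E e = gen_base g" "e \<notin> gen_cut g" using that T_arcs by auto
    then show "gelt g \<otimes>\<^bsub>L\<^esub> lpa_t K E e = lpa_t K E e" "lpa_t_star K E e \<otimes>\<^bsub>L\<^esub> gelt g = lpa_t_star K E e"
      "lpa_t K E e \<otimes>\<^bsub>L\<^esub> gelt (GVert (head E e)) = lpa_t K E e"
      "gelt (GVert (head E e)) \<otimes>\<^bsub>L\<^esub> lpa_t_star K E e = lpa_t_star K E e"
      "lpa_t K E e \<in> carrier L" "lpa_t_star K E e \<in> carrier L" "gelt g \<in> carrier L" "gelt (GVert (head E e)) \<in> carrier L"
      using gelt_t[OF W_facts(1)[OF that(1)] e(1,3)] W_facts(4)[OF that(1)]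
      by (simp_all add: gelt_GVert t_p p_t_star t_closed t_star_closed p_closed)
  qed
  have stop: "gelt g \<otimes>\<^bsub>L\<^esub> gelt (rest g) = gelt (rest g)" "gelt (rest g) \<otimes>\<^bsub>L\<^esub> gelt g = gelt (rest g)"
    "gelt (rest g) \<otimes>\<^bsub>L\<^esub> gelt (rest g) = gelt (rest g)" "gelt (rest g) \<in> carrier L" "gelt g \<in> carrier L"
    if "g \<in> W" "stops g" for g
    using gelt_gelt[of g "rest g"] W_facts[OF that(1)] W_facts[OF rest_W[OF that]] gelt_idem by auto
  have row: "gelt g \<in> carrier L" "gelt g \<otimes>\<^bsub>L\<^esub> gelt g = gelt g" if "(i, g) \<in> R" for i g
    using R_W[OF that] W_facts gelt_idem by auto
  show "cP (tail G a) \<otimes>\<^bsub>MatL\<^esub> cS a = cS a" "cS a \<otimes>\<^bsub>MatL\<^esub> cP (head G a) = cS a"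
    "cP (head G a) \<otimes>\<^bsub>MatL\<^esub> cS' a = cS' a" "cS' a \<otimes>\<^bsub>MatL\<^esub> cP (tail G a) = cS' a"
  proof -
    have "cP (tail G a) \<otimes>\<^bsub>MatL\<^esub> cS a = cS a \<and> cS a \<otimes>\<^bsub>MatL\<^esub> cP (head G a) = cS a \<and>
      cP (head G a) \<otimes>\<^bsub>MatL\<^esub> cS' a = cS' a \<and> cS' a \<otimes>\<^bsub>MatL\<^esub> cP (tail G a) = cS' a"
    proof (cases a)
      case (AEdge g e)
      then have ge: "g \<in> W" "e \<in> full g - gen_cut g" using a by (simp_all add: arcs_G)
      show ?thesis unfolding AEdge using edge[OF ge] by (simp add: munit_mult)
    next
      case (AStop g)
      then have g: "g \<in> W" "stops g" using a by (simp_all add: arcs_G)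
      show ?thesis unfolding AStop using stop[OF g] by (simp add: munit_mult)
    next
      case (ARow i g)
      then have g: "(i, g) \<in> R" using a by (simp add: arcs_G)
      show ?thesis unfolding ARow using row[OF g] cP_row[OF g] by (simp add: munit_mult del: cP.simps(1))
    qed
    then show "cP (tail G a) \<otimes>\<^bsub>MatL\<^esub> cS a = cS a" "cS a \<otimes>\<^bsub>MatL\<^esub> cP (head G a) = cS a"
      "cP (head G a) \<otimes>\<^bsub>MatL\<^esub> cS' a = cS' a" "cS' a \<otimes>\<^bsub>MatL\<^esub> cP (tail G a) = cS' a" by blast+
  qed
  fix b assume b: "b \<in> arcs G" and ab: "tail G a = tail G b"
  show "cS' a \<otimes>\<^bsub>MatL\<^esub> cS b = (if a = b then cP (head G a) else \<zero>\<^bsub>MatL\<^esub>)"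
  proof (cases a)
    case (AEdge g e)
    then have ge: "g \<in> W" "e \<in> full g - gen_cut g" "e \<in> arcs E" using a T_arcs by (auto simp: arcs_G)
    have hv: "head E e \<in> verts E" using ge(3) by simp
    show ?thesis
    proof (cases b)
      case (AEdge g' f)
      then have "g' = g" "f \<in> arcs E" "f \<in> full g - gen_cut g" using b ab \<open>a = AEdge g e\<close> T_arcs by (auto simp: arcs_G)
      then show ?thesis using AEdge \<open>a = AEdge g e\<close> ge edge hv
        by (simp add: munit_mult t_star_t gelt_GVert munit_zero)
    next
      case (AStop g')
      then have "g' = g" and r: "rest g \<in> mbar_gens E" "gelt (rest g) \<in> carrier L"
        using b ab \<open>a = AEdge g e\<close> rest_W W_facts by (auto simp: arcs_G)
      \<comment> \<open>The edge \<open>e\<close> belongs to the cut of \<open>rest g\<close>, so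
        its ghost annihilates that idempotent.\<close>
      then have "lpa_t_star K E e \<otimes>\<^bsub>L\<^esub> gelt (rest g) = \<zero>\<^bsub>L\<^esub>" using ge gelt_t(2)[OF r(1), of e] by auto
      then show ?thesis using AStop \<open>g' = g\<close> \<open>a = AEdge g e\<close> r edge(6)[OF ge(1,2)] by (simp add: munit_mult munit_zero)
    qed (use ab AEdge in auto)
  next
    case (AStop g)
    then have g: "g \<in> W" "stops g" using a by (auto simp: arcs_G)
    then have r: "rest g \<in> mbar_gens E" "gelt (rest g) \<in> carrier L" using rest_W W_facts by auto
    show ?thesis
    proof (cases b)
      case (AEdge g' f)
      then have f: "g' = g" "f \<in> arcs E" "f \<in> full g - gen_cut g" using b ab \<open>a = AStop g\<close> T_arcs by (auto simp: arcs_G)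
      then have "gelt (rest g) \<otimes>\<^bsub>L\<^esub> lpa_t K E f = \<zero>\<^bsub>L\<^esub>" using gelt_t(1)[OF r(1), of f] by auto
      then show ?thesis using AEdge f(1) \<open>a = AStop g\<close> r edge(5)[OF g(1) f(3)] by (simp add: munit_mult munit_zero)
    next
      case (AStop g')
      then show ?thesis using ab \<open>a = AStop g\<close> stop[OF g] by (auto simp: munit_mult)
    qed (use ab AStop in auto)
  next
    case (ARow i g)
    then obtain j h where "b = ARow j h" using ab by (cases b) auto
    then show ?thesis using a b ARow row_mult[of i g j h] by (auto simp: arcs_G)
  qed
qed

end

section \<open>Membership in the spans by expansion at a vertex\<close>

context leavitt_rep
begin

lemma S_Lspan: "a \<in> arcs F \<Longrightarrow> S a \<in> Lspan (tail F a) (head F a)"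
  using sp_Lspan[of "tail F a" "[a]" "head F a"] by (simp add: awalk_simps S_P)

lemma S'_Lspan: "a \<in> arcs F \<Longrightarrow> S' a \<in> Lspan (head F a) (tail F a)"
  using sq_Lspan[of "tail F a" "[a]" "head F a"] by (simp add: awalk_simps P_S')

lemma P_Lspan: "g \<in> verts F \<Longrightarrow> P g \<in> Lspan g g"
  using sp_Lspan[of g "[]" g] by (simp add: awalk_simps)

text \<open>\<open>P_sum\<close> rebuilds \<open>x\<close> from its components along the outgoing
  edges, so membership has to be known for these alone.\<close>

lemma Lspan_expand_left:
  assumes "g \<in> verts F" "out_arcs F g \<noteq> {}" "x \<in> carrier A" "P g \<otimes> x = x"
    and "\<And>a. a \<in> out_arcs F g \<Longrightarrow> S' a \<otimes> x \<in> Lspan (head F a) h"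
  shows "x \<in> Lspan g h"
proof -
  have "x = (\<Oplus>a\<in>out_arcs F g. S a \<otimes> S' a) \<otimes> x" using P_sum[OF assms(1,2)] assms(4) by simp
  also have "\<dots> = (\<Oplus>a\<in>out_arcs F g. S a \<otimes> S' a \<otimes> x)"
    using assms(3) finite_out by (intro finsum_ldistr') auto
  also have "\<dots> = (\<Oplus>a\<in>out_arcs F g. S a \<otimes> (S' a \<otimes> x))"
    using assms(3) by (intro finsum_cong') (auto simp: m_assoc)
  also have "\<dots> \<in> Lspan g h"
  proof (rule kspan_finsum[OF finite_out _ Lgen_carrier])
    fix a assume a: "a \<in> out_arcs F g"
    then have "S a \<in> Lspan g (head F a)" using S_Lspan[of a] by auto
    then show "S a \<otimes> (S' a \<otimes> x) \<in> Lspan g h" using assms(5)[OF a] Lspan_mult by blast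
  qed
  finally show ?thesis .
qed

lemma Lspan_expand_right:
  assumes "h \<in> verts F" "out_arcs F h \<noteq> {}" "x \<in> carrier A" "x \<otimes> P h = x"
    and "\<And>a. a \<in> out_arcs F h \<Longrightarrow> x \<otimes> S a \<in> Lspan g (head F a)"
  shows "x \<in> Lspan g h"
proof -
  have "x = x \<otimes> (\<Oplus>a\<in>out_arcs F h. S a \<otimes> S' a)" using P_sum[OF assms(1,2)] assms(4) by simp
  also have "\<dots> = (\<Oplus>a\<in>out_arcs F h. x \<otimes> (S a \<otimes> S' a))"
    using assms(3) finite_out by (intro finsum_rdistr') auto
  also have "\<dots> = (\<Oplus>a\<in>out_arcs F h. x \<otimes> S a \<otimes> S' a)"
    using assms(3) by (intro finsum_cong') (auto simp: m_assoc)
  also have "\<dots> \<in> Lspan g h"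
  proof (rule kspan_finsum[OF finite_out _ Lgen_carrier])
    fix a assume a: "a \<in> out_arcs F h"
    then have "S' a \<in> Lspan (head F a) h" using S'_Lspan[of a] by auto
    then show "x \<otimes> S a \<otimes> S' a \<in> Lspan g h" using assms(5)[OF a] Lspan_mult by blast
  qed
  finally show ?thesis .
qed

end

sublocale cut_graph \<subseteq> rep: leavitt_rep K MatL G cP cS cS'
  by (rule leavitt_rep_G)

section \<open>Independence of paths in a finite piece\<close>

context cut_graph
begin

text \<open>The empty list keeps the point outside the images of all edges at an infinite emitter,
  so that \<open>gelt g\<close> fixes its point mass; degree 0 is the origin for counting
  edges.\<close>

definition pt :: "('v, 'e) mbar_gen \<Rightarrow> 'v \<times> int \<times> nat \<times> 'e list" where "pt g = (gen_base g, 0, 0, [])"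

text \<open>Away from the root a path is a matrix with one entry, and \<open>lp\<close> is that
  entry, to which \<open>op\<close> applies; \<open>track\<close> follows a point along the path
  from its end. The clauses for \<open>ARow\<close> are placeholders, as this edge starts only at
  the root.\<close>

primrec lp where
  "lp g [] = gelt g"
| "lp g (a # m) = (case a of AEdge h e \<Rightarrow> lpa_t K E e \<otimes>\<^bsub>L\<^esub> lp (GVert (head E e)) m
    | AStop h \<Rightarrow> gelt (rest h) \<otimes>\<^bsub>L\<^esub> lp (rest h) m | ARow i h \<Rightarrow> lp h m)"

primrec track where
  "track z [] = z"
| "track z (a # m) = (case a of AEdge h e \<Rightarrow> branch e (track z m) | AStop h \<Rightarrow> track z m | ARow i h \<Rightarrow> track z m)"

lemma gelt_delta:
  assumes "g \<in> mbar_gens E" shows "op (gelt g) (delta (pt g)) = delta (pt g)"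
proof (rule ext)
  fix x
  note g = gen_facts[OF assms]
  have "pt g \<notin> branch e ` fiber (head E e)" if "e \<in> gen_cut g" for e
  proof (cases g)
    case (GCut v S)
    then have "infinite (out_arcs E v)" using assms by (auto simp: mbar_gens_def infinite_emitter_def)
    then show ?thesis using base_not_branch GCut by (simp add: pt_def)
  qed (use that in simp)
  then have "op (Q (gen_cut g)) (delta (pt g)) x = \<zero>\<^bsub>K\<^esub>" using g by (intro op_Q_delta) auto
  then show "op (gelt g) (delta (pt g)) x = delta (pt g) x"
    using g by (simp add: gelt_def a_minus_def op_add op_minus delta_closed p_closed Q_closed op_p_delta
        K.minus_zero) (simp add: pt_def delta_closed)
qed

lemma gelt_nonzero: assumes "g \<in> mbar_gens E" shows "gelt g \<noteq> \<zero>\<^bsub>L\<^esub>"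
proof
  assume "gelt g = \<zero>\<^bsub>L\<^esub>"
  then have "delta (pt g) (pt g) = \<zero>\<^bsub>K\<^esub>"
    using gelt_delta[OF assms] op_zero[of "delta (pt g)" "pt g"] by (simp add: delta_closed)
  then show False by (simp add: delta_def)
qed

lemma rest_sink: "rep.awalk (Some (rest g)) m w \<Longrightarrow> m = []"
  by (cases m; cases "hd m") (auto simp: rep.awalk_Cons_iff arcs_G stops_def)

text \<open>The base and the degree are carried along in the induction: the base puts the tracked
  point into the fiber that \<open>branch_eqD\<close> wants, and the degree, raised by true edges
  alone, tells edges from stops in \<open>track_inj\<close>.\<close>

lemma lp_track:
  assumes "rep.awalk (Some g) m (Some h)"
  shows "lp g m \<in> carrier L \<and> rep.sp (Some g) m = munit L 0 0 (lp g m) \<and>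
    op (lp g m) (delta (pt h)) = delta (track (pt h) m) \<and>
    fst (track (pt h) m) = gen_base g \<and> fst (snd (track (pt h) m)) \<ge> 0"
  using assms
proof (induction m arbitrary: g)
  case Nil
  then have "h = g" "g \<in> W" by (auto simp: rep.awalk_Nil_iff)
  then show ?case using W_facts gelt_delta by (simp add: pt_def)
next
  case (Cons a m)
  then have a: "a \<in> arcs G" "Some g = ctail a" "rep.awalk (chead a) m (Some h)" by (auto simp: rep.awalk_Cons_iff)
  show ?case
  proof (cases a)
    case (AEdge g' e)
    have g': "g' = g" using AEdge a(2) by simp
    have e: "e \<in> arcs E" "tail E e = gen_base g" using AEdge a g' by (auto simp: arcs_G)
    have IH: "lp (GVert (head E e)) m \<in> carrier L" "rep.sp (Some (GVert (head E e))) m = munit L 0 0 (lp (GVert (head E e)) m)"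
      "op (lp (GVert (head E e)) m) (delta (pt h)) = delta (track (pt h) m)"
      "fst (track (pt h) m) = head E e" "fst (snd (track (pt h) m)) \<ge> 0"
      using Cons.IH[of "GVert (head E e)"] a(3) AEdge by auto
    show ?thesis
      using IH e t_closed[OF e(1)] AEdge
      by (simp add: munit_mult op_mult delta_closed op_t_delta level_branch)
  next
    case (AStop g')
    have g': "g' = g" using AStop a(2) by simp
    have aw: "rep.awalk (Some (rest g)) m (Some h)" using a(3) AStop g' by simp
    have m: "m = []" using rest_sink[OF aw] .
    then have h: "h = rest g" using aw by (auto simp: rep.awalk_Nil_iff)
    have gW: "g \<in> W" "stops g" using a(1) AStop g' by (auto simp: arcs_G)
    have r: "rest g \<in> mbar_gens E" "gelt (rest g) \<in> carrier L" "gelt (rest g) \<otimes>\<^bsub>L\<^esub> gelt (rest g) = gelt (rest g)"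
      using W_facts[OF rest_W[OF gW]] gelt_idem by auto
    show ?thesis using m h r AStop g' gelt_delta[OF r(1)] by (simp add: munit_mult) (simp add: pt_def)
  qed (use a in simp)
qed

text \<open>An edge is peeled off by \<open>branch_eqD\<close>. A stop leaves the point where it is,
  but it ends the path in degree 0, while an edge makes the degree positive. Nor can a stop be
  mistaken for the empty path: then \<open>g\<close> would equal \<open>rest g\<close>, which
  excludes stops.\<close>

lemma track_inj:
  assumes "rep.awalk (Some g) m (Some h)" "rep.awalk (Some g) m' (Some h)"
    and "track (pt h) m = track (pt h) m'"
  shows "m = m'"
  using assms
proof (induction m arbitrary: g m')
  case Nil
  then have gh: "g = h" by (auto simp: rep.awalk_Nil_iff)
  show ?case
  proof (cases m')
    case (Cons a m1)
    then have a: "a \<in> arcs G" "Some g = ctail a" "rep.awalk (chead a) m1 (Some h)"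
      using Nil(2) by (auto simp: rep.awalk_Cons_iff)
    show ?thesis
    proof (cases a)
      case (AEdge g' e)
      then have "rep.awalk (Some (GVert (head E e))) m1 (Some h)" using a by simp
      from lp_track[OF this] have "fst (snd (track (pt h) m')) > 0"
        using Cons AEdge by (simp add: level_branch)
      then show ?thesis using Nil(3) by (simp add: pt_def)
    next
      case (AStop g')
      have g': "g' = g" using AStop a(2) by simp
      have aw: "rep.awalk (Some (rest g)) m1 (Some h)" using a(3) AStop g' by simp
      then have "h = rest g" using rest_sink[OF aw] by (auto simp: rep.awalk_Nil_iff)
      then have "gen_cut g = full g" using gh by (metis gen_base.simps(2) gen_cut.simps(2))
      then show ?thesis using a(1) AStop g' by (simp add: arcs_G stops_def)
    qed (use a in simp)
  qed simp
next
  case (Cons a m)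
  then have a: "a \<in> arcs G" "Some g = ctail a" "rep.awalk (chead a) m (Some h)" by (auto simp: rep.awalk_Cons_iff)
  show ?case
  proof (cases m')
    case Nil
    then have gh: "g = h" using Cons.prems(2) by (auto simp: rep.awalk_Nil_iff)
    show ?thesis
    proof (cases a)
      case (AEdge g' e)
      then have "rep.awalk (Some (GVert (head E e))) m (Some h)" using a by simp
      from lp_track[OF this] have "fst (snd (track (pt h) (a # m))) > 0"
        using AEdge by (simp add: level_branch)
      then show ?thesis using Cons.prems(3) Nil by (auto simp: pt_def)
    next
      case (AStop g')
      have g': "g' = g" using AStop a(2) by simp
      have aw: "rep.awalk (Some (rest g)) m (Some h)" using a(3) AStop g' by simp
      then have "h = rest g" using rest_sink[OF aw] by (auto simp: rep.awalk_Nil_iff)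
      then have "gen_cut g = full g" using gh by (metis gen_base.simps(2) gen_cut.simps(2))
      then show ?thesis using a(1) AStop g' by (simp add: arcs_G stops_def)
    qed (use a in simp)
  next
    case (Cons b m1)
    then have b: "b \<in> arcs G" "Some g = ctail b" "rep.awalk (chead b) m1 (Some h)"
      using Cons.prems(2) \<open>m' = b # m1\<close> by (auto simp: rep.awalk_Cons_iff)
    have level: "fst (snd (track (pt h) (c # n))) > 0" if "c = AEdge g' e" "rep.awalk (chead c) n (Some h)" for c g' e n
      using lp_track[of "GVert (head E e)" n h] that by (simp add: level_branch)
    have stop: "fst (snd (track (pt h) (c # n))) = 0 \<and> n = []" if "c = AStop g'" "rep.awalk (chead c) n (Some h)" for c g' n
      using rest_sink[of g' n "Some h"] that by (simp add: pt_def)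
    have eq: "track (pt h) (a # m) = track (pt h) (b # m1)" using Cons.prems(3) unfolding Cons .
    consider e f where "a = AEdge g e" "b = AEdge g f" | "a = AStop g" "b = AStop g"
      | e where "a = AEdge g e" "b = AStop g" | e where "a = AStop g" "b = AEdge g e"
      using a(2) b(2) by (cases a; cases b) auto
    then show ?thesis
    proof cases
      case 1
      have aw: "rep.awalk (Some (GVert (head E e))) m (Some h)" "rep.awalk (Some (GVert (head E f))) m1 (Some h)"
        using a(3) b(3) unfolding 1 by simp_all
      have ef: "e \<in> arcs E" "f \<in> arcs E" using a(1) b(1) unfolding 1 by (simp_all add: arcs_G)
      have eq: "branch e (track (pt h) m) = branch f (track (pt h) m1)"
        using Cons.prems(3) unfolding Cons 1 by simp
      have fib: "track (pt h) m \<in> fiber (head E e)" "track (pt h) m1 \<in> fiber (head E f)"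
        using lp_track[OF aw(1)] lp_track[OF aw(2)] by (simp_all add: fiber_def)
      from branch_eqD[OF ef eq fib] have *: "e = f" "track (pt h) m = track (pt h) m1" by simp_all
      have "m = m1" by (rule Cons.IH[OF aw(1) _ *(2)]) (use aw(2) *(1) in simp)
      then show ?thesis unfolding Cons 1 using * by simp
    next
      case 2
      then show ?thesis using stop[OF 2(1) a(3)] stop[OF 2(2) b(3)] Cons by simp
    next
      case 3
      have False using level[OF 3(1) a(3)] stop[OF 3(2) b(3)] unfolding eq by linarith
      then show ?thesis ..
    next
      case 4
      have False using stop[OF 4(1) a(3)] level[OF 4(2) b(3)] unfolding eq by linarith
      then show ?thesis ..
    qed
  qed
qed

lemma awalk_None:
  assumes "rep.awalk None m (Some h)"
  obtains i g m' where "m = ARow i g # m'" "(i, g) \<in> R" "rep.awalk (Some g) m' (Some h)"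
proof (cases m)
  case Nil
  then show ?thesis using assms by (simp add: rep.awalk_Nil_iff)
next
  case (Cons a m')
  then show ?thesis using assms that by (cases a) (auto simp: rep.awalk_Cons_iff arcs_G)
qed

lemma sp_None_entry:
  assumes "(i, g) \<in> R" "rep.awalk (Some g) m (Some h)"
  shows "rep.sp None (ARow i g # m) = munit L i 0 (lp g m)"
proof -
  have g: "gelt g \<in> carrier L" "g \<in> W" using W_facts R_W assms by auto
  have l: "lp g m \<in> carrier L" "rep.sp (Some g) m = munit L 0 0 (lp g m)" using lp_track[OF assms(2)] by auto
  have "munit L 0 0 (gelt g \<otimes>\<^bsub>L\<^esub> lp g m) = munit L 0 0 (lp g m)"
    using rep.P_sp[OF assms(2)] g l by (simp add: munit_mult)
  then have "gelt g \<otimes>\<^bsub>L\<^esub> lp g m = lp g m" by (auto simp: munit_def fun_eq_iff split: if_splits)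
  then show ?thesis using g l by (simp add: munit_mult)
qed

lemma rooted: "rooted_leavitt_rep K MatL G cP cS cS' None"
proof (intro rooted_leavitt_rep.intro rooted_leavitt_rep_axioms.intro)
  show "leavitt_rep K MatL G cP cS cS'" by (rule leavitt_rep_G)
  show "None \<in> verts G" by simp
  show "head G a \<noteq> None" if "a \<in> arcs G" for a using that by (cases a) auto
  show "out_arcs G None \<noteq> {}" using R_ne by (simp add: out_None)
  obtain i0 g0 where r0: "(i0, g0) \<in> R" using R_ne by auto
  have nz: "munit L i j (gelt g) \<noteq> \<zero>\<^bsub>MatL\<^esub>" if "g \<in> W" for i j g
  proof
    assume "munit L i j (gelt g) = \<zero>\<^bsub>MatL\<^esub>"
    then have "munit L i j (gelt g) i j = \<zero>\<^bsub>MatL\<^esub> i j" by simp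
    then show False using gelt_nonzero[OF W_facts(1)[OF that]] by (simp add: munit_def mat_alg_simps mat_zero_def)
  qed
  show "cP g \<noteq> \<zero>\<^bsub>MatL\<^esub>" if "g \<in> verts G" for g
  proof (cases g)
    case None
    have "cP None \<noteq> \<zero>\<^bsub>MatL\<^esub>"
    proof
      assume "cP None = \<zero>\<^bsub>MatL\<^esub>"
      then have "munit L i0 0 (gelt g0) = \<zero>\<^bsub>MatL\<^esub>"
        using cP_row(1)[OF r0] munit_closed[of "gelt g0" i0 0] W_facts(4)[OF R_W[OF r0]] by simp
      then show False using nz R_W[OF r0] by blast
    qed
    then show ?thesis using None by simp
  next
    case (Some h)
    then have "h \<in> W" using that by auto
    then show ?thesis using nz Some by (simp only: cP.simps not_False_eq_True)
  qed
  fix w m assume w: "w \<noteq> None" and m: "rep.awalk None m w"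
  obtain h where h: "w = Some h" using w by auto
  obtain i g m1 where m1: "m = ARow i g # m1" "(i, g) \<in> R" "rep.awalk (Some g) m1 (Some h)"
    using awalk_None m h by metis
  \<comment> \<open>Row \<open>i\<close> of a path from the root holds \<open>lp\<close> of the rest
    of the path. It turns the point mass at \<open>pt h\<close> into another point mass, which is
    evaluated at the point belonging to \<open>m\<close>.\<close>
  define f where "f X = op (X i 0) (delta (pt h)) (track (pt h) m1)" for X :: "nat \<Rightarrow> nat \<Rightarrow> ('v, 'e, 'k) lpa_term set"
  have X: "X i 0 \<in> carrier L" if "X \<in> carrier MatL" for X using that L.mat_inf_carrier by (simp add: mat_alg_simps)
  have "f (c \<odot>\<^bsub>MatL\<^esub> rep.sp None m') = (if m' = m then c else \<zero>\<^bsub>K\<^esub>)"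
    if c: "c \<in> carrier K" and m': "rep.awalk None m' w" for c m'
  proof -
    obtain j g' m2 where m2: "m' = ARow j g' # m2" "(j, g') \<in> R" "rep.awalk (Some g') m2 (Some h)"
      using awalk_None m' h by metis
    note l = lp_track[OF m2(3)] and l1 = lp_track[OF m1(3)]
    have "f (c \<odot>\<^bsub>MatL\<^esub> rep.sp None m') = op (c \<odot>\<^bsub>L\<^esub> (if j = i then lp g' m2 else \<zero>\<^bsub>L\<^esub>)) (delta (pt h)) (track (pt h) m1)"
      unfolding f_def m2(1) sp_None_entry[OF m2(2,3)] by (simp add: mat_alg_simps munit_def)
    also have "\<dots> = c \<otimes>\<^bsub>K\<^esub> (if j = i then delta (track (pt h) m2) (track (pt h) m1) else \<zero>\<^bsub>K\<^esub>)"
      using c l by (auto simp: op_smult delta_closed op_zero)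
    also have "\<dots> = (if m' = m then c else \<zero>\<^bsub>K\<^esub>)"
    proof (cases "j = i \<and> track (pt h) m1 = track (pt h) m2")
      case True
      \<comment> \<open>Equal points lie over the same vertex, and within one row the base
        determines the generator.\<close>
      then have "gen_base g' = gen_base g" using l l1 by metis
      then have "g' = g" using R_base m2(2) m1(2) True by blast
      then have "m1 = m2" using track_inj[OF m1(3)] m2(3) True by blast
      then show ?thesis using True \<open>g' = g\<close> c by (simp add: delta_def m1(1) m2(1))
    next
      case False
      then have "m' \<noteq> m" using m1(1) m2(1) by auto
      then show ?thesis using False c by (auto simp: delta_def)
    qed
    finally show ?thesis .
  qed
  moreover have "f \<in> carrier MatL \<rightarrow> carrier K" using X by (auto simp: f_def op_closed delta_closed)
  moreover have "f (X \<oplus>\<^bsub>MatL\<^esub> Y) = f X \<oplus>\<^bsub>K\<^esub> f Y" if "X \<in> carrier MatL" "Y \<in> carrier MatL" for X Y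
    using X that by (simp add: f_def mat_alg_simps(4) op_add delta_closed)
  ultimately show "\<exists>f. f \<in> carrier MatL \<rightarrow> carrier K \<and>
      (\<forall>x\<in>carrier MatL. \<forall>y\<in>carrier MatL. f (x \<oplus>\<^bsub>MatL\<^esub> y) = f x \<oplus>\<^bsub>K\<^esub> f y) \<and>
      (\<forall>c\<in>carrier K. \<forall>m'. rep.awalk None m' w \<longrightarrow>
        f (c \<odot>\<^bsub>MatL\<^esub> rep.sp None m') = (if m' = m then c else \<zero>\<^bsub>K\<^esub>))"
    by blast
qed

end

context nu_ring
begin

lemma mat_times_munit_munit:
  assumes "X \<in> mat_inf R" "x \<in> carrier R" "y \<in> carrier R"
  shows "mat_times R (mat_times R (munit R 0 i x) X) (munit R j 0 y) = munit R 0 0 (x \<otimes> X i j \<otimes> y)"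
proof (intro ext)
  fix k l
  have "mat_times R (munit R 0 i x) X \<in> mat_inf R"
    using assms by (intro mat_times_inf_closed munit_closed)
  then show "mat_times R (mat_times R (munit R 0 i x) X) (munit R j 0 y) k l = munit R 0 0 (x \<otimes> X i j \<otimes> y) k l"
    using assms by (simp add: munit_times_right munit_times_left) (simp add: munit_def)
qed

end

context lpa_setup
begin

text \<open>It serves to bound the generators that occur in a term. The classes of its terms are
  still taken in \<open>L\<close>, and the relations of a smaller path algebra never enter.\<close>

definition "subg U T = \<lparr>verts = U, arcs = T, tail = tail E, head = head E\<rparr>"

lemma subg_terms:
  assumes "x \<in> lpa_terms K (subg U T)" "U \<subseteq> verts E" "T \<subseteq> arcs E"
  shows "x \<in> lpa_terms K E"
  using assms(1) by (induction rule: lpa_terms.induct) (use assms(2,3) in \<open>auto simp: subg_def intro: lpa_terms.intros\<close>)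

lemma cls_neg: "x \<in> lpa_terms K E \<Longrightarrow> cls (TNeg x) = \<ominus>\<^bsub>L\<^esub> cls x"
  by (rule L.minus_equality[symmetric])
    (auto simp: L_ops lpa_terms.intros cls_carrier intro!: cls_eqI lpa_cong.add_neg)

lemma geval_sum:
  assumes "finite J" "\<And>j. j \<in> J \<Longrightarrow> h j \<in> mbar_gens E"
  shows "geval (\<Sum>j\<in>J. {#h j#}) = finprod V (\<lambda>j. gval (h j)) J"
proof -
  interpret V: comm_monoid V by (rule L.V_comm_monoid)
  show ?thesis using assms
  proof (induction J rule: finite_induct)
    case empty then show ?case by (simp add: geval_empty)
  next
    case (insert i J)
    then show ?case by (simp add: geval_add_mset gval_closed Pi_def)
  qed
qed

lemma munit_neg:
  assumes "x \<in> carrier L" shows "munit L i j (\<ominus>\<^bsub>L\<^esub> x) = \<ominus>\<^bsub>MatL\<^esub> munit L i j x"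
  using assms
  by (intro LM.M.minus_equality[symmetric])
    (auto simp: mat_alg_simps L.munit_closed, auto simp: fun_eq_iff mat_alg_simps munit_def mat_zero_def L.l_neg)

lemma munit_smult: "c \<in> carrier K \<Longrightarrow> munit L i j (c \<odot>\<^bsub>L\<^esub> x) = c \<odot>\<^bsub>MatL\<^esub> munit L i j x"
  by (auto simp: fun_eq_iff mat_alg_simps munit_def L.smult_r_null)

lemma munit_sandwich:
  assumes "X \<in> carrier MatL" "x \<in> carrier L" "y \<in> carrier L"
  shows "munit L 0 i x \<otimes>\<^bsub>MatL\<^esub> X \<otimes>\<^bsub>MatL\<^esub> munit L j 0 y = munit L 0 0 (x \<otimes>\<^bsub>L\<^esub> X i j \<otimes>\<^bsub>L\<^esub> y)"
  using L.mat_times_munit_munit[of X x y i j] assms by (simp add: mat_alg_simps)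

end

sublocale cut_graph \<subseteq> rep: rooted_leavitt_rep K MatL G cP cS cS' None
  by (rule rooted)

section \<open>Corners of the algebra inside the span of paths\<close>

context cut_graph
begin

definition "V0 = {v. GVert v \<in> W}"
text \<open>A local unit: \<open>L\<close> itself need not have a unit when there are infinitely
  many vertices.\<close>

definition "uV = (\<Oplus>\<^bsub>L\<^esub>v\<in>V0. lpa_p K E v)"
abbreviation "Lsub \<equiv> cls ` lpa_terms K (subg V0 T)"

lemma V0: "finite V0" "V0 \<subseteq> verts E"
proof -
  have "finite (GVert -` W :: 'v set)" using finW by (rule finite_vimageI) (auto simp: inj_on_def)
  then show "finite V0" by (simp add: V0_def vimage_def)
  show "V0 \<subseteq> verts E" using W_facts(2) by (force simp: V0_def)
qed

lemma uV_closed: "uV \<in> carrier L"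
  unfolding uV_def using V0 p_closed by (intro L.finsum_closed) auto

lemma uV_p:
  assumes "v \<in> V0" shows "uV \<otimes>\<^bsub>L\<^esub> lpa_p K E v = lpa_p K E v" "lpa_p K E v \<otimes>\<^bsub>L\<^esub> uV = lpa_p K E v"
proof -
  have pc: "lpa_p K E w \<in> carrier L" if "w \<in> V0" for w using V0 that p_closed by auto
  have pp: "lpa_p K E w \<otimes>\<^bsub>L\<^esub> lpa_p K E v = (if v = w then lpa_p K E w else \<zero>\<^bsub>L\<^esub>)"
    "lpa_p K E v \<otimes>\<^bsub>L\<^esub> lpa_p K E w = (if v = w then lpa_p K E w else \<zero>\<^bsub>L\<^esub>)" if "w \<in> V0" for w
    using V0(2) that assms p_orth[of w v] p_orth[of v w] p_idem[of v] by (auto simp del: L_mult)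
  have s: "(\<Oplus>\<^bsub>L\<^esub>w\<in>V0. if v = w then lpa_p K E w else \<zero>\<^bsub>L\<^esub>) = lpa_p K E v"
    using assms V0(1) pc by (intro L.add.finprod_singleton) auto
  have "uV \<otimes>\<^bsub>L\<^esub> lpa_p K E v = (\<Oplus>\<^bsub>L\<^esub>w\<in>V0. lpa_p K E w \<otimes>\<^bsub>L\<^esub> lpa_p K E v)"
    unfolding uV_def using V0(1) pc assms by (intro L.finsum_ldistr') auto
  also have "\<dots> = (\<Oplus>\<^bsub>L\<^esub>w\<in>V0. if v = w then lpa_p K E w else \<zero>\<^bsub>L\<^esub>)"
    using pc pp by (intro L.finsum_cong') simp_all
  also note s
  finally show "uV \<otimes>\<^bsub>L\<^esub> lpa_p K E v = lpa_p K E v" .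
  have "lpa_p K E v \<otimes>\<^bsub>L\<^esub> uV = (\<Oplus>\<^bsub>L\<^esub>w\<in>V0. lpa_p K E v \<otimes>\<^bsub>L\<^esub> lpa_p K E w)"
    unfolding uV_def using V0(1) pc assms by (intro L.finsum_rdistr') auto
  also have "\<dots> = (\<Oplus>\<^bsub>L\<^esub>w\<in>V0. if v = w then lpa_p K E w else \<zero>\<^bsub>L\<^esub>)"
    using pc pp by (intro L.finsum_cong') simp_all
  also note s
  finally show "lpa_p K E v \<otimes>\<^bsub>L\<^esub> uV = lpa_p K E v" .
qed

lemma Lsub_carrier: "X \<in> Lsub \<Longrightarrow> X \<in> carrier L"
  using subg_terms[OF _ V0(2) T_arcs] cls_carrier by auto

lemma T_V0: "e \<in> T \<Longrightarrow> tail E e \<in> V0 \<and> head E e \<in> V0"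
  using T_verts by (simp add: V0_def)

lemma uV_unit:
  assumes "X \<in> Lsub" shows "uV \<otimes>\<^bsub>L\<^esub> X = X \<and> X \<otimes>\<^bsub>L\<^esub> uV = X"
proof -
  have "uV \<otimes>\<^bsub>L\<^esub> cls x = cls x \<and> cls x \<otimes>\<^bsub>L\<^esub> uV = cls x" if "x \<in> lpa_terms K (subg V0 T)" for x
    using that
  proof (induction rule: lpa_terms.induct)
    case (1 v)
    then show ?case using uV_p[of v] by (simp add: subg_def lpa_p_def)
  next
    case (2 e)
    then have e: "e \<in> T" "e \<in> arcs E" using T_arcs by (auto simp: subg_def)
    have t: "lpa_t K E e = cls (TEdge e)" by (simp add: lpa_t_def)
    have pc: "lpa_p K E (tail E e) \<in> carrier L" "lpa_p K E (head E e) \<in> carrier L" "lpa_t K E e \<in> carrier L"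
      using e p_closed t_closed by auto
    show ?case
      using L.m_assoc[OF uV_closed pc(1,3)] L.m_assoc[OF pc(3,2) uV_closed] p_t[OF e(2)] t_p[OF e(2)]
        uV_p T_V0[OF e(1)] unfolding t[symmetric] by metis
  next
    case (3 e)
    then have e: "e \<in> T" "e \<in> arcs E" using T_arcs by (auto simp: subg_def)
    have t: "lpa_t_star K E e = cls (TGhost e)" by (simp add: lpa_t_star_def)
    have pc: "lpa_p K E (head E e) \<in> carrier L" "lpa_p K E (tail E e) \<in> carrier L" "lpa_t_star K E e \<in> carrier L"
      using e p_closed t_star_closed by auto
    show ?case
      using L.m_assoc[OF uV_closed pc(1,3)] L.m_assoc[OF pc(3,2) uV_closed] p_t_star[OF e(2)] t_star_p[OF e(2)]
        uV_p T_V0[OF e(1)] unfolding t[symmetric] by metis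
  next
    case 4
    then show ?case using uV_closed by (simp add: L_zero[symmetric])
  next
    case (5 x)
    then have "x \<in> lpa_terms K E" using subg_terms V0(2) T_arcs by blast
    then show ?case using 5 uV_closed cls_carrier by (simp add: cls_neg L.l_minus L.r_minus)
  next
    case (6 x y)
    then have "x \<in> lpa_terms K E" "y \<in> lpa_terms K E" using subg_terms V0(2) T_arcs by blast+
    then show ?case using 6 uV_closed cls_carrier by (simp add: L_add[symmetric] L.l_distr L.r_distr)
  next
    case (7 x y)
    then have xy: "x \<in> lpa_terms K E" "y \<in> lpa_terms K E" using subg_terms V0(2) T_arcs by blast+
    then have c: "cls x \<in> carrier L" "cls y \<in> carrier L" using cls_carrier by auto
    then show ?case using 7 L.m_assoc[OF uV_closed c] L.m_assoc[OF c uV_closed] unfolding L_mult[OF xy, symmetric] by simp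
  next
    case (8 c x)
    then have x: "x \<in> lpa_terms K E" using subg_terms V0(2) T_arcs by blast
    then show ?case using 8 uV_closed cls_carrier
      by (simp add: L_smult[symmetric] L.smult_mult_left L.smult_mult_right)
  qed
  then show ?thesis using assms by auto
qed

text \<open>A corner of a product involves the corners of both factors at all intermediate vertices,
  which is why the induction runs over arbitrary \<open>v\<close> and \<open>w\<close>.\<close>

lemma corner_Lspan:
  assumes "X \<in> Lsub" "v \<in> V0" "w \<in> V0"
  shows "munit L 0 0 (lpa_p K E v \<otimes>\<^bsub>L\<^esub> X \<otimes>\<^bsub>L\<^esub> lpa_p K E w) \<in> rep.Lspan (Some (GVert v)) (Some (GVert w))"
proof -
  have GV: "Some (GVert v) \<in> verts G" if "v \<in> V0" for v using that by (simp add: V0_def)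
  have pc: "lpa_p K E w \<in> carrier L" "lpa_p K E w \<otimes>\<^bsub>L\<^esub> lpa_p K E w = lpa_p K E w" if "w \<in> V0" for w
    using V0 that p_closed p_idem by auto
  have po: "lpa_p K E w \<otimes>\<^bsub>L\<^esub> lpa_p K E w' = \<zero>\<^bsub>L\<^esub>" if "w \<in> V0" "w' \<in> V0" "w \<noteq> w'" for w w'
    using V0 that p_orth by auto
  have P: "munit L 0 0 (lpa_p K E w) \<in> rep.Lspan (Some (GVert w)) (Some (GVert w))" if "w \<in> V0" for w
    using rep.P_Lspan[OF GV[OF that]] V0 that by (simp add: gelt_GVert subset_iff)
  note zero = LM.M.kspan.zero[of "rep.Lgen (Some (GVert v)) (Some (GVert w))" for v w, unfolded munit_zero[of 0 0, symmetric]]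
  have "munit L 0 0 (lpa_p K E v \<otimes>\<^bsub>L\<^esub> cls x \<otimes>\<^bsub>L\<^esub> lpa_p K E w) \<in> rep.Lspan (Some (GVert v)) (Some (GVert w))"
    if "x \<in> lpa_terms K (subg V0 T)" "v \<in> V0" "w \<in> V0" for x v w
    using that
  proof (induction arbitrary: v w rule: lpa_terms.induct)
    case (1 u)
    then have u: "u \<in> V0" by (simp add: subg_def)
    have "lpa_p K E v \<otimes>\<^bsub>L\<^esub> lpa_p K E u \<otimes>\<^bsub>L\<^esub> lpa_p K E w = (if v = u \<and> u = w then lpa_p K E v else \<zero>\<^bsub>L\<^esub>)"
      using u 1 pc po by (cases "v = u"; cases "u = w") simp_all
    then show ?case using P zero 1 by (simp add: lpa_p_def[symmetric])
  next
    case (2 e)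
    then have e: "e \<in> T" "e \<in> arcs E" using T_arcs by (auto simp: subg_def)
    have ta: "tail E e \<in> V0" "head E e \<in> V0" using T_V0[OF e(1)] by auto
    have tc: "lpa_t K E e \<in> carrier L" using t_closed[OF e(2)] .
    have l: "lpa_p K E v \<otimes>\<^bsub>L\<^esub> lpa_t K E e = (if v = tail E e then lpa_t K E e else \<zero>\<^bsub>L\<^esub>)"
      using L.m_assoc[OF pc(1)[OF 2(2)] pc(1)[OF ta(1)] tc] p_t[OF e(2)] po[OF 2(2) ta(1)] tc by (cases "v = tail E e") simp_all
    have r: "lpa_t K E e \<otimes>\<^bsub>L\<^esub> lpa_p K E w = (if w = head E e then lpa_t K E e else \<zero>\<^bsub>L\<^esub>)"
      using L.m_assoc[OF tc pc(1)[OF ta(2)] pc(1)[OF 2(3)]] t_p[OF e(2)] po[OF ta(2) 2(3)] tc by (cases "w = head E e") simp_all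
    have a: "AEdge (GVert (tail E e)) e \<in> arcs G" using e ta by (simp add: arcs_G V0_def)
    then have "munit L 0 0 (lpa_t K E e) \<in> rep.Lspan (Some (GVert (tail E e))) (Some (GVert (head E e)))"
      using rep.S_Lspan[OF a] by simp
    then show ?case using l r zero pc(1)[OF 2(3)] unfolding lpa_t_def[symmetric] by (simp del: L_mult)
  next
    case (3 e)
    then have e: "e \<in> T" "e \<in> arcs E" using T_arcs by (auto simp: subg_def)
    have ta: "tail E e \<in> V0" "head E e \<in> V0" using T_V0[OF e(1)] by auto
    have tc: "lpa_t_star K E e \<in> carrier L" using t_star_closed[OF e(2)] .
    have l: "lpa_p K E v \<otimes>\<^bsub>L\<^esub> lpa_t_star K E e = (if v = head E e then lpa_t_star K E e else \<zero>\<^bsub>L\<^esub>)"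
      using L.m_assoc[OF pc(1)[OF 3(2)] pc(1)[OF ta(2)] tc] p_t_star[OF e(2)] po[OF 3(2) ta(2)] tc by (cases "v = head E e") simp_all
    have r: "lpa_t_star K E e \<otimes>\<^bsub>L\<^esub> lpa_p K E w = (if w = tail E e then lpa_t_star K E e else \<zero>\<^bsub>L\<^esub>)"
      using L.m_assoc[OF tc pc(1)[OF ta(1)] pc(1)[OF 3(3)]] t_star_p[OF e(2)] po[OF ta(1) 3(3)] tc by (cases "w = tail E e") simp_all
    have a: "AEdge (GVert (tail E e)) e \<in> arcs G" using e ta by (simp add: arcs_G V0_def)
    then have "munit L 0 0 (lpa_t_star K E e) \<in> rep.Lspan (Some (GVert (head E e))) (Some (GVert (tail E e)))"
      using rep.S'_Lspan[OF a] by simp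
    then show ?case using l r zero pc(1)[OF 3(3)] unfolding lpa_t_star_def[symmetric] by (simp del: L_mult)
  next
    case 4
    then show ?case using pc zero by (simp add: L_zero[symmetric])
  next
    case (5 x)
    then have x: "x \<in> lpa_terms K E" using subg_terms V0(2) T_arcs by blast
    have c: "cls x \<in> carrier L" "lpa_p K E v \<in> carrier L" "lpa_p K E w \<in> carrier L" using x cls_carrier pc 5 by auto
    have "lpa_p K E v \<otimes>\<^bsub>L\<^esub> cls (TNeg x) \<otimes>\<^bsub>L\<^esub> lpa_p K E w = \<ominus>\<^bsub>L\<^esub> (lpa_p K E v \<otimes>\<^bsub>L\<^esub> cls x \<otimes>\<^bsub>L\<^esub> lpa_p K E w)"
      unfolding cls_neg[OF x] using c by (simp only: L.l_minus L.r_minus L.m_closed)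
    then show ?case using 5 c by (simp only: munit_neg L.m_closed LM.M.kspan_minus rep.Lgen_carrier)
  next
    case (6 x y)
    then have x: "x \<in> lpa_terms K E" "y \<in> lpa_terms K E" using subg_terms V0(2) T_arcs by blast+
    have c: "cls x \<in> carrier L" "cls y \<in> carrier L" "lpa_p K E v \<in> carrier L" "lpa_p K E w \<in> carrier L"
      using x cls_carrier pc 6 by auto
    have "lpa_p K E v \<otimes>\<^bsub>L\<^esub> cls (TAdd x y) \<otimes>\<^bsub>L\<^esub> lpa_p K E w =
        lpa_p K E v \<otimes>\<^bsub>L\<^esub> cls x \<otimes>\<^bsub>L\<^esub> lpa_p K E w \<oplus>\<^bsub>L\<^esub> lpa_p K E v \<otimes>\<^bsub>L\<^esub> cls y \<otimes>\<^bsub>L\<^esub> lpa_p K E w"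
      unfolding L_add[OF x, symmetric] using c by (simp only: L.l_distr L.r_distr L.m_closed)
    then show ?case using 6 c by (simp only: munit_add L.m_closed LM.M.kspan_add rep.Lgen_carrier)
  next
    case (7 x y)
    then have x: "x \<in> lpa_terms K E" "y \<in> lpa_terms K E" using subg_terms V0(2) T_arcs by blast+
    define X Y p p' where "X = cls x" and "Y = cls y" and "p = lpa_p K E v" and "p' = lpa_p K E w"
    have c: "X \<in> carrier L" "Y \<in> carrier L" "p \<in> carrier L" "p' \<in> carrier L"
      unfolding X_def Y_def p_def p'_def using x cls_carrier pc 7 by auto
    \<comment> \<open>The local unit is put between the factors and expanded as a sum of vertices,
      which splits the product into products of corners.\<close>
    have Xu: "X \<otimes>\<^bsub>L\<^esub> uV = X" using uV_unit[of X] 7 by (simp add: X_def)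
    have "p \<otimes>\<^bsub>L\<^esub> (X \<otimes>\<^bsub>L\<^esub> Y) \<otimes>\<^bsub>L\<^esub> p' = (p \<otimes>\<^bsub>L\<^esub> X) \<otimes>\<^bsub>L\<^esub> uV \<otimes>\<^bsub>L\<^esub> (Y \<otimes>\<^bsub>L\<^esub> p')"
    proof -
      have "p \<otimes>\<^bsub>L\<^esub> (X \<otimes>\<^bsub>L\<^esub> Y) \<otimes>\<^bsub>L\<^esub> p' = p \<otimes>\<^bsub>L\<^esub> (X \<otimes>\<^bsub>L\<^esub> uV) \<otimes>\<^bsub>L\<^esub> (Y \<otimes>\<^bsub>L\<^esub> p')"
        unfolding Xu using c by (simp only: L.m_assoc L.m_closed)
      then show ?thesis using c uV_closed by (simp only: L.m_assoc L.m_closed)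
    qed
    also have "\<dots> = (\<Oplus>\<^bsub>L\<^esub>u\<in>V0. (p \<otimes>\<^bsub>L\<^esub> X) \<otimes>\<^bsub>L\<^esub> lpa_p K E u) \<otimes>\<^bsub>L\<^esub> (Y \<otimes>\<^bsub>L\<^esub> p')"
      unfolding uV_def using V0(1) c pc by (subst L.finsum_rdistr') auto
    also have "\<dots> = (\<Oplus>\<^bsub>L\<^esub>u\<in>V0. (p \<otimes>\<^bsub>L\<^esub> X) \<otimes>\<^bsub>L\<^esub> lpa_p K E u \<otimes>\<^bsub>L\<^esub> (Y \<otimes>\<^bsub>L\<^esub> p'))"
      using V0(1) c pc by (intro L.finsum_ldistr') auto
    also have "\<dots> = (\<Oplus>\<^bsub>L\<^esub>u\<in>V0. (p \<otimes>\<^bsub>L\<^esub> X \<otimes>\<^bsub>L\<^esub> lpa_p K E u) \<otimes>\<^bsub>L\<^esub> (lpa_p K E u \<otimes>\<^bsub>L\<^esub> Y \<otimes>\<^bsub>L\<^esub> p'))"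
    proof (rule L.finsum_cong')
      fix u assume u: "u \<in> V0"
      have "(p \<otimes>\<^bsub>L\<^esub> X) \<otimes>\<^bsub>L\<^esub> (lpa_p K E u \<otimes>\<^bsub>L\<^esub> lpa_p K E u) \<otimes>\<^bsub>L\<^esub> (Y \<otimes>\<^bsub>L\<^esub> p') =
          (p \<otimes>\<^bsub>L\<^esub> X \<otimes>\<^bsub>L\<^esub> lpa_p K E u) \<otimes>\<^bsub>L\<^esub> (lpa_p K E u \<otimes>\<^bsub>L\<^esub> Y \<otimes>\<^bsub>L\<^esub> p')"
        using c pc(1)[OF u] by (simp only: L.m_assoc L.m_closed)
      then show "(p \<otimes>\<^bsub>L\<^esub> X) \<otimes>\<^bsub>L\<^esub> lpa_p K E u \<otimes>\<^bsub>L\<^esub> (Y \<otimes>\<^bsub>L\<^esub> p') =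
          (p \<otimes>\<^bsub>L\<^esub> X \<otimes>\<^bsub>L\<^esub> lpa_p K E u) \<otimes>\<^bsub>L\<^esub> (lpa_p K E u \<otimes>\<^bsub>L\<^esub> Y \<otimes>\<^bsub>L\<^esub> p')"
        using pc(2)[OF u] by simp
    qed (use c pc in auto)
    finally have eq: "p \<otimes>\<^bsub>L\<^esub> (X \<otimes>\<^bsub>L\<^esub> Y) \<otimes>\<^bsub>L\<^esub> p' =
      (\<Oplus>\<^bsub>L\<^esub>u\<in>V0. (p \<otimes>\<^bsub>L\<^esub> X \<otimes>\<^bsub>L\<^esub> lpa_p K E u) \<otimes>\<^bsub>L\<^esub> (lpa_p K E u \<otimes>\<^bsub>L\<^esub> Y \<otimes>\<^bsub>L\<^esub> p'))" .
    have "munit L 0 0 (p \<otimes>\<^bsub>L\<^esub> (X \<otimes>\<^bsub>L\<^esub> Y) \<otimes>\<^bsub>L\<^esub> p') =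
        (\<Oplus>\<^bsub>MatL\<^esub>u\<in>V0. munit L 0 0 ((p \<otimes>\<^bsub>L\<^esub> X \<otimes>\<^bsub>L\<^esub> lpa_p K E u) \<otimes>\<^bsub>L\<^esub> (lpa_p K E u \<otimes>\<^bsub>L\<^esub> Y \<otimes>\<^bsub>L\<^esub> p')))"
      unfolding eq using V0(1) c pc by (intro munit_finsum) auto
    also have "\<dots> \<in> rep.Lspan (Some (GVert v)) (Some (GVert w))"
    proof (rule LM.M.kspan_finsum[OF V0(1) _ rep.Lgen_carrier])
      fix u assume u: "u \<in> V0"
      have "munit L 0 0 ((p \<otimes>\<^bsub>L\<^esub> X \<otimes>\<^bsub>L\<^esub> lpa_p K E u) \<otimes>\<^bsub>L\<^esub> (lpa_p K E u \<otimes>\<^bsub>L\<^esub> Y \<otimes>\<^bsub>L\<^esub> p')) =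
          munit L 0 0 (p \<otimes>\<^bsub>L\<^esub> X \<otimes>\<^bsub>L\<^esub> lpa_p K E u) \<otimes>\<^bsub>MatL\<^esub> munit L 0 0 (lpa_p K E u \<otimes>\<^bsub>L\<^esub> Y \<otimes>\<^bsub>L\<^esub> p')"
        using c pc(1)[OF u] by (simp add: munit_mult)
      then show "munit L 0 0 ((p \<otimes>\<^bsub>L\<^esub> X \<otimes>\<^bsub>L\<^esub> lpa_p K E u) \<otimes>\<^bsub>L\<^esub> (lpa_p K E u \<otimes>\<^bsub>L\<^esub> Y \<otimes>\<^bsub>L\<^esub> p')) \<in> rep.Lspan (Some (GVert v)) (Some (GVert w))"
        using rep.Lspan_mult[OF 7(3)[OF 7(5) u] 7(4)[OF u 7(6)]] by (simp add: X_def Y_def p_def p'_def)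
    qed
    finally show ?case unfolding X_def Y_def p_def p'_def L_mult[OF x] .
  next
    case (8 k x)
    then have x: "x \<in> lpa_terms K E" using subg_terms V0(2) T_arcs by blast
    have c: "cls x \<in> carrier L" "lpa_p K E v \<in> carrier L" "lpa_p K E w \<in> carrier L" using x cls_carrier pc 8 by auto
    have "lpa_p K E v \<otimes>\<^bsub>L\<^esub> cls (TScal k x) \<otimes>\<^bsub>L\<^esub> lpa_p K E w = k \<odot>\<^bsub>L\<^esub> (lpa_p K E v \<otimes>\<^bsub>L\<^esub> cls x \<otimes>\<^bsub>L\<^esub> lpa_p K E w)"
      unfolding L_smult[OF 8(1) x, symmetric] using c 8(1) by (simp only: L.smult_mult_left L.smult_mult_right L.m_closed)
    then show ?case using 8 c by (simp only: munit_smult L.m_closed LM.M.kspan_smult rep.Lgen_carrier)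
  qed
  then show ?thesis using assms by auto
qed

text \<open>If the cut of \<open>g\<close> is not yet full, no edge of \<open>G\<close> joins
  \<open>GVert v\<close> to \<open>g\<close>. The two are then related through the edges out of
  \<open>g\<close>, each of which has a copy at \<open>GVert v\<close> with the same head and the
  same matrix.\<close>

lemma gelt_Lspan:
  assumes "g \<in> W"
  shows "munit L 0 0 (gelt g) \<in> rep.Lspan (Some g) (Some (GVert (gen_base g)))"
    "munit L 0 0 (gelt g) \<in> rep.Lspan (Some (GVert (gen_base g))) (Some g)"
proof -
  have P: "munit L 0 0 (gelt g) \<in> rep.Lspan (Some g) (Some g)" using rep.P_Lspan[of "Some g"] assms by simp
  show "munit L 0 0 (gelt g) \<in> rep.Lspan (Some g) (Some (GVert (gen_base g)))"
    "munit L 0 0 (gelt g) \<in> rep.Lspan (Some (GVert (gen_base g))) (Some g)"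
  proof (atomize (full), cases g)
    case (GVert v)
    then show "munit L 0 0 (gelt g) \<in> rep.Lspan (Some g) (Some (GVert (gen_base g))) \<and>
        munit L 0 0 (gelt g) \<in> rep.Lspan (Some (GVert (gen_base g))) (Some g)" using P by simp
  next
    case (GCut v C)
    have inf: "infinite_emitter E v" "C \<noteq> {}" using W_facts(1)[OF assms] GCut by (auto simp: mbar_gens_def)
    have v: "GVert v \<in> W" using W_base[OF assms] GCut by simp
    have Cf: "C \<subseteq> full g" using W_facts(3)[OF assms] GCut by simp
    then have sv: "stops (GVert v)" using inf GCut by (auto simp: stops_def)
    have av: "AStop (GVert v) \<in> arcs G" using v sv by (simp add: arcs_G)
    have rest_eq: "rest g = rest (GVert v)" using GCut by simp
    show "munit L 0 0 (gelt g) \<in> rep.Lspan (Some g) (Some (GVert (gen_base g))) \<and>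
        munit L 0 0 (gelt g) \<in> rep.Lspan (Some (GVert (gen_base g))) (Some g)"
    proof (cases "C = full g")
      case True
      then have g: "g = rest (GVert v)" using GCut by simp
      then have "chead (AStop (GVert v)) = Some g" "cS (AStop (GVert v)) = munit L 0 0 (gelt g)"
        "cS' (AStop (GVert v)) = munit L 0 0 (gelt g)" by simp_all
      then show ?thesis using rep.S_Lspan[OF av] rep.S'_Lspan[OF av] GCut by simp
    next
      case False
      then have sg: "stops g" using inf GCut by (simp add: stops_def)
      have ne: "out_arcs G (Some g) \<noteq> {}" using out_Some[OF assms] sg by simp
      have c: "munit L 0 0 (gelt g) \<in> carrier MatL" using W_facts(4)[OF assms] by (rule munit_closed)
      have e_arc: "AEdge (GVert v) e \<in> arcs G" if "AEdge g e \<in> arcs G" for e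
        using that v GCut by (simp add: arcs_G)
      have idem: "munit L 0 0 (gelt g) \<otimes>\<^bsub>MatL\<^esub> munit L 0 0 (gelt g) = munit L 0 0 (gelt g)"
        using W_facts[OF assms] gelt_idem by (simp add: munit_mult)
      have "munit L 0 0 (gelt g) \<in> rep.Lspan (Some g) (Some (GVert v))"
      proof (rule rep.Lspan_expand_left[OF _ ne c])
        fix a assume a: "a \<in> out_arcs G (Some g)"
        then have "cS' a \<otimes>\<^bsub>MatL\<^esub> munit L 0 0 (gelt g) = cS' a" using rep.S'_P[of a] by simp
        moreover have "cS' a \<in> rep.Lspan (head G a) (Some (GVert v))"
        proof (cases a)
          case (AEdge g' e)
          then have "AEdge g e \<in> arcs G" "g' = g" using a by auto
          then show ?thesis using rep.S'_Lspan[OF e_arc[of e]] AEdge by simp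
        next
          case (AStop g')
          then have "g' = g" using a by auto
          then show ?thesis using rep.S'_Lspan[OF av] AStop GCut by simp
        qed (use a in auto)
        ultimately show "cS' a \<otimes>\<^bsub>MatL\<^esub> munit L 0 0 (gelt g) \<in> rep.Lspan (head G a) (Some (GVert v))" by simp
      qed (use assms idem in simp_all)
      moreover have "munit L 0 0 (gelt g) \<in> rep.Lspan (Some (GVert v)) (Some g)"
      proof (rule rep.Lspan_expand_right[OF _ ne c])
        fix a assume a: "a \<in> out_arcs G (Some g)"
        then have "munit L 0 0 (gelt g) \<otimes>\<^bsub>MatL\<^esub> cS a = cS a" using rep.P_S[of a] by simp
        moreover have "cS a \<in> rep.Lspan (Some (GVert v)) (head G a)"
        proof (cases a)
          case (AEdge g' e)
          then have "AEdge g e \<in> arcs G" "g' = g" using a by auto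
          then show ?thesis using rep.S_Lspan[OF e_arc[of e]] AEdge by simp
        next
          case (AStop g')
          then have "g' = g" using a by auto
          then show ?thesis using rep.S_Lspan[OF av] AStop GCut by simp
        qed (use a in auto)
        ultimately show "munit L 0 0 (gelt g) \<otimes>\<^bsub>MatL\<^esub> cS a \<in> rep.Lspan (Some (GVert v)) (head G a)" by simp
      qed (use assms idem in simp_all)
      ultimately show ?thesis using GCut by simp
    qed
  qed
qed

lemma gelt_corner_Lspan:
  assumes "g \<in> W" "h \<in> W" "X \<in> Lsub"
  shows "munit L 0 0 (gelt g \<otimes>\<^bsub>L\<^esub> X \<otimes>\<^bsub>L\<^esub> gelt h) \<in> rep.Lspan (Some g) (Some h)"
proof -
  let ?p = "lpa_p K E (gen_base g)" and ?q = "lpa_p K E (gen_base h)"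
  have V: "gen_base g \<in> V0" "gen_base h \<in> V0" using assms W_base by (auto simp: V0_def)
  have c: "gelt g \<in> carrier L" "gelt h \<in> carrier L" "X \<in> carrier L" "?p \<in> carrier L" "?q \<in> carrier L"
    using assms W_facts Lsub_carrier p_closed by auto
  have "(gelt g \<otimes>\<^bsub>L\<^esub> ?p) \<otimes>\<^bsub>L\<^esub> X \<otimes>\<^bsub>L\<^esub> (?q \<otimes>\<^bsub>L\<^esub> gelt h) = gelt g \<otimes>\<^bsub>L\<^esub> (?p \<otimes>\<^bsub>L\<^esub> X \<otimes>\<^bsub>L\<^esub> ?q) \<otimes>\<^bsub>L\<^esub> gelt h"
    using c by (simp only: L.m_assoc L.m_closed)
  then have eq: "gelt g \<otimes>\<^bsub>L\<^esub> X \<otimes>\<^bsub>L\<^esub> gelt h = gelt g \<otimes>\<^bsub>L\<^esub> (?p \<otimes>\<^bsub>L\<^esub> X \<otimes>\<^bsub>L\<^esub> ?q) \<otimes>\<^bsub>L\<^esub> gelt h"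
    using p_gelt(2)[OF W_facts(1)[OF assms(1)]] p_gelt(1)[OF W_facts(1)[OF assms(2)]] by simp
  have "munit L 0 0 (gelt g \<otimes>\<^bsub>L\<^esub> X \<otimes>\<^bsub>L\<^esub> gelt h) =
      munit L 0 0 (gelt g) \<otimes>\<^bsub>MatL\<^esub> munit L 0 0 (?p \<otimes>\<^bsub>L\<^esub> X \<otimes>\<^bsub>L\<^esub> ?q) \<otimes>\<^bsub>MatL\<^esub> munit L 0 0 (gelt h)"
    unfolding eq using c by (simp add: munit_mult)
  then show ?thesis
    using rep.Lspan_mult[OF rep.Lspan_mult[OF gelt_Lspan(1)[OF assms(1)] corner_Lspan[OF assms(3) V]] gelt_Lspan(2)[OF assms(2)]]
    by simp
qed

text \<open>Expanding at the root on both sides reduces membership of \<open>e\<close> to corners of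
  its entries. The vertices that \<open>idempotent_resolution\<close> returns differ from the root,
  so they are generators, and \<open>idem_class_resolution\<close> adds up their classes.\<close>

lemma idem_class_geval:
  assumes e: "e \<in> idem_mats L" "cP None \<otimes>\<^bsub>MatL\<^esub> e = e" "e \<otimes>\<^bsub>MatL\<^esub> cP None = e"
    and entries: "\<And>i j. e i j \<in> Lsub"
  shows "\<exists>m\<in>mbar_words E. idem_class L e = geval m"
proof -
  have ec: "e \<in> carrier MatL" "e \<otimes>\<^bsub>MatL\<^esub> e = e" using e(1) by (auto simp: LM.idem_mats_M)
  have ne: "out_arcs G None \<noteq> {}" using rep.root_out .
  have sc: "cS a \<in> carrier MatL" "cS' a \<in> carrier MatL" if "a \<in> out_arcs G None" for a using that by auto
  have eL: "e \<in> rep.Lspan None None"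
  proof (rule rep.Lspan_expand_left[OF _ ne ec(1)])
    fix a assume a: "a \<in> out_arcs G None"
    then obtain i g where ag: "a = ARow i g" "(i, g) \<in> R" by (auto simp: out_None)
    show "cS' a \<otimes>\<^bsub>MatL\<^esub> e \<in> rep.Lspan (head G a) None"
    proof (rule rep.Lspan_expand_right[OF _ ne])
      show "cS' a \<otimes>\<^bsub>MatL\<^esub> e \<in> carrier MatL" using sc[OF a] ec by simp
      show "cS' a \<otimes>\<^bsub>MatL\<^esub> e \<otimes>\<^bsub>MatL\<^esub> cP None = cS' a \<otimes>\<^bsub>MatL\<^esub> e"
        using LM.M.m_assoc[OF sc(2)[OF a] ec(1) cP_closed[of None]] e(3) by simp
      fix b assume b: "b \<in> out_arcs G None"
      then obtain j h where bh: "b = ARow j h" "(j, h) \<in> R" by (auto simp: out_None)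
      have gh: "g \<in> W" "h \<in> W" using ag bh R_W by auto
      then show "cS' a \<otimes>\<^bsub>MatL\<^esub> e \<otimes>\<^bsub>MatL\<^esub> cS b \<in> rep.Lspan (head G a) (head G b)"
        using gelt_corner_Lspan[OF gh entries[of i j]] munit_sandwich[OF ec(1), of "gelt g" "gelt h" i j] W_facts(4)
        by (simp add: ag(1) bh(1))
    qed simp
  qed (use e in simp_all)
  obtain J :: "(unit \<times> ('v, 'e) cut_arc list) set" and ww b y where
    Jr: "finite J \<and> (\<forall>j\<in>J. ww j \<in> verts G \<and> ww j \<noteq> None) \<and> rep.resolves J ww e b y \<and> rep.biorth J ww b y"
    using rep.idempotent_resolution[OF eL ec(2)] by (elim exE)
  then have J: "finite J" "\<And>j. j \<in> J \<Longrightarrow> ww j \<in> verts G \<and> ww j \<noteq> None"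
    and r: "rep.resolves J ww e b y" "rep.biorth J ww b y" by simp_all
  define h where "h j = the (ww j)" for j
  have h: "ww j = Some (h j)" "h j \<in> W" if "j \<in> J" for j using J(2)[OF that] by (auto simp: h_def)
  have L: "b j \<in> rep.Lspan None (ww j)" "y j \<in> rep.Lspan (ww j) None" if "j \<in> J" for j
    using r(1) that by (simp_all add: rep.resolves_def)
  have "idem_class L (\<Oplus>\<^bsub>MatL\<^esub>j\<in>J. b j \<otimes>\<^bsub>MatL\<^esub> y j) = finprod V (\<lambda>j. idem_class L (cP (ww j))) J"
  proof (rule LM.idem_class_resolution[OF J(1), THEN conjunct2])
    show "b j \<in> carrier MatL \<and> y j \<in> carrier MatL \<and> b j \<otimes>\<^bsub>MatL\<^esub> cP (ww j) = b j \<and> cP (ww j) \<in> carrier MatL"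
      if "j \<in> J" for j
      using L[OF that] rep.Lspan_closed rep.Lspan_P_right J(2)[OF that] cP_closed by blast
    show "y i \<otimes>\<^bsub>MatL\<^esub> b j = (if i = j then cP (ww i) else \<zero>\<^bsub>MatL\<^esub>)" if "i \<in> J" "j \<in> J" for i j
      using r(2) that by (simp add: rep.biorth_def)
    show "cP (ww j) \<otimes>\<^bsub>MatL\<^esub> cP (ww j) = cP (ww j)" if "j \<in> J" for j
      using J(2)[OF that] rep.P_idem by blast
  qed
  also have "(\<Oplus>\<^bsub>MatL\<^esub>j\<in>J. b j \<otimes>\<^bsub>MatL\<^esub> y j) = e" using r(1) by (simp add: rep.resolves_def)
  also have "finprod V (\<lambda>j. idem_class L (cP (ww j))) J = finprod V (\<lambda>j. gval (h j)) J"
  proof -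
    interpret V: comm_monoid V by (rule L.V_comm_monoid)
    show ?thesis
    proof (rule V.finprod_cong')
      fix j assume j: "j \<in> J"
      have "cP (ww j) = mat_single L (gelt (h j))" using h[OF j] by (simp add: L.mat_single_munit)
      then show "idem_class L (cP (ww j)) = gval (h j)" using gval_gelt W_facts(1) h(2)[OF j] by simp
    qed (use gval_closed W_facts(1) h(2) in auto)
  qed
  also have "\<dots> = geval (\<Sum>j\<in>J. {#h j#})"
    using J(1) W_facts(1) h(2) by (intro geval_sum[symmetric]) auto
  finally have "idem_class L e = geval (\<Sum>j\<in>J. {#h j#})" .
  moreover have "(\<Sum>j\<in>J. {#h j#}) \<in> mbar_words E"
    using J(1) W_facts(1) h(2) by (auto simp: mbar_words_def sum_singleton_mset)
  ultimately show ?thesis by blast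
qed

end

section \<open>The isomorphism\<close>

context lpa_setup
begin

text \<open>The root idempotent depends on the rows alone; named outside \<open>cut_graph\<close>,
  it can be spoken of before a finite piece is chosen and compared for two sets of rows.\<close>

definition "diag R = (\<Oplus>\<^bsub>MatL\<^esub>r\<in>R. case r of (i, g) \<Rightarrow> munit L i i (gelt g))"

end

section \<open>Equivalent diagonal idempotents within one finite piece\<close>

context cut_graph
begin

lemma cP_diag: "cP None = diag R"
  by (simp add: diag_def)

lemma row_closed:
  assumes "(i, g) \<in> R"
  shows "munit L i 0 (gelt g) \<in> carrier MatL" "munit L 0 i (gelt g) \<in> carrier MatL" "munit L i i (gelt g) \<in> carrier MatL"
    "munit L i 0 (gelt g) \<otimes>\<^bsub>MatL\<^esub> munit L 0 i (gelt g) = munit L i i (gelt g)"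
    "munit L i 0 (gelt g) \<otimes>\<^bsub>MatL\<^esub> munit L 0 0 (gelt g) = munit L i 0 (gelt g)"
    "munit L 0 0 (gelt g) \<in> carrier MatL"
    "munit L 0 0 (gelt g) \<otimes>\<^bsub>MatL\<^esub> munit L 0 0 (gelt g) = munit L 0 0 (gelt g)"
  using W_facts[OF R_W[OF assms]] gelt_idem by (simp_all add: munit_mult munit_closed)

lemma diag_resolution:
  "diag R = (\<Oplus>\<^bsub>MatL\<^esub>r\<in>R. munit L (fst r) 0 (gelt (snd r)) \<otimes>\<^bsub>MatL\<^esub> munit L 0 (fst r) (gelt (snd r)))"
  unfolding diag_def
  by (rule LM.M.finsum_cong') (auto simp: row_closed intro!: LM.M.m_closed)

lemma diag_class:
  "diag R \<in> idem_mats L \<and> idem_class L (diag R) = geval (\<Sum>r\<in>R. {#snd r#})"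
proof -
  interpret V: comm_monoid V by (rule L.V_comm_monoid)
  have g: "snd r \<in> mbar_gens E" "gval (snd r) \<in> carrier V" if "r \<in> R" for r
    using that R_W[of "fst r" "snd r"] W_facts(1) gval_closed by auto
  have "diag R \<in> idem_mats L \<and> idem_class L (diag R) = finprod V (\<lambda>r. idem_class L (munit L 0 0 (gelt (snd r)))) R"
    unfolding diag_resolution
  proof (rule LM.idem_class_resolution[OF finR])
    fix r assume r: "r \<in> R"
    show "munit L (fst r) 0 (gelt (snd r)) \<in> carrier MatL \<and> munit L 0 (fst r) (gelt (snd r)) \<in> carrier MatL \<and>
        munit L (fst r) 0 (gelt (snd r)) \<otimes>\<^bsub>MatL\<^esub> munit L 0 0 (gelt (snd r)) = munit L (fst r) 0 (gelt (snd r)) \<and>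
        munit L 0 0 (gelt (snd r)) \<in> carrier MatL"
      "munit L 0 0 (gelt (snd r)) \<otimes>\<^bsub>MatL\<^esub> munit L 0 0 (gelt (snd r)) = munit L 0 0 (gelt (snd r))"
      using row_closed[of "fst r" "snd r"] r by simp_all
    fix s assume s: "s \<in> R"
    show "munit L 0 (fst r) (gelt (snd r)) \<otimes>\<^bsub>MatL\<^esub> munit L (fst s) 0 (gelt (snd s)) =
        (if r = s then munit L 0 0 (gelt (snd r)) else \<zero>\<^bsub>MatL\<^esub>)"
      using row_mult[of "fst r" "snd r" "fst s" "snd s"] r s by (simp add: prod_eq_iff)
  qed
  moreover have "finprod V (\<lambda>r. idem_class L (munit L 0 0 (gelt (snd r)))) R = finprod V (\<lambda>r. gval (snd r)) R"
    using g gval_gelt by (intro V.finprod_cong') (auto simp: L.mat_single_munit)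
  moreover have "\<dots> = geval (\<Sum>r\<in>R. {#snd r#})"
    using finR g by (intro geval_sum[symmetric]) auto
  ultimately show ?thesis by simp
qed

text \<open>Along this map the congruence of the graph monoid is pulled back to words in the
  vertices of \<open>G\<close>; the root stands for the sum of its rows.\<close>

definition "words_of m = sum_mset (image_mset (\<lambda>g. case g of None \<Rightarrow> (\<Sum>r\<in>R. {#snd r#}) | Some h \<Rightarrow> {#h#}) m)"

lemma words_of_sum: "finite I \<Longrightarrow> words_of (\<Sum>i\<in>I. {#h i#}) =
    (\<Sum>i\<in>I. case h i of None \<Rightarrow> (\<Sum>r\<in>R. {#snd r#}) | Some h \<Rightarrow> {#h#})"
  by (induction I rule: finite_induct) (auto simp: words_of_def)

lemma rows_words: "(\<Sum>r\<in>R. {#snd r#}) \<in> mbar_words E"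
  using finR R_W W_facts(1) by (auto simp: sum_singleton_mset mbar_words_def)

lemma words_of_words: "set_mset m \<subseteq> verts G \<Longrightarrow> words_of m \<in> mbar_words E"
proof (induction m)
  case (add g m)
  then have "words_of m \<in> mbar_words E" by auto
  moreover have "words_of {#g#} \<in> mbar_words E"
    using add.prems rows_words W_facts(1) by (auto simp: words_of_def mbar_words_def split: option.splits)
  ultimately show ?case using mbar_words_add[of "words_of {#g#}" "words_of m"] by (simp add: words_of_def)
qed (simp add: words_of_def)

text \<open>Each vertex of the finite graph uses one relation of the graph monoid:
  \<open>regular\<close> at a regular vertex, \<open>cut\<close> where an infinite emitter is split,
  \<open>cut_cut\<close> where a cut is enlarged. At the root both sides coincide.\<close>

lemma words_of_regular:
  assumes "g \<in> verts G" "out_arcs G g \<noteq> {}"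
  shows "mbar_cong E (words_of {#g#}) (words_of (\<Sum>a\<in>out_arcs G g. {#head G a#}))"
proof (cases g)
  case None
  have "(\<Sum>a\<in>out_arcs G None. {#head G a#}) = (\<Sum>r\<in>R. {#Some (snd r)#})"
    unfolding out_None by (subst sum.reindex) (auto simp: inj_on_def intro!: sum.cong)
  then have "words_of (\<Sum>a\<in>out_arcs G None. {#head G a#}) = (\<Sum>r\<in>R. {#snd r#})"
    using words_of_sum[OF finR, of "\<lambda>r. Some (snd r)"] by simp
  then show ?thesis using rows_words None by (simp add: words_of_def mbar_cong.refl)
next
  case (Some h)
  have h: "h \<in> W" using assms Some by auto
  have fin: "finite (full h - gen_cut h)" "finite (full h)" using finT by auto
  have edges: "words_of (\<Sum>a\<in>AEdge h ` (full h - gen_cut h). {#head G a#}) = range_sum E (full h - gen_cut h)"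
  proof -
    have "(\<Sum>a\<in>AEdge h ` (full h - gen_cut h). {#head G a#}) = (\<Sum>e\<in>full h - gen_cut h. {#Some (GVert (head E e))#})"
      by (subst sum.reindex) (auto simp: inj_on_def)
    then show ?thesis using words_of_sum[OF fin(1), of "\<lambda>e. Some (GVert (head E e))"] fin
      by (simp add: range_sum_def sum_singleton_mset)
  qed
  show ?thesis
  proof (cases "infinite_emitter E (gen_base h)")
    case True
    then have s: "stops h" using assms(2) out_Some[OF h] Some by (auto simp: stops_def)
    have "(\<Sum>a\<in>out_arcs G g. {#head G a#}) = {#Some (rest h)#} + (\<Sum>a\<in>AEdge h ` (full h - gen_cut h). {#head G a#})"
    proof -
      have "finite (AEdge h ` (full h - gen_cut h))" by (intro finite_imageI fin)
      moreover have "AStop h \<notin> AEdge h ` (full h - gen_cut h)" by blast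
      moreover have "out_arcs G g = insert (AStop h) (AEdge h ` (full h - gen_cut h))"
        using out_Some[OF h] s Some by simp
      ultimately show ?thesis by (simp add: sum.insert del: sum.insert_remove)
    qed
    then have eq: "words_of (\<Sum>a\<in>out_arcs G g. {#head G a#}) = {#rest h#} + range_sum E (full h - gen_cut h)"
      using edges by (simp add: words_of_def)
    have "mbar_cong E {#h#} ({#rest h#} + range_sum E (full h - gen_cut h))"
    proof (cases h)
      case (GVert v)
      then show ?thesis using True s fin mbar_cong.sym[OF mbar_cong.cut[of E v "full h"]] by (auto simp: stops_def)
    next
      case (GCut v C)
      have C: "finite C" "C \<noteq> {}" "C \<subseteq> out_arcs E v" "C \<subseteq> full h"
        using W_facts(1,3)[OF h] GCut by (auto simp: mbar_gens_def)
      \<comment> \<open>The cut of \<open>h\<close> lies inside \<open>full h\<close>, so one of the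
        range sums in \<open>cut_cut\<close> is empty.\<close>
      then have "C - full h = {}" "full h \<noteq> {}" by auto
      then have "range_sum E (C - full h) = {#}" by (simp only: range_sum_def) simp
      then show ?thesis
        using mbar_cong.cut_cut[of E v C "full h"] True C fin GCut \<open>full h \<noteq> {}\<close> by simp
    qed
    then show ?thesis using eq Some by (simp add: words_of_def)
  next
    case False
    obtain v where v: "h = GVert v" "v \<in> verts E" using W_facts(1)[OF h] False by (auto simp: mbar_gens_def)
    have out: "out_arcs G g = AEdge h ` (full h - gen_cut h)" using out_Some[OF h] False Some by (simp add: stops_def)
    have "full h - gen_cut h \<noteq> {}" using assms(2) unfolding out by blast
    then obtain e where "e \<in> full h" by blast
    then have e: "e \<in> T" "e \<in> out_arcs E v" using v(1) by simp_all
    have reg: "regular_vertex E v" using v False e by (auto simp: regular_vertex_def infinite_emitter_def)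
    then have "out_arcs E v \<subseteq> T" using T_regular[OF e(1)] e(2) by simp
    then have "full h - gen_cut h = out_arcs E v" using v by auto
    then have "words_of (\<Sum>a\<in>out_arcs G g. {#head G a#}) = range_sum E (out_arcs E v)" using edges out by simp
    moreover have "words_of {#g#} = {#GVert v#}" by (simp add: Some v(1) words_of_def)
    ultimately show ?thesis using mbar_cong.regular[OF reg] by simp
  qed
qed

text \<open>The two graphs share \<open>W\<close> and \<open>T\<close> and differ only at the root.
  The second set of rows thus names vertices of the first graph, and the equivalence of the
  diagonals resolves its root by these vertices, as \<open>resolution_class\<close>
  requires.\<close>

lemma diag_relation:
  assumes "cut_graph E K W T R'"
    and xy: "x \<in> carrier MatL" "y \<in> carrier MatL" "x \<otimes>\<^bsub>MatL\<^esub> y = diag R" "y \<otimes>\<^bsub>MatL\<^esub> x = diag R'"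
    and entries: "\<And>i j. x i j \<in> Lsub" "\<And>i j. y i j \<in> Lsub"
  shows "mbar_cong E (\<Sum>r\<in>R. {#snd r#}) (\<Sum>r\<in>R'. {#snd r#})"
proof -
  interpret C: cut_graph E K W T R' by (rule assms(1))
  define P where "P = diag R"
  define D where "D = diag R'"
  have P: "P = cP None" and D: "D = C.cP None" by (simp_all only: P_def D_def cP_diag C.cP_diag)
  have Pc: "P \<in> carrier MatL" "P \<otimes>\<^bsub>MatL\<^esub> P = P" unfolding P by (rule cP_closed, simp, rule cP_None_idem)
  have Dc: "D \<in> carrier MatL" "D \<otimes>\<^bsub>MatL\<^esub> D = D" unfolding D by (rule C.cP_closed, simp, rule C.cP_None_idem)
  have xy': "x \<otimes>\<^bsub>MatL\<^esub> y = P" "y \<otimes>\<^bsub>MatL\<^esub> x = D" using xy by (simp_all add: P_def D_def)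
  define u where "u r = munit L (fst r) 0 (gelt (snd r))" for r :: "nat \<times> ('v, 'e) mbar_gen"
  define u' where "u' r = munit L 0 (fst r) (gelt (snd r))" for r :: "nat \<times> ('v, 'e) mbar_gen"
  have uc: "u r \<in> carrier MatL" "u' r \<in> carrier MatL" if "r \<in> R'" for r
    using C.row_closed[of "fst r" "snd r"] that by (simp_all add: u_def u'_def)
  have uD: "D \<otimes>\<^bsub>MatL\<^esub> u r = u r" "u' r \<otimes>\<^bsub>MatL\<^esub> D = u' r" if "r \<in> R'" for r
    using C.cP_row[of "fst r" "snd r"] that unfolding D u_def u'_def by simp_all
  have uu: "u' r \<otimes>\<^bsub>MatL\<^esub> u s = (if r = s then cP (Some (snd r)) else \<zero>\<^bsub>MatL\<^esub>)" if "r \<in> R'" "s \<in> R'" for r s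
    using C.row_mult[of "fst r" "snd r" "fst s" "snd s"] that by (simp add: u_def u'_def prod_eq_iff)
  have D_sum: "D = (\<Oplus>\<^bsub>MatL\<^esub>r\<in>R'. u r \<otimes>\<^bsub>MatL\<^esub> u' r)"
    unfolding D_def u_def u'_def by (rule C.diag_resolution)
  \<comment> \<open>The column of \<open>x\<close> and, with \<open>b'\<close>, the row of
    \<open>y\<close> that belong to \<open>r\<close>. The equations for x y and y x together make
    them a biorthogonal resolution of \<open>P\<close>.\<close>
  define b where "b r = P \<otimes>\<^bsub>MatL\<^esub> x \<otimes>\<^bsub>MatL\<^esub> u r" for r
  define b' where "b' r = u' r \<otimes>\<^bsub>MatL\<^esub> y \<otimes>\<^bsub>MatL\<^esub> P" for r
  have bc: "b r \<in> carrier MatL" "b' r \<in> carrier MatL" if "r \<in> R'" for r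
    using uc[OF that] Pc xy by (simp_all add: b_def b'_def)
  have ne: "out_arcs G None \<noteq> {}" using rep.root_out .
  have bL: "b r \<in> rep.Lspan None (Some (snd r))" if r: "r \<in> R'" for r
  proof (rule rep.Lspan_expand_left[OF _ ne bc(1)[OF r]])
    have "P \<otimes>\<^bsub>MatL\<^esub> b r = (P \<otimes>\<^bsub>MatL\<^esub> P) \<otimes>\<^bsub>MatL\<^esub> x \<otimes>\<^bsub>MatL\<^esub> u r"
      unfolding b_def using Pc(1) xy(1) uc[OF r] by (simp only: LM.M.m_assoc LM.M.m_closed)
    then show "cP None \<otimes>\<^bsub>MatL\<^esub> b r = b r" unfolding P[symmetric] Pc(2) b_def .
    fix a assume "a \<in> out_arcs G None"
    then obtain i g where ag: "a = ARow i g" "(i, g) \<in> R" by (auto simp: out_None)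
    have sc: "cS' a \<in> carrier MatL" using row_closed[OF ag(2)] by (simp add: ag(1))
    have gh: "g \<in> W" "snd r \<in> W" using R_W[OF ag(2)] C.R_W[of "fst r" "snd r"] r by simp_all
    have "cS' a \<otimes>\<^bsub>MatL\<^esub> b r = (cS' a \<otimes>\<^bsub>MatL\<^esub> P) \<otimes>\<^bsub>MatL\<^esub> x \<otimes>\<^bsub>MatL\<^esub> u r"
      unfolding b_def using sc Pc(1) xy(1) uc[OF r] by (simp only: LM.M.m_assoc LM.M.m_closed)
    also have "cS' a \<otimes>\<^bsub>MatL\<^esub> P = munit L 0 i (gelt g)"
      using cP_row(2)[OF ag(2)] unfolding P ag(1) by simp
    also have "munit L 0 i (gelt g) \<otimes>\<^bsub>MatL\<^esub> x \<otimes>\<^bsub>MatL\<^esub> u r =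
        munit L 0 0 (gelt g \<otimes>\<^bsub>L\<^esub> x i (fst r) \<otimes>\<^bsub>L\<^esub> gelt (snd r))"
      unfolding u_def using munit_sandwich[OF xy(1)] W_facts(4) gh by blast
    finally show "cS' a \<otimes>\<^bsub>MatL\<^esub> b r \<in> rep.Lspan (head G a) (Some (snd r))"
      using gelt_corner_Lspan[OF gh entries(1)[of i "fst r"]] by (simp add: ag(1))
  qed simp
  have b'L: "b' r \<in> rep.Lspan (Some (snd r)) None" if r: "r \<in> R'" for r
  proof (rule rep.Lspan_expand_right[OF _ ne bc(2)[OF r]])
    have "b' r \<otimes>\<^bsub>MatL\<^esub> P = u' r \<otimes>\<^bsub>MatL\<^esub> y \<otimes>\<^bsub>MatL\<^esub> (P \<otimes>\<^bsub>MatL\<^esub> P)"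
      unfolding b'_def using Pc(1) xy(2) uc[OF r] by (simp only: LM.M.m_assoc LM.M.m_closed)
    then show "b' r \<otimes>\<^bsub>MatL\<^esub> cP None = b' r" unfolding P[symmetric] Pc(2) b'_def .
    fix a assume "a \<in> out_arcs G None"
    then obtain i g where ag: "a = ARow i g" "(i, g) \<in> R" by (auto simp: out_None)
    have sc: "cS a \<in> carrier MatL" using row_closed[OF ag(2)] by (simp add: ag(1))
    have gh: "g \<in> W" "snd r \<in> W" using R_W[OF ag(2)] C.R_W[of "fst r" "snd r"] r by simp_all
    have "b' r \<otimes>\<^bsub>MatL\<^esub> cS a = u' r \<otimes>\<^bsub>MatL\<^esub> y \<otimes>\<^bsub>MatL\<^esub> (P \<otimes>\<^bsub>MatL\<^esub> cS a)"
      unfolding b'_def using sc Pc(1) xy(2) uc[OF r] by (simp only: LM.M.m_assoc LM.M.m_closed)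
    also have "P \<otimes>\<^bsub>MatL\<^esub> cS a = munit L i 0 (gelt g)"
      using cP_row(1)[OF ag(2)] unfolding P ag(1) by simp
    also have "u' r \<otimes>\<^bsub>MatL\<^esub> y \<otimes>\<^bsub>MatL\<^esub> munit L i 0 (gelt g) =
        munit L 0 0 (gelt (snd r) \<otimes>\<^bsub>L\<^esub> y (fst r) i \<otimes>\<^bsub>L\<^esub> gelt g)"
      unfolding u'_def using munit_sandwich[OF xy(2)] W_facts(4) gh by blast
    finally show "b' r \<otimes>\<^bsub>MatL\<^esub> cS a \<in> rep.Lspan (Some (snd r)) (head G a)"
      using gelt_corner_Lspan[OF gh(2,1) entries(2)[of "fst r" i]] by (simp add: ag(1))
  qed simp
  have P5: "(P \<otimes>\<^bsub>MatL\<^esub> x) \<otimes>\<^bsub>MatL\<^esub> D \<otimes>\<^bsub>MatL\<^esub> (y \<otimes>\<^bsub>MatL\<^esub> P) = P"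
  proof -
    have "(P \<otimes>\<^bsub>MatL\<^esub> x) \<otimes>\<^bsub>MatL\<^esub> (y \<otimes>\<^bsub>MatL\<^esub> x) \<otimes>\<^bsub>MatL\<^esub> (y \<otimes>\<^bsub>MatL\<^esub> P) =
        P \<otimes>\<^bsub>MatL\<^esub> (x \<otimes>\<^bsub>MatL\<^esub> y) \<otimes>\<^bsub>MatL\<^esub> (x \<otimes>\<^bsub>MatL\<^esub> y) \<otimes>\<^bsub>MatL\<^esub> P"
      using Pc(1) xy(1,2) by (simp only: LM.M.m_assoc LM.M.m_closed)
    then show ?thesis unfolding xy' Pc(2) .
  qed
  have "P = (\<Oplus>\<^bsub>MatL\<^esub>r\<in>R'. b r \<otimes>\<^bsub>MatL\<^esub> b' r)"
  proof -
    have "P = (P \<otimes>\<^bsub>MatL\<^esub> x) \<otimes>\<^bsub>MatL\<^esub> (\<Oplus>\<^bsub>MatL\<^esub>r\<in>R'. u r \<otimes>\<^bsub>MatL\<^esub> u' r) \<otimes>\<^bsub>MatL\<^esub> (y \<otimes>\<^bsub>MatL\<^esub> P)"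
      using P5 unfolding D_sum by simp
    also have "\<dots> = (\<Oplus>\<^bsub>MatL\<^esub>r\<in>R'. (P \<otimes>\<^bsub>MatL\<^esub> x) \<otimes>\<^bsub>MatL\<^esub> (u r \<otimes>\<^bsub>MatL\<^esub> u' r)) \<otimes>\<^bsub>MatL\<^esub> (y \<otimes>\<^bsub>MatL\<^esub> P)"
      using C.finR uc Pc(1) xy(1) by (subst LM.M.finsum_rdistr') auto
    also have "\<dots> = (\<Oplus>\<^bsub>MatL\<^esub>r\<in>R'. (P \<otimes>\<^bsub>MatL\<^esub> x) \<otimes>\<^bsub>MatL\<^esub> (u r \<otimes>\<^bsub>MatL\<^esub> u' r) \<otimes>\<^bsub>MatL\<^esub> (y \<otimes>\<^bsub>MatL\<^esub> P))"
      using C.finR uc Pc(1) xy(1,2) by (intro LM.M.finsum_ldistr') auto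
    also have "\<dots> = (\<Oplus>\<^bsub>MatL\<^esub>r\<in>R'. b r \<otimes>\<^bsub>MatL\<^esub> b' r)"
    proof (rule LM.M.finsum_cong')
      fix r assume r: "r \<in> R'"
      show "(P \<otimes>\<^bsub>MatL\<^esub> x) \<otimes>\<^bsub>MatL\<^esub> (u r \<otimes>\<^bsub>MatL\<^esub> u' r) \<otimes>\<^bsub>MatL\<^esub> (y \<otimes>\<^bsub>MatL\<^esub> P) = b r \<otimes>\<^bsub>MatL\<^esub> b' r"
        unfolding b_def b'_def using uc[OF r] Pc(1) xy(1,2) by (simp only: LM.M.m_assoc LM.M.m_closed)
    qed (use bc in auto)
    finally show ?thesis .
  qed
  then have res: "rep.resolves R' (\<lambda>r. Some (snd r)) (cP None) b b'"
    unfolding rep.resolves_def P[symmetric] using bL b'L by blast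
  have bio: "rep.biorth R' (\<lambda>r. Some (snd r)) b b'"
    unfolding rep.biorth_def
  proof (intro ballI)
    fix r s assume r: "r \<in> R'" and s: "s \<in> R'"
    have "b' r \<otimes>\<^bsub>MatL\<^esub> b s = u' r \<otimes>\<^bsub>MatL\<^esub> y \<otimes>\<^bsub>MatL\<^esub> (P \<otimes>\<^bsub>MatL\<^esub> P) \<otimes>\<^bsub>MatL\<^esub> x \<otimes>\<^bsub>MatL\<^esub> u s"
      unfolding b_def b'_def using uc[OF r] uc[OF s] Pc(1) xy(1,2) by (simp only: LM.M.m_assoc LM.M.m_closed)
    also have "\<dots> = u' r \<otimes>\<^bsub>MatL\<^esub> y \<otimes>\<^bsub>MatL\<^esub> (x \<otimes>\<^bsub>MatL\<^esub> y) \<otimes>\<^bsub>MatL\<^esub> x \<otimes>\<^bsub>MatL\<^esub> u s"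
      unfolding Pc(2) xy'(1) ..
    also have "\<dots> = u' r \<otimes>\<^bsub>MatL\<^esub> (y \<otimes>\<^bsub>MatL\<^esub> x) \<otimes>\<^bsub>MatL\<^esub> ((y \<otimes>\<^bsub>MatL\<^esub> x) \<otimes>\<^bsub>MatL\<^esub> u s)"
      using uc[OF r] uc[OF s] xy(1,2) by (simp only: LM.M.m_assoc LM.M.m_closed)
    also have "\<dots> = u' r \<otimes>\<^bsub>MatL\<^esub> u s" unfolding xy'(2) uD(1)[OF s] uD(2)[OF r] ..
    finally show "b' r \<otimes>\<^bsub>MatL\<^esub> b s = (if r = s then cP (Some (snd r)) else \<zero>\<^bsub>MatL\<^esub>)"
      using uu[OF r s] by simp
  qed
  have "mbar_cong E (words_of {#None#}) (words_of (\<Sum>r\<in>R'. {#Some (snd r)#}))"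
  proof (rule rep.resolution_class[where R = "\<lambda>m n. mbar_cong E (words_of m) (words_of n)" and J = R' and b = b and y = b'])
    show "mbar_cong E (words_of m) (words_of m)" if "set_mset m \<subseteq> verts G" for m
      using words_of_words[OF that] by (rule mbar_cong.refl)
    show "mbar_cong E (words_of m) (words_of l)" if "mbar_cong E (words_of l) (words_of m)" for l m
      using that by (rule mbar_cong.sym)
    show "mbar_cong E (words_of l) (words_of n)" if "mbar_cong E (words_of l) (words_of m)" "mbar_cong E (words_of m) (words_of n)" for l m n
      using that by (rule mbar_cong.trans)
    show "mbar_cong E (words_of (l + m)) (words_of (l' + m'))"
      if "mbar_cong E (words_of l) (words_of l')" "mbar_cong E (words_of m) (words_of m')" for l l' m m'
      using mbar_cong.add[OF that] by (simp add: words_of_def)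
    show "Some (snd r) \<in> verts G" if "r \<in> R'" for r using C.R_W[of "fst r" "snd r"] that by simp
  qed (use words_of_regular C.finR res bio in simp_all)
  moreover have "words_of (\<Sum>r\<in>R'. {#Some (snd r)#}) = (\<Sum>r\<in>R'. {#snd r#})"
    using words_of_sum[OF C.finR, of "\<lambda>r. Some (snd r)"] by simp
  ultimately show ?thesis by (simp add: words_of_def)
qed

text \<open>With all vertices of \<open>V0\<close> in each of the first \<open>n\<close> rows,
  \<open>diag R\<close> is \<open>uV\<close> times the identity matrix of size
  \<open>n\<close>.\<close>

lemma diag_unit:
  assumes R: "R = {..<n} \<times> GVert ` V0" and e: "e \<in> matn L n" and entries: "\<And>i j. e i j \<in> Lsub"
  shows "diag R \<otimes>\<^bsub>MatL\<^esub> e = e" "e \<otimes>\<^bsub>MatL\<^esub> diag R = e"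
proof -
  have ec: "e \<in> carrier MatL" "e \<in> mat_inf L" using e by (simp_all add: mat_alg_simps matn_imp_mat_inf)
  have el: "e i j \<in> carrier L" for i j using e by (rule matn_carrier)
  have pc: "lpa_p K E v \<in> carrier L" "gelt (GVert v) = lpa_p K E v" if "v \<in> V0" for v
    using that V0(2) p_closed gelt_GVert by auto
  have mc: "munit L i i (gelt g) \<in> carrier MatL" if "(i, g) \<in> R" for i g using row_closed(3)[OF that] .
  have gc: "gelt g \<in> carrier L" if "g \<in> GVert ` V0" for g using that pc by auto
  have reindex: "(\<Oplus>\<^bsub>L\<^esub>g\<in>GVert ` V0. f (gelt g)) = (\<Oplus>\<^bsub>L\<^esub>v\<in>V0. f (lpa_p K E v))"
    if "\<And>v. v \<in> V0 \<Longrightarrow> f (lpa_p K E v) \<in> carrier L" for f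
  proof -
    have "(\<Oplus>\<^bsub>L\<^esub>g\<in>GVert ` V0. f (gelt g)) = (\<Oplus>\<^bsub>L\<^esub>v\<in>V0. f (gelt (GVert v)))"
      using that pc by (intro L.finsum_reindex) (auto simp: inj_on_def)
    also have "\<dots> = (\<Oplus>\<^bsub>L\<^esub>v\<in>V0. f (lpa_p K E v))" using that pc by (intro L.finsum_cong') auto
    finally show ?thesis .
  qed
  have collapse: "(\<Oplus>\<^bsub>L\<^esub>r\<in>R. if k = fst r then F (snd r) else \<zero>\<^bsub>L\<^esub>) = (if k < n then (\<Oplus>\<^bsub>L\<^esub>g\<in>GVert ` V0. F g) else \<zero>\<^bsub>L\<^esub>)"
    if F: "\<And>g. g \<in> GVert ` V0 \<Longrightarrow> F g \<in> carrier L" for F k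
  proof -
    have "(\<Oplus>\<^bsub>L\<^esub>r\<in>R. if k = fst r then F (snd r) else \<zero>\<^bsub>L\<^esub>) =
        (\<Oplus>\<^bsub>L\<^esub>i\<in>{..<n}. \<Oplus>\<^bsub>L\<^esub>g\<in>GVert ` V0. if k = i then F g else \<zero>\<^bsub>L\<^esub>)"
      unfolding R
      by (rule L.finsum_Sigma'[of "{..<n}" "\<lambda>_. GVert ` V0" "\<lambda>r. if k = fst r then F (snd r) else \<zero>\<^bsub>L\<^esub>",
            unfolded fst_conv snd_conv]) (use F V0(1) in simp_all)
    also have "\<dots> = (\<Oplus>\<^bsub>L\<^esub>i\<in>{..<n}. if k = i then (\<Oplus>\<^bsub>L\<^esub>g\<in>GVert ` V0. F g) else \<zero>\<^bsub>L\<^esub>)"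
      using F by (intro L.finsum_cong') (auto intro!: L.finsum_closed)
    also have "\<dots> = (if k < n then (\<Oplus>\<^bsub>L\<^esub>g\<in>GVert ` V0. F g) else \<zero>\<^bsub>L\<^esub>)"
    proof (cases "k < n")
      case True
      then show ?thesis using F by (simp add: L.add.finprod_singleton L.finsum_closed Pi_def)
    next
      case False
      then have "(\<Oplus>\<^bsub>L\<^esub>i\<in>{..<n}. if k = i then (\<Oplus>\<^bsub>L\<^esub>g\<in>GVert ` V0. F g) else \<zero>\<^bsub>L\<^esub>) = (\<Oplus>\<^bsub>L\<^esub>i\<in>{..<n}. \<zero>\<^bsub>L\<^esub>)"
        by (intro L.finsum_cong') auto
      then show ?thesis using False by simp
    qed
    finally show ?thesis .
  qed
  show "diag R \<otimes>\<^bsub>MatL\<^esub> e = e"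
  proof (intro ext)
    fix k l
    have "diag R \<otimes>\<^bsub>MatL\<^esub> e = (\<Oplus>\<^bsub>MatL\<^esub>r\<in>R. (case r of (i, g) \<Rightarrow> munit L i i (gelt g)) \<otimes>\<^bsub>MatL\<^esub> e)"
      unfolding diag_def using finR mc ec by (intro LM.M.finsum_ldistr') auto
    then have "(diag R \<otimes>\<^bsub>MatL\<^esub> e) k l = (\<Oplus>\<^bsub>L\<^esub>r\<in>R. ((case r of (i, g) \<Rightarrow> munit L i i (gelt g)) \<otimes>\<^bsub>MatL\<^esub> e) k l)"
      using finR mc ec by (simp only:) (rule LM.finsum_M_entry, auto)
    also have "\<dots> = (\<Oplus>\<^bsub>L\<^esub>r\<in>R. if k = fst r then gelt (snd r) \<otimes>\<^bsub>L\<^esub> e (fst r) l else \<zero>\<^bsub>L\<^esub>)"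
      using el ec gc R by (intro L.finsum_cong') (auto simp: mat_alg_simps(2) L.munit_times_left)
    also have "\<dots> = (\<Oplus>\<^bsub>L\<^esub>r\<in>R. if k = fst r then gelt (snd r) \<otimes>\<^bsub>L\<^esub> e k l else \<zero>\<^bsub>L\<^esub>)"
      using el gc R by (intro L.finsum_cong') auto
    also have "\<dots> = (if k < n then (\<Oplus>\<^bsub>L\<^esub>g\<in>GVert ` V0. gelt g \<otimes>\<^bsub>L\<^esub> e k l) else \<zero>\<^bsub>L\<^esub>)"
      using gc el by (intro collapse) auto
    also have "(\<Oplus>\<^bsub>L\<^esub>g\<in>GVert ` V0. gelt g \<otimes>\<^bsub>L\<^esub> e k l) = (\<Oplus>\<^bsub>L\<^esub>v\<in>V0. lpa_p K E v \<otimes>\<^bsub>L\<^esub> e k l)"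
      using pc el by (intro reindex) auto
    also have "\<dots> = uV \<otimes>\<^bsub>L\<^esub> e k l"
      unfolding uV_def using V0(1) pc el by (intro L.finsum_ldistr'[symmetric]) auto
    also have "\<dots> = e k l" using uV_unit[OF entries] by blast
    also have "(if k < n then e k l else \<zero>\<^bsub>L\<^esub>) = e k l" using matn_zero[OF e, of k l] by simp
    finally show "(diag R \<otimes>\<^bsub>MatL\<^esub> e) k l = e k l" .
  qed
  show "e \<otimes>\<^bsub>MatL\<^esub> diag R = e"
  proof (intro ext)
    fix l k
    have "e \<otimes>\<^bsub>MatL\<^esub> diag R = (\<Oplus>\<^bsub>MatL\<^esub>r\<in>R. e \<otimes>\<^bsub>MatL\<^esub> (case r of (i, g) \<Rightarrow> munit L i i (gelt g)))"
      unfolding diag_def using finR mc ec by (intro LM.M.finsum_rdistr') auto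
    then have "(e \<otimes>\<^bsub>MatL\<^esub> diag R) l k = (\<Oplus>\<^bsub>L\<^esub>r\<in>R. (e \<otimes>\<^bsub>MatL\<^esub> (case r of (i, g) \<Rightarrow> munit L i i (gelt g))) l k)"
      using finR mc ec by (simp only:) (rule LM.finsum_M_entry, auto)
    also have "\<dots> = (\<Oplus>\<^bsub>L\<^esub>r\<in>R. if k = fst r then e l (fst r) \<otimes>\<^bsub>L\<^esub> gelt (snd r) else \<zero>\<^bsub>L\<^esub>)"
      using el ec gc R by (intro L.finsum_cong') (auto simp: mat_alg_simps(2) L.munit_times_right)
    also have "\<dots> = (\<Oplus>\<^bsub>L\<^esub>r\<in>R. if k = fst r then e l k \<otimes>\<^bsub>L\<^esub> gelt (snd r) else \<zero>\<^bsub>L\<^esub>)"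
      using el gc R by (intro L.finsum_cong') auto
    also have "\<dots> = (if k < n then (\<Oplus>\<^bsub>L\<^esub>g\<in>GVert ` V0. e l k \<otimes>\<^bsub>L\<^esub> gelt g) else \<zero>\<^bsub>L\<^esub>)"
      using gc el by (intro collapse) auto
    also have "(\<Oplus>\<^bsub>L\<^esub>g\<in>GVert ` V0. e l k \<otimes>\<^bsub>L\<^esub> gelt g) = (\<Oplus>\<^bsub>L\<^esub>v\<in>V0. e l k \<otimes>\<^bsub>L\<^esub> lpa_p K E v)"
      using pc el by (intro reindex) auto
    also have "\<dots> = e l k \<otimes>\<^bsub>L\<^esub> uV"
      unfolding uV_def using V0(1) pc el by (intro L.finsum_rdistr'[symmetric]) auto
    also have "\<dots> = e l k" using uV_unit[OF entries] by blast
    also have "(if k < n then e l k else \<zero>\<^bsub>L\<^esub>) = e l k" using matn_zero[OF e, of l k] by simp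
    finally show "(e \<otimes>\<^bsub>MatL\<^esub> diag R) l k = e l k" .
  qed
qed

end

section \<open>Enclosing finitely many elements in a finite piece\<close>

context lpa_setup
begin

lemma subg_terms_mono:
  "\<lbrakk>x \<in> lpa_terms K (subg U T); U \<subseteq> U'; T \<subseteq> T'\<rbrakk> \<Longrightarrow> x \<in> lpa_terms K (subg U' T')"
  by (induction rule: lpa_terms.induct) (auto simp: subg_def subset_iff intro!: lpa_terms.intros)

text \<open>The ends of edges in \<open>T\<close> may lie outside \<open>U\<close>; closing up is
  left to \<open>cut_graph_exists\<close>.\<close>

definition "finite_part U T \<longleftrightarrow> finite U \<and> U \<subseteq> verts E \<and> finite T \<and> T \<subseteq> arcs E"

lemma finite_part_Un: "\<lbrakk>finite_part U T; finite_part U' T'\<rbrakk> \<Longrightarrow> finite_part (U \<union> U') (T \<union> T')"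
  by (auto simp: finite_part_def)

lemma terms_finite_part:
  "x \<in> lpa_terms K E \<Longrightarrow> \<exists>U T. finite_part U T \<and> x \<in> lpa_terms K (subg U T)"
proof (induction rule: lpa_terms.induct)
  case (1 v)
  then show ?case by (intro exI[of _ "{v}"] exI[of _ "{}"]) (auto simp: finite_part_def subg_def intro: lpa_terms.intros)
next
  case (2 e)
  then show ?case by (intro exI[of _ "{}"] exI[of _ "{e}"]) (auto simp: finite_part_def subg_def intro: lpa_terms.intros)
next
  case (3 e)
  then show ?case by (intro exI[of _ "{}"] exI[of _ "{e}"]) (auto simp: finite_part_def subg_def intro: lpa_terms.intros)
next
  case 4
  show ?case by (intro exI[of _ "{}"]) (auto simp: finite_part_def intro: lpa_terms.intros)
next
  case (5 x) then show ?case by (blast intro: lpa_terms.intros)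
next
  case (6 x y)
  then obtain U T U' T' where "finite_part U T" "x \<in> lpa_terms K (subg U T)" "finite_part U' T'" "y \<in> lpa_terms K (subg U' T')"
    by blast
  then show ?case
    using finite_part_Un subg_terms_mono[of x U T "U \<union> U'" "T \<union> T'"] subg_terms_mono[of y U' T' "U \<union> U'" "T \<union> T'"]
    by (intro exI[of _ "U \<union> U'"] exI[of _ "T \<union> T'"]) (auto intro: lpa_terms.intros)
next
  case (7 x y)
  then obtain U T U' T' where "finite_part U T" "x \<in> lpa_terms K (subg U T)" "finite_part U' T'" "y \<in> lpa_terms K (subg U' T')"
    by blast
  then show ?case
    using finite_part_Un subg_terms_mono[of x U T "U \<union> U'" "T \<union> T'"] subg_terms_mono[of y U' T' "U \<union> U'" "T \<union> T'"]
    by (intro exI[of _ "U \<union> U'"] exI[of _ "T \<union> T'"]) (auto intro: lpa_terms.intros)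
next
  case (8 c x) then show ?case by (blast intro: lpa_terms.intros)
qed

lemma set_finite_part:
  assumes "finite A" "A \<subseteq> carrier L"
  shows "\<exists>U T. finite_part U T \<and> A \<subseteq> cls ` lpa_terms K (subg U T)"
  using assms
proof (induction A rule: finite_induct)
  case empty
  then show ?case by (intro exI[of _ "{}"]) (auto simp: finite_part_def)
next
  case (insert a A)
  then obtain U T where UT: "finite_part U T" "A \<subseteq> cls ` lpa_terms K (subg U T)" by auto
  obtain x where x: "x \<in> lpa_terms K E" "a = cls x" using insert.prems L_carrierE by blast
  obtain U' T' where UT': "finite_part U' T'" "x \<in> lpa_terms K (subg U' T')" using terms_finite_part[OF x(1)] by blast
  have "insert a A \<subseteq> cls ` lpa_terms K (subg (U \<union> U') (T \<union> T'))"
    using UT(2) UT'(2) x(2) subg_terms_mono[of _ U T "U \<union> U'" "T \<union> T'"] subg_terms_mono[of x U' T' "U \<union> U'" "T \<union> T'"]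
    by blast
  then show ?case using finite_part_Un[OF UT(1) UT'(1)] by blast
qed

lemma finite_entries:
  assumes "X \<in> mat_inf L" shows "finite (range (\<lambda>(i, j). X i j))" "range (\<lambda>(i, j). X i j) \<subseteq> carrier L"
proof -
  obtain n where n: "X \<in> matn L n" using assms by (rule mat_infE)
  have "range (\<lambda>(i, j). X i j) \<subseteq> insert \<zero>\<^bsub>L\<^esub> ((\<lambda>(i, j). X i j) ` ({..<n} \<times> {..<n}))"
  proof clarify
    fix i j assume "X i j \<notin> (\<lambda>(i, j). X i j) ` ({..<n} \<times> {..<n})"
    then have "\<not> (i < n \<and> j < n)" by auto
    then show "X i j = \<zero>\<^bsub>L\<^esub>" using matn_zero[OF n, of i j] by auto
  qed
  then show "finite (range (\<lambda>(i, j). X i j))" by (rule finite_subset) simp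
  show "range (\<lambda>(i, j). X i j) \<subseteq> carrier L" using matn_carrier[OF n] by auto
qed

text \<open>These are the conditions of \<open>cut_graph\<close> on the rows alone. They are kept
  apart because \<open>W\<close> and \<open>T\<close> are chosen first and then serve several sets
  of rows.\<close>

definition "rows_ok W R \<longleftrightarrow> finite R \<and> R \<noteq> {} \<and> snd ` R \<subseteq> W \<and>
  (\<forall>i g h. (i, g) \<in> R \<longrightarrow> (i, h) \<in> R \<longrightarrow> gen_base g = gen_base h \<longrightarrow> g = h)"

text \<open>One round of closure is enough: completing a regular vertex adds only edges with the
  same source, and the new end points bring no obligation to add edges, since a vertex may become a
  sink of the finite graph.\<close>

lemma cut_graph_exists:
  assumes UT: "finite_part U T1" and C: "finite C" "C \<subseteq> mbar_gens E"
  shows "\<exists>W T. C \<union> GVert ` U \<subseteq> W \<and> T1 \<subseteq> T \<and> (\<forall>R. rows_ok W R \<longrightarrow> cut_graph E K W T R)"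
proof -
  define T0 where "T0 = T1 \<union> \<Union> (gen_cut ` C)"
  have T0: "finite T0" "T0 \<subseteq> arcs E"
    using UT C gen_facts by (auto simp: T0_def finite_part_def subset_iff)
  define T where "T = (\<Union>e\<in>T0. if regular_vertex E (tail E e) then out_arcs E (tail E e) else {e})"
  have T: "finite T" "T \<subseteq> arcs E" "T0 \<subseteq> T"
  proof -
    show "finite T" unfolding T_def using T0(1) by (intro finite_UN_I) (auto simp: regular_vertex_def)
    show "T \<subseteq> arcs E" unfolding T_def using T0(2) by (auto split: if_splits)
    have "e \<in> T" if "e \<in> T0" for e
      unfolding T_def by (rule UN_I[OF that]) (use T0(2) that in auto)
    then show "T0 \<subseteq> T" by blast
  qed
  have T_reg: "out_arcs E (tail E e) \<subseteq> T" if e: "e \<in> T" "regular_vertex E (tail E e)" for e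
  proof -
    obtain f where f: "f \<in> T0" "e \<in> (if regular_vertex E (tail E f) then out_arcs E (tail E f) else {f})"
      using e(1) unfolding T_def by blast
    then have "tail E f = tail E e" by (auto split: if_splits)
    then have "out_arcs E (tail E e) \<subseteq> (if regular_vertex E (tail E f) then out_arcs E (tail E f) else {f})"
      using e(2) by simp
    then show ?thesis using f(1) unfolding T_def by blast
  qed
  define U' where "U' = U \<union> tail E ` T \<union> head E ` T \<union> gen_base ` C"
  have U': "finite U'" "U' \<subseteq> verts E"
    using UT T C gen_facts(1) by (auto simp: U'_def finite_part_def)
  define D where "D = (\<lambda>v. GCut v (T \<inter> out_arcs E v)) ` {v\<in>U'. infinite_emitter E v \<and> T \<inter> out_arcs E v \<noteq> {}}"
  define W where "W = GVert ` U' \<union> C \<union> D"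
  have D: "finite D" "D \<subseteq> mbar_gens E"
  proof -
    show "finite D" using U' by (simp add: D_def)
    have "GCut v (T \<inter> out_arcs E v) \<in> mbar_gens E" if "infinite_emitter E v" "T \<inter> out_arcs E v \<noteq> {}" for v
      unfolding mbar_gens_def using that T(1) by blast
    then show "D \<subseteq> mbar_gens E" unfolding D_def by blast
  qed
  have "cut_graph E K W T R" if R: "rows_ok W R" for R
  proof (intro cut_graph.intro cut_graph_axioms.intro)
    show "lpa_setup E K" by (rule lpa_setup_axioms)
    show "finite W" using U' C D by (simp add: W_def)
    show "W \<subseteq> mbar_gens E" using U' C D by (auto simp: W_def mbar_gens_def)
    show "GVert (gen_base g) \<in> W" if "g \<in> W" for g
      using that by (auto simp: W_def D_def U'_def)
    show "gen_cut g \<subseteq> T" if "g \<in> W" for g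
    proof -
      have "gen_cut g \<subseteq> T" if "g \<in> C" using that T(3) by (auto simp: T0_def)
      then show ?thesis using that by (auto simp: W_def D_def)
    qed
    show "finite T" "T \<subseteq> arcs E" by fact+
    show "GVert (tail E e) \<in> W \<and> GVert (head E e) \<in> W" if "e \<in> T" for e
      using that by (auto simp: W_def U'_def)
    show "out_arcs E (tail E e) \<subseteq> T" if "e \<in> T" "regular_vertex E (tail E e)" for e
      using that by (rule T_reg)
    show "GCut v (T \<inter> out_arcs E v) \<in> W" if v: "infinite_emitter E v" "T \<inter> out_arcs E v \<noteq> {}" for v
    proof -
      have "v \<in> U'" using v(2) by (auto simp: U'_def)
      then show ?thesis using v by (auto simp: W_def D_def)
    qed
    show "finite R" "R \<noteq> {}" using R by (auto simp: rows_ok_def)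
    show "g \<in> W" if "(i, g) \<in> R" for i g using R that by (force simp: rows_ok_def)
    show "g = h" if "(i, g) \<in> R" "(i, h) \<in> R" "gen_base g = gen_base h" for i g h
      using R that unfolding rows_ok_def by blast
  qed
  moreover have "C \<union> GVert ` U \<subseteq> W" by (auto simp: W_def U'_def)
  moreover have "T1 \<subseteq> T" using T(3) by (auto simp: T0_def)
  ultimately show ?thesis by blast
qed

text \<open>The graph without vertices is set apart because a finite piece must have a nonempty set
  of rows.\<close>

lemma no_verts_zero:
  assumes "verts E = {}" "X \<in> carrier L" shows "X = \<zero>\<^bsub>L\<^esub>"
proof -
  have na: "e \<notin> arcs E" for e using assms(1) tail_in_verts by blast
  have "cls x = \<zero>\<^bsub>L\<^esub>" if "x \<in> lpa_terms K E" for x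
    using that
  proof (induction rule: lpa_terms.induct)
    case (5 x) then show ?case by (simp add: cls_neg L.minus_zero')
  next
    case (6 x y) then show ?case by (simp add: L_add[symmetric])
  next
    case (7 x y) then show ?case by (simp add: L_mult[symmetric])
  next
    case (8 c x) then show ?case by (simp add: L_smult[symmetric] L.smult_r_null)
  qed (use assms(1) na in \<open>auto simp: L_zero\<close>)
  then show ?thesis using assms(2) L_carrierE by metis
qed

lemma class_is_geval:
  assumes "X \<in> carrier V" shows "\<exists>m\<in>mbar_words E. X = geval m"
proof -
  obtain e n where e: "e \<in> idem_mats L" "e \<in> matn L n" "X = idem_class L e"
    using assms by (rule L.V_carrierE)
  show ?thesis
  proof (cases "verts E = {}")
    case True
    have "e = mat_zero L"
    proof (intro ext)
      fix i j show "e i j = mat_zero L i j"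
        using no_verts_zero[OF True matn_carrier[OF e(2), of i j]] by (simp add: mat_zero_def)
    qed
    then have "X = geval {#}" using e(3) by (simp add: geval_empty V_monoid_def)
    then show ?thesis using mbar_words_empty by blast
  next
    case False
    then obtain v0 where v0: "v0 \<in> verts E" by blast
    \<comment> \<open>The size \<open>Suc n\<close>, together with the vertex \<open>v0\<close>,
      keeps the set of rows from being empty.\<close>
    have e': "e \<in> matn L (Suc n)" using e(2) matn_mono[of n "Suc n" L] by auto
    obtain U T1 where UT: "finite_part U T1" "range (\<lambda>(i, j). e i j) \<subseteq> cls ` lpa_terms K (subg U T1)"
      using set_finite_part[OF finite_entries[OF matn_imp_mat_inf[OF e(2)]]] by blast
    have "\<exists>W T. {GVert v0} \<union> GVert ` U \<subseteq> W \<and> T1 \<subseteq> T \<and> (\<forall>R. rows_ok W R \<longrightarrow> cut_graph E K W T R)"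
      using v0 by (intro cut_graph_exists[OF UT(1)]) (auto simp: mbar_gens_def)
    then obtain W T where WT: "{GVert v0} \<union> GVert ` U \<subseteq> W" "T1 \<subseteq> T" and cg: "\<And>R. rows_ok W R \<Longrightarrow> cut_graph E K W T R"
      by blast
    \<comment> \<open>A provisional choice of rows, from which the finiteness of \<open>W\<close> is
      read off.\<close>
    have "cut_graph E K W T {(0, GVert v0)}" using WT by (intro cg) (auto simp: rows_ok_def)
    then have finW: "finite W" by (rule cut_graph.finW)
    define U0 where "U0 = {v. GVert v \<in> W}"
    define R :: "(nat \<times> ('v, 'e) mbar_gen) set" where "R = {..<Suc n} \<times> GVert ` U0"
    have "finite (GVert -` W :: 'v set)" using finW by (rule finite_vimageI) (auto simp: inj_on_def)
    then have "finite U0" by (simp add: U0_def vimage_def)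
    then have "rows_ok W R" using WT(1) by (auto simp: rows_ok_def R_def U0_def)
    then interpret C: cut_graph E K W T R by (rule cg)
    have V0: "C.V0 = U0" by (simp add: C.V0_def U0_def)
    have "lpa_terms K (subg U T1) \<subseteq> lpa_terms K (subg C.V0 T)"
      using subg_terms_mono[of _ U T1 C.V0 T] WT by (auto simp: V0 U0_def)
    then have entries: "e i j \<in> C.Lsub" for i j using UT(2) by blast
    have "diag R \<otimes>\<^bsub>MatL\<^esub> e = e" "e \<otimes>\<^bsub>MatL\<^esub> diag R = e"
      by (rule C.diag_unit[OF _ e' entries], simp add: R_def V0)+
    then show ?thesis using C.idem_class_geval[OF e(1) _ _ entries] e(3) unfolding C.cP_diag by blast
  qed
qed

text \<open>Words are spread over the diagonal, so that equal values mean equivalent diagonal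
  idempotents. A finite piece that contains the entries of \<open>x\<close> and \<open>y\<close> and
  the generators of both words brings them within reach of \<open>diag_relation\<close>.\<close>

lemma geval_inject:
  assumes mn: "m \<in> mbar_words E" "n \<in> mbar_words E" and eq: "geval m = geval n"
  shows "mbar_cong E m n"
proof -
  obtain ms ns where ms: "mset ms = m" and ns: "mset ns = n" using ex_mset by metis
  \<comment> \<open>One generator per row: repetitions in the word are kept apart, and the condition
    on bases within a row holds trivially.\<close>
  define rows where "rows hs = (\<lambda>i. (i, hs ! i)) ` {..<length hs}" for hs :: "('v, 'e) mbar_gen list"
  have rows_sum: "(\<Sum>r\<in>rows hs. {#snd r#}) = mset hs" for hs
  proof -
    have "(\<Sum>r\<in>rows hs. {#snd r#}) = (\<Sum>i\<in>{..<length hs}. {#hs ! i#})"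
      unfolding rows_def by (subst sum.reindex) (auto simp: inj_on_def)
    also have "\<dots> = image_mset ((!) hs) (mset_set {..<length hs})" by (simp add: sum_singleton_mset)
    also have "mset_set {..<length hs} = mset [0..<length hs]" by (simp add: atLeast0LessThan)
    also have "image_mset ((!) hs) (mset [0..<length hs]) = mset hs" by (metis map_nth mset_map)
    finally show ?thesis .
  qed
  have rows_ok: "rows_ok W (rows hs)" if "hs \<noteq> []" "set hs \<subseteq> W" for hs W
    using that by (auto simp: rows_ok_def rows_def)
  define C where "C = set ms \<union> set ns"
  have C: "finite C" "C \<subseteq> mbar_gens E" using mn ms ns by (auto simp: C_def mbar_words_def)
  have diag_rows: "diag (rows hs) \<in> idem_mats L \<and> idem_class L (diag (rows hs)) = geval (mset hs)"
    and diag_nonzero: "diag (rows hs) \<noteq> \<zero>\<^bsub>MatL\<^esub>"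
    if hs: "hs \<noteq> []" "set hs \<subseteq> C" for hs
  proof -
    obtain W T where W: "C \<union> GVert ` {} \<subseteq> W" "{} \<subseteq> T" "\<And>R. rows_ok W R \<Longrightarrow> cut_graph E K W T R"
      using cut_graph_exists[of "{}" "{}" C] C by (auto simp: finite_part_def)
    then interpret D: cut_graph E K W T "rows hs" using rows_ok hs by blast
    show "diag (rows hs) \<in> idem_mats L \<and> idem_class L (diag (rows hs)) = geval (mset hs)"
      using D.diag_class rows_sum by simp
    show "diag (rows hs) \<noteq> \<zero>\<^bsub>MatL\<^esub>" using D.rep.P_nonzero[of None] unfolding D.cP_diag by simp
  qed
  \<comment> \<open>The empty word has no rows and is handled here: an idempotent equivalent to zero
    is zero, and a nonempty diagonal is not.\<close>
  have nonzero_class: "geval (mset hs) \<noteq> \<one>\<^bsub>V\<^esub>" if hs: "hs \<noteq> []" "set hs \<subseteq> C" for hs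
  proof
    assume "geval (mset hs) = \<one>\<^bsub>V\<^esub>"
    then have "idem_class L (diag (rows hs)) = idem_class L (mat_zero L)"
      using diag_rows[OF hs] by (simp add: V_monoid_def)
    then have "(diag (rows hs), mat_zero L) \<in> idem_rel L"
      using L.idem_class_eq_iff diag_rows[OF hs] L.mat_zero_idem by blast
    then obtain x y where xy: "x \<in> carrier MatL" "y \<in> carrier MatL" "x \<otimes>\<^bsub>MatL\<^esub> y = diag (rows hs)" "y \<otimes>\<^bsub>MatL\<^esub> x = \<zero>\<^bsub>MatL\<^esub>"
      by (auto simp: mat_alg_simps elim!: L.idem_relE)
    have "diag (rows hs) = diag (rows hs) \<otimes>\<^bsub>MatL\<^esub> diag (rows hs)"
      using diag_rows[OF hs] by (auto simp: LM.idem_mats_M)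
    also have "\<dots> = x \<otimes>\<^bsub>MatL\<^esub> (y \<otimes>\<^bsub>MatL\<^esub> x) \<otimes>\<^bsub>MatL\<^esub> y"
      unfolding xy(3)[symmetric] using xy(1,2) by (simp only: LM.M.m_assoc LM.M.m_closed)
    also have "\<dots> = \<zero>\<^bsub>MatL\<^esub>" unfolding xy(4) using xy(1,2) by simp
    finally show False using diag_nonzero[OF hs] by simp
  qed
  have sub: "set ms \<subseteq> C" "set ns \<subseteq> C" by (auto simp: C_def)
  show ?thesis
  proof (cases "ms = [] \<or> ns = []")
    case True
    have "ms = [] \<longleftrightarrow> ns = []"
      using nonzero_class[OF _ sub(1)] nonzero_class[OF _ sub(2)] eq geval_empty unfolding ms[symmetric] ns[symmetric]
      by (metis mset.simps(1))
    then have "ms = []" "ns = []" using True by simp_all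
    then show ?thesis using ms ns mn mbar_cong.refl by auto
  next
    case False
    then have ne: "ms \<noteq> []" "ns \<noteq> []" by auto
    have "idem_class L (diag (rows ms)) = idem_class L (diag (rows ns))"
      using diag_rows[OF ne(1) sub(1)] diag_rows[OF ne(2) sub(2)] eq ms ns by simp
    then have "(diag (rows ms), diag (rows ns)) \<in> idem_rel L"
      using L.idem_class_eq_iff diag_rows[OF ne(1) sub(1)] diag_rows[OF ne(2) sub(2)] by blast
    then obtain x y where xy: "x \<in> mat_inf L" "y \<in> mat_inf L" "mat_times L x y = diag (rows ms)" "mat_times L y x = diag (rows ns)"
      by (rule L.idem_relE)
    obtain U T1 where UT: "finite_part U T1"
      "range (\<lambda>(i, j). x i j) \<union> range (\<lambda>(i, j). y i j) \<subseteq> cls ` lpa_terms K (subg U T1)"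
    proof -
      have "finite (range (\<lambda>(i, j). x i j) \<union> range (\<lambda>(i, j). y i j))"
        "range (\<lambda>(i, j). x i j) \<union> range (\<lambda>(i, j). y i j) \<subseteq> carrier L"
        using finite_entries[OF xy(1)] finite_entries[OF xy(2)] by simp_all
      from set_finite_part[OF this] that show thesis by blast
    qed
    obtain W T where W: "C \<union> GVert ` U \<subseteq> W" "T1 \<subseteq> T" and cg: "\<And>R. rows_ok W R \<Longrightarrow> cut_graph E K W T R"
      using cut_graph_exists[OF UT(1) C] by blast
    have cgm: "cut_graph E K W T (rows ms)" "cut_graph E K W T (rows ns)"
      using W sub ne by (auto intro!: cg rows_ok)
    interpret D: cut_graph E K W T "rows ms" by (rule cgm(1))
    have "U \<subseteq> D.V0" using W(1) by (auto simp: D.V0_def)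
    then have "lpa_terms K (subg U T1) \<subseteq> lpa_terms K (subg D.V0 T)"
      using subg_terms_mono W(2) by blast
    then have entries: "x i j \<in> D.Lsub" "y i j \<in> D.Lsub" for i j using UT(2) by blast+
    have "mbar_cong E (\<Sum>r\<in>rows ms. {#snd r#}) (\<Sum>r\<in>rows ns. {#snd r#})"
      by (rule D.diag_relation[OF cgm(2), of x y]) (use xy entries in \<open>simp_all add: mat_alg_simps\<close>)
    then show ?thesis using rows_sum ms ns by simp
  qed
qed

text \<open>\<open>gamma\<close> is known only by its defining properties, while both halves of the
  isomorphism are proved for the explicit \<open>geval\<close>; this connects the two.\<close>

lemma is_gamma_geval:
  assumes "is_gamma K E \<gamma>" "m \<in> mbar_words E"
  shows "\<gamma> (mbar_class E m) = geval m"
  using assms(2)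
proof (induction m)
  case empty
  then show ?case using assms(1) by (simp add: is_gamma_def Let_def mbar_one geval_empty)
next
  case (add g m)
  then have g: "g \<in> mbar_gens E" "m \<in> mbar_words E" "{#g#} \<in> mbar_words E" by (auto simp: mbar_words_def)
  have "\<gamma> (mbar_class E {#g#}) = gval g"
    using g(1) assms(1) unfolding mbar_gens_def is_gamma_def Let_def
    by (elim UnE imageE CollectE exE conjE) simp_all
  moreover have "mbar_class E (add_mset g m) = mbar_class E {#g#} \<otimes>\<^bsub>mbar_monoid E\<^esub> mbar_class E m"
    using mbar_mult[OF g(3,2)] by simp
  moreover have "\<gamma> \<in> hom (mbar_monoid E) V" using assms(1) by (simp add: is_gamma_def Let_def)
  ultimately show ?case
    using add g by (simp add: hom_mult mbar_class_carrier geval_add_mset)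
qed

lemma gamma_iso: "gamma K E \<in> iso (mbar_monoid E) V"
proof -
  have ig: "is_gamma K E (gamma K E)"
    using is_gamma_gamma wf_digraph_axioms K.field_axioms by blast
  have g: "gamma K E (mbar_class E m) = geval m" if "m \<in> mbar_words E" for m
    using ig that by (rule is_gamma_geval)
  have "inj_on (gamma K E) (carrier (mbar_monoid E))"
  proof (rule inj_onI)
    fix X Y assume "X \<in> carrier (mbar_monoid E)" "Y \<in> carrier (mbar_monoid E)" and eq: "gamma K E X = gamma K E Y"
    then obtain m n where "m \<in> mbar_words E" "X = mbar_class E m" "n \<in> mbar_words E" "Y = mbar_class E n"
      by (elim mbar_carrierE)
    then show "X = Y" using eq g geval_inject mbar_class_eqI by metis
  qed
  moreover have "gamma K E ` carrier (mbar_monoid E) = carrier V"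
  proof
    show "gamma K E ` carrier (mbar_monoid E) \<subseteq> carrier V"
      using g geval_closed by (auto elim!: mbar_carrierE)
    show "carrier V \<subseteq> gamma K E ` carrier (mbar_monoid E)"
      using class_is_geval g mbar_class_carrier by (metis image_eqI subsetI)
  qed
  moreover have "gamma K E \<in> hom (mbar_monoid E) V" using ig by (simp add: is_gamma_def Let_def)
  ultimately show ?thesis by (simp add: iso_def bij_betw_def)
qed

end

theorem theorem4p9:
  fixes E :: "('v, 'e) pre_digraph" and K :: "('k, 'm) ring_scheme"
  assumes "wf_digraph E" and "field K"
  shows "gamma K E \<in> iso (mbar_monoid E) (V_monoid (leavitt_path_algebra K E))"
proof -
  interpret lpa_setup E K using assms by (simp add: lpa_setup_def)
  show ?thesis by (rule gamma_iso)
qed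

end
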